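(* Suppose $\lambda$ is a singular cardinal of uncountable cofinality $\kappa$, and suppose that $\theta^{\kappa} < \lambda$ for every cardinal $\theta<\lambda$. Then for each nonzero cardinal $\mu \leq \lambda^{\kappa}$ there is a model $\mathcal{M}$ (with relations having finitely many places only) satisfying $|\mathcal{M}| = \lambda$ and $\mathrm{No}(\mathcal{M}) = \mu$.
   Context: For a model $\mathcal{M}$, $|\mathcal{M}|$ denotes the cardinality of its universe. $L_{\infty\lambda}$ is the infinitary language allowing conjunctions and disjunctions over arbitrary sets of formulas and quantification over strings of fewer than $\lambda$ variables. For models $\mathcal{M},\mathcal{N}$ of the same vocabulary, $\mathcal{M}\equiv_{\infty\lambda}\mathcal{N}$ means that they satisfy the same sentences of $L_{\infty\lambda}$. For a model $\mathcal{M}$ of cardinality $\lambda$, $\mathrm{No}(\mathcal{M})$ is the cardinality of the set $\{\mathcal{N}/{\cong} \;:\; |\mathcal{N}|=\lambda \text{ and } \mathcal{N}\equiv_{\infty\lambda}\mathcal{M}\}$, where $\mathcal{N}/{\cong}$ is the equivalence class of $\mathcal{N}$ under the isomorphism relation; i.e. $\mathrm{No}(\mathcal{M})$ is the number of isomorphism types of models of cardinality $\lambda$ which are $L_{\infty\lambda}$-equivalent to $\mathcal{M}$. *)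

theory Defs
  imports Main
begin

unbundle cardinal_syntax

text \<open>Cardinals are rendered as in the library: a cardinal is a relation \<open>r\<close> with
  \<^prop>\<open>Card_order r\<close> (an initial well-order of its field), compared by
  \<open><o\<close>, \<open>\<le>o\<close>, \<open>=o\<close> (the latter also across types), with exponentiation \<open>^c\<close>.\<close>

definition is_cofinality :: "'k rel \<Rightarrow> 'a rel \<Rightarrow> bool" where
  "is_cofinality kap lam \<longleftrightarrow> Card_order kap \<and>
     (\<exists>K \<subseteq> Field lam. cofinal K lam \<and> |K| =o kap) \<and>
     (\<forall>K \<subseteq> Field lam. cofinal K lam \<longrightarrow> kap \<le>o |K| )"

definition singular_cardinal :: "'a rel \<Rightarrow> bool" where
  "singular_cardinal lam \<longleftrightarrow> Card_order lam \<and> cinfinite lam \<and> \<not> regularCard lam"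


subsection \<open>Models\<close>

text \<open>A vocabulary is a partial map from symbols to arities; all symbols are relation symbols
  with finitely many places.\<close>

type_synonym 's vocabulary = "'s \<rightharpoonup> nat"

record ('u, 's) model =
  universe :: "'u set"
  interp :: "'s \<Rightarrow> 'u list set"

text \<open>Symbols outside the vocabulary are interpreted by the empty set, so that equality of
  records is equality of models.\<close>

definition is_model :: "'s vocabulary \<Rightarrow> ('u, 's) model \<Rightarrow> bool" where
  "is_model voc M \<longleftrightarrow> universe M \<noteq> {} \<and>
     (\<forall>R. case voc R of
            None \<Rightarrow> interp M R = {}
          | Some n \<Rightarrow> interp M R \<subseteq> {xs. set xs \<subseteq> universe M \<and> length xs = n})"

definition isomorphic :: "'s vocabulary \<Rightarrow> ('u, 's) model \<Rightarrow> ('u, 's) model \<Rightarrow> bool" where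
  "isomorphic voc M N \<longleftrightarrow> (\<exists>f. bij_betw f (universe M) (universe N) \<and>
     (\<forall>R n xs. voc R = Some n \<and> set xs \<subseteq> universe M \<and> length xs = n \<longrightarrow>
        (xs \<in> interp M R \<longleftrightarrow> map f xs \<in> interp N R)))"

definition iso_rel :: "'s vocabulary \<Rightarrow> ('u, 's) model rel" where
  "iso_rel voc = {(M, N). is_model voc M \<and> is_model voc N \<and> isomorphic voc M N}"


subsection \<open>The infinitary language\<close>

text \<open>Sets of formulas are given as families \<open>F\<close> restricted to an index set \<open>I\<close>, which may be
  any subset of the type \<open>'i\<close>. The values of \<open>F\<close> outside \<open>I\<close> play no role.\<close>

datatype ('s, 'v, 'i) formula =
    Eq 'v 'v
  | Rel 's "'v list"
  | Neg "('s, 'v, 'i) formula"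
  | Conj "'i set" "'i \<Rightarrow> ('s, 'v, 'i) formula"
  | Disj "'i set" "'i \<Rightarrow> ('s, 'v, 'i) formula"
  | Exists "'v set" "('s, 'v, 'i) formula"
  | Forall "'v set" "('s, 'v, 'i) formula"

primrec L_inf :: "'c rel \<Rightarrow> 's vocabulary \<Rightarrow> ('s, 'v, 'i) formula \<Rightarrow> bool" where
  "L_inf lam voc (Eq x y) \<longleftrightarrow> True"
| "L_inf lam voc (Rel R xs) \<longleftrightarrow> voc R = Some (length xs)"
| "L_inf lam voc (Neg p) \<longleftrightarrow> L_inf lam voc p"
| "L_inf lam voc (Conj I F) \<longleftrightarrow> (\<forall>i\<in>I. L_inf lam voc (F i))"
| "L_inf lam voc (Disj I F) \<longleftrightarrow> (\<forall>i\<in>I. L_inf lam voc (F i))"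
| "L_inf lam voc (Exists X p) \<longleftrightarrow> |X| <o lam \<and> L_inf lam voc p"
| "L_inf lam voc (Forall X p) \<longleftrightarrow> |X| <o lam \<and> L_inf lam voc p"

primrec fv :: "('s, 'v, 'i) formula \<Rightarrow> 'v set" where
  "fv (Eq x y) = {x, y}"
| "fv (Rel R xs) = set xs"
| "fv (Neg p) = fv p"
| "fv (Conj I F) = (\<Union>i\<in>I. fv (F i))"
| "fv (Disj I F) = (\<Union>i\<in>I. fv (F i))"
| "fv (Exists X p) = fv p - X"
| "fv (Forall X p) = fv p - X"

definition variant_on :: "'u set \<Rightarrow> 'v set \<Rightarrow> ('v \<Rightarrow> 'u) \<Rightarrow> ('v \<Rightarrow> 'u) \<Rightarrow> bool" where
  "variant_on A X e e' \<longleftrightarrow> (\<forall>x. x \<notin> X \<longrightarrow> e' x = e x) \<and> e' ` X \<subseteq> A"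

primrec sat :: "('u, 's) model \<Rightarrow> ('s, 'v, 'i) formula \<Rightarrow> ('v \<Rightarrow> 'u) \<Rightarrow> bool" where
  "sat M (Eq x y) = (\<lambda>e. e x = e y)"
| "sat M (Rel R xs) = (\<lambda>e. map e xs \<in> interp M R)"
| "sat M (Neg p) = (\<lambda>e. \<not> sat M p e)"
| "sat M (Conj I F) = (\<lambda>e. \<forall>i\<in>I. sat M (F i) e)"
| "sat M (Disj I F) = (\<lambda>e. \<exists>i\<in>I. sat M (F i) e)"
| "sat M (Exists X p) = (\<lambda>e. \<exists>e'. variant_on (universe M) X e e' \<and> sat M p e')"
| "sat M (Forall X p) = (\<lambda>e. \<forall>e'. variant_on (universe M) X e e' \<longrightarrow> sat M p e')"

definition L_inf_sentence :: "'c rel \<Rightarrow> 's vocabulary \<Rightarrow> ('s, 'v, 'i) formula \<Rightarrow> bool" where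
  "L_inf_sentence lam voc p \<longleftrightarrow> L_inf lam voc p \<and> fv p = {}"

definition models :: "('u, 's) model \<Rightarrow> ('s, 'v, 'i) formula \<Rightarrow> bool" where
  "models M p \<longleftrightarrow> (\<forall>e. range e \<subseteq> universe M \<longrightarrow> sat M p e)"

text \<open>The formulas of the infinitary language form a proper class, whereas a HOL type of formulas
  bounds the index sets of conjunctions and the supply of variables. For models with universe
  inside \<open>'a\<close>, where \<open>'a\<close> is the underlying type of the cardinal, nothing is lost by taking
  variables from \<open>'a\<close> and indices from models paired with assignments: this is the content of
  \<open>L_inf_equiv_any_sentence\<close> below.\<close>

definition L_inf_equiv ::
  "'a rel \<Rightarrow> 's vocabulary \<Rightarrow> ('a, 's) model \<Rightarrow> ('a, 's) model \<Rightarrow> bool" where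
  "L_inf_equiv lam voc M N \<longleftrightarrow>
     (\<forall>p :: ('s, 'a, ('a, 's) model \<times> ('a \<Rightarrow> 'a)) formula.
        L_inf_sentence lam voc p \<longrightarrow> (models M p \<longleftrightarrow> models N p))"

lemma sat_cong: "(\<And>x. x \<in> fv p \<Longrightarrow> e x = d x) \<Longrightarrow> sat M p e \<longleftrightarrow> sat M p d"
proof (induction p arbitrary: e d)
  case (Rel R xs)
  then have "map e xs = map d xs" by simp
  then show ?case by (simp only: sat.simps)
next
  case (Neg p)
  then show ?case by (metis fv.simps(3) sat.simps(3))
next
  case (Conj I F)
  have "sat M (F i) e \<longleftrightarrow> sat M (F i) d" if "i \<in> I" for i
    by (rule Conj.IH) (use Conj.prems that in auto)
  then show ?case by simp
next
  case (Disj I F)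
  have "sat M (F i) e \<longleftrightarrow> sat M (F i) d" if "i \<in> I" for i
    by (rule Disj.IH) (use Disj.prems that in auto)
  then show ?case by simp
next
  case (Exists X p)
  have *: "\<exists>d'. variant_on (universe M) X d d' \<and> sat M p d'"
    if "\<And>x. x \<in> fv p - X \<Longrightarrow> e x = d x" "variant_on (universe M) X e e'" "sat M p e'" for e d e'
  proof (intro exI conjI)
    show "variant_on (universe M) X d (\<lambda>x. if x \<in> X then e' x else d x)"
      using that(2) by (auto simp: variant_on_def)
    have "sat M p e' \<longleftrightarrow> sat M p (\<lambda>x. if x \<in> X then e' x else d x)"
      by (rule Exists.IH) (use that(1,2) in \<open>auto simp: variant_on_def\<close>)
    then show "sat M p (\<lambda>x. if x \<in> X then e' x else d x)" using that(3) by simp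
  qed
  from *[of e d] *[of d e] Exists.prems show ?case by (simp, metis)
next
  case (Forall X p)
  have *: "\<exists>d'. variant_on (universe M) X d d' \<and> \<not> sat M p d'"
    if "\<And>x. x \<in> fv p - X \<Longrightarrow> e x = d x" "variant_on (universe M) X e e'" "\<not> sat M p e'" for e d e'
  proof (intro exI conjI)
    show "variant_on (universe M) X d (\<lambda>x. if x \<in> X then e' x else d x)"
      using that(2) by (auto simp: variant_on_def)
    have "sat M p e' \<longleftrightarrow> sat M p (\<lambda>x. if x \<in> X then e' x else d x)"
      by (rule Forall.IH) (use that(1,2) in \<open>auto simp: variant_on_def\<close>)
    then show "\<not> sat M p (\<lambda>x. if x \<in> X then e' x else d x)" using that(3) by simp
  qed
  from *[of e d] *[of d e] Forall.prems show ?case by (simp, metis)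
qed simp

text \<open>The elements of \<open>X\<close> can be renamed apart from the fewer than \<open>lam\<close> other variables.\<close>

lemma rename_bound:
  fixes lam :: "'a rel" and g :: "'w \<Rightarrow> 'a"
  assumes lam: "Card_order lam" "cinfinite lam"
    and A: "|A - X| <o lam" and X: "|X| <o lam" and g: "inj_on g (A - X)"
  obtains h where "inj_on h A" "\<And>x. x \<in> A - X \<Longrightarrow> h x = g x"
proof -
  let ?K = "g ` (A - X)"
  have fin: "\<not> finite (Field lam)" using lam(2) by (simp add: BNF_Cardinal_Arithmetic.cinfinite_def)
  have K: "|?K| <o lam" using A card_of_image ordLeq_ordLess_trans by blast
  have "\<not> |UNIV - ?K| <o lam"
  proof
    assume "|UNIV - ?K| <o lam"
    then have "|(UNIV - ?K) \<union> ?K| <o lam"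
      using card_of_Un_ordLess_infinite_Field[OF fin lam(1)] K by blast
    then have "|UNIV :: 'a set| <o lam" by simp
    moreover have "lam \<le>o |UNIV :: 'a set|"
      using lam(1) card_of_Field_ordIso card_of_mono1[of "Field lam" UNIV]
      by (metis ordIso_ordLeq_trans ordIso_symmetric top_greatest)
    ultimately show False using not_ordLess_ordLeq by blast
  qed
  then have "lam \<le>o |UNIV - ?K|"
    using lam(1) card_of_Well_order not_ordLess_iff_ordLeq
    by (metis card_order_on_well_order_on)
  moreover have "|A \<inter> X| <o lam"
    using X card_of_mono1[of "A \<inter> X" X] ordLeq_ordLess_trans by blast
  ultimately have "|A \<inter> X| \<le>o |UNIV - ?K|"
    using ordLess_imp_ordLeq ordLeq_transitive by blast
  then obtain k where k: "inj_on k (A \<inter> X)" "k ` (A \<inter> X) \<subseteq> UNIV - ?K"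
    by (metis card_of_ordLeq)
  show ?thesis
  proof
    show "inj_on (\<lambda>x. if x \<in> X then k x else g x) A"
    proof (rule inj_onI)
      fix x y
      assume *: "x \<in> A" "y \<in> A" "(if x \<in> X then k x else g x) = (if y \<in> X then k y else g y)"
      consider "x \<in> X" "y \<in> X" | "x \<notin> X" "y \<notin> X" | "x \<in> X" "y \<notin> X" | "x \<notin> X" "y \<in> X" by blast
      then show "x = y"
      proof cases
        case 1 then show ?thesis using * inj_onD[OF k(1)] by simp
      next
        case 2 then show ?thesis using * inj_onD[OF g] by simp
      next
        case 3
        then have "k x \<in> ?K" "k x \<in> UNIV - ?K" using * k(2) by auto
        then show ?thesis by blast
      next
        case 4
        then have "k y \<in> ?K" "k y \<in> UNIV - ?K" using * k(2) by (auto simp: image_iff)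
        then show ?thesis by blast
      qed
    qed
  qed simp
qed

lemma variant_rename:
  fixes g h :: "'w \<Rightarrow> 'a"
  assumes A: "A \<noteq> {}" and h: "inj_on h (fv p)" "\<And>x. x \<in> fv p - X \<Longrightarrow> h x = g x"
  shows "(\<exists>e'. variant_on A (h ` (fv p \<inter> X)) e e' \<and> (sat M p (e' \<circ> h) \<longleftrightarrow> b))
     \<longleftrightarrow> (\<exists>d'. variant_on A X (e \<circ> g) d' \<and> (sat M p d' \<longleftrightarrow> b))"
proof
  assume "\<exists>e'. variant_on A (h ` (fv p \<inter> X)) e e' \<and> (sat M p (e' \<circ> h) \<longleftrightarrow> b)"
  then obtain e' where e': "variant_on A (h ` (fv p \<inter> X)) e e'" "sat M p (e' \<circ> h) \<longleftrightarrow> b" by blast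
  obtain a where a: "a \<in> A" using A by blast
  let ?d = "\<lambda>x. if x \<in> X then if x \<in> fv p then e' (h x) else a else e (g x)"
  have "variant_on A X (e \<circ> g) ?d"
    using a e'(1) by (auto simp: variant_on_def)
  moreover have "sat M p ?d \<longleftrightarrow> sat M p (e' \<circ> h)"
  proof (rule sat_cong)
    fix x assume x: "x \<in> fv p"
    show "?d x = (e' \<circ> h) x"
    proof (cases "x \<in> X")
      case False
      then have "h x \<notin> h ` (fv p \<inter> X)" using x h(1) by (auto dest: inj_onD)
      then show ?thesis using False x e'(1) h(2) by (simp add: variant_on_def)
    qed (use x in simp)
  qed
  ultimately show "\<exists>d'. variant_on A X (e \<circ> g) d' \<and> (sat M p d' \<longleftrightarrow> b)" using e'(2) by blast
next
  assume "\<exists>d'. variant_on A X (e \<circ> g) d' \<and> (sat M p d' \<longleftrightarrow> b)"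
  then obtain d' where d': "variant_on A X (e \<circ> g) d'" "sat M p d' \<longleftrightarrow> b" by blast
  let ?e = "\<lambda>y. if y \<in> h ` (fv p \<inter> X) then d' (inv_into (fv p) h y) else e y"
  have inv: "inv_into (fv p) h (h x) = x" if "x \<in> fv p" for x using h(1) that by simp
  have "variant_on A (h ` (fv p \<inter> X)) e ?e"
    using d'(1) inv by (auto simp: variant_on_def)
  moreover have "sat M p (?e \<circ> h) \<longleftrightarrow> sat M p d'"
  proof (rule sat_cong)
    fix x assume x: "x \<in> fv p"
    show "(?e \<circ> h) x = d' x"
    proof (cases "x \<in> X")
      case True
      then show ?thesis using x inv by auto
    next
      case False
      then have "h x \<notin> h ` (fv p \<inter> X)" using x h(1) by (auto dest: inj_onD)
      then show ?thesis using False x d'(1) h(2) by (simp add: variant_on_def)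
    qed
  qed
  ultimately show "\<exists>e'. variant_on A (h ` (fv p \<inter> X)) e e' \<and> (sat M p (e' \<circ> h) \<longleftrightarrow> b)"
    using d'(2) by blast
qed

lemma translate_formula:
  fixes lam :: "'a rel" and p :: "('s, 'w, 'j) formula" and g :: "'w \<Rightarrow> 'a"
  assumes lam: "Card_order lam" "cinfinite lam"
  shows "L_inf lam voc p \<Longrightarrow> |fv p| <o lam \<Longrightarrow> inj_on g (fv p) \<Longrightarrow>
    \<exists>q :: ('s, 'a, ('a, 's) model \<times> ('a \<Rightarrow> 'a)) formula.
      L_inf lam voc q \<and> fv q \<subseteq> g ` fv p \<and>
      (\<forall>(M :: ('a, 's) model) e. universe M \<noteq> {} \<longrightarrow> (sat M q e \<longleftrightarrow> sat M p (e \<circ> g)))"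
proof (induction p arbitrary: g)
  case (Eq x y)
  show ?case by (rule exI[of _ "Eq (g x) (g y)"]) simp
next
  case (Rel R xs)
  then show ?case by (intro exI[of _ "Rel R (map g xs)"]) (simp add: comp_def)
next
  case (Neg p)
  then obtain q :: "('s, 'a, ('a, 's) model \<times> ('a \<Rightarrow> 'a)) formula" where
    "L_inf lam voc q" "fv q \<subseteq> g ` fv p"
    "\<forall>(M :: ('a, 's) model) e. universe M \<noteq> {} \<longrightarrow> (sat M q e \<longleftrightarrow> sat M p (e \<circ> g))"
    by (metis L_inf.simps(3) fv.simps(3))
  then show ?case by (intro exI[of _ "Neg q"]) (simp add: comp_def)
next
  case (Conj I F)
  have "\<forall>i\<in>I. \<exists>q :: ('s, 'a, ('a, 's) model \<times> ('a \<Rightarrow> 'a)) formula.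
      L_inf lam voc q \<and> fv q \<subseteq> g ` fv (F i) \<and>
      (\<forall>(M :: ('a, 's) model) e. universe M \<noteq> {} \<longrightarrow> (sat M q e \<longleftrightarrow> sat M (F i) (e \<circ> g)))"
  proof
    fix i assume i: "i \<in> I"
    then have sub: "fv (F i) \<subseteq> fv (Conj I F)" by auto
    show "\<exists>q :: ('s, 'a, ('a, 's) model \<times> ('a \<Rightarrow> 'a)) formula.
      L_inf lam voc q \<and> fv q \<subseteq> g ` fv (F i) \<and>
      (\<forall>(M :: ('a, 's) model) e. universe M \<noteq> {} \<longrightarrow> (sat M q e \<longleftrightarrow> sat M (F i) (e \<circ> g)))"
    proof (rule Conj.IH)
      show "|fv (F i)| <o lam" using Conj.prems(2) card_of_mono1[OF sub] ordLeq_ordLess_trans by blast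
      show "inj_on g (fv (F i))" using Conj.prems(3) sub inj_on_subset by blast
    qed (use i Conj.prems in auto)
  qed
  then obtain G :: "'j \<Rightarrow> ('s, 'a, ('a, 's) model \<times> ('a \<Rightarrow> 'a)) formula" where
    G: "\<And>i. i \<in> I \<Longrightarrow> L_inf lam voc (G i)" "\<And>i. i \<in> I \<Longrightarrow> fv (G i) \<subseteq> g ` fv (F i)"
    "\<And>i (M :: ('a, 's) model) e. i \<in> I \<Longrightarrow> universe M \<noteq> {} \<Longrightarrow> sat M (G i) e \<longleftrightarrow> sat M (F i) (e \<circ> g)"
    by metis
  define P :: "(('a, 's) model \<times> ('a \<Rightarrow> 'a)) set" where "P = {(M, e). \<exists>i\<in>I. \<not> sat M (G i) e}"
  define c :: "('a, 's) model \<times> ('a \<Rightarrow> 'a) \<Rightarrow> 'j" where "c z = (SOME i. i \<in> I \<and> \<not> sat (fst z) (G i) (snd z))" for z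
  have c: "c z \<in> I" "\<not> sat (fst z) (G (c z)) (snd z)" if "z \<in> P" for z
  proof -
    have "\<exists>i. i \<in> I \<and> \<not> sat (fst z) (G i) (snd z)" using that by (auto simp: P_def)
    from someI_ex[OF this] show "c z \<in> I" "\<not> sat (fst z) (G (c z)) (snd z)"
      unfolding c_def by auto
  qed
  have eq: "(\<forall>z\<in>P. sat M (G (c z)) e) \<longleftrightarrow> (\<forall>i\<in>I. sat M (G i) e)"
    for M :: "('a, 's) model" and e
  proof (cases "(M, e) \<in> P")
    case True
    then have "\<not> sat M (G (c (M, e))) e" "c (M, e) \<in> I" using c[OF True] by simp_all
    then show ?thesis using True by blast
  next
    case False
    then have "\<forall>i\<in>I. sat M (G i) e" by (simp add: P_def)
    then show ?thesis using c(1) by blast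
  qed
  have "L_inf lam voc (Conj P (\<lambda>z. G (c z)))" using G(1) c(1) by simp
  moreover have "fv (Conj P (\<lambda>z. G (c z))) \<subseteq> g ` fv (Conj I F)"
  proof
    fix y assume "y \<in> fv (Conj P (\<lambda>z. G (c z)))"
    then obtain z where z: "z \<in> P" "y \<in> fv (G (c z))" by auto
    then have "y \<in> g ` fv (F (c z))" using G(2)[OF c(1)] by blast
    then show "y \<in> g ` fv (Conj I F)" using c(1)[OF z(1)] by auto
  qed
  moreover have "sat M (Conj P (\<lambda>z. G (c z))) e \<longleftrightarrow> sat M (Conj I F) (e \<circ> g)"
    if "universe M \<noteq> {}" for M :: "('a, 's) model" and e
    using eq G(3)[OF _ that] by simp
  ultimately show ?case by blast
next
  case (Disj I F)
  have "\<forall>i\<in>I. \<exists>q :: ('s, 'a, ('a, 's) model \<times> ('a \<Rightarrow> 'a)) formula.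
      L_inf lam voc q \<and> fv q \<subseteq> g ` fv (F i) \<and>
      (\<forall>(M :: ('a, 's) model) e. universe M \<noteq> {} \<longrightarrow> (sat M q e \<longleftrightarrow> sat M (F i) (e \<circ> g)))"
  proof
    fix i assume i: "i \<in> I"
    then have sub: "fv (F i) \<subseteq> fv (Disj I F)" by auto
    show "\<exists>q :: ('s, 'a, ('a, 's) model \<times> ('a \<Rightarrow> 'a)) formula.
      L_inf lam voc q \<and> fv q \<subseteq> g ` fv (F i) \<and>
      (\<forall>(M :: ('a, 's) model) e. universe M \<noteq> {} \<longrightarrow> (sat M q e \<longleftrightarrow> sat M (F i) (e \<circ> g)))"
    proof (rule Disj.IH)
      show "|fv (F i)| <o lam" using Disj.prems(2) card_of_mono1[OF sub] ordLeq_ordLess_trans by blast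
      show "inj_on g (fv (F i))" using Disj.prems(3) sub inj_on_subset by blast
    qed (use i Disj.prems in auto)
  qed
  then obtain G :: "'j \<Rightarrow> ('s, 'a, ('a, 's) model \<times> ('a \<Rightarrow> 'a)) formula" where
    G: "\<And>i. i \<in> I \<Longrightarrow> L_inf lam voc (G i)" "\<And>i. i \<in> I \<Longrightarrow> fv (G i) \<subseteq> g ` fv (F i)"
    "\<And>i (M :: ('a, 's) model) e. i \<in> I \<Longrightarrow> universe M \<noteq> {} \<Longrightarrow> sat M (G i) e \<longleftrightarrow> sat M (F i) (e \<circ> g)"
    by metis
  define P :: "(('a, 's) model \<times> ('a \<Rightarrow> 'a)) set" where "P = {(M, e). \<exists>i\<in>I. sat M (G i) e}"
  define c :: "('a, 's) model \<times> ('a \<Rightarrow> 'a) \<Rightarrow> 'j" where "c z = (SOME i. i \<in> I \<and> sat (fst z) (G i) (snd z))" for z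
  have c: "c z \<in> I" "sat (fst z) (G (c z)) (snd z)" if "z \<in> P" for z
  proof -
    have "\<exists>i. i \<in> I \<and> sat (fst z) (G i) (snd z)" using that by (auto simp: P_def)
    from someI_ex[OF this] show "c z \<in> I" "sat (fst z) (G (c z)) (snd z)"
      unfolding c_def by auto
  qed
  have eq: "(\<exists>z\<in>P. sat M (G (c z)) e) \<longleftrightarrow> (\<exists>i\<in>I. sat M (G i) e)"
    for M :: "('a, 's) model" and e
  proof (cases "(M, e) \<in> P")
    case True
    then have "sat M (G (c (M, e))) e" "c (M, e) \<in> I" using c[OF True] by simp_all
    then show ?thesis using True by blast
  next
    case False
    then have "\<forall>i\<in>I. \<not> sat M (G i) e" by (simp add: P_def)
    then show ?thesis using c(1) by blast
  qed
  have "L_inf lam voc (Disj P (\<lambda>z. G (c z)))" using G(1) c(1) by simp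
  moreover have "fv (Disj P (\<lambda>z. G (c z))) \<subseteq> g ` fv (Disj I F)"
  proof
    fix y assume "y \<in> fv (Disj P (\<lambda>z. G (c z)))"
    then obtain z where z: "z \<in> P" "y \<in> fv (G (c z))" by auto
    then have "y \<in> g ` fv (F (c z))" using G(2)[OF c(1)] by blast
    then show "y \<in> g ` fv (Disj I F)" using c(1)[OF z(1)] by auto
  qed
  moreover have "sat M (Disj P (\<lambda>z. G (c z))) e \<longleftrightarrow> sat M (Disj I F) (e \<circ> g)"
    if "universe M \<noteq> {}" for M :: "('a, 's) model" and e
    using eq G(3)[OF _ that] by simp
  ultimately show ?case by blast
next
  case (Exists X p)
  have fin: "\<not> finite (Field lam)" using lam(2) by (simp add: BNF_Cardinal_Arithmetic.cinfinite_def)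
  have X: "|X| <o lam" "|fv p - X| <o lam" using Exists.prems by simp_all
  have L: "L_inf lam voc p" using Exists.prems(1) by simp
  obtain h where h: "inj_on h (fv p)" "\<And>x. x \<in> fv p - X \<Longrightarrow> h x = g x"
    using rename_bound[OF lam X(2,1)] Exists.prems(3) by auto
  have "|(fv p - X) \<union> X| <o lam" using card_of_Un_ordLess_infinite_Field[OF fin lam(1)] X by blast
  then have "|fv p| <o lam"
    using card_of_mono1[of "fv p" "(fv p - X) \<union> X"] ordLeq_ordLess_trans by blast
  then obtain q :: "('s, 'a, ('a, 's) model \<times> ('a \<Rightarrow> 'a)) formula" where
    q: "L_inf lam voc q" "fv q \<subseteq> h ` fv p"
    "\<And>(M :: ('a, 's) model) e. universe M \<noteq> {} \<Longrightarrow> sat M q e \<longleftrightarrow> sat M p (e \<circ> h)"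
    using Exists.IH[OF L _ h(1)] by blast
  have "|h ` (fv p \<inter> X)| <o lam"
    using X(1) card_of_image[of h "fv p \<inter> X"] card_of_mono1[of "fv p \<inter> X" X]
    by (meson inf_le2 ordLeq_ordLess_trans)
  moreover have "fv q - h ` (fv p \<inter> X) \<subseteq> g ` (fv p - X)" using q(2) h(2) by force
  moreover have "(\<exists>e'. variant_on (universe M) (h ` (fv p \<inter> X)) e e' \<and> sat M p (e' \<circ> h))
     \<longleftrightarrow> (\<exists>d'. variant_on (universe M) X (e \<circ> g) d' \<and> sat M p d')"
    if "universe M \<noteq> {}" for M :: "('a, 's) model" and e
    using variant_rename[where X = X and b = True and e = e and M = M, OF that h(1) h(2)] by simp
  ultimately show ?case
    using q(1,3) by (intro exI[of _ "Exists (h ` (fv p \<inter> X)) q"]) (simp add: comp_def)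
next
  case (Forall X p)
  have fin: "\<not> finite (Field lam)" using lam(2) by (simp add: BNF_Cardinal_Arithmetic.cinfinite_def)
  have X: "|X| <o lam" "|fv p - X| <o lam" using Forall.prems by simp_all
  have L: "L_inf lam voc p" using Forall.prems(1) by simp
  obtain h where h: "inj_on h (fv p)" "\<And>x. x \<in> fv p - X \<Longrightarrow> h x = g x"
    using rename_bound[OF lam X(2,1)] Forall.prems(3) by auto
  have "|(fv p - X) \<union> X| <o lam" using card_of_Un_ordLess_infinite_Field[OF fin lam(1)] X by blast
  then have "|fv p| <o lam"
    using card_of_mono1[of "fv p" "(fv p - X) \<union> X"] ordLeq_ordLess_trans by blast
  then obtain q :: "('s, 'a, ('a, 's) model \<times> ('a \<Rightarrow> 'a)) formula" where
    q: "L_inf lam voc q" "fv q \<subseteq> h ` fv p"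
    "\<And>(M :: ('a, 's) model) e. universe M \<noteq> {} \<Longrightarrow> sat M q e \<longleftrightarrow> sat M p (e \<circ> h)"
    using Forall.IH[OF L _ h(1)] by blast
  have "|h ` (fv p \<inter> X)| <o lam"
    using X(1) card_of_image[of h "fv p \<inter> X"] card_of_mono1[of "fv p \<inter> X" X]
    by (meson inf_le2 ordLeq_ordLess_trans)
  moreover have "fv q - h ` (fv p \<inter> X) \<subseteq> g ` (fv p - X)" using q(2) h(2) by force
  moreover have "(\<forall>e'. variant_on (universe M) (h ` (fv p \<inter> X)) e e' \<longrightarrow> sat M p (e' \<circ> h))
     \<longleftrightarrow> (\<forall>d'. variant_on (universe M) X (e \<circ> g) d' \<longrightarrow> sat M p d')"
    if "universe M \<noteq> {}" for M :: "('a, 's) model" and e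
    using variant_rename[where X = X and b = False and e = e and M = M, OF that h(1) h(2)] by (simp, blast)
  ultimately show ?case
    using q(1,3) by (intro exI[of _ "Forall (h ` (fv p \<inter> X)) q"]) (simp add: comp_def)
qed

text \<open>Equivalent models agree on sentences with conjunctions and disjunctions over sets of any
  size (the type \<open>'j\<close>) and variables from any type \<open>'w\<close>.\<close>

theorem L_inf_equiv_any_sentence:
  fixes lam :: "'a rel" and p :: "('s, 'w, 'j) formula"
  assumes "Card_order lam" "cinfinite lam"
    and MN: "universe M \<noteq> {}" "universe N \<noteq> {}" "L_inf_equiv lam voc M N"
    and p: "L_inf_sentence lam voc p"
  shows "models M p \<longleftrightarrow> models N p"
proof -
  have p': "L_inf lam voc p" "fv p = {}" using p by (auto simp: L_inf_sentence_def)
  define g :: "'w \<Rightarrow> 'a" where "g = (\<lambda>_. undefined)"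
  have "Field lam \<noteq> {}" using assms(2) by (auto simp: BNF_Cardinal_Arithmetic.cinfinite_def)
  then have "|{} :: 'w set| <o lam"
    using assms(1) card_of_ordLess2[of "Field lam" "{} :: 'w set"]
    by (metis card_of_Field_ordIso image_empty ordLess_ordIso_trans subset_empty)
  then obtain q :: "('s, 'a, ('a, 's) model \<times> ('a \<Rightarrow> 'a)) formula" where
    q: "L_inf lam voc q" "fv q = {}"
    "\<And>(M :: ('a, 's) model) e. universe M \<noteq> {} \<Longrightarrow> sat M q e \<longleftrightarrow> sat M p (e \<circ> g)"
    using translate_formula[OF assms(1,2) p'(1), of g] p'(2) by auto
  have "models M p \<longleftrightarrow> models M q" if M: "universe M \<noteq> {}" for M :: "('a, 's) model"
  proof -
    obtain a where a: "a \<in> universe M" using M by blast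
    have cong: "sat M p d \<longleftrightarrow> sat M p d'" for d d' by (rule sat_cong) (simp add: p'(2))
    have ex: "range (\<lambda>_ :: 'w. a) \<subseteq> universe M" "range (\<lambda>_ :: 'a. a) \<subseteq> universe M" using a by auto
    show ?thesis unfolding models_def q(3)[OF M] using cong ex by metis
  qed
  then show ?thesis
    using MN q(1,2) unfolding L_inf_equiv_def L_inf_sentence_def by blast
qed


subsection \<open>The number of equivalent models\<close>

text \<open>Every model of cardinality \<open>lam\<close> is isomorphic to one with universe inside the type \<open>'a\<close>
  underlying \<open>lam\<close>, so counting isomorphism classes of such models counts isomorphism types.\<close>

definition No :: "'a rel \<Rightarrow> 's vocabulary \<Rightarrow> ('a, 's) model \<Rightarrow> ('a, 's) model set rel" where
  "No lam voc M =
     |{N. is_model voc N \<and> |universe N| =o lam \<and> L_inf_equiv lam voc N M} // iso_rel voc|"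

end

theory Submission
  imports Defs "HOL-Library.FuncSet"
begin

text \<open>
  Why the theorem holds. Let \<open>K\<close> be the field of \<open>kap\<close>, and let an inverse system of sets
  \<open>T j\<close>, for \<open>j\<close> in \<open>K\<close>, be given, a tree in which any two threads, the elements of its inverse
  limit, are exchanged by an automorphism, and whose levels have fewer than \<open>lam\<close> elements. Each family
  \<open>s\<close> of threads, indexed by the places \<open>(i, d)\<close> with \<open>d\<close> a limit point of \<open>K\<close> above \<open>i\<close>, is
  hidden in a structure of cardinality \<open>lam\<close>. The structure is a disjoint union of torsors
  under groups of sections, connected by relations that compare coordinates only eventually, along
  linear orders whose lengths are regular and cofinal in \<open>lam\<close>.

  Fewer than \<open>lam\<close> elements stay bounded in almost all of these orders. Therefore partial isomorphisms
  between the structures of two families, given by multiplication with sections, can always be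
  extended, and all these structures are equivalent in the infinitary language (\<open>mdl_equiv\<close>).
  Conversely, in an equivalent model one can choose base points in the torsors, level by level, such
  that fewer than \<open>lam\<close> of them at a time look like identity sections. The choices at different
  levels differ by sections, and the limits of these sections form a family of threads that the
  model hides (\<open>classification\<close>). Up to isomorphism, the equivalent models are thus exactly the
  structures of families.

  An ultrafilter on the places decides isomorphism well enough. Isomorphic structures have families with
  the same limits at each level (\<open>iso_limit\<close>), so families that are constantly equal to
  different threads give different isomorphism types. Structures are isomorphic if their families meet each
  point of the tree in the same way almost everywhere (\<open>same_type_iso\<close>). Hence the number of models lies
  between the number of threads and the number of these types (\<open>count_models\<close>).

  It remains to choose trees for which both numbers are \<open>mu\<close>. For \<open>mu\<close> below \<open>lam\<close>, all levels
  consist of the same \<open>mu\<close> points (\<open>few_models\<close>). For larger \<open>mu\<close> one starts from a set of \<open>mu\<close>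
  sequences of length \<open>kap\<close> that is closed under limits of truncations and has fewer than \<open>lam\<close>
  truncations at each level. Finite subsets of it, added modulo two, make a homogeneous tree, and its
  threads are again finite sets of sequences because \<open>kap\<close> is uncountable (\<open>many_models\<close>). That
  such closed sets exist in all cardinalities from \<open>lam\<close> to \<open>lam ^c kap\<close> is shown by minimizing a
  rank of functions modulo bounded sets of coordinates (\<open>family_exists\<close>).
\<close>

section \<open>Tuples of the same infinitary type\<close>

text \<open>Tuples are indexed by sets of variables. As the type of variables has at least as many
  elements as the cardinal, a tuple of fewer elements always leaves fresh variables for its
  prolongations.\<close>

definition elem_eq :: "'a rel \<Rightarrow> 's vocabulary \<Rightarrow> ('a, 's) model \<Rightarrow> ('a, 's) model \<Rightarrow>
    'a set \<Rightarrow> ('a \<Rightarrow> 'a) \<Rightarrow> ('a \<Rightarrow> 'a) \<Rightarrow> bool" where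
  "elem_eq lam voc M N X e d \<longleftrightarrow> e ` X \<subseteq> universe M \<and> d ` X \<subseteq> universe N \<and>
     (\<forall>p :: ('s, 'a, ('a, 's) model \<times> ('a \<Rightarrow> 'a)) formula.
        L_inf lam voc p \<and> fv p \<subseteq> X \<longrightarrow> (sat M p e \<longleftrightarrow> sat N p d))"

lemma elem_eq_sym: "elem_eq lam voc M N X e d \<Longrightarrow> elem_eq lam voc N M X d e"
  unfolding elem_eq_def by auto

text \<open>If no prolongation of the second tuple worked, each candidate would falsify some formula that
  is true of the first one. The conjunction of these formulas, preceded by a quantifier over the
  new variables, would then separate the given tuples. The candidates are assignments, so they
  can serve as the indices of this conjunction.\<close>

lemma elem_eq_forth:
  fixes M N :: "('a, 's) model"
  assumes eq: "elem_eq lam voc M N X e d" and X': "|X'| <o lam" "X \<inter> X' = {}"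
    and e1: "\<And>x. x \<in> X \<Longrightarrow> e1 x = e x" "e1 ` X' \<subseteq> universe M"
  obtains d1 where "\<And>x. x \<in> X \<Longrightarrow> d1 x = d x" "elem_eq lam voc M N (X \<union> X') e1 d1"
proof (rule ccontr)
  note thesisI = that
  assume no: "\<not> thesis"
  define I :: "(('a, 's) model \<times> ('a \<Rightarrow> 'a)) set" where
    "I = {i. variant_on (universe N) X' d (snd i)}"
  have eX: "e1 ` (X \<union> X') \<subseteq> universe M" using e1 eq by (auto simp: elem_eq_def)
  have "\<exists>p :: ('s, 'a, ('a, 's) model \<times> ('a \<Rightarrow> 'a)) formula.
      L_inf lam voc p \<and> fv p \<subseteq> X \<union> X' \<and> sat M p e1 \<and> \<not> sat N p d1"
    if d1: "variant_on (universe N) X' d d1" for d1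
  proof -
    have agree: "d1 x = d x" if "x \<in> X" for x using d1 that X'(2) by (auto simp: variant_on_def)
    have dX: "d1 ` (X \<union> X') \<subseteq> universe N"
      using d1 agree eq by (auto simp: variant_on_def elem_eq_def)
    have "\<not> elem_eq lam voc M N (X \<union> X') e1 d1" using no thesisI agree by blast
    then obtain p :: "('s, 'a, ('a, 's) model \<times> ('a \<Rightarrow> 'a)) formula" where
      p: "L_inf lam voc p" "fv p \<subseteq> X \<union> X'" "sat M p e1 \<noteq> sat N p d1"
      using eX dX unfolding elem_eq_def by blast
    show ?thesis
    proof (cases "sat M p e1")
      case True then show ?thesis using p by blast
    next
      case False
      then show ?thesis using p by (intro exI[of _ "Neg p"]) auto
    qed
  qed
  then obtain P :: "('a \<Rightarrow> 'a) \<Rightarrow> ('s, 'a, ('a, 's) model \<times> ('a \<Rightarrow> 'a)) formula" where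
    P: "\<And>d1. variant_on (universe N) X' d d1 \<Longrightarrow>
      L_inf lam voc (P d1) \<and> fv (P d1) \<subseteq> X \<union> X' \<and> sat M (P d1) e1 \<and> \<not> sat N (P d1) d1"
    by metis
  define q where "q = Exists X' (Conj I (\<lambda>i. P (snd i)))"
  have q: "L_inf lam voc q" "fv q \<subseteq> X" using P X' by (auto simp: q_def I_def)
  define e' where "e' = (\<lambda>x. if x \<in> X' then e1 x else e x)"
  have "variant_on (universe M) X' e e'" using e1 by (auto simp: variant_on_def e'_def)
  moreover have "sat M (P (snd i)) e'" if "i \<in> I" for i
  proof -
    have "sat M (P (snd i)) e1 = sat M (P (snd i)) e'"
      by (rule sat_cong) (use P that e1 in \<open>auto simp: I_def e'_def\<close>)
    then show ?thesis using P that by (auto simp: I_def)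
  qed
  ultimately have "sat M q e" unfolding q_def by auto
  then have "sat N q d" using eq q unfolding elem_eq_def by blast
  then obtain d1 where d1: "variant_on (universe N) X' d d1" "\<forall>i\<in>I. sat N (P (snd i)) d1"
    unfolding q_def by auto
  then have "sat N (P d1) d1" by (auto simp: I_def)
  then show False using P d1(1) by blast
qed

lemma elem_eq_subset: "elem_eq lam voc M N X e d \<Longrightarrow> Y \<subseteq> X \<Longrightarrow> elem_eq lam voc M N Y e d"
  unfolding elem_eq_def by blast

lemma elem_eq_empty:
  fixes M N :: "('a, 's) model"
  assumes "L_inf_equiv lam voc M N" "universe M \<noteq> {}" "universe N \<noteq> {}"
  shows "elem_eq lam voc M N {} e d"
proof -
  have *: "models A p \<longleftrightarrow> sat A p e"
    if A: "universe A \<noteq> {}" "fv p = {}"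
    for A :: "('a, 's) model" and p :: "('s, 'a, ('a, 's) model \<times> ('a \<Rightarrow> 'a)) formula" and e
  proof -
    obtain a where a: "a \<in> universe A" using A(1) by blast
    have "sat A p e1 = sat A p e2" for e1 e2 by (rule sat_cong) (simp add: A(2))
    moreover have "range (\<lambda>_ :: 'a. a) \<subseteq> universe A" using a by auto
    ultimately show ?thesis unfolding models_def by metis
  qed
  show ?thesis
    using assms * unfolding elem_eq_def L_inf_equiv_def L_inf_sentence_def by simp
qed

lemma elem_eq_eq: "elem_eq lam voc M N X e d \<Longrightarrow> x \<in> X \<Longrightarrow> y \<in> X \<Longrightarrow> e x = e y \<longleftrightarrow> d x = d y"
  unfolding elem_eq_def by (elim conjE allE[of _ "Eq x y"]) auto

lemma elem_eq_rel:
  "elem_eq lam voc M N X e d \<Longrightarrow> set xs \<subseteq> X \<Longrightarrow> voc R = Some (length xs) \<Longrightarrow>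
    map e xs \<in> interp M R \<longleftrightarrow> map d xs \<in> interp N R"
  unfolding elem_eq_def by (elim conjE allE[of _ "Rel R xs"]) auto

text \<open>The converse of \<open>elem_eq_forth\<close>. Only fewer than \<open>lam\<close> elements have
  to be added in one step, since a quantifier binds fewer than \<open>lam\<close> variables.\<close>

locale back_and_forth =
  fixes lam :: "'c rel" and voc :: "'s vocabulary" and M :: "('u, 's) model" and N :: "('w, 's) model"
    and F :: "('u set \<times> ('u \<Rightarrow> 'w)) set"
  assumes dom: "(D, f) \<in> F \<Longrightarrow> D \<subseteq> universe M \<and> inj_on f D \<and> f ` D \<subseteq> universe N"
    and atomic: "(D, f) \<in> F \<Longrightarrow> voc R = Some (length xs) \<Longrightarrow> set xs \<subseteq> D \<Longrightarrow>
      xs \<in> interp M R \<longleftrightarrow> map f xs \<in> interp N R"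
    and forth_step: "(D, f) \<in> F \<Longrightarrow> X \<subseteq> universe M \<Longrightarrow> |X| <o lam \<Longrightarrow>
      \<exists>D' f'. (D', f') \<in> F \<and> D \<union> X \<subseteq> D' \<and> (\<forall>x\<in>D. f' x = f x)"
    and back_step: "(D, f) \<in> F \<Longrightarrow> Y \<subseteq> universe N \<Longrightarrow> |Y| <o lam \<Longrightarrow>
      \<exists>D' f'. (D', f') \<in> F \<and> D \<subseteq> D' \<and> Y \<subseteq> f' ` D' \<and> (\<forall>x\<in>D. f' x = f x)"
begin

text \<open>The case \<open>b = True\<close> is the existential quantifier. The universal one is the case
  \<open>b = False\<close>, read contrapositively.\<close>

lemma quantifier_step:
  assumes IH: "\<And>D f e. (D, f) \<in> F \<Longrightarrow> e ` fv p \<subseteq> D \<Longrightarrow> sat M p e \<longleftrightarrow> sat N p (f \<circ> e)"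
    and DF: "(D, f) \<in> F" and e: "e ` (fv p - X) \<subseteq> D" and X: "|X| <o lam"
  shows "(\<exists>e'. variant_on (universe M) X e e' \<and> (sat M p e' \<longleftrightarrow> b)) \<longleftrightarrow>
         (\<exists>d'. variant_on (universe N) X (f \<circ> e) d' \<and> (sat N p d' \<longleftrightarrow> b))"
proof
  assume "\<exists>e'. variant_on (universe M) X e e' \<and> (sat M p e' \<longleftrightarrow> b)"
  then obtain e' where e': "variant_on (universe M) X e e'" "sat M p e' \<longleftrightarrow> b" by blast
  have "|e' ` X| <o lam" using X card_of_image ordLeq_ordLess_trans by blast
  then obtain D' f' where D': "(D', f') \<in> F" "D \<union> e' ` X \<subseteq> D'" "\<forall>x\<in>D. f' x = f x"
    using forth_step[OF DF] e'(1) unfolding variant_on_def by metis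
  have e'D: "e' ` fv p \<subseteq> D'"
  proof
    fix y assume "y \<in> e' ` fv p"
    then obtain x where x: "x \<in> fv p" "y = e' x" by blast
    show "y \<in> D'"
    proof (cases "x \<in> X")
      case False
      then have "e' x = e x" using e'(1) by (simp add: variant_on_def)
      then show ?thesis using x e D'(2) False by auto
    qed (use x D'(2) in auto)
  qed
  define d' where "d' = (\<lambda>x. if x \<in> X then f' (e' x) else (f \<circ> e) x)"
  have "variant_on (universe N) X (f \<circ> e) d'"
    using dom[OF D'(1)] D'(2) by (auto simp: variant_on_def d'_def image_subset_iff)
  moreover have "sat N p d' \<longleftrightarrow> sat N p (f' \<circ> e')"
  proof (rule sat_cong)
    fix x assume x: "x \<in> fv p"
    show "d' x = (f' \<circ> e') x"
    proof (cases "x \<in> X")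
      case False
      then have "e' x = e x" using e'(1) by (simp add: variant_on_def)
      moreover have "e x \<in> D" using e x False by auto
      ultimately show ?thesis using D'(3) False by (simp add: d'_def)
    qed (simp add: d'_def)
  qed
  ultimately show "\<exists>d'. variant_on (universe N) X (f \<circ> e) d' \<and> (sat N p d' \<longleftrightarrow> b)"
    using IH[OF D'(1) e'D] e'(2) by blast
next
  assume "\<exists>d'. variant_on (universe N) X (f \<circ> e) d' \<and> (sat N p d' \<longleftrightarrow> b)"
  then obtain d' where d': "variant_on (universe N) X (f \<circ> e) d'" "sat N p d' \<longleftrightarrow> b" by blast
  have "|d' ` X| <o lam" using X card_of_image ordLeq_ordLess_trans by blast
  then obtain D' f' where D': "(D', f') \<in> F" "D \<subseteq> D'" "d' ` X \<subseteq> f' ` D'" "\<forall>x\<in>D. f' x = f x"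
    using back_step[OF DF] d'(1) unfolding variant_on_def by metis
  define e' where "e' = (\<lambda>x. if x \<in> X then inv_into D' f' (d' x) else e x)"
  have inv: "inv_into D' f' (d' x) \<in> D'" "f' (inv_into D' f' (d' x)) = d' x" if "x \<in> X" for x
    using subsetD[OF D'(3) imageI[OF that]] by (rule inv_into_into, rule f_inv_into_f)
  have var: "variant_on (universe M) X e e'"
    using dom[OF D'(1)] inv by (auto simp: variant_on_def e'_def)
  have e'D: "e' ` fv p \<subseteq> D'" using inv e D'(2) by (auto simp: e'_def)
  have "sat N p d' \<longleftrightarrow> sat N p (f' \<circ> e')"
  proof (rule sat_cong)
    fix x assume x: "x \<in> fv p"
    show "d' x = (f' \<circ> e') x"
    proof (cases "x \<in> X")
      case False
      then have "d' x = f (e x)" using d'(1) by (simp add: variant_on_def)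
      moreover have "e x \<in> D" using e x False by auto
      ultimately show ?thesis using D'(4) False by (simp add: e'_def)
    qed (use inv in \<open>simp add: e'_def\<close>)
  qed
  then show "\<exists>e'. variant_on (universe M) X e e' \<and> (sat M p e' \<longleftrightarrow> b)"
    using IH[OF D'(1) e'D] var d'(2) by blast
qed

lemma sat_iff:
  "L_inf lam voc p \<Longrightarrow> (D, f) \<in> F \<Longrightarrow> e ` fv p \<subseteq> D \<Longrightarrow> sat M p e \<longleftrightarrow> sat N p (f \<circ> e)"
proof (induction p arbitrary: D f e)
  case (Eq x y)
  then show ?case using dom[OF Eq(2)] by (auto simp: inj_on_eq_iff)
next
  case (Rel R xs)
  then show ?case using atomic[OF Rel(2), of R "map e xs"] by (auto simp: comp_def)
next
  case (Neg p)
  have "sat M p e \<longleftrightarrow> sat N p (f \<circ> e)" using Neg.prems by (intro Neg.IH[of D f]) auto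
  then show ?case by (simp add: comp_def)
next
  case (Conj I G)
  have "sat M (G i) e \<longleftrightarrow> sat N (G i) (f \<circ> e)" if "i \<in> I" for i
    using Conj.prems that by (intro Conj.IH[of _ D f]) auto
  then show ?case by (simp add: comp_def)
next
  case (Disj I G)
  have "sat M (G i) e \<longleftrightarrow> sat N (G i) (f \<circ> e)" if "i \<in> I" for i
    using Disj.prems that by (intro Disj.IH[of _ D f]) auto
  then show ?case by (simp add: comp_def)
next
  case (Exists X p)
  have p: "L_inf lam voc p" "|X| <o lam" "e ` (fv p - X) \<subseteq> D" using Exists.prems by auto
  have IH: "sat M p e \<longleftrightarrow> sat N p (f \<circ> e)" if "(D, f) \<in> F" "e ` fv p \<subseteq> D" for D f e
    using Exists.IH[OF p(1) that] .
  have "(\<exists>e'. variant_on (universe M) X e e' \<and> (sat M p e' \<longleftrightarrow> True)) \<longleftrightarrow>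
        (\<exists>d'. variant_on (universe N) X (f \<circ> e) d' \<and> (sat N p d' \<longleftrightarrow> True))"
    by (rule quantifier_step[OF IH Exists.prems(2) p(3,2)])
  then show ?case unfolding sat.simps by blast
next
  case (Forall X p)
  have p: "L_inf lam voc p" "|X| <o lam" "e ` (fv p - X) \<subseteq> D" using Forall.prems by auto
  have IH: "sat M p e \<longleftrightarrow> sat N p (f \<circ> e)" if "(D, f) \<in> F" "e ` fv p \<subseteq> D" for D f e
    using Forall.IH[OF p(1) that] .
  have "(\<exists>e'. variant_on (universe M) X e e' \<and> (sat M p e' \<longleftrightarrow> False)) \<longleftrightarrow>
        (\<exists>d'. variant_on (universe N) X (f \<circ> e) d' \<and> (sat N p d' \<longleftrightarrow> False))"
    by (rule quantifier_step[OF IH Forall.prems(2) p(3,2)])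
  then show ?case unfolding sat.simps by blast
qed

lemma sentence_iff:
  assumes "F \<noteq> {}" "universe M \<noteq> {}" "universe N \<noteq> {}" "L_inf_sentence lam voc p"
  shows "models M p \<longleftrightarrow> models N p"
proof -
  have p: "L_inf lam voc p" "fv p = {}" using assms(4) by (auto simp: L_inf_sentence_def)
  obtain D f where DF: "(D, f) \<in> F" using assms(1) by auto
  obtain a b where ab: "a \<in> universe M" "b \<in> universe N" using assms by blast
  have "sat M p e = sat M p e'" "sat N p d = sat N p d'" for e e' d d'
    by (rule sat_cong, simp add: p)+
  moreover have "sat M p e = sat N p (f \<circ> e)" for e using sat_iff[OF p(1) DF] p(2) by simp
  moreover have "range (\<lambda>_. a) \<subseteq> universe M" "range (\<lambda>_. b) \<subseteq> universe N" using ab by auto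
  ultimately show ?thesis unfolding models_def by metis
qed

end

section \<open>Cardinal arithmetic below a singular cardinal\<close>

lemma card_lists_infinite:
  assumes "infinite A" shows "|lists A| \<le>o |A|"
proof -
  have A: "A \<noteq> {}" using assms by auto
  have n: "|{xs \<in> lists A. length xs = n}| \<le>o |A|" for n
  proof (induction n)
    case 0
    have "{xs \<in> lists A. length xs = 0} = {[]}" by auto
    then show ?case using card_of_singl_ordLeq[OF A] by simp
  next
    case (Suc n)
    have "{xs \<in> lists A. length xs = Suc n} \<subseteq> (\<lambda>(x, xs). x # xs) ` (A \<times> {xs \<in> lists A. length xs = n})"
      by (auto simp: length_Suc_conv image_iff)
    then have "|{xs \<in> lists A. length xs = Suc n}| \<le>o |A \<times> {xs \<in> lists A. length xs = n}|"
      by (rule ordLeq_transitive[OF card_of_mono1 card_of_image])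
    also have "|A \<times> {xs \<in> lists A. length xs = n}| \<le>o |A|"
      using Suc assms card_of_Sigma_ordLeq_infinite[of A A "\<lambda>_. {xs \<in> lists A. length xs = n}"]
      by (simp add: card_of_refl ordIso_imp_ordLeq)
    finally show ?case .
  qed
  have "lists A = (\<Union>n\<in>(UNIV :: nat set). {xs \<in> lists A. length xs = n})" by auto
  moreover have "|\<Union>n\<in>(UNIV :: nat set). {xs \<in> lists A. length xs = n}| \<le>o |A|"
    using n assms infinite_iff_card_of_nat[of A]
    by (intro card_of_UNION_ordLeq_infinite[OF assms] ballI) simp_all
  ultimately show ?thesis by simp
qed

lemma ordLeq_imp_inj:
  assumes "|A| \<le>o |B|" obtains f where "inj_on f A" "f ` A \<subseteq> B"
  using assms unfolding card_of_ordLeq[symmetric] by blast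

lemma card_of_ordLess_surj: "\<not> |A| \<le>o |B| \<Longrightarrow> |B| <o |A|"
  using not_ordLeq_iff_ordLess[OF card_of_Well_order card_of_Well_order] by blast

locale singular =
  fixes lam :: "'a rel" and kap :: "'k rel"
  assumes singular: "singular_cardinal lam" and cof: "is_cofinality kap lam"
    and unc: "natLeq <o kap"
    and pow: "\<forall>theta :: 'a rel. Card_order theta \<and> theta <o lam \<longrightarrow> theta ^c kap <o lam"
begin

definition K where "K = Field kap"
definition lt where "lt i j \<longleftrightarrow> (i, j) \<in> kap \<and> i \<noteq> j"

abbreviation tiny where "tiny A \<equiv> |A| <o lam"
abbreviation small where "small A \<equiv> |A| \<le>o lam"

lemma lamC: "Card_order lam" and lamI: "infinite (Field lam)"
  using singular by (auto simp: singular_cardinal_def BNF_Cardinal_Arithmetic.cinfinite_def)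

lemma kapC: "Card_order kap" using cof by (simp add: is_cofinality_def)
lemma lamW: "Well_order lam" using lamC by (simp add: card_order_on_def)
lemma kapW: "Well_order kap" using kapC by (simp add: card_order_on_def)
lemma K_kap: "|K| =o kap" unfolding K_def by (rule card_of_Field_ordIso[OF kapC])

lemma lam_total: "a \<in> Field lam \<Longrightarrow> b \<in> Field lam \<Longrightarrow> (a, b) \<in> lam \<or> (b, a) \<in> lam"
  using lamW wo_rel.TOTALS[of lam] by (auto simp: wo_rel_def)
lemma lam_trans: "(a, b) \<in> lam \<Longrightarrow> (b, c) \<in> lam \<Longrightarrow> (a, c) \<in> lam"
  using lamW wo_rel.TRANS[of lam] by (auto simp: wo_rel_def trans_def)
lemma lam_antisym: "(a, b) \<in> lam \<Longrightarrow> (b, a) \<in> lam \<Longrightarrow> a = b"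
  using lamW wo_rel.ANTISYM[of lam] by (auto simp: wo_rel_def antisym_def)
lemma lam_refl: "a \<in> Field lam \<Longrightarrow> (a, a) \<in> lam"
  using lam_total by blast

lemma lt_K: "lt i j \<Longrightarrow> i \<in> K \<and> j \<in> K" by (auto simp: lt_def K_def Field_def)
lemma lt_irrefl: "\<not> lt i i" by (simp add: lt_def)
lemma lt_trans: "lt i j \<Longrightarrow> lt j k \<Longrightarrow> lt i k"
  using kapW wo_rel.TRANS[of kap] wo_rel.ANTISYM[of kap]
  unfolding lt_def wo_rel_def trans_def antisym_def by metis
lemma lt_total: "i \<in> K \<Longrightarrow> j \<in> K \<Longrightarrow> lt i j \<or> i = j \<or> lt j i"
  using kapW wo_rel.TOTALS[of kap] by (auto simp: wo_rel_def lt_def K_def)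
lemma lt_wf: "wfp lt"
proof -
  have "wf (kap - Id)" using kapW by (simp add: order_on_defs)
  moreover have "{(i, j). lt i j} = kap - Id" by (auto simp: lt_def)
  ultimately show ?thesis by (simp add: wfp_def)
qed

lemma tiny_le: "|A| \<le>o |B| \<Longrightarrow> tiny B \<Longrightarrow> tiny A" using ordLeq_ordLess_trans by blast
lemma tiny_mono: "A \<subseteq> B \<Longrightarrow> tiny B \<Longrightarrow> tiny A" using card_of_mono1 tiny_le by blast
lemma tiny_image: "tiny A \<Longrightarrow> tiny (f ` A)" using card_of_image tiny_le by blast
lemma tiny_Un: "tiny A \<Longrightarrow> tiny B \<Longrightarrow> tiny (A \<union> B)"
  by (rule card_of_Un_ordLess_infinite_Field[OF lamI lamC])
lemma tiny_finite: "finite A \<Longrightarrow> tiny A"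
proof -
  assume "finite A"
  then have "|A| <o natLeq" using finite_iff_ordLess_natLeq by blast
  also have "natLeq \<le>o |Field lam|" using infinite_iff_natLeq_ordLeq lamI by blast
  finally show ?thesis using card_of_Field_ordIso[OF lamC] ordLess_ordIso_trans by blast
qed
lemma small_tiny: "tiny A \<Longrightarrow> small A" by (rule ordLess_imp_ordLeq)
lemma small_le: "|A| \<le>o |B| \<Longrightarrow> small B \<Longrightarrow> small A" using ordLeq_transitive by blast
lemma small_mono: "A \<subseteq> B \<Longrightarrow> small B \<Longrightarrow> small A" using card_of_mono1 small_le by blast
lemma small_image: "small A \<Longrightarrow> small (f ` A)" using card_of_image small_le by blast
lemma small_Un: "small A \<Longrightarrow> small B \<Longrightarrow> small (A \<union> B)"
  by (rule card_of_Un_ordLeq_infinite_Field[OF lamI _ _ lamC])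
lemma small_Times: "small A \<Longrightarrow> small B \<Longrightarrow> small (A \<times> B)"
  by (rule card_of_Times_ordLeq_infinite_Field[OF lamI _ _ lamC])
lemma small_Sigma: "small I \<Longrightarrow> (\<And>i. i \<in> I \<Longrightarrow> small (A i)) \<Longrightarrow> small (Sigma I A)"
  by (rule card_of_Sigma_ordLeq_infinite_Field[OF lamI lamC]) auto

lemma tiny_Times: assumes "tiny A" "tiny B" shows "tiny (A \<times> B)"
proof (cases "finite A \<and> finite B")
  case True then show ?thesis using tiny_finite[of "A \<times> B"] by simp
next
  case False
  let ?C = "A <+> B"
  have inf: "infinite ?C" using False by (auto simp: finite_Plus_iff)
  have C: "tiny ?C" by (rule card_of_Plus_ordLess_infinite_Field[OF lamI lamC assms])
  have "|A \<times> B| \<le>o |?C \<times> ?C|"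
    by (rule card_of_ordLeqI[where f = "\<lambda>(a, b). (Inl a, Inr b)"]) (auto simp: inj_on_def)
  also have "|?C \<times> ?C| =o |?C|" using card_of_Times_same_infinite[OF inf] .
  finally show ?thesis using C tiny_le by blast
qed

lemma tiny_Sigma_le:
  assumes I: "tiny I" and B: "tiny B" and le: "\<And>i. i \<in> I \<Longrightarrow> |A i| \<le>o |B|" shows "tiny (Sigma I A)"
proof -
  have "|Sigma I A| \<le>o |I \<times> B|" using card_of_Sigma_mono1[of I A "\<lambda>_. B"] le by blast
  then show ?thesis using tiny_Times[OF I B] tiny_le by blast
qed

lemma lam_bound:
  assumes X: "X \<subseteq> Field lam" "|X| <o kap"
  obtains a where "a \<in> Field lam" "\<And>x. x \<in> X \<Longrightarrow> (x, a) \<in> lam"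
proof -
  have "\<not> cofinal X lam"
    using cof X not_ordLess_ordLeq unfolding is_cofinality_def by blast
  then obtain a where a: "a \<in> Field lam" "\<forall>b\<in>X. \<not> (a \<noteq> b \<and> (a, b) \<in> lam)"
    unfolding cofinal_def by blast
  have "(x, a) \<in> lam" if x: "x \<in> X" for x
  proof -
    have "x \<in> Field lam" using X(1) x by auto
    then show ?thesis using a x lam_total[of x a] lam_refl[of x] by auto
  qed
  then show ?thesis using that a(1) by blast
qed

lemma cof_seq:
  obtains c where "\<And>i. i \<in> K \<Longrightarrow> c i \<in> Field lam"
    "\<And>a. a \<in> Field lam \<Longrightarrow> \<exists>i\<in>K. (a, c i) \<in> lam \<and> a \<noteq> c i"
proof -
  obtain X where X: "X \<subseteq> Field lam" "cofinal X lam" "|X| =o kap"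
    using cof unfolding is_cofinality_def by blast
  have "|K| =o |X|" using X(3) K_kap ordIso_transitive ordIso_symmetric by blast
  then obtain c where c: "bij_betw c K X" using card_of_ordIso by blast
  show ?thesis
  proof (rule that)
    show "c i \<in> Field lam" if "i \<in> K" for i using c that X(1) by (auto simp: bij_betw_def)
    show "\<exists>i\<in>K. (a, c i) \<in> lam \<and> a \<noteq> c i" if "a \<in> Field lam" for a
      using X(2) that c unfolding cofinal_def bij_betw_def by blast
  qed
qed

lemma tiny_underS: "a \<in> Field lam \<Longrightarrow> tiny (underS lam a)"
  by (rule card_of_underS[OF lamC])

lemma tiny_embed:
  assumes "tiny A" obtains a where "a \<in> Field lam" "|A| =o |underS lam a|"
proof -
  obtain a where a: "a \<in> Field lam" "|A| =o Restr lam (underS lam a)"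
    using assms ordLess_iff_ordIso_Restr[OF lamW card_of_Well_order] by blast
  have "Refl lam" using lamW wo_rel.REFL[of lam] by (simp add: wo_rel_def)
  moreover have "underS lam a \<subseteq> Field lam" by (auto simp: underS_def Field_def)
  ultimately have F: "Field (Restr lam (underS lam a)) = underS lam a"
    using Refl_Field_Restr2 by blast
  have "|Field |A| | =o |underS lam a|" using card_of_cong[OF a(2)] F by simp
  then show ?thesis using that a(1) by (simp add: Field_card_of)
qed

lemma K_small_ordLess: "|X| <o kap \<longleftrightarrow> |X| <o |K|"
  using K_kap ordIso_symmetric ordLess_ordIso_trans by blast

lemma K_inf: "infinite K"
proof
  assume "finite K"
  then have "|K| <o natLeq" using finite_iff_ordLess_natLeq by blast
  then show False using unc K_kap ordIso_ordLess_trans ordIso_symmetric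
      ordLess_irreflexive ordLess_transitive by metis
qed

text \<open>The hypothesis on exponentiation, for sets instead of cardinals.\<close>

lemma pow_kap:
  assumes "tiny A" shows "tiny (Func K A)"
proof -
  obtain B where B: "B \<subset> Field lam" "|A| =o |B|" "|B| <o lam"
    using assms internalize_card_of_ordLess[of A lam] by blast
  have "|B| ^c kap <o lam" by (rule pow[rule_format, OF conjI[OF card_of_Card_order B(3)]])
  moreover have "|A| ^c kap =o |B| ^c kap" using cexp_cong1[OF B(2) kapC] .
  ultimately have "|A| ^c kap <o lam" using ordIso_ordLess_trans by blast
  then show ?thesis by (simp add: cexp_def K_def Field_card_of)
qed

lemma tiny_Func:
  assumes "tiny A" "|I| \<le>o |K|" shows "tiny (Func I A)"
proof (cases "I = {} \<or> A = {}")
  case True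
  then have "Func I A = {\<lambda>_. undefined} \<or> Func I A = {}"
    using Func_empty[of A] Func_is_emp[of I A] by auto
  then have "finite (Func I A)" by auto
  then show ?thesis by (rule tiny_finite)
next
  case False
  obtain f where f: "inj_on f I" "f ` I \<subseteq> K" using ordLeq_imp_inj[OF assms(2)] .
  obtain a where a: "a \<in> A" using False by blast
  let ?h = "\<lambda>g. \<lambda>x. if x \<in> K then (if x \<in> f ` I then g (inv_into I f x) else a) else undefined"
  have "inj_on ?h (Func I A)"
  proof (rule inj_onI, rule ext)
    fix g h x assume gh: "g \<in> Func I A" "h \<in> Func I A" and eq: "?h g = ?h h"
    show "g x = h x"
    proof (cases "x \<in> I")
      case True
      then have "f x \<in> K" "f x \<in> f ` I" "inv_into I f (f x) = x" using f by auto
      then show ?thesis using fun_cong[OF eq, of "f x"] by simp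
    qed (use gh in \<open>simp add: Func_def\<close>)
  qed
  moreover have "?h ` Func I A \<subseteq> Func K A"
    using a by (auto simp: Func_def inv_into_into)
  ultimately have "|Func I A| \<le>o |Func K A|" using card_of_ordLeq by blast
  then show ?thesis using pow_kap[OF assms(1)] tiny_le by blast
qed

lemma tiny_PowI: assumes "|I| \<le>o |K|" shows "tiny (Pow I)"
proof -
  let ?h = "\<lambda>X. \<lambda>x. if x \<in> I then x \<in> X else undefined"
  have "inj_on ?h (Pow I)"
  proof (rule inj_onI)
    fix X Y assume "X \<in> Pow I" "Y \<in> Pow I" and eq: "?h X = ?h Y"
    moreover have "x \<in> X \<longleftrightarrow> x \<in> Y" if "x \<in> I" for x using fun_cong[OF eq, of x] that by simp
    ultimately show "X = Y" by blast
  qed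
  moreover have "?h ` Pow I \<subseteq> Func I (UNIV :: bool set)" by (auto simp: Func_def)
  ultimately have "|Pow I| \<le>o |Func I (UNIV :: bool set)|" using card_of_ordLeq by blast
  then show ?thesis using tiny_Func[OF tiny_finite[of "UNIV :: bool set"] assms] tiny_le by auto
qed

lemma tiny_K: "tiny K"
  using tiny_PowI[OF card_of_mono1[OF subset_refl]] card_of_Pow ordLess_transitive by blast


text \<open>The bounds of fewer than \<open>kap\<close> tiny sets are not cofinal. For \<open>kap\<close>
  many sets the lemma fails.\<close>

lemma tiny_UN:
  assumes I: "|I| <o |K|" and A: "\<And>i. i \<in> I \<Longrightarrow> tiny (A i)" shows "tiny (\<Union>i\<in>I. A i)"
proof -
  have "\<forall>i\<in>I. \<exists>a. a \<in> Field lam \<and> |A i| =o |underS lam a|" using A tiny_embed by metis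
  then obtain f where f: "\<And>i. i \<in> I \<Longrightarrow> f i \<in> Field lam \<and> |A i| =o |underS lam (f i)|" by metis
  have "|f ` I| <o kap" using I K_small_ordLess card_of_image ordLeq_ordLess_trans by blast
  then obtain a where a: "a \<in> Field lam" "\<And>x. x \<in> f ` I \<Longrightarrow> (x, a) \<in> lam"
    using lam_bound[of "f ` I"] f by blast
  have B: "tiny (underS lam a)" using tiny_underS a by blast
  have le: "|A i| \<le>o |underS lam a|" if "i \<in> I" for i
  proof -
    have "underS lam (f i) \<subseteq> underS lam a"
      using a(2)[of "f i"] that lam_trans lam_antisym unfolding underS_def by blast
    then show ?thesis using f[OF that] card_of_mono1 ordIso_ordLeq_trans by blast
  qed
  have "tiny I" using I ordLess_imp_ordLeq tiny_K tiny_le by blast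
  then have "tiny (Sigma I A)" by (rule tiny_Sigma_le[OF _ B le])
  then show ?thesis using card_of_UNION_Sigma tiny_le by blast
qed

lemma kap_underS: "i \<in> K \<Longrightarrow> |{j. lt j i}| <o |K|"
proof -
  assume "i \<in> K"
  then have "|underS kap i| <o kap" using card_of_underS[OF kapC] by (simp add: K_def)
  moreover have "underS kap i = {j. lt j i}" by (auto simp: underS_def lt_def)
  ultimately show ?thesis using K_small_ordLess by auto
qed

lemma K_ordLess_Un: "|X| <o |K| \<Longrightarrow> |Y| <o |K| \<Longrightarrow> |X \<union> Y| <o |K|"
  using card_of_Un_ordLess_infinite[OF K_inf] by blast

lemma K_finite: "finite X \<Longrightarrow> |X| <o |K|"
  using K_inf card_of_ordLess_surj card_of_ordLeq_finite by blast

text \<open>The cofinality is regular: a short cofinal sequence in \<open>K\<close> would give a short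
  cofinal sequence in the singular cardinal.\<close>

lemma K_bound:
  assumes X: "X \<subseteq> K" "|X| <o |K|" obtains b where "b \<in> K" "\<And>x. x \<in> X \<Longrightarrow> lt x b"
proof (rule ccontr)
  note thesisI = that
  assume no: "\<not> thesis"
  obtain c where c: "\<And>i. i \<in> K \<Longrightarrow> c i \<in> Field lam"
    "\<And>a. a \<in> Field lam \<Longrightarrow> \<exists>i\<in>K. (a, c i) \<in> lam \<and> a \<noteq> c i" using cof_seq by blast
  have "\<exists>a. a \<in> Field lam \<and> (\<forall>j. lt j x \<or> j = x \<longrightarrow> (c j, a) \<in> lam)" if "x \<in> X" for x
  proof -
    have x: "x \<in> K" using X that by blast
    have "|{j. lt j x} \<union> {x}| <o |K|" 
      by (rule K_ordLess_Un[OF kap_underS[OF x] K_finite]) simp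
    then have "|c ` ({j. lt j x} \<union> {x})| <o kap"
      using card_of_image ordLeq_ordLess_trans K_small_ordLess by blast
    moreover have "c ` ({j. lt j x} \<union> {x}) \<subseteq> Field lam" using c(1) x lt_K by blast
    ultimately obtain a where "a \<in> Field lam" "\<And>y. y \<in> c ` ({j. lt j x} \<union> {x}) \<Longrightarrow> (y, a) \<in> lam"
      using lam_bound by metis
    then show ?thesis by blast
  qed
  then obtain f where f: "\<And>x. x \<in> X \<Longrightarrow> f x \<in> Field lam \<and> (\<forall>j. lt j x \<or> j = x \<longrightarrow> (c j, f x) \<in> lam)"
    by metis
  have "|f ` X| <o kap" using X(2) card_of_image ordLeq_ordLess_trans K_small_ordLess by blast
  moreover have "f ` X \<subseteq> Field lam" using f by blast
  ultimately obtain a where a: "a \<in> Field lam" "\<And>y. y \<in> f ` X \<Longrightarrow> (y, a) \<in> lam" using lam_bound by metis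
  obtain i where i: "i \<in> K" "(a, c i) \<in> lam" "a \<noteq> c i" using c(2)[OF a(1)] by blast
  obtain x where x: "x \<in> X" "\<not> lt x i" using no thesisI[OF i(1)] by blast
  then have "lt i x \<or> i = x" using lt_total i(1) X(1) by blast
  then have "(c i, f x) \<in> lam" using f[OF x(1)] by blast
  then have "(c i, a) \<in> lam" using a(2) x(1) lam_trans by blast
  then show False using i lam_antisym by blast
qed

lemma K_nomax: "i \<in> K \<Longrightarrow> \<exists>j. lt i j"
  using K_bound[of "{i}"] K_finite[of "{i}"] by blast

text \<open>Uncountable cofinality is used mainly in this form.\<close>

lemma K_bound_nat:
  fixes f :: "nat \<Rightarrow> 'k"
  assumes "range f \<subseteq> K" obtains b where "b \<in> K" "\<And>n. lt (f n) b"
proof -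
  have "|range f| \<le>o natLeq"
    by (rule ordLeq_ordIso_trans[OF card_of_image card_of_nat])
  then have "|range f| <o |K|"
    by (rule ordLeq_ordLess_trans) (rule ordLess_ordIso_trans[OF unc ordIso_symmetric[OF K_kap]])
  then obtain b where b: "b \<in> K" "\<And>x. x \<in> range f \<Longrightarrow> lt x b" using K_bound[OF assms] by metis
  show ?thesis by (rule that[OF b(1) b(2)[OF rangeI]])
qed

text \<open>A singular cardinal is a limit cardinal, because an infinite successor is regular.\<close>

lemma tiny_cardSuc: assumes "tiny A" shows "tiny (Field (cardSuc |A| ))"
proof (cases "finite A")
  case True
  then have "finite (Field (cardSuc |A| ))"
    using cardSuc_finite[OF card_of_Card_order, of A] by (simp add: Field_card_of)
  then show ?thesis by (rule tiny_finite)
next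
  case False
  have C: "Card_order (cardSuc |A| )" using cardSuc_Card_order card_of_Card_order by blast
  have le: "cardSuc |A| \<le>o lam" using cardSuc_least[OF card_of_Card_order lamC assms] .
  have reg: "regularCard (cardSuc |A| )"
    using infinite_cardSuc_regularCard[OF _ card_of_Card_order] False by (simp add: Field_card_of)
  have ci: "Cinfinite (cardSuc |A| )"
    by (rule Cinfinite_cardSuc)
      (simp add: False BNF_Cardinal_Arithmetic.cinfinite_def Field_card_of card_of_card_order_on)
  have "\<not> cardSuc |A| =o lam"
  proof
    assume "cardSuc |A| =o lam"
    then have "regularCard lam" using regularCard_ordIso ci reg by blast
    then show False using singular by (simp add: singular_cardinal_def)
  qed
  then have "cardSuc |A| <o lam" using le ordLeq_iff_ordLess_or_ordIso by blast
  then show ?thesis using card_of_Field_ordIso[OF C] ordIso_ordLess_trans by blast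
qed

lemma tiny_nat: "tiny (UNIV :: nat set)"
  using unc K_kap tiny_K card_of_nat ordIso_ordLess_trans ordIso_symmetric ordLess_transitive by metis

lemma tiny_lists: fixes A :: "'c set" assumes "tiny A" shows "tiny (lists A)"
proof -
  let ?B = "(Inl :: 'c \<Rightarrow> 'c + nat) ` A \<union> Inr ` (UNIV :: nat set)"
  let ?f = "map (Inl :: 'c \<Rightarrow> 'c + nat)"
  have B: "tiny ?B" by (intro tiny_Un tiny_image assms tiny_nat)
  have inf: "infinite ?B" using finite_imageD[of "Inr :: nat \<Rightarrow> 'c + nat" UNIV] by (auto simp: inj_on_def)
  have "|lists A| \<le>o |lists ?B|"
    by (rule card_of_ordLeqI[where f = ?f]) (auto intro!: inj_onI simp: inj_map_eq_map)
  then show ?thesis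
    by (rule tiny_le[OF ordLeq_transitive[OF _ card_lists_infinite[OF inf]] B])
qed

lemma tiny_subsets: assumes "tiny A" shows "tiny {X. finite X \<and> X \<subseteq> A}"
proof -
  have "{X. finite X \<and> X \<subseteq> A} \<subseteq> set ` lists A"
  proof
    fix X assume "X \<in> {X. finite X \<and> X \<subseteq> A}"
    then obtain xs where "set xs = X" "X \<subseteq> A" using finite_list by blast
    then show "X \<in> set ` lists A" by auto
  qed
  then show ?thesis by (rule tiny_mono[OF _ tiny_image[OF tiny_lists[OF assms]]])
qed

end

context singular
begin

definition le where "le i j \<longleftrightarrow> i \<in> K \<and> j \<in> K \<and> \<not> lt j i"

lemma le_refl: "i \<in> K \<Longrightarrow> le i i" by (simp add: le_def lt_irrefl)
lemma lt_le: "lt i j \<Longrightarrow> le i j" unfolding le_def using lt_K lt_irrefl lt_trans by blast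
lemma le_K: "le i j \<Longrightarrow> i \<in> K \<and> j \<in> K" by (simp add: le_def)
lemma le_total: "i \<in> K \<Longrightarrow> j \<in> K \<Longrightarrow> le i j \<or> le j i"
  unfolding le_def using lt_irrefl lt_trans by blast
lemma le_trans: "le i j \<Longrightarrow> le j k \<Longrightarrow> le i k"
  unfolding le_def using lt_total lt_trans by blast
lemma le_lt_trans: "le i j \<Longrightarrow> lt j k \<Longrightarrow> lt i k"
  unfolding le_def using lt_total lt_trans lt_K by blast
lemma lt_le_trans: "lt i j \<Longrightarrow> le j k \<Longrightarrow> lt i k"
  unfolding le_def using lt_total lt_trans lt_K by blast
lemma le_iff: "le i j \<longleftrightarrow> lt i j \<or> (i = j \<and> i \<in> K)"
  using le_def lt_le le_refl lt_total by blast
lemma not_lt_le: "i \<in> K \<Longrightarrow> j \<in> K \<Longrightarrow> \<not> lt i j \<longleftrightarrow> le j i" by (auto simp: le_def)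

lemma le_max: assumes "i \<in> K" "j \<in> K" obtains m where "m \<in> K" "le i m" "le j m"
  using assms le_total le_refl by blast

definition Lim where
  "Lim = {d \<in> K. (\<exists>i. lt i d) \<and> (\<forall>i. lt i d \<longrightarrow> (\<exists>i'. lt i i' \<and> lt i' d))}"
definition Ind where "Ind = {(i, d). d \<in> Lim \<and> lt i d}"

lemma Lim_K: "d \<in> Lim \<Longrightarrow> d \<in> K" by (simp add: Lim_def)
lemma Ind_D: "(i, d) \<in> Ind \<Longrightarrow> d \<in> Lim \<and> lt i d \<and> i \<in> K \<and> d \<in> K"
  using lt_K by (auto simp: Ind_def Lim_def)

text \<open>The closure points of a function are cofinal; \<open>d\<close> is the supremum of countably
  many iterations.\<close>

lemma lim_closed:
  assumes h: "\<And>i. i \<in> K \<Longrightarrow> h i \<in> K"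
  obtains d where "d \<in> Lim" "\<And>i. lt i d \<Longrightarrow> lt (h i) d"
proof -
  have step: "\<exists>y. y \<in> K \<and> lt x y \<and> (\<forall>i. le i x \<longrightarrow> lt (h i) y)" if x: "x \<in> K" for x
  proof -
    let ?X = "insert x (h ` ({i. lt i x} \<union> {x}))"
    have "|{i. lt i x} \<union> {x}| <o |K|" by (rule K_ordLess_Un[OF kap_underS[OF x] K_finite]) simp
    then have 1: "|h ` ({i. lt i x} \<union> {x})| <o |K|" by (rule ordLeq_ordLess_trans[OF card_of_image])
    have "?X = {x} \<union> h ` ({i. lt i x} \<union> {x})" by auto
    then have "|?X| <o |K|" using K_ordLess_Un[OF K_finite[of "{x}"] 1] by simp
    moreover have "?X \<subseteq> K" using x h lt_K by auto
    ultimately obtain y where y: "y \<in> K" "\<And>z. z \<in> ?X \<Longrightarrow> lt z y" using K_bound by metis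
    then show ?thesis by (intro exI[of _ y]) (auto simp: le_iff)
  qed
  then obtain g where g: "\<And>x. x \<in> K \<Longrightarrow> g x \<in> K \<and> lt x (g x) \<and> (\<forall>i. le i x \<longrightarrow> lt (h i) (g x))" by metis
  obtain x0 where x0: "x0 \<in> K" using K_inf by fastforce
  define a where "a n = (g ^^ n) x0" for n :: nat
  have aK: "a n \<in> K" for n by (induction n) (auto simp: a_def x0 g)
  have aS: "lt (a n) (a (Suc n)) \<and> (\<forall>i. le i (a n) \<longrightarrow> lt (h i) (a (Suc n)))" for n
    using g[OF aK[of n]] by (simp add: a_def)
  define P where "P = {d \<in> K. \<forall>n. lt (a n) d}"
  have "range a \<subseteq> K" using aK by auto
  then obtain b where "b \<in> K" "\<And>n. lt (a n) b" by (rule K_bound_nat) blast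
  then have "P \<noteq> {}" by (auto simp: P_def)
  then obtain d where d: "d \<in> P" "\<And>y. lt y d \<Longrightarrow> y \<notin> P"
    using lt_wf unfolding wfp_eq_minimal by blast
  have below: "\<exists>n. le i (a n)" if "lt i d" for i
    using d(2)[OF that] lt_K[OF that] aK by (auto simp: P_def not_lt_le)
  show ?thesis
  proof (rule that[of d])
    show "d \<in> Lim"
    proof -
      have "\<exists>i'. lt i i' \<and> lt i' d" if i: "lt i d" for i
      proof -
        obtain n where "le i (a n)" using below[OF i] by blast
        then have "lt i (a (Suc n))" using aS le_lt_trans by blast
        then show ?thesis using d(1) by (auto simp: P_def)
      qed
      then show ?thesis using d(1) by (auto simp: Lim_def P_def)
    qed
    show "lt (h i) d" if i: "lt i d" for i
    proof -
      obtain n where "le i (a n)" using below[OF i] by blast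
      then have "lt (h i) (a (Suc n))" using aS by blast
      then show ?thesis using d(1) lt_trans by (auto simp: P_def)
    qed
  qed
qed

end

section \<open>Structures that hide a family of threads\<close>

text \<open>The elements of the structures come in sorts, and the elements of one sort form a torsor under
  a group of sections: functions that attach to each coordinate of the sort a permutation of one
  level \<open>j\<close> of a tree. The coordinates \<open>P i d\<close> are the places where
  threads are hidden; the coordinates \<open>B i b\<close> range over the thresholds
  \<open>b\<close> of a linear order attached to \<open>i\<close>. A sort \<open>Q j\<close>
  uses all places, \<open>R i b j\<close> a row of places, \<open>C d c j\<close> a column of
  thresholds below \<open>d\<close>, and \<open>E i b d j\<close> the thresholds at
  \<open>d\<close>; the last kind of sort ties the rows to the columns. A link is a binary
  relation between two sorts, a symbol either a link or a translation of the torsor.\<close>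

datatype ('k, 'b) srt = Q 'k | R 'k 'b 'k | E 'k 'b 'k 'k | C 'k 'b 'k
datatype ('k, 'b) crd = P 'k 'k | B 'k 'b
datatype ('k, 'b) lnk = Ev 'k 'b 'k | Pr 'k 'b 'k 'k 'k | Li 'k 'b 'k 'k | Xx 'k 'b 'k 'b 'k | Pu 'k | St 'k 'b 'k

type_synonym ('k, 'b, 't) sec = "('k, 'b) crd \<Rightarrow> 't \<Rightarrow> 't"
type_synonym ('k, 'b, 't) el = "('k, 'b) srt \<times> ('k, 'b, 't) sec"
datatype ('k, 'b, 't) sym = Tr "('k, 'b) srt" "('k, 'b, 't) sec" | Ln "('k, 'b) lnk"

text \<open>The group structure of sections: pointwise composition.\<close>

definition sec_mult :: "('x \<Rightarrow> 't \<Rightarrow> 't) \<Rightarrow> ('x \<Rightarrow> 't \<Rightarrow> 't) \<Rightarrow> 'x \<Rightarrow> 't \<Rightarrow> 't" (infixl "\<odot>" 70) where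
  "f \<odot> g = (\<lambda>x. f x \<circ> g x)"
definition sec_inv :: "('x \<Rightarrow> 't \<Rightarrow> 't) \<Rightarrow> 'x \<Rightarrow> 't \<Rightarrow> 't" where "sec_inv f = (\<lambda>x. inv (f x))"
definition sec_one :: "'x \<Rightarrow> 't \<Rightarrow> 't" where "sec_one = (\<lambda>_. id)"

lemma sec_mult_assoc: "f \<odot> g \<odot> h = f \<odot> (g \<odot> h)" by (simp add: sec_mult_def comp_assoc)
lemma sec_mult_one [simp]: "sec_one \<odot> f = f" "f \<odot> sec_one = f" by (simp_all add: sec_mult_def sec_one_def)

text \<open>The levels \<open>T j\<close> form an inverse system with projections \<open>pr\<close>, on
  which the groups \<open>A j\<close> act. The orders on \<open>Th i\<close> are so long that
  the thresholds of \<open>kap\<close> many conditions have a common bound, and so have those of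
  all conditions indexed by lower thresholds, whereas all \<open>Th i\<close> stay below
  \<open>lam\<close>; their lengths are cofinal in \<open>lam\<close>. The ultrafilter lives on
  the places.\<close>

locale hidden_threads = singular lam kap for lam :: "'a rel" and kap :: "'k rel" +
  fixes Th :: "'k \<Rightarrow> 'b set" and tl :: "'k \<Rightarrow> 'b \<Rightarrow> 'b \<Rightarrow> bool"
    and T :: "'k \<Rightarrow> 't set" and pr :: "'k \<Rightarrow> 'k \<Rightarrow> 't \<Rightarrow> 't" and A :: "'k \<Rightarrow> ('t \<Rightarrow> 't) set"
    and UF :: "('k \<times> 'k) set set" and oo :: "'k \<Rightarrow> 't"
  assumes Th_ne: "i \<in> K \<Longrightarrow> Th i \<noteq> {}"
    and tl_irrefl: "\<not> tl i x x"
    and tl_trans: "tl i x y \<Longrightarrow> tl i y z \<Longrightarrow> tl i x z"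
    and tl_total: "x \<in> Th i \<Longrightarrow> y \<in> Th i \<Longrightarrow> tl i x y \<or> x = y \<or> tl i y x"
    and Th_bd_K: "i \<in> K \<Longrightarrow> (\<And>d. d \<in> K \<Longrightarrow> f d \<in> Th i) \<Longrightarrow> \<exists>b\<in>Th i. \<forall>d\<in>K. tl i (f d) b"
    and Th_bd_Low: "d \<in> K \<Longrightarrow> (\<And>i b. lt i d \<Longrightarrow> b \<in> Th i \<Longrightarrow> g i b \<in> Th d) \<Longrightarrow>
        \<exists>c\<in>Th d. \<forall>i b. lt i d \<longrightarrow> b \<in> Th i \<longrightarrow> tl d (g i b) c"
    and Th_tiny: "i \<in> K \<Longrightarrow> |Th i| <o lam"
    and Th_cof: "a \<in> Field lam \<Longrightarrow> \<exists>i0\<in>K. \<forall>i. lt i0 i \<longrightarrow>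
        (\<forall>Y \<subseteq> Th i. |Y| \<le>o |underS lam a| \<longrightarrow> (\<exists>b\<in>Th i. \<forall>y\<in>Y. tl i y b))"
    and Low_lam: "lam \<le>o |SIGMA i:K. Th i|"
    and T_pr: "le i j \<Longrightarrow> t \<in> T j \<Longrightarrow> pr j i t \<in> T i"
    and A_id: "j \<in> K \<Longrightarrow> id \<in> A j"
    and A_comp: "j \<in> K \<Longrightarrow> p \<in> A j \<Longrightarrow> q \<in> A j \<Longrightarrow> p \<circ> q \<in> A j"
    and A_inv: "j \<in> K \<Longrightarrow> p \<in> A j \<Longrightarrow> inv p \<in> A j"
    and A_bij: "j \<in> K \<Longrightarrow> p \<in> A j \<Longrightarrow> bij p"
    and A_T: "j \<in> K \<Longrightarrow> p \<in> A j \<Longrightarrow> t \<in> T j \<Longrightarrow> p t \<in> T j"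
    and A_tiny: "j \<in> K \<Longrightarrow> |A j| <o lam"
    and oo_T: "j \<in> K \<Longrightarrow> oo j \<in> T j" and oo_pr: "le i j \<Longrightarrow> pr j i (oo j) = oo i"
    and UF_sub: "X \<in> UF \<Longrightarrow> X \<subseteq> Y \<Longrightarrow> Y \<subseteq> Ind \<Longrightarrow> Y \<in> UF"
    and UF_int: "X \<in> UF \<Longrightarrow> Y \<in> UF \<Longrightarrow> X \<inter> Y \<in> UF"
    and UF_Ind: "X \<in> UF \<Longrightarrow> X \<subseteq> Ind"
    and UF_ne: "{} \<notin> UF"
    and UF_B: "(\<And>i. i \<in> K \<Longrightarrow> h i \<in> K) \<Longrightarrow> (\<And>d. d \<in> Lim \<Longrightarrow> lt (k d) d) \<Longrightarrow>
        {(i, d) \<in> Ind. \<not> lt i (k d) \<and> \<not> lt d (h i)} \<in> UF"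
begin

definition thr where
  "thr x \<longleftrightarrow> (\<forall>j\<in>K. x j \<in> T j) \<and> (\<forall>i j. le i j \<longrightarrow> pr j i (x j) = x i)"
definition tree_auto where
  "tree_auto p \<longleftrightarrow> (\<forall>j\<in>K. p j \<in> A j) \<and> (\<forall>i j. le i j \<longrightarrow> (\<forall>t\<in>T j. pr j i (p j t) = p i (pr j i t)))"

definition ev where "ev i U \<longleftrightarrow> (\<exists>a\<in>Th i. \<forall>x\<in>Th i. \<not> tl i x a \<longrightarrow> U x)"
text \<open>Functions with finitely many steps have a limit along the order, but their values on a proper
  initial segment put no constraint on it.\<close>

definition FS where
  "FS i f \<longleftrightarrow> (\<exists>F. finite F \<and> F \<subseteq> Th i \<and>
     (\<forall>x\<in>Th i. \<forall>y\<in>Th i. (\<forall>a\<in>F. tl i x a \<longleftrightarrow> tl i y a) \<longrightarrow> f x = f y))"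

lemma ev_true: "i \<in> K \<Longrightarrow> (\<And>x. x \<in> Th i \<Longrightarrow> U x) \<Longrightarrow> ev i U"
  unfolding ev_def using Th_ne by blast

lemma ev_mono: "ev i U \<Longrightarrow> (\<And>x. x \<in> Th i \<Longrightarrow> U x \<Longrightarrow> W x) \<Longrightarrow> ev i W"
  unfolding ev_def by blast

lemma ev_conj: assumes "ev i U" "ev i W" shows "ev i (\<lambda>x. U x \<and> W x)"
proof -
  obtain a b where a: "a \<in> Th i" "\<And>x. x \<in> Th i \<Longrightarrow> \<not> tl i x a \<Longrightarrow> U x"
    and b: "b \<in> Th i" "\<And>x. x \<in> Th i \<Longrightarrow> \<not> tl i x b \<Longrightarrow> W x"
    using assms unfolding ev_def by blast
  show ?thesis
  proof (cases "tl i a b")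
    case True
    then show ?thesis unfolding ev_def using a b tl_trans tl_total by (intro bexI[of _ b]) blast+
  next
    case False
    then show ?thesis unfolding ev_def using a b tl_trans tl_total by (intro bexI[of _ a]) blast+
  qed
qed

lemma ev_conj2: "ev i U \<Longrightarrow> ev i W \<Longrightarrow> (\<And>x. x \<in> Th i \<Longrightarrow> U x \<Longrightarrow> W x \<Longrightarrow> Z x) \<Longrightarrow> ev i Z"
  using ev_conj[of i U W] ev_mono[of i "\<lambda>x. U x \<and> W x" Z] by blast

lemma ev_cong: "ev i U \<Longrightarrow> (\<And>x. x \<in> Th i \<Longrightarrow> U x \<Longrightarrow> W x \<longleftrightarrow> Z x) \<Longrightarrow> ev i W \<longleftrightarrow> ev i Z"
  using ev_conj2[of i U W Z] ev_conj2[of i U Z W] by blast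

lemma ev_ex: assumes "ev i U" obtains x where "x \<in> Th i" "U x"
  using assms tl_irrefl unfolding ev_def by blast

lemma FS_const: "FS i (\<lambda>_. c)" unfolding FS_def by (intro exI[of _ "{}"]) simp

lemma FS_comb:
  assumes "FS i f" "FS i g" shows "FS i (\<lambda>x. h (f x) (g x))"
proof -
  obtain F G where F: "finite F" "F \<subseteq> Th i"
    "\<And>x y. x \<in> Th i \<Longrightarrow> y \<in> Th i \<Longrightarrow> \<forall>a\<in>F. tl i x a \<longleftrightarrow> tl i y a \<Longrightarrow> f x = f y"
    and G: "finite G" "G \<subseteq> Th i"
    "\<And>x y. x \<in> Th i \<Longrightarrow> y \<in> Th i \<Longrightarrow> \<forall>a\<in>G. tl i x a \<longleftrightarrow> tl i y a \<Longrightarrow> g x = g y"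
    using assms unfolding FS_def by metis
  show ?thesis unfolding FS_def
  proof (intro exI[of _ "F \<union> G"] conjI ballI impI)
    fix x y assume "x \<in> Th i" "y \<in> Th i" "\<forall>a\<in>F \<union> G. tl i x a \<longleftrightarrow> tl i y a"
    then show "h (f x) (g x) = h (f y) (g y)" using F(3)[of x y] G(3)[of x y] by simp
  qed (use F G in auto)
qed

lemma FS_map: "FS i f \<Longrightarrow> FS i (\<lambda>x. h (f x))"
  using FS_comb[of i f f "\<lambda>a _. h a"] by simp

lemma FS_cong: "FS i f \<Longrightarrow> (\<And>x. x \<in> Th i \<Longrightarrow> f x = g x) \<Longrightarrow> FS i g"
  unfolding FS_def by metis

lemma FS_cut: "b \<in> Th i \<Longrightarrow> FS i (\<lambda>x. tl i x b)"
  unfolding FS_def by (intro exI[of _ "{b}"]) simp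

lemma FS_glue:
  assumes "FS i f" "FS i g" "b \<in> Th i" shows "FS i (\<lambda>x. if tl i x b then f x else g x)"
  by (rule FS_cong[OF FS_comb[OF FS_cut[OF assms(3)] FS_comb[OF assms(1,2), of Pair],
      of "\<lambda>c p. if c then fst p else snd p"]]) simp

lemma finite_bound:
  assumes "i \<in> K" "finite F" "F \<subseteq> Th i"
  shows "\<exists>m\<in>Th i. \<forall>a\<in>F. \<not> tl i m a"
  using assms(2,3)
proof (induction F)
  case empty
  then show ?case using Th_ne[OF assms(1)] by blast
next
  case (insert a F)
  then obtain m where m: "m \<in> Th i" "\<forall>b\<in>F. \<not> tl i m b" by blast
  show ?case
  proof (cases "tl i m a")
    case True
    then have "\<forall>b\<in>insert a F. \<not> tl i a b"
      using m tl_trans tl_irrefl by blast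
    then show ?thesis using insert.prems by blast
  qed (use m in blast)
qed

lemma FS_limit:
  assumes "i \<in> K" "FS i f" obtains c where "ev i (\<lambda>x. f x = c)" "\<exists>x\<in>Th i. c = f x"
proof -
  obtain F where F: "finite F" "F \<subseteq> Th i"
    "\<And>x y. x \<in> Th i \<Longrightarrow> y \<in> Th i \<Longrightarrow> \<forall>a\<in>F. tl i x a \<longleftrightarrow> tl i y a \<Longrightarrow> f x = f y"
    using assms unfolding FS_def by metis
  obtain m where m: "m \<in> Th i" "\<forall>a\<in>F. \<not> tl i m a" using finite_bound[OF assms(1) F(1,2)] by blast
  have "f x = f m" if "x \<in> Th i" "\<not> tl i x m" for x
  proof (rule F(3)[OF that(1) m(1)])
    show "\<forall>a\<in>F. tl i x a \<longleftrightarrow> tl i m a"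
      using m that tl_trans tl_total[OF that(1) m(1)] by blast
  qed
  then have "ev i (\<lambda>x. f x = f m)" unfolding ev_def using m by blast
  then show ?thesis using that m by blast
qed

definition FSall where "FSall f \<longleftrightarrow> (\<forall>i\<in>K. FS i (\<lambda>b. f (B i b)))"

fun Dm :: "('k, 'b) srt \<Rightarrow> ('k, 'b) crd set" where
  "Dm (Q j) = {P i d |i d. (i, d) \<in> Ind}"
| "Dm (R i b j) = {P i d |d. (i, d) \<in> Ind}"
| "Dm (E i b d j) = {B d c |c. c \<in> Th d}"
| "Dm (C d c j) = {B i b |i b. lt i d \<and> b \<in> Th i}"

fun ix :: "('k, 'b) srt \<Rightarrow> 'k" where
  "ix (Q j) = j" | "ix (R i b j) = j" | "ix (E i b d j) = j" | "ix (C d c j) = j"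

definition Srt :: "('k, 'b) srt set" where
  "Srt = {s. case s of Q j \<Rightarrow> j \<in> K | R i b j \<Rightarrow> i \<in> K \<and> b \<in> Th i \<and> j \<in> K
     | E i b d j \<Rightarrow> (i, d) \<in> Ind \<and> b \<in> Th i \<and> j \<in> K | C d c j \<Rightarrow> d \<in> Lim \<and> c \<in> Th d \<and> j \<in> K}"

lemma Srt_simps [simp]:
  "Q j \<in> Srt \<longleftrightarrow> j \<in> K" "R i b j \<in> Srt \<longleftrightarrow> i \<in> K \<and> b \<in> Th i \<and> j \<in> K"
  "E i b d j \<in> Srt \<longleftrightarrow> (i, d) \<in> Ind \<and> b \<in> Th i \<and> j \<in> K"
  "C d c j \<in> Srt \<longleftrightarrow> d \<in> Lim \<and> c \<in> Th d \<and> j \<in> K"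
  by (simp_all add: Srt_def)

lemma ix_K: "s \<in> Srt \<Longrightarrow> ix s \<in> K" by (cases s) auto

text \<open>The steps are required only in the threshold coordinates; in the places a section is
  arbitrary.\<close>

definition G :: "('k, 'b) srt \<Rightarrow> ('k, 'b, 't) sec set" where
  "G s = {f. (\<forall>x\<in>Dm s. f x \<in> A (ix s)) \<and> (\<forall>x. x \<notin> Dm s \<longrightarrow> f x = id) \<and> FSall f}"

lemma G_A: "s \<in> Srt \<Longrightarrow> f \<in> G s \<Longrightarrow> f x \<in> A (ix s)"
  unfolding G_def using A_id ix_K by (cases "x \<in> Dm s") auto
lemma G_bij: "s \<in> Srt \<Longrightarrow> f \<in> G s \<Longrightarrow> bij (f x)"
  using G_A A_bij ix_K by blast
lemma G_inj: "s \<in> Srt \<Longrightarrow> f \<in> G s \<Longrightarrow> f x t = f x u \<longleftrightarrow> t = u"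
  using G_bij by (metis bij_is_inj inj_eq)
lemma G_injc: "s \<in> Srt \<Longrightarrow> f \<in> G s \<Longrightarrow> f x \<circ> p = f x \<circ> q \<longleftrightarrow> p = q"
  using G_inj by (metis comp_def ext)
lemma G_T: "s \<in> Srt \<Longrightarrow> f \<in> G s \<Longrightarrow> t \<in> T (ix s) \<Longrightarrow> f x t \<in> T (ix s)"
  using G_A A_T ix_K by blast

lemma G_one: "s \<in> Srt \<Longrightarrow> sec_one \<in> G s"
  unfolding G_def FSall_def sec_one_def using A_id ix_K FS_const by auto
lemma G_mult: "s \<in> Srt \<Longrightarrow> f \<in> G s \<Longrightarrow> g \<in> G s \<Longrightarrow> f \<odot> g \<in> G s"
  unfolding G_def FSall_def sec_mult_def using A_comp ix_K by (auto intro: FS_comb[where h = "(\<circ>)"])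
lemma G_siv: "s \<in> Srt \<Longrightarrow> f \<in> G s \<Longrightarrow> sec_inv f \<in> G s"
  unfolding G_def FSall_def sec_inv_def using A_inv ix_K by (auto simp: inv_id intro: FS_map[where h = inv])
lemma sec_inv_left: "s \<in> Srt \<Longrightarrow> f \<in> G s \<Longrightarrow> sec_inv f \<odot> f = sec_one"
  using G_bij by (auto simp: sec_inv_def sec_mult_def sec_one_def fun_eq_iff bij_is_inj)
lemma sec_inv_right: "s \<in> Srt \<Longrightarrow> f \<in> G s \<Longrightarrow> f \<odot> sec_inv f = sec_one"
  using G_bij by (auto simp: sec_inv_def sec_mult_def sec_one_def fun_eq_iff bij_is_surj surj_f_inv_f)
lemma G_cancel: "s \<in> Srt \<Longrightarrow> f \<in> G s \<Longrightarrow> f \<odot> g = f \<odot> h \<longleftrightarrow> g = h"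
  using sec_inv_left by (metis sec_mult_assoc sec_mult_one(1))

fun src :: "('k, 'b) lnk \<Rightarrow> ('k, 'b) srt" where
  "src (Ev i b j) = R i b j" | "src (Pr i b d j j') = R i b j" | "src (Li i b d j) = E i b d j"
| "src (Xx i b d c j) = E i b d j" | "src (Pu j) = Q j" | "src (St d c j) = C d c j"
fun tgt :: "('k, 'b) lnk \<Rightarrow> ('k, 'b) srt" where
  "tgt (Ev i b j) = Q j" | "tgt (Pr i b d j j') = R i b j'" | "tgt (Li i b d j) = R i b j"
| "tgt (Xx i b d c j) = C d c j" | "tgt (Pu j) = Q j" | "tgt (St d c j) = C d c j"

text \<open>The marker \<open>St\<close> is the only link that depends on the hidden family: the germ of a
  column at row \<open>i\<close> carries the base thread to \<open>s i d\<close>. All others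
  define subgroups of the product of two groups. \<open>Ev\<close> lets a row agree with
  \<open>Q j\<close> at late \<open>d\<close>, \<open>Li\<close> compares a limit along
  thresholds with a place, \<open>Xx\<close> identifies a row and a column entry,
  \<open>Pr\<close> is compatibility with the projections, and \<open>Pu\<close> says that a
  section fixes each point at almost all places.\<close>

fun holds :: "('k \<Rightarrow> 'k \<Rightarrow> 'k \<Rightarrow> 't) \<Rightarrow> ('k, 'b) lnk \<Rightarrow> ('k, 'b, 't) sec \<Rightarrow> ('k, 'b, 't) sec \<Rightarrow> bool" where
  "holds s (Ev i b j) f g \<longleftrightarrow> (\<exists>h\<in>K. \<forall>d\<in>Lim. lt i d \<and> \<not> lt d h \<longrightarrow> f (P i d) = g (P i d))"
| "holds s (Pr i b d j j') f g \<longleftrightarrow> (\<forall>t\<in>T j. pr j j' (f (P i d) t) = g (P i d) (pr j j' t))"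
| "holds s (Li i b d j) f g \<longleftrightarrow> ev d (\<lambda>c. f (B d c) = g (P i d))"
| "holds s (Xx i b d c j) f g \<longleftrightarrow> f (B d c) = g (B i b)"
| "holds s (Pu j) f g \<longleftrightarrow> f = g \<and> (\<forall>t\<in>T j. {(i, d) \<in> Ind. f (P i d) t = t} \<in> UF)"
| "holds s (St d c j) f g \<longleftrightarrow> f = g \<and> (\<exists>k. lt k d \<and> (\<forall>i. \<not> lt i k \<and> lt i d \<longrightarrow>
      ev i (\<lambda>b. f (B i b) (oo j) = s i d j)))"

definition Lnk where
  "Lnk = {l. src l \<in> Srt \<and> tgt l \<in> Srt \<and> (case l of Pr i b d j j' \<Rightarrow> le j' j \<and> (i, d) \<in> Ind | _ \<Rightarrow> True)}"

fun isSt where "isSt (St d c j) = True" | "isSt _ = False"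

text \<open>Partial isomorphisms multiply each torsor from the left by a section.\<close>

definition link_preserved where
  "link_preserved s s' l a b \<longleftrightarrow> (\<forall>f\<in>G (src l). \<forall>g\<in>G (tgt l). holds s l f g \<longleftrightarrow> holds s' l (a \<odot> f) (b \<odot> g))"

text \<open>A link other than the marker is a subgroup, so multiplication by one of its elements preserves
  it.\<close>

lemma link_preserved_by_group:
  assumes l: "l \<in> Lnk" "\<not> isSt l" and a: "a \<in> G (src l)" and b: "b \<in> G (tgt l)" and ab: "holds s'' l a b"
  shows "link_preserved s s' l a b"
  unfolding link_preserved_def
proof (intro ballI)
  fix f g assume f: "f \<in> G (src l)" and g: "g \<in> G (tgt l)"
  have sS: "src l \<in> Srt" and tS: "tgt l \<in> Srt" using l by (auto simp: Lnk_def)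
  show "holds s l f g \<longleftrightarrow> holds s' l (a \<odot> f) (b \<odot> g)"
  proof (cases l)
    case (Ev i x j)
    obtain h where h: "h \<in> K" "\<forall>d\<in>Lim. lt i d \<and> \<not> lt d h \<longrightarrow> a (P i d) = b (P i d)"
      using ab Ev by auto
    have eq: "f (P i d) = g (P i d) \<longleftrightarrow> (a \<odot> f) (P i d) = (b \<odot> g) (P i d)"
      if "d \<in> Lim" "lt i d" "\<not> lt d h" for d
      using h(2)[rule_format, of d] that by (simp add: sec_mult_def G_injc[OF tS b])
    show ?thesis
    proof
      assume "holds s l f g"
      then obtain h' where h': "h' \<in> K" "\<forall>d\<in>Lim. lt i d \<and> \<not> lt d h' \<longrightarrow> f (P i d) = g (P i d)"
        using Ev by auto
      obtain m where m: "m \<in> K" "le h m" "le h' m" using le_max h(1) h'(1) by blast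
      have "\<forall>d\<in>Lim. lt i d \<and> \<not> lt d m \<longrightarrow> (a \<odot> f) (P i d) = (b \<odot> g) (P i d)"
        using eq h'(2) m lt_le_trans by blast
      then show "holds s' l (a \<odot> f) (b \<odot> g)" using Ev m(1) by auto
    next
      assume "holds s' l (a \<odot> f) (b \<odot> g)"
      then obtain h' where h': "h' \<in> K" "\<forall>d\<in>Lim. lt i d \<and> \<not> lt d h' \<longrightarrow> (a \<odot> f) (P i d) = (b \<odot> g) (P i d)"
        using Ev by auto
      obtain m where m: "m \<in> K" "le h m" "le h' m" using le_max h(1) h'(1) by blast
      have "\<forall>d\<in>Lim. lt i d \<and> \<not> lt d m \<longrightarrow> f (P i d) = g (P i d)"
        using eq h'(2) m lt_le_trans by blast
      then show "holds s l f g" using Ev m(1) by auto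
    qed
  next
    case (Pr i x d j j')
    have *: "pr j j' ((a \<odot> f) (P i d) t) = (b \<odot> g) (P i d) (pr j j' t) \<longleftrightarrow>
        pr j j' (f (P i d) t) = g (P i d) (pr j j' t)" if t: "t \<in> T j" for t
    proof -
      have "f (P i d) t \<in> T j" using G_T[OF sS f] Pr t by simp
      then have "pr j j' (a (P i d) (f (P i d) t)) = b (P i d) (pr j j' (f (P i d) t))"
        using ab Pr by simp
      then show ?thesis using G_inj[OF tS b, of "P i d"] by (simp add: sec_mult_def)
    qed
    then show ?thesis using Pr by simp
  next
    case (Li i x d j)
    have "ev d (\<lambda>c. a (B d c) = b (P i d))" using ab Li by simp
    then have "ev d (\<lambda>c. f (B d c) = g (P i d)) \<longleftrightarrow> ev d (\<lambda>c. (a \<odot> f) (B d c) = (b \<odot> g) (P i d))"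
      by (rule ev_cong) (simp add: sec_mult_def G_injc[OF tS b])
    then show ?thesis using Li by simp
  next
    case (Xx i x d c j)
    then show ?thesis using ab by (simp add: sec_mult_def G_injc[OF tS b])
  next
    case (Pu j)
    have ab': "a = b" "\<And>t. t \<in> T j \<Longrightarrow> {(i, d) \<in> Ind. a (P i d) t = t} \<in> UF" using ab Pu by auto
    have inj: "a x t = a x u \<longleftrightarrow> t = u" for x t u using G_inj[OF sS a] .
    have "{(i, d) \<in> Ind. f (P i d) t = t} \<in> UF \<longleftrightarrow> {(i, d) \<in> Ind. (a \<odot> f) (P i d) t = t} \<in> UF"
      if t: "t \<in> T j" for t
    proof
      assume "{(i, d) \<in> Ind. f (P i d) t = t} \<in> UF"
      then show "{(i, d) \<in> Ind. (a \<odot> f) (P i d) t = t} \<in> UF"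
        by (rule UF_sub[OF UF_int[OF ab'(2)[OF t]]]) (auto simp: sec_mult_def)
    next
      assume "{(i, d) \<in> Ind. (a \<odot> f) (P i d) t = t} \<in> UF"
      then show "{(i, d) \<in> Ind. f (P i d) t = t} \<in> UF"
        by (rule UF_sub[OF UF_int[OF ab'(2)[OF t]]]) (use inj in \<open>auto simp: sec_mult_def, metis\<close>)
    qed
    then show ?thesis using Pu ab'(1) G_cancel[OF sS a] by auto
  next
    case (St d c j)
    then show ?thesis using l(2) by simp
  qed
qed

text \<open>Multiplication by \<open>a\<close> turns the family \<open>s\<close> into \<open>s'\<close> as
  soon as the germs of \<open>a\<close> do so in all late rows.\<close>

lemma link_preserved_marker:
  assumes S: "C d c j \<in> Srt" and a: "a \<in> G (C d c j)" and k: "lt k d"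
    and mv: "\<And>i. \<not> lt i k \<Longrightarrow> lt i d \<Longrightarrow> ev i (\<lambda>b. a (B i b) (s i d j) = s' i d j)"
  shows "link_preserved s s' (St d c j) a a"
  unfolding link_preserved_def
proof (intro ballI)
  fix f g assume f: "f \<in> G (src (St d c j))" and g: "g \<in> G (tgt (St d c j))"
  have inj: "a x t = a x u \<longleftrightarrow> t = u" for x t u using G_inj[OF S a] .
  have *: "ev i (\<lambda>b. f (B i b) (oo j) = s i d j) \<longleftrightarrow> ev i (\<lambda>b. (a \<odot> f) (B i b) (oo j) = s' i d j)"
    if "\<not> lt i k" "lt i d" for i
    by (rule ev_cong[OF mv[OF that]]) (use inj in \<open>auto simp: sec_mult_def, metis\<close>)
  have max: "\<exists>m. lt m d \<and> le k m \<and> le k' m" if "lt k' d" for k'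
    using that k le_total le_refl lt_K by metis
  have "(\<exists>k'. lt k' d \<and> (\<forall>i. \<not> lt i k' \<and> lt i d \<longrightarrow> ev i (\<lambda>b. f (B i b) (oo j) = s i d j))) \<longleftrightarrow>
     (\<exists>k'. lt k' d \<and> (\<forall>i. \<not> lt i k' \<and> lt i d \<longrightarrow> ev i (\<lambda>b. (a \<odot> f) (B i b) (oo j) = s' i d j)))"
    using * max lt_le_trans by meson
  then show "holds s (St d c j) f g \<longleftrightarrow> holds s' (St d c j) (a \<odot> f) (a \<odot> g)"
    using G_cancel[OF S a] by simp
qed

end

section \<open>The number of elements and of symbols\<close>

lemma PiE_Func: "PiE I (\<lambda>_. W) = Func I W"
  by (auto simp: PiE_def Func_def extensional_def)

context hidden_threads
begin

text \<open>A function with finitely many steps is coded by finitely many thresholds and by the finite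
  table that assigns its values to their cuts.\<close>

lemma FS_tiny:
  fixes V :: "'v set"
  assumes i: "i \<in> K" and V: "tiny V"
  shows "tiny {restrict f (Th i) |f. f ` Th i \<subseteq> V \<and> FS i f}" (is "tiny ?S")
proof -
  define cut where "cut F x = {a \<in> F. tl i x a}" for F x
  define Fin where "Fin = {X. finite X \<and> X \<subseteq> Th i}"
  define cod where "cod = {Z. finite Z \<and> Z \<subseteq> Fin \<times> V}"
  define dec where "dec = (\<lambda>(F, Z :: ('b set \<times> 'v) set). restrict (\<lambda>x. THE v. (cut F x, v) \<in> Z) (Th i))"
  have "?S \<subseteq> dec ` (Fin \<times> cod)"
  proof
    fix g assume "g \<in> ?S"
    then obtain f where f: "g = restrict f (Th i)" "f ` Th i \<subseteq> V" "FS i f" by blast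
    obtain F where F: "finite F" "F \<subseteq> Th i"
      "\<And>x y. x \<in> Th i \<Longrightarrow> y \<in> Th i \<Longrightarrow> \<forall>a\<in>F. tl i x a \<longleftrightarrow> tl i y a \<Longrightarrow> f x = f y"
      using f(3) unfolding FS_def by metis
    have eq: "f x = f y" if "x \<in> Th i" "y \<in> Th i" "cut F x = cut F y" for x y
      by (rule F(3)[OF that(1,2)]) (use that(3) in \<open>auto simp: cut_def\<close>)
    define Z where "Z = (\<lambda>x. (cut F x, f x)) ` Th i"
    have "Z \<subseteq> (\<lambda>c. (c, f (SOME x. x \<in> Th i \<and> cut F x = c))) ` Pow F"
    proof
      fix z assume "z \<in> Z"
      then obtain x where x: "x \<in> Th i" "z = (cut F x, f x)" by (auto simp: Z_def)
      have "(SOME y. y \<in> Th i \<and> cut F y = cut F x) \<in> Th i \<and>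
          cut F (SOME y. y \<in> Th i \<and> cut F y = cut F x) = cut F x"
        by (rule someI[of _ x]) (simp add: x)
      then have "f (SOME y. y \<in> Th i \<and> cut F y = cut F x) = f x" using eq x(1) by blast
      moreover have "cut F x \<in> Pow F" by (auto simp: cut_def)
      ultimately show "z \<in> (\<lambda>c. (c, f (SOME x. x \<in> Th i \<and> cut F x = c))) ` Pow F"
        using x(2) by (intro image_eqI[of _ _ "cut F x"]) auto
    qed
    then have "finite Z" using F(1) finite_subset by blast
    moreover have "Z \<subseteq> Fin \<times> V" using f(2) F(1,2) by (auto simp: Z_def Fin_def cut_def)
    ultimately have "(F, Z) \<in> Fin \<times> cod" using F(1,2) by (simp add: Fin_def cod_def)
    moreover have "g = dec (F, Z)"
    proof
      fix x show "g x = dec (F, Z) x"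
      proof (cases "x \<in> Th i")
        case True
        have "(THE v. (cut F x, v) \<in> Z) = f x"
        proof (rule the_equality)
          show "(cut F x, f x) \<in> Z" using True by (simp add: Z_def)
          fix v assume "(cut F x, v) \<in> Z"
          then obtain y where "y \<in> Th i" "cut F x = cut F y" "v = f y" by (auto simp: Z_def)
          then show "v = f x" using eq[OF True] by metis
        qed
        then show ?thesis using True f(1) by (simp add: dec_def)
      qed (simp add: f(1) dec_def)
    qed
    ultimately show "g \<in> dec ` (Fin \<times> cod)" by blast
  qed
  moreover have Fin: "tiny Fin" unfolding Fin_def by (rule tiny_subsets[OF Th_tiny[OF i]])
  moreover have "tiny cod" unfolding cod_def by (rule tiny_subsets[OF tiny_Times[OF Fin V]])
  ultimately show ?thesis by (rule tiny_mono[OF _ tiny_image[OF tiny_Times]])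
qed

fun level :: "('k, 'b) srt \<Rightarrow> 'k" where
  "level (Q j) = j" | "level (R i b j) = i" | "level (E i b d j) = d" | "level (C d c j) = d"

lemma level_K: "s \<in> Srt \<Longrightarrow> level s \<in> K" by (cases s) (auto dest: Ind_D Lim_K)

lemma K_Times: "|K \<times> K| \<le>o |K|"
  using card_of_Times_same_infinite[OF K_inf] ordIso_imp_ordLeq by blast

text \<open>A section of one sort involves fewer than \<open>kap\<close> threshold orders, so there are
  fewer than \<open>lam\<close> sections. This holds although all orders together have
  \<open>lam\<close> elements.\<close>

lemma G_tiny:
  assumes s: "s \<in> Srt" shows "tiny (G s)"
proof -
  define L where "L = {i. le i (level s)}"
  define Fs where "Fs i = {restrict f (Th i) |f. f ` Th i \<subseteq> A (ix s) \<and> FS i f}" for i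
  have "L = {i. lt i (level s)} \<union> {level s}" using level_K[OF s] by (auto simp: L_def le_iff)
  then have L: "|L| <o |K|" using K_ordLess_Un[OF kap_underS[OF level_K[OF s]] K_finite[of "{level s}"]] by simp
  have LK: "L \<subseteq> K" by (auto simp: L_def le_def)
  define V where "V = (\<Union>i\<in>L. Fs i)"
  have V: "tiny V" unfolding V_def Fs_def
    using LK FS_tiny[OF _ A_tiny[OF ix_K[OF s]]] by (intro tiny_UN[OF L]) blast
  define cod where "cod f = (restrict (\<lambda>(i, d). f (P i d)) (K \<times> K),
      restrict (\<lambda>i. restrict (\<lambda>b. f (B i b)) (Th i)) L)" for f :: "('k, 'b, 't) sec"
  have "inj_on cod (G s)"
  proof (rule inj_onI, rule ext)
    fix f g x assume f: "f \<in> G s" and g: "g \<in> G s" and eq: "cod f = cod g"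
    show "f x = g x"
    proof (cases "x \<in> Dm s")
      case False
      then show ?thesis using f g by (simp add: G_def)
    next
      case True
      show ?thesis
      proof (cases x)
        case (P i d)
        then have "i \<in> K" "d \<in> K" using True Ind_D by (cases s; auto)+
        then show ?thesis
          using eq P unfolding cod_def by (auto dest!: fun_cong[of _ _ "(i, d)"])
      next
        case (B i b)
        then have "i \<in> L" "b \<in> Th i" using True s by (cases s; auto simp: L_def lt_le le_refl Ind_def Lim_def)+
        then show ?thesis
          using eq B unfolding cod_def by (auto dest!: fun_cong[of _ _ i] fun_cong[of _ _ b])
      qed
    qed
  qed
  moreover have "cod ` G s \<subseteq> (PiE (K \<times> K) (\<lambda>_. A (ix s))) \<times> (PiE L (\<lambda>_. V))"
  proof -
    have "restrict (\<lambda>b. f (B i b)) (Th i) \<in> V" if "f \<in> G s" "i \<in> L" for f i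
    proof -
      have "restrict (\<lambda>b. f (B i b)) (Th i) \<in> Fs i"
        unfolding Fs_def
      proof (intro CollectI exI conjI)
        show "(\<lambda>b. f (B i b)) ` Th i \<subseteq> A (ix s)" using G_A[OF s that(1)] by blast
        show "FS i (\<lambda>b. f (B i b))" using that LK by (simp add: G_def FSall_def subset_iff)
      qed simp
      then show ?thesis using that by (auto simp: V_def)
    qed
    moreover have "restrict (\<lambda>(i, d). f (P i d)) (K \<times> K) \<in> PiE (K \<times> K) (\<lambda>_. A (ix s))"
      if "f \<in> G s" for f
      by (rule restrict_PiE_iff[THEN iffD2]) (use G_A[OF s that] in auto)
    ultimately show ?thesis unfolding cod_def image_subset_iff mem_Times_iff by (auto simp del: restrict_apply)
  qed
  ultimately have "|G s| \<le>o |(PiE (K \<times> K) (\<lambda>_. A (ix s))) \<times> (PiE L (\<lambda>_. V))|"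
    using card_of_ordLeq by blast
  moreover have "tiny (Func (K \<times> K) (A (ix s)) \<times> Func L V)"
    by (intro tiny_Times tiny_Func A_tiny ix_K s K_Times V ordLess_imp_ordLeq[OF L])
  ultimately show ?thesis unfolding PiE_Func by (rule tiny_le)
qed

definition UU :: "('k, 'b, 't) el set" where "UU = Sigma Srt G"
definition SYM :: "('k, 'b, 't) sym set" where
  "SYM = (\<lambda>(s, a). Tr s a) ` Sigma Srt G \<union> Ln ` Lnk"

fun rel :: "('k \<Rightarrow> 'k \<Rightarrow> 'k \<Rightarrow> 't) \<Rightarrow> ('k, 'b, 't) sym \<Rightarrow> ('k, 'b, 't) el \<Rightarrow> ('k, 'b, 't) el \<Rightarrow> bool" where
  "rel s (Tr \<kappa> a) u v \<longleftrightarrow> fst u = \<kappa> \<and> fst v = \<kappa> \<and> snd v = snd u \<odot> a"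
| "rel s (Ln l) u v \<longleftrightarrow> fst u = src l \<and> fst v = tgt l \<and> holds s l (snd u) (snd v)"

lemma small_LL: "small (Sigma K Th)"
  by (rule small_Sigma[OF small_tiny[OF tiny_K] small_tiny[OF Th_tiny]])
lemma small_K: "small K" by (rule small_tiny[OF tiny_K])

lemma small_Srt: "small Srt"
proof -
  let ?LL = "Sigma K Th"
  have "Srt \<subseteq> Q ` K \<union> (\<lambda>((i, b), j). R i b j) ` (?LL \<times> K) \<union>
      (\<lambda>((i, b), d, j). E i b d j) ` (?LL \<times> K \<times> K) \<union> (\<lambda>((d, c), j). C d c j) ` (?LL \<times> K)"
  proof
    fix s assume s: "s \<in> Srt"
    show "s \<in> Q ` K \<union> (\<lambda>((i, b), j). R i b j) ` (?LL \<times> K) \<union>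
      (\<lambda>((i, b), d, j). E i b d j) ` (?LL \<times> K \<times> K) \<union> (\<lambda>((d, c), j). C d c j) ` (?LL \<times> K)"
    proof (cases s)
      case (R i b j)
      have *: "((i, b), j) \<in> ?LL \<times> K" using s R by simp
      have "s \<in> (\<lambda>((i, b), j). R i b j) ` (?LL \<times> K)" by (rule image_eqI[OF _ *]) (simp add: R)
      then show ?thesis by (simp only: Un_iff simp_thms)
    next
      case (E i b d j)
      have *: "((i, b), d, j) \<in> ?LL \<times> K \<times> K" using s E Ind_D by auto
      have "s \<in> (\<lambda>((i, b), d, j). E i b d j) ` (?LL \<times> K \<times> K)" by (rule image_eqI[OF _ *]) (simp add: E)
      then show ?thesis by (simp only: Un_iff simp_thms)
    next
      case (C d c j)
      have *: "((d, c), j) \<in> ?LL \<times> K" using s C Lim_K by auto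
      have "s \<in> (\<lambda>((d, c), j). C d c j) ` (?LL \<times> K)" by (rule image_eqI[OF _ *]) (simp add: C)
      then show ?thesis by (simp only: Un_iff simp_thms)
    qed (use s in auto)
  qed
  then show ?thesis
    by (rule small_mono) (intro small_Un small_image small_Times small_LL small_K)
qed

lemma small_Lnk: "small Lnk"
proof -
  let ?LL = "Sigma K Th"
  let ?S = "(\<lambda>((i, b), j). Ev i b j) ` (?LL \<times> K) \<union> (\<lambda>((i, b), d, j, j'). Pr i b d j j') ` (?LL \<times> K \<times> K \<times> K)
    \<union> (\<lambda>((i, b), d, j). Li i b d j) ` (?LL \<times> K \<times> K)
    \<union> (\<lambda>((i, b), (d, c), j). Xx i b d c j) ` (?LL \<times> ?LL \<times> K) \<union> Pu ` K \<union> (\<lambda>((d, c), j). St d c j) ` (?LL \<times> K)"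
  have "Lnk \<subseteq> ?S"
  proof
    fix l assume l: "l \<in> Lnk"
    show "l \<in> ?S"
    proof (cases l)
      case (Ev i b j)
      have *: "((i, b), j) \<in> ?LL \<times> K" using l Ev by (simp add: Lnk_def)
      have "l \<in> (\<lambda>((i, b), j). Ev i b j) ` (?LL \<times> K)" by (rule image_eqI[OF _ *]) (simp add: Ev)
      then show ?thesis by (simp only: Un_iff simp_thms)
    next
      case (Pr i b d j j')
      have *: "((i, b), d, j, j') \<in> ?LL \<times> K \<times> K \<times> K" using l Pr Ind_D by (auto simp: Lnk_def)
      have "l \<in> (\<lambda>((i, b), d, j, j'). Pr i b d j j') ` (?LL \<times> K \<times> K \<times> K)" by (rule image_eqI[OF _ *]) (simp add: Pr)
      then show ?thesis by (simp only: Un_iff simp_thms)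
    next
      case (Li i b d j)
      have *: "((i, b), d, j) \<in> ?LL \<times> K \<times> K" using l Li Ind_D by (auto simp: Lnk_def)
      have "l \<in> (\<lambda>((i, b), d, j). Li i b d j) ` (?LL \<times> K \<times> K)" by (rule image_eqI[OF _ *]) (simp add: Li)
      then show ?thesis by (simp only: Un_iff simp_thms)
    next
      case (Xx i b d c j)
      have *: "((i, b), (d, c), j) \<in> ?LL \<times> ?LL \<times> K" using l Xx Ind_D by (auto simp: Lnk_def)
      have "l \<in> (\<lambda>((i, b), (d, c), j). Xx i b d c j) ` (?LL \<times> ?LL \<times> K)" by (rule image_eqI[OF _ *]) (simp add: Xx)
      then show ?thesis by (simp only: Un_iff simp_thms)
    next
      case (Pu j) then show ?thesis using l by (auto simp: Lnk_def)
    next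
      case (St d c j)
      have *: "((d, c), j) \<in> ?LL \<times> K" using l St Lim_K by (auto simp: Lnk_def)
      have "l \<in> (\<lambda>((d, c), j). St d c j) ` (?LL \<times> K)" by (rule image_eqI[OF _ *]) (simp add: St)
      then show ?thesis by (simp only: Un_iff simp_thms)
    qed
  qed
  then show ?thesis
    by (rule small_mono) (intro small_Un small_image small_Times small_LL small_K)
qed

lemma small_UU: "small UU"
  unfolding UU_def by (rule small_Sigma[OF small_Srt small_tiny[OF G_tiny]])

lemma small_SYM: "small SYM"
  unfolding SYM_def using small_UU unfolding UU_def by (intro small_Un small_image small_Lnk)

lemma UU_lam: "|UU| =o lam"
proof -
  have "|Sigma K Th| \<le>o |UU|"
  proof (rule card_of_ordLeqI[where f = "\<lambda>(i, b). (R i b i, sec_one)"])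
    show "inj_on (\<lambda>(i, b). (R i b i, sec_one :: ('k, 'b, 't) sec)) (Sigma K Th)" by (auto simp: inj_on_def)
    show "(case a of (i, b) \<Rightarrow> (R i b i, sec_one)) \<in> UU" if "a \<in> Sigma K Th" for a
      using that G_one by (auto simp: UU_def)
  qed
  then have "lam \<le>o |UU|" using Low_lam ordLeq_transitive by blast
  then show ?thesis using small_UU ordIso_iff_ordLeq by blast
qed

lemma encodings:
  obtains enc :: "('k, 'b, 't) el \<Rightarrow> 'a" and \<sigma> :: "('k, 'b, 't) sym \<Rightarrow> 'a set"
  where "inj_on enc UU" "inj_on \<sigma> SYM"
proof -
  have lamF: "lam \<le>o |Field lam|"
    using card_of_Field_ordIso[OF lamC] ordIso_symmetric ordIso_imp_ordLeq by blast
  obtain e where "inj_on e UU" "e ` UU \<subseteq> Field lam"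
    using ordLeq_transitive[OF small_UU lamF] by (rule ordLeq_imp_inj)
  moreover obtain t where t: "inj_on t SYM" "t ` SYM \<subseteq> Field lam"
    using ordLeq_transitive[OF small_SYM lamF] by (rule ordLeq_imp_inj)
  moreover have "inj_on (\<lambda>y. {t y}) SYM" using t(1) by (auto simp: inj_on_def)
  ultimately show ?thesis using that by blast
qed

end

text \<open>Elements and symbols are moved into the types that the theorem prescribes.\<close>

locale coded = hidden_threads lam kap Th tl T pr A UF oo
  for lam :: "'a rel" and kap :: "'k rel" and Th :: "'k \<Rightarrow> 'b set" and tl
    and T :: "'k \<Rightarrow> 't set" and pr A UF oo +
  fixes enc :: "('k, 'b, 't) el \<Rightarrow> 'a" and \<sigma> :: "('k, 'b, 't) sym \<Rightarrow> 'a set"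
  assumes enc: "inj_on enc UU" and \<sigma>: "inj_on \<sigma> SYM"
begin

definition voc :: "'a set vocabulary" where "voc S = (if S \<in> \<sigma> ` SYM then Some 2 else None)"

definition mdl :: "('k \<Rightarrow> 'k \<Rightarrow> 'k \<Rightarrow> 't) \<Rightarrow> ('a, 'a set) model" where
  "mdl s = \<lparr>universe = enc ` UU,
     interp = (\<lambda>S. {[enc u, enc v] |u v y. y \<in> SYM \<and> S = \<sigma> y \<and> u \<in> UU \<and> v \<in> UU \<and> rel s y u v})\<rparr>"

definition rel_in :: "('a, 'a set) model \<Rightarrow> ('k, 'b, 't) sym \<Rightarrow> 'a \<Rightarrow> 'a \<Rightarrow> bool" where
  "rel_in N y b c \<longleftrightarrow> [b, c] \<in> interp N (\<sigma> y)"

lemma mdl_universe [simp]: "universe (mdl s) = enc ` UU" by (simp add: mdl_def)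

lemma rel_in_mdl: "y \<in> SYM \<Longrightarrow> u \<in> UU \<Longrightarrow> v \<in> UU \<Longrightarrow> rel_in (mdl s) y (enc u) (enc v) \<longleftrightarrow> rel s y u v"
proof
  assume *: "y \<in> SYM" "u \<in> UU" "v \<in> UU" "rel_in (mdl s) y (enc u) (enc v)"
  then obtain u' v' y' where "enc u = enc u'" "enc v = enc v'" "\<sigma> y = \<sigma> y'"
    "y' \<in> SYM" "u' \<in> UU" "v' \<in> UU" "rel s y' u' v'" by (auto simp: rel_in_def mdl_def)
  then show "rel s y u v" using * inj_onD[OF enc] inj_onD[OF \<sigma>] by metis
next
  assume "y \<in> SYM" "u \<in> UU" "v \<in> UU" "rel s y u v"
  then show "rel_in (mdl s) y (enc u) (enc v)" unfolding rel_in_def mdl_def model.simps mem_Collect_eq by blast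
qed

lemma UU_ne: "UU \<noteq> {}"
proof
  assume "UU = {}"
  then have "|UU| <o lam" using tiny_finite[of UU] by simp
  then show False using UU_lam not_ordLess_ordIso by blast
qed

lemma mdl_model: "is_model voc (mdl s)"
  using UU_ne by (auto simp: is_model_def voc_def mdl_def)

lemma mdl_card: "|universe (mdl s)| =o lam"
proof -
  have "|enc ` UU| =o |UU|" using enc card_of_ordIsoI[of enc UU "enc ` UU"] ordIso_symmetric
    by (auto simp: bij_betw_def)
  then show ?thesis using UU_lam ordIso_transitive by auto
qed

lemma voc_SYM: "y \<in> SYM \<Longrightarrow> voc (\<sigma> y) = Some 2" by (simp add: voc_def)

lemma iso_iff:
  "isomorphic voc (mdl s) N \<longleftrightarrow> (\<exists>\<phi>. bij_betw \<phi> UU (universe N) \<and>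
     (\<forall>y\<in>SYM. \<forall>u\<in>UU. \<forall>v\<in>UU. rel s y u v \<longleftrightarrow> rel_in N y (\<phi> u) (\<phi> v)))" (is "_ \<longleftrightarrow> ?R")
proof
  assume "isomorphic voc (mdl s) N"
  then obtain f where f: "bij_betw f (enc ` UU) (universe N)"
    and R: "\<And>R n xs. voc R = Some n \<Longrightarrow> set xs \<subseteq> enc ` UU \<Longrightarrow> length xs = n \<Longrightarrow>
        xs \<in> interp (mdl s) R \<longleftrightarrow> map f xs \<in> interp N R"
    unfolding isomorphic_def by auto
  have "bij_betw (f \<circ> enc) UU (universe N)"
    using bij_betw_trans[of enc UU "enc ` UU" f] f enc by (simp add: bij_betw_def)
  moreover have "rel s y u v \<longleftrightarrow> rel_in N y ((f \<circ> enc) u) ((f \<circ> enc) v)" if "y \<in> SYM" "u \<in> UU" "v \<in> UU" for y u v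
    using R[OF voc_SYM[OF that(1)], of "[enc u, enc v]"] rel_in_mdl[OF that, of s] that
    by (simp add: rel_in_def)
  ultimately show ?R by blast
next
  assume ?R
  then obtain \<phi> where \<phi>: "bij_betw \<phi> UU (universe N)"
    and R: "\<And>y u v. y \<in> SYM \<Longrightarrow> u \<in> UU \<Longrightarrow> v \<in> UU \<Longrightarrow> rel s y u v \<longleftrightarrow> rel_in N y (\<phi> u) (\<phi> v)" by blast
  define f where "f = \<phi> \<circ> inv_into UU enc"
  have f: "f (enc u) = \<phi> u" if "u \<in> UU" for u using that enc by (simp add: f_def)
  show "isomorphic voc (mdl s) N" unfolding isomorphic_def
  proof (intro exI[of _ f] conjI allI impI)
    show "bij_betw f (universe (mdl s)) (universe N)"
      unfolding f_def mdl_universe by (rule bij_betw_trans[OF bij_betw_inv_into \<phi>]) (simp add: bij_betw_def enc)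
    fix R n xs
    assume *: "voc R = Some n \<and> set xs \<subseteq> universe (mdl s) \<and> length xs = n"
    then obtain y where y: "y \<in> SYM" "R = \<sigma> y" "n = 2" by (auto simp: voc_def split: if_splits)
    then obtain b c where xs: "xs = [b, c]" using * by (auto simp: numeral_2_eq_2 length_Suc_conv)
    then obtain u v where uv: "u \<in> UU" "v \<in> UU" "b = enc u" "c = enc v" using * by auto
    show "xs \<in> interp (mdl s) R \<longleftrightarrow> map f xs \<in> interp N R"
      using rel_in_mdl[OF y(1) uv(1,2), of s] R[OF y(1) uv(1,2)] uv xs y f by (simp add: rel_in_def)
  qed
qed

end

section \<open>All families of threads give equivalent structures\<close>

text \<open>The permutations \<open>sw j a b\<close> act as automorphisms of the tree that exchange given
  threads. The last assumption says that a point moved by \<open>sw j a b\<close> separates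
  \<open>a\<close> from \<open>b\<close> already by its meets with them.\<close>

locale homogeneous = coded lam kap Th tl T pr A UF oo enc \<sigma>
  for lam :: "'a rel" and kap :: "'k rel" and Th :: "'k \<Rightarrow> 'b set" and tl
    and T :: "'k \<Rightarrow> 't set" and pr A UF oo enc \<sigma> +
  fixes sw :: "'k \<Rightarrow> 't \<Rightarrow> 't \<Rightarrow> 't \<Rightarrow> 't"
  assumes sw_AT: "thr x \<Longrightarrow> thr y \<Longrightarrow> tree_auto (\<lambda>j. sw j (x j) (y j))"
    and sw_eq: "j \<in> K \<Longrightarrow> a \<in> T j \<Longrightarrow> b \<in> T j \<Longrightarrow> sw j a b a = b"
    and sw_mv: "j \<in> K \<Longrightarrow> a \<in> T j \<Longrightarrow> b \<in> T j \<Longrightarrow> t \<in> T j \<Longrightarrow> sw j a b t \<noteq> t \<Longrightarrow>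
        {i. le i j \<and> pr j i a = pr j i t} \<noteq> {i. le i j \<and> pr j i b = pr j i t}"
begin

text \<open>The section by which each torsor is multiplied, read off from automorphisms of the tree:
  \<open>w i d\<close> at the places of the sorts \<open>Q\<close>, \<open>v i b d\<close> at
  those of the rows, and \<open>V i b d c\<close> at a crossing of thresholds, in both kinds of
  sorts.\<close>

fun shift :: "('k \<Rightarrow> 'k \<Rightarrow> 'k \<Rightarrow> 't \<Rightarrow> 't) \<Rightarrow> ('k \<Rightarrow> 'b \<Rightarrow> 'k \<Rightarrow> 'k \<Rightarrow> 't \<Rightarrow> 't) \<Rightarrow>
    ('k \<Rightarrow> 'b \<Rightarrow> 'k \<Rightarrow> 'b \<Rightarrow> 'k \<Rightarrow> 't \<Rightarrow> 't) \<Rightarrow> ('k, 'b) srt \<Rightarrow> ('k, 'b, 't) sec" where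
  "shift w v V (Q j) = (\<lambda>x. case x of P i d \<Rightarrow> if (i, d) \<in> Ind then w i d j else id | B i b \<Rightarrow> id)"
| "shift w v V (R i b j) = (\<lambda>x. case x of P i' d \<Rightarrow> if i' = i \<and> (i, d) \<in> Ind then v i b d j else id | B i b \<Rightarrow> id)"
| "shift w v V (E i b d j) = (\<lambda>x. case x of P i d \<Rightarrow> id | B d' c \<Rightarrow> if d' = d \<and> c \<in> Th d then V i b d c j else id)"
| "shift w v V (C d c j) = (\<lambda>x. case x of P i d \<Rightarrow> id | B i b \<Rightarrow> if lt i d \<and> b \<in> Th i then V i b d c j else id)"

text \<open>The conditions are those under which the shifts preserve all links between known sorts;
  \<open>known\<close> says which thresholds are known. Only the last condition involves
  \<open>s\<close> and \<open>s'\<close>.\<close>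

definition compatible where
  "compatible s s' known w v V \<longleftrightarrow>
    (\<forall>i d. (i, d) \<in> Ind \<longrightarrow> tree_auto (w i d) \<and> (\<forall>b\<in>Th i. tree_auto (v i b d) \<and> FS d (\<lambda>c. V i b d c) \<and> (\<forall>c\<in>Th d. tree_auto (V i b d c)))) \<and>
    (\<forall>i d. (i, d) \<in> Ind \<longrightarrow> (\<forall>c\<in>Th d. FS i (\<lambda>b. V i b d c))) \<and>
    (\<forall>j\<in>K. \<forall>t\<in>T j. {(i, d) \<in> Ind. w i d j t = t} \<in> UF) \<and>
    (\<forall>i b. known i b \<longrightarrow> (\<exists>h\<in>K. \<forall>d\<in>Lim. lt i d \<and> \<not> lt d h \<longrightarrow> v i b d = w i d)) \<and>
    (\<forall>i d b. known i b \<and> (i, d) \<in> Ind \<longrightarrow> ev d (\<lambda>c. V i b d c = v i b d)) \<and>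
    (\<forall>d c. known d c \<and> d \<in> Lim \<longrightarrow> (\<exists>k. lt k d \<and> (\<forall>i. \<not> lt i k \<and> lt i d \<longrightarrow>
        ev i (\<lambda>b. \<forall>j\<in>K. V i b d c j (s i d j) = s' i d j))))"

lemma compatibleD:
  assumes "compatible s s' known w v V"
  shows "(i, d) \<in> Ind \<Longrightarrow> tree_auto (w i d)" "(i, d) \<in> Ind \<Longrightarrow> b \<in> Th i \<Longrightarrow> tree_auto (v i b d)"
    "(i, d) \<in> Ind \<Longrightarrow> b \<in> Th i \<Longrightarrow> c \<in> Th d \<Longrightarrow> tree_auto (V i b d c)"
    "(i, d) \<in> Ind \<Longrightarrow> b \<in> Th i \<Longrightarrow> FS d (\<lambda>c. V i b d c)"
    "(i, d) \<in> Ind \<Longrightarrow> c \<in> Th d \<Longrightarrow> FS i (\<lambda>b. V i b d c)"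
    "j \<in> K \<Longrightarrow> t \<in> T j \<Longrightarrow> {(i, d) \<in> Ind. w i d j t = t} \<in> UF"
    "known i b \<Longrightarrow> \<exists>h\<in>K. \<forall>d\<in>Lim. lt i d \<and> \<not> lt d h \<longrightarrow> v i b d = w i d"
    "known i b \<Longrightarrow> (i, d) \<in> Ind \<Longrightarrow> ev d (\<lambda>c. V i b d c = v i b d)"
    "known d c \<Longrightarrow> d \<in> Lim \<Longrightarrow> \<exists>k. lt k d \<and> (\<forall>i. \<not> lt i k \<and> lt i d \<longrightarrow>
        ev i (\<lambda>b. \<forall>j\<in>K. V i b d c j (s i d j) = s' i d j))"
  using assms unfolding compatible_def by auto

fun known_sort :: "('k \<Rightarrow> 'b \<Rightarrow> bool) \<Rightarrow> ('k, 'b) srt \<Rightarrow> bool" where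
  "known_sort known (Q j) = True" | "known_sort known (R i b j) = known i b" | "known_sort known (E i b d j) = known i b"
| "known_sort known (C d c j) = known d c"

lemma tree_auto_A: "tree_auto p \<Longrightarrow> j \<in> K \<Longrightarrow> p j \<in> A j" by (simp add: tree_auto_def)

lemma FS_id: "FS i (\<lambda>_. id)" by (rule FS_const)

lemma UF_all: "Ind \<in> UF"
proof -
  have "\<forall>d\<in>Lim. \<exists>k. lt k d" by (simp add: Lim_def)
  then obtain h where h: "\<And>d. d \<in> Lim \<Longrightarrow> lt (h d) d" by metis
  have "{(i, d) \<in> Ind. \<not> lt i (h d) \<and> \<not> lt d i} \<in> UF" using UF_B[of "\<lambda>i. i" h] h by blast
  then show ?thesis by (rule UF_sub) auto
qed

lemma shift_G_general:
  assumes w: "\<And>i d j. (i, d) \<in> Ind \<Longrightarrow> j \<in> K \<Longrightarrow> w i d j \<in> A j"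
    and v: "\<And>i b d j. (i, d) \<in> Ind \<Longrightarrow> b \<in> Th i \<Longrightarrow> j \<in> K \<Longrightarrow> v i b d j \<in> A j"
    and V: "\<And>i b d c j. (i, d) \<in> Ind \<Longrightarrow> b \<in> Th i \<Longrightarrow> c \<in> Th d \<Longrightarrow> j \<in> K \<Longrightarrow> V i b d c j \<in> A j"
    and FS1: "\<And>i b d j. (i, d) \<in> Ind \<Longrightarrow> b \<in> Th i \<Longrightarrow> j \<in> K \<Longrightarrow> FS d (\<lambda>c. V i b d c j)"
    and FS2: "\<And>i d c j. (i, d) \<in> Ind \<Longrightarrow> c \<in> Th d \<Longrightarrow> j \<in> K \<Longrightarrow> FS i (\<lambda>b. V i b d c j)"
    and \<kappa>: "\<kappa> \<in> Srt" shows "shift w v V \<kappa> \<in> G \<kappa>"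
proof (cases \<kappa>)
  case (Q j)
  then show ?thesis using w \<kappa> by (auto simp: G_def FSall_def FS_id split: crd.split)
next
  case (R i b j)
  then show ?thesis using v \<kappa> by (auto simp: G_def FSall_def FS_id split: crd.split)
next
  case (E i b d j)
  have "FS d (\<lambda>c. V i b d c j)" using FS1 E \<kappa> by simp
  then have "FS d (\<lambda>c. if c \<in> Th d then V i b d c j else id)" by (rule FS_cong) simp
  then have "FS i' (\<lambda>c. if i' = d \<and> c \<in> Th d then V i b d c j else id)" for i'
    by (cases "i' = d") (simp_all add: FS_id)
  then have "FSall (shift w v V \<kappa>)"
    unfolding FSall_def E by simp
  then show ?thesis using V \<kappa> E by (auto simp: G_def split: crd.split)
next
  case (C d c j)
  have "FS i (\<lambda>b. if lt i d \<and> b \<in> Th i then V i b d c j else id)" for i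
  proof (cases "lt i d")
    case True
    then have "(i, d) \<in> Ind" using C \<kappa> by (simp add: Ind_def)
    then have "FS i (\<lambda>b. V i b d c j)" using FS2 C \<kappa> by simp
    then show ?thesis by (rule FS_cong) (simp add: True)
  qed (simp add: FS_id)
  then have "FSall (shift w v V \<kappa>)" unfolding FSall_def C by simp
  then show ?thesis using V \<kappa> C by (auto simp: G_def Ind_def split: crd.split)
qed

lemma shift_G:
  assumes compatible: "compatible s s' known w v V" and \<kappa>: "\<kappa> \<in> Srt" shows "shift w v V \<kappa> \<in> G \<kappa>"
  by (rule shift_G_general[OF _ _ _ _ _ \<kappa>])
    (simp_all add: compatibleD[OF compatible] tree_auto_A FS_map[of _ _ "\<lambda>p. p _", OF compatibleD(4)[OF compatible]] FS_map[of _ _ "\<lambda>p. p _", OF compatibleD(5)[OF compatible]])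

lemma compatible_link:
  assumes compatible: "compatible s s' known w v V" and l: "l \<in> Lnk" and known: "known_sort known (src l)" "known_sort known (tgt l)"
  shows "link_preserved s s' l (shift w v V (src l)) (shift w v V (tgt l))"
proof -
  have S: "src l \<in> Srt" "tgt l \<in> Srt" using l by (auto simp: Lnk_def)
  have grp: ?thesis if "\<not> isSt l" "holds s l (shift w v V (src l)) (shift w v V (tgt l))"
    using link_preserved_by_group[OF l that(1) shift_G[OF compatible S(1)] shift_G[OF compatible S(2)] that(2)] .
  show ?thesis
  proof (cases l)
    case (Ev i b j)
    obtain h where "h \<in> K" "\<forall>d\<in>Lim. lt i d \<and> \<not> lt d h \<longrightarrow> v i b d = w i d"
      using compatibleD(7)[OF compatible, of i b] known Ev by auto
    then show ?thesis by (intro grp) (auto simp: Ev Ind_def intro!: bexI[of _ h])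
  next
    case (Pr i b d j j')
    have "(i, d) \<in> Ind" "b \<in> Th i" "le j' j" using l Pr by (auto simp: Lnk_def)
    moreover have "tree_auto (v i b d)" using compatibleD(2)[OF compatible] calculation by blast
    ultimately show ?thesis by (intro grp) (auto simp: Pr tree_auto_def)
  next
    case (Li i b d j)
    have I: "(i, d) \<in> Ind" using l Li by (auto simp: Lnk_def)
    have "ev d (\<lambda>c. V i b d c = v i b d)" using compatibleD(8)[OF compatible _ I] known Li by simp
    then have "ev d (\<lambda>c. shift w v V (E i b d j) (B d c) = v i b d j)" by (rule ev_mono) simp
    then show ?thesis using I by (intro grp) (simp_all add: Li)
  next
    case (Xx i b d c j)
    then show ?thesis using l by (intro grp) (auto simp: Lnk_def Ind_def)
  next
    case (Pu j)
    have "{(i, d) \<in> Ind. shift w v V (Q j) (P i d) t = t} \<in> UF" if "t \<in> T j" for t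
    proof -
      have j: "j \<in> K" using l Pu by (simp add: Lnk_def)
      have "{(i, d) \<in> Ind. shift w v V (Q j) (P i d) t = t} = {(i, d) \<in> Ind. w i d j t = t}" by auto
      then show ?thesis using compatibleD(6)[OF compatible j that] by simp
    qed
    then show ?thesis by (intro grp) (simp_all add: Pu)
  next
    case (St d c j)
    have S: "C d c j \<in> Srt" "d \<in> Lim" "j \<in> K" using l St by (auto simp: Lnk_def)
    obtain k where k: "lt k d" "\<And>i. \<not> lt i k \<Longrightarrow> lt i d \<Longrightarrow>
        ev i (\<lambda>b. \<forall>j\<in>K. V i b d c j (s i d j) = s' i d j)"
    proof -
      have "known d c" using known St by simp
      from compatibleD(9)[OF compatible this S(2)] show ?thesis using that by blast
    qed
    have "link_preserved s s' (St d c j) (shift w v V (C d c j)) (shift w v V (C d c j))"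
    proof (rule link_preserved_marker[OF S(1) shift_G[OF compatible S(1)] k(1)])
      fix i assume i: "\<not> lt i k" "lt i d"
      show "ev i (\<lambda>b. shift w v V (C d c j) (B i b) (s i d j) = s' i d j)"
        by (rule ev_mono[OF k(2)[OF i]]) (simp add: i S(3))
    qed
    then show ?thesis by (simp add: St)
  qed
qed

definition shift_map where "shift_map w v V = (\<lambda>(\<kappa>, f). (\<kappa> :: ('k, 'b) srt, shift w v V \<kappa> \<odot> f))"
definition known_part where "known_part known = {u \<in> UU. known_sort known (fst u)}"

lemma shift_map_UU: "compatible s s' known w v V \<Longrightarrow> u \<in> UU \<Longrightarrow> shift_map w v V u \<in> UU"
  using shift_G G_mult by (auto simp: UU_def shift_map_def)

lemma shift_map_inj: assumes compatible: "compatible s s' known w v V" shows "inj_on (shift_map w v V) UU"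
  using shift_G[OF compatible] G_cancel by (auto simp: inj_on_def UU_def shift_map_def)

lemma shift_map_surj: assumes compatible: "compatible s s' known w v V" and u: "u \<in> UU"
  obtains u' where "u' \<in> UU" "fst u' = fst u" "shift_map w v V u' = u"
proof -
  obtain \<kappa> f where u': "u = (\<kappa>, f)" "\<kappa> \<in> Srt" "f \<in> G \<kappa>" using u by (auto simp: UU_def)
  show ?thesis
  proof (rule that)
    show "(\<kappa>, sec_inv (shift w v V \<kappa>) \<odot> f) \<in> UU" using u' G_mult G_siv shift_G[OF compatible] by (simp add: UU_def)
    show "shift_map w v V (\<kappa>, sec_inv (shift w v V \<kappa>) \<odot> f) = u"
      using sec_inv_right[OF u'(2) shift_G[OF compatible u'(2)]] u'(1) by (simp add: shift_map_def sec_mult_assoc[symmetric])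
  qed (simp add: u')
qed

lemma shift_map_rel:
  assumes compatible: "compatible s s' known w v V" and y: "y \<in> SYM" and u: "u \<in> known_part known" "v' \<in> known_part known"
  shows "rel s y u v' \<longleftrightarrow> rel s' y (shift_map w v V u) (shift_map w v V v')"
proof -
  obtain \<kappa> f \<mu> g where uv: "u = (\<kappa>, f)" "\<kappa> \<in> Srt" "f \<in> G \<kappa>" "known_sort known \<kappa>"
    "v' = (\<mu>, g)" "\<mu> \<in> Srt" "g \<in> G \<mu>" "known_sort known \<mu>" using u by (auto simp: known_part_def UU_def)
  show ?thesis
  proof (cases y)
    case (Tr \<nu> a)
    show ?thesis
    proof (cases "\<nu> = \<kappa> \<and> \<nu> = \<mu>")
      case True
      then have "\<kappa> = \<nu>" "\<mu> = \<nu>" by auto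
      then show ?thesis using G_cancel[OF uv(2) shift_G[OF compatible uv(2)]]
        by (simp add: Tr uv shift_map_def sec_mult_assoc)
    qed (auto simp: Tr uv shift_map_def)
  next
    case (Ln l)
    have l: "l \<in> Lnk" using y Ln by (auto simp: SYM_def)
    show ?thesis
    proof (cases "\<kappa> = src l \<and> \<mu> = tgt l")
      case True
      then show ?thesis using compatible_link[OF compatible l] uv by (simp add: Ln shift_map_def link_preserved_def)
    qed (auto simp: Ln uv shift_map_def)
  qed
qed

text \<open>If all thresholds are known, the partial isomorphism is total.\<close>

lemma compatible_all_iso:
  assumes compatible: "compatible s s' (\<lambda>i b. i \<in> K \<and> b \<in> Th i) w v V"
  shows "isomorphic voc (mdl s) (mdl s')"
  unfolding iso_iff
proof (intro exI[of _ "enc \<circ> shift_map w v V"] conjI ballI)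
  let ?known = "\<lambda>i b. i \<in> K \<and> b \<in> Th i"
  have all: "known_part ?known = UU"
  proof -
    have "known_sort ?known \<kappa>" if "\<kappa> \<in> Srt" for \<kappa> using that by (cases \<kappa>) (auto dest: Ind_D Lim_K)
    then show ?thesis by (auto simp: known_part_def UU_def)
  qed
  have "u \<in> shift_map w v V ` UU" if "u \<in> UU" for u using shift_map_surj[OF compatible that] by (metis imageI)
  then have "bij_betw (shift_map w v V) UU UU"
    using shift_map_UU[OF compatible] by (intro bij_betw_imageI[OF shift_map_inj[OF compatible]]) auto
  then show "bij_betw (enc \<circ> shift_map w v V) UU (universe (mdl s'))"
    by (rule bij_betw_trans) (simp add: bij_betw_def enc)
  fix y u v' assume y: "y \<in> SYM" and u: "u \<in> UU" "v' \<in> UU"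
  show "rel s y u v' \<longleftrightarrow> rel_in (mdl s') y ((enc \<circ> shift_map w v V) u) ((enc \<circ> shift_map w v V) v')"
    using shift_map_rel[OF compatible y, of u v'] u rel_in_mdl[OF y shift_map_UU[OF compatible u(1)] shift_map_UU[OF compatible u(2)]] by (simp add: all)
qed

text \<open>A stage: all thresholds of low rows are known, and an initial segment of the others. Unknown
  thresholds remain cofinal in the late rows.\<close>

definition known where "known i0 b i x \<longleftrightarrow> i \<in> K \<and> x \<in> Th i \<and> (le i i0 \<or> tl i x (b i))"

text \<open>Fewer than \<open>lam\<close> thresholds can be made known at once: late orders are too long
  to be exhausted, and early rows are added as a whole.\<close>

lemma stage_ext:
  assumes Z: "Z \<subseteq> Sigma K Th" "tiny Z" and i0: "i0 \<in> K" and b: "\<And>i. i \<in> K \<Longrightarrow> b i \<in> Th i"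
  obtains i0' b' where "i0' \<in> K" "\<And>i. i \<in> K \<Longrightarrow> b' i \<in> Th i" "\<And>i x. known i0 b i x \<Longrightarrow> known i0' b' i x"
    "\<And>i x. (i, x) \<in> Z \<Longrightarrow> known i0' b' i x" "le i0 i0'"
proof -
  define Z' where "Z' = Z \<union> (\<lambda>i. (i, b i)) ` K"
  have Z': "tiny Z'" "Z' \<subseteq> Sigma K Th"
    unfolding Z'_def using Z b by (auto intro: tiny_Un tiny_image tiny_K)
  obtain a where a: "a \<in> Field lam" "|Z'| =o |underS lam a|" using tiny_embed[OF Z'(1)] .
  from Th_cof[OF a(1)] obtain i1 where i1: "i1 \<in> K"
    "\<forall>i. lt i1 i \<longrightarrow> (\<forall>Y \<subseteq> Th i. |Y| \<le>o |underS lam a| \<longrightarrow> (\<exists>b\<in>Th i. \<forall>y\<in>Y. tl i y b))" ..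
  have "\<exists>b\<in>Th i. \<forall>y\<in>{x. (i, x) \<in> Z'}. tl i y b" if i: "lt i1 i" for i
  proof (rule i1(2)[rule_format, OF i])
    show "{x. (i, x) \<in> Z'} \<subseteq> Th i" using Z'(2) by auto
    have "{x. (i, x) \<in> Z'} \<subseteq> snd ` Z'" by force
    then have "|{x. (i, x) \<in> Z'}| \<le>o |Z'|" by (rule ordLeq_transitive[OF card_of_mono1 card_of_image])
    then show "|{x. (i, x) \<in> Z'}| \<le>o |underS lam a|" using a(2) ordLeq_ordIso_trans by blast
  qed
  then have "\<exists>b. lt i1 i \<longrightarrow> b \<in> Th i \<and> (\<forall>y. (i, y) \<in> Z' \<longrightarrow> tl i y b)" for i by blast
  then obtain b1 where b1: "\<And>i. lt i1 i \<Longrightarrow> b1 i \<in> Th i \<and> (\<forall>y. (i, y) \<in> Z' \<longrightarrow> tl i y (b1 i))" by metis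
  obtain i0' where i0': "i0' \<in> K" "le i0 i0'" "le i1 i0'" using le_max[OF i0 i1(1)] .
  define b' where "b' i = (if lt i1 i then b1 i else b i)" for i
  have low: "le i i0'" if "i \<in> K" "\<not> lt i1 i" for i
    using that i0'(3) i1(1) le_trans not_lt_le by blast
  show ?thesis
  proof (rule that[of i0' b'])
    show "b' i \<in> Th i" if "i \<in> K" for i using that b b1 by (simp add: b'_def)
    show "known i0' b' i x" if "(i, x) \<in> Z" for i x
    proof (cases "lt i1 i")
      case True
      then have "tl i x (b' i)" using b1[OF True] that by (simp add: b'_def Z'_def)
      then show ?thesis using that Z(1) by (auto simp: known_def)
    qed (use that Z(1) low in \<open>auto simp: known_def\<close>)
    show "known i0' b' i x" if "known i0 b i x" for i x
    proof (cases "le i i0 \<or> \<not> lt i1 i")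
      case True
      then have "le i i0'" using that i0'(2) le_trans low unfolding known_def by blast
      then show ?thesis using that by (simp add: known_def)
    next
      case False
      then have "tl i x (b i)" using that by (simp add: known_def)
      moreover have "tl i (b i) (b' i)" using b1[of i] that False by (auto simp: b'_def Z'_def known_def)
      ultimately show ?thesis using that tl_trans unfolding known_def by blast
    qed
  qed (use i0' in auto)
qed

lemma ev_not_known:
  assumes "i \<in> K" "\<not> le i i0" "b i \<in> Th i" shows "ev i (\<lambda>x. \<not> known i0 b i x)"
  unfolding ev_def using assms by (intro bexI[of _ "b i"]) (auto simp: known_def)

lemma known_le: "le i i0 \<Longrightarrow> x \<in> Th i \<Longrightarrow> known i0 b i x" by (simp add: known_def le_def)

lemma FS_known:
  assumes i: "i \<in> K" and b: "b i \<in> Th i" and f: "FS i f" and g: "FS i g"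
  shows "FS i (\<lambda>x. if known i0 b i x then f x else g x)"
proof (cases "le i i0")
  case True
  show ?thesis by (rule FS_cong[OF f]) (simp add: known_le[OF True])
next
  case False
  show ?thesis by (rule FS_cong[OF FS_glue[OF f g b]]) (use i False in \<open>simp add: known_def\<close>)
qed

context
  fixes s s' u
  assumes u: "\<And>i d. (i, d) \<in> Ind \<Longrightarrow> tree_auto (u i d) \<and> (\<forall>j\<in>K. u i d j (s i d j) = s' i d j)"
begin

lemma tree_auto_id: "tree_auto (\<lambda>_. id)" by (simp add: tree_auto_def A_id)

text \<open>Here \<open>u i d\<close> carries \<open>s i d\<close> to \<open>s' i d\<close>. The known
  columns take the values \<open>u\<close>. The limit along the columns at \<open>d\<close> is
  \<open>u\<close> only if all of them are known, that is for \<open>d\<close> up to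
  \<open>i0\<close>; the rows follow these limits.\<close>

lemma compatible_initial:
  assumes i0: "i0 \<in> K" and b: "\<And>i. i \<in> K \<Longrightarrow> b i \<in> Th i"
  shows "compatible s s' (known i0 b) (\<lambda>_ _ _. id) (\<lambda>i x d. if le d i0 then u i d else (\<lambda>_. id))
     (\<lambda>i x d c. if known i0 b d c then u i d else (\<lambda>_. id))"
  unfolding compatible_def
proof (intro conjI allI impI ballI; (elim conjE)?)
  fix i d assume I: "(i, d) \<in> Ind"
  have id: "i \<in> K" "d \<in> K" "lt i d" using Ind_D[OF I] by auto
  show "tree_auto (\<lambda>_. id)" by (rule tree_auto_id)
  show "tree_auto (if le d i0 then u i d else (\<lambda>_. id))" using u[OF I] tree_auto_id by simp
  show "FS d (\<lambda>c. if known i0 b d c then u i d else (\<lambda>_. id))" by (intro FS_known id b FS_const)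
  show "tree_auto (if known i0 b d c then u i d else (\<lambda>_. id))" for c using u[OF I] tree_auto_id by simp
  show "FS i (\<lambda>x. if known i0 b d c then u i d else (\<lambda>_. id))" for c by (rule FS_const)
  show "ev d (\<lambda>c. (if known i0 b d c then u i d else (\<lambda>_. id)) = (if le d i0 then u i d else (\<lambda>_. id)))"
  proof (cases "le d i0")
    case True then show ?thesis using known_le[OF True] by (intro ev_true id) simp
  next
    case False
    show ?thesis by (rule ev_mono[where i = d, OF ev_not_known[of d i0 b, OF id(2) False b[OF id(2)]]]) (simp add: False)
  qed
next
  fix j t show "{(i, d) \<in> Ind. id t = t} \<in> UF" using UF_all by simp
next
  fix i x assume "known i0 b i x"
  have "(if le d i0 then u i d else (\<lambda>_. id)) = (\<lambda>_. id)" if "lt i0 d" for d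
    using that lt_irrefl le_lt_trans by auto
  moreover obtain h where h: "lt i0 h" "h \<in> K" using K_nomax[OF i0] lt_K by blast
  moreover have "lt i0 d" if "d \<in> Lim" "\<not> lt d h" for d
    by (rule lt_le_trans[OF h(1)]) (simp add: le_def h(2) Lim_K that)
  ultimately show "\<exists>h\<in>K. \<forall>d\<in>Lim. lt i d \<and> \<not> lt d h \<longrightarrow> (if le d i0 then u i d else (\<lambda>_. id)) = (\<lambda>_. id)"
    by (intro bexI[of _ h]) auto
next
  fix d c assume known: "known i0 b d c" and d: "d \<in> Lim"
  obtain k where k: "lt k d" using d by (auto simp: Lim_def)
  have "ev i (\<lambda>_. \<forall>j\<in>K. u i d j (s i d j) = s' i d j)" if "lt i d" for i
    using u[of i d] that d lt_K[OF that] by (intro ev_true) (auto simp: Ind_def)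
  then show "\<exists>k. lt k d \<and> (\<forall>i. \<not> lt i k \<and> lt i d \<longrightarrow>
      ev i (\<lambda>b'. \<forall>j\<in>K. (if known i0 b d c then u i d else (\<lambda>_. id)) j (s i d j) = s' i d j))"
    using k known by auto
qed

text \<open>Values at known thresholds are kept. A new column has to convert \<open>s\<close> into
  \<open>s'\<close>, hence takes the values \<open>u\<close> in the unknown rows, which are
  cofinal in every late row; a new row has to converge to \<open>w\<close> at late places, hence
  takes the values \<open>w\<close> in the columns that remain unknown, which are cofinal as
  well. The two demands never meet.\<close>

lemma compatible_enlarge:
  assumes compatible: "compatible s s' (known i0 b) w v V" and i0: "i0 \<in> K" "i0' \<in> K" "le i0 i0'"
    and b: "\<And>i. i \<in> K \<Longrightarrow> b i \<in> Th i" "\<And>i. i \<in> K \<Longrightarrow> b' i \<in> Th i"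
    and mono: "\<And>i x. known i0 b i x \<Longrightarrow> known i0' b' i x"
  shows "compatible s s' (known i0' b') w
      (\<lambda>i x d. if known i0 b i x then v i x d else if le d i0' then u i d else w i d)
      (\<lambda>i x d c. if known i0 b d c then V i x d c else
         if known i0 b i x then V i x d c else if known i0' b' d c then u i d else w i d)" (is "compatible s s' _ w ?v ?V")
  unfolding compatible_def
proof (intro conjI allI impI ballI; (elim conjE)?)
  fix i d assume I: "(i, d) \<in> Ind"
  have id: "i \<in> K" "d \<in> K" "lt i d" using Ind_D[OF I] by auto
  show w: "tree_auto (w i d)" using compatibleD(1)[OF compatible I] .
  show "tree_auto (?v i x d)" if "x \<in> Th i" for x using w u[OF I] compatibleD(2)[OF compatible I that] by simp
  show "FS d (?V i x d)" if x: "x \<in> Th i" for x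
  proof (cases "known i0 b i x")
    case True
    show ?thesis by (rule FS_cong[OF compatibleD(4)[OF compatible I x]]) (simp add: True)
  next
    case False
    have "FS d (\<lambda>c. if known i0' b' d c then u i d else w i d)"
      by (rule FS_known[where b = b', OF id(2) b(2)[OF id(2)] FS_const FS_const])
    then show ?thesis using FS_known[where b = b, OF id(2) b(1)[OF id(2)] compatibleD(4)[OF compatible I x], of _ i0] False
      by simp
  qed
  show "tree_auto (?V i x d c)" if "x \<in> Th i" "c \<in> Th d" for x c using w u[OF I] compatibleD(3)[OF compatible I that] by simp
  show "FS i (\<lambda>x. ?V i x d c)" if c: "c \<in> Th d" for c
  proof (cases "known i0 b d c")
    case True
    then show ?thesis using compatibleD(5)[OF compatible I c] by simp
  next
    case False
    then show ?thesis using FS_known[where b = b, OF id(1) b(1)[OF id(1)] compatibleD(5)[OF compatible I c]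
        FS_const[of _ "if known i0' b' d c then u i d else w i d"], of i0] by simp
  qed
  show "ev d (\<lambda>c. ?V i x d c = ?v i x d)" if known: "known i0' b' i x" for x
  proof (cases "known i0 b i x")
    case True
    then show ?thesis using compatibleD(8)[OF compatible True I] by (auto elim: ev_mono)
  next
    case False
    have x: "x \<in> Th i" using known by (simp add: known_def)
    have nle: "\<not> le d i0"
    proof
      assume "le d i0"
      then have "le i i0" using id(3) lt_le le_trans by blast
      then show False using known_le x False by blast
    qed
    show ?thesis
    proof (cases "le d i0'")
      case True
      show ?thesis
        by (rule ev_mono[where i = d, OF ev_not_known[of d i0 b, OF id(2) nle b(1)[OF id(2)]]])
          (simp add: False True known_le[OF True])
    next
      case le: False
      show ?thesis
        by (rule ev_conj2[where i = d, OF ev_not_known[of d i0 b, OF id(2) nle b(1)[OF id(2)]]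
              ev_not_known[of d i0' b', OF id(2) le b(2)[OF id(2)]]]) (simp add: False le)
    qed
  qed
next
  fix j t assume "j \<in> K" "t \<in> T j"
  then show "{(i, d) \<in> Ind. w i d j t = t} \<in> UF" by (rule compatibleD(6)[OF compatible])
next
  fix i x assume "known i0' b' i x"
  show "\<exists>h\<in>K. \<forall>d\<in>Lim. lt i d \<and> \<not> lt d h \<longrightarrow> ?v i x d = w i d"
  proof (cases "known i0 b i x")
    case True
    then show ?thesis using compatibleD(7)[OF compatible True] by simp
  next
    case False
    obtain h where h: "lt i0' h" "h \<in> K" using K_nomax[OF i0(2)] lt_K by blast
    have "\<not> le d i0'" if "d \<in> Lim" "\<not> lt d h" for d
    proof
      assume "le d i0'"
      then have "lt d h" using h(1) le_lt_trans by blast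
      then show False using that(2) by simp
    qed
    then show ?thesis using h(2) False by (intro bexI[of _ h]) auto
  qed
next
  fix d c assume known: "known i0' b' d c" and d: "d \<in> Lim"
  show "\<exists>k. lt k d \<and> (\<forall>i. \<not> lt i k \<and> lt i d \<longrightarrow> ev i (\<lambda>x. \<forall>j\<in>K. ?V i x d c j (s i d j) = s' i d j))"
  proof (cases "known i0 b d c")
    case True
    then show ?thesis using compatibleD(9)[OF compatible True d] by simp
  next
    case False
    have dK: "d \<in> K" "c \<in> Th d" using known by (simp_all add: known_def)
    have "lt i0 d" using False dK known_le not_lt_le[OF i0(1) dK(1)] by blast
    then obtain k where k: "lt i0 k" "lt k d" using d unfolding Lim_def by blast
    have "ev i (\<lambda>x. \<forall>j\<in>K. ?V i x d c j (s i d j) = s' i d j)" if i: "\<not> lt i k" "lt i d" for i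
    proof -
      have I: "(i, d) \<in> Ind" using d i by (simp add: Ind_def)
      have iK: "i \<in> K" using Ind_D[OF I] by simp
      have "\<not> le i i0" using i(1) k(1) le_lt_trans by blast
      from ev_not_known[of i i0 b, OF iK this b(1)[OF iK]] show ?thesis
        by (rule ev_mono) (use False known u[OF I] in simp)
    qed
    then show ?thesis using k(2) by blast
  qed
qed

fun prs :: "('k, 'b) srt \<Rightarrow> ('k \<times> 'b) set" where
  "prs (Q j) = {}" | "prs (R i b j) = {(i, b)}" | "prs (E i b d j) = {(i, b)}" | "prs (C d c j) = {(d, c)}"

lemma compatible_extend:
  assumes compatible: "compatible s s' (known i0 b) w v V" and i0: "i0 \<in> K" and b: "\<And>i. i \<in> K \<Longrightarrow> b i \<in> Th i"
    and S: "S \<subseteq> Srt" "tiny S"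
  obtains i0' b' v' V' where "i0' \<in> K" "\<And>i. i \<in> K \<Longrightarrow> b' i \<in> Th i" "compatible s s' (known i0' b') w v' V'"
    "\<And>\<kappa>. \<kappa> \<in> Srt \<Longrightarrow> known_sort (known i0 b) \<kappa> \<Longrightarrow> known_sort (known i0' b') \<kappa> \<and> shift w v' V' \<kappa> = shift w v V \<kappa>"
    "\<And>\<kappa>. \<kappa> \<in> S \<Longrightarrow> known_sort (known i0' b') \<kappa>"
proof -
  have fin: "finite (prs \<kappa>)" for \<kappa> by (cases \<kappa>) auto
  have pK: "prs \<kappa> \<subseteq> Sigma K Th" if "\<kappa> \<in> Srt" for \<kappa> using that by (cases \<kappa>) (auto dest: Ind_D Lim_K)
  have kp: "known_sort known \<kappa> \<longleftrightarrow> (\<forall>(i, x)\<in>prs \<kappa>. known i x)" for known \<kappa> by (cases \<kappa>) auto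
  have "tiny (Sigma S prs)"
  proof (rule tiny_Sigma_le[OF S(2) tiny_nat])
    have "|prs \<kappa>| <o natLeq" for \<kappa> using fin finite_iff_ordLess_natLeq by blast
    then show "|prs \<kappa>| \<le>o |UNIV :: nat set|" for \<kappa>
      by (rule ordLess_imp_ordLeq[OF ordLess_ordIso_trans[OF _ ordIso_symmetric[OF card_of_nat]]])
  qed
  then have "tiny (snd ` Sigma S prs)" by (rule tiny_image)
  moreover have "snd ` Sigma S prs \<subseteq> Sigma K Th" using pK S(1) by force
  ultimately obtain i0' b' where st: "i0' \<in> K" "\<And>i. i \<in> K \<Longrightarrow> b' i \<in> Th i"
    "\<And>i x. known i0 b i x \<Longrightarrow> known i0' b' i x" "\<And>i x. (i, x) \<in> snd ` Sigma S prs \<Longrightarrow> known i0' b' i x" "le i0 i0'"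
    using stage_ext[of "snd ` Sigma S prs" i0 b] i0 b by metis
  note ok' = compatible_enlarge[OF compatible i0 st(1,5) b st(2,3)]
  show ?thesis
  proof (rule that[OF st(1,2) ok'])
    show "known_sort (known i0' b') \<kappa>" if "\<kappa> \<in> S" for \<kappa> unfolding kp using st(4) that by force
    show "known_sort (known i0' b') \<kappa> \<and>
        shift w (\<lambda>i x d. if known i0 b i x then v i x d else if le d i0' then u i d else w i d)
         (\<lambda>i x d c. if known i0 b d c then V i x d c else
         if known i0 b i x then V i x d c else if known i0' b' d c then u i d else w i d) \<kappa> = shift w v V \<kappa>"
      if "known_sort (known i0 b) \<kappa>" for \<kappa>
      using that st(3) by (cases \<kappa>) (auto split: crd.split)
  qed
qed


text \<open>The back step needs no separate construction, as a shift maps every known sort onto itself.\<close>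

lemma back_forth_family:
  obtains F where "back_and_forth lam voc (mdl s) (mdl s') F" "F \<noteq> {}"
proof -
  define F where "F = {(enc ` known_part (known i0 b), \<lambda>x. enc (shift_map w v V (inv_into UU enc x))) |i0 b w v V.
     i0 \<in> K \<and> (\<forall>i\<in>K. b i \<in> Th i) \<and> compatible s s' (known i0 b) w v V}"
  have inv: "inv_into UU enc (enc z) = z" if "z \<in> UU" for z using that enc by simp
  have known_part: "known_part known \<subseteq> UU" for known by (auto simp: known_part_def)
  have sorts: "\<exists>D' f'. (D', f') \<in> F \<and> (\<forall>x\<in>D. x \<in> D' \<and> f' x = f x) \<and>
      (\<forall>z\<in>Z. enc z \<in> D' \<and> (\<exists>z'. enc z' \<in> D' \<and> f' (enc z') = enc z))"
    if DF: "(D, f) \<in> F" and Z: "Z \<subseteq> UU" "tiny Z" for D f Z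
  proof -
    obtain i0 b w v V where D: "D = enc ` known_part (known i0 b)" "f = (\<lambda>x. enc (shift_map w v V (inv_into UU enc x)))"
      "i0 \<in> K" "\<And>i. i \<in> K \<Longrightarrow> b i \<in> Th i" "compatible s s' (known i0 b) w v V" using DF unfolding F_def by blast
    have S: "fst ` Z \<subseteq> Srt" "tiny (fst ` Z)" using Z tiny_image by (auto simp: UU_def)
    obtain i0' b' v' V' where e: "i0' \<in> K" "\<And>i. i \<in> K \<Longrightarrow> b' i \<in> Th i" "compatible s s' (known i0' b') w v' V'"
      "\<And>\<kappa>. \<kappa> \<in> Srt \<Longrightarrow> known_sort (known i0 b) \<kappa> \<Longrightarrow> known_sort (known i0' b') \<kappa> \<and> shift w v' V' \<kappa> = shift w v V \<kappa>"
      "\<And>\<kappa>. \<kappa> \<in> fst ` Z \<Longrightarrow> known_sort (known i0' b') \<kappa>"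
      using compatible_extend[OF D(5,3,4) S] by metis
    let ?D = "enc ` known_part (known i0' b')" and ?f = "\<lambda>x. enc (shift_map w v' V' (inv_into UU enc x))"
    have "(?D, ?f) \<in> F" unfolding F_def using e(1,2,3) by blast
    moreover have "x \<in> ?D \<and> ?f x = f x" if "x \<in> D" for x
    proof -
      obtain \<kappa> g where g: "x = enc (\<kappa>, g)" "(\<kappa>, g) \<in> UU" "known_sort (known i0 b) \<kappa>"
        using \<open>x \<in> D\<close> by (auto simp: D(1) known_part_def)
      then have "\<kappa> \<in> Srt" by (simp add: UU_def)
      then show ?thesis using e(4)[of \<kappa>] g inv by (auto simp: known_part_def D(2) shift_map_def)
    qed
    moreover have "enc z \<in> ?D \<and> (\<exists>z'. enc z' \<in> ?D \<and> ?f (enc z') = enc z)" if z: "z \<in> Z" for z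
    proof -
      have zU: "z \<in> UU" using Z z by blast
      obtain z' where z': "z' \<in> UU" "fst z' = fst z" "shift_map w v' V' z' = z" using shift_map_surj[OF e(3) zU] .
      have "z \<in> known_part (known i0' b')" "z' \<in> known_part (known i0' b')"
        using e(5)[of "fst z"] z zU z'(1,2) by (auto simp: known_part_def)
      then show ?thesis using z'(3) inv[OF z'(1)] by (intro conjI exI[of _ z']) auto
    qed
    ultimately show ?thesis by blast
  qed
  have pull: "\<exists>Z. Z \<subseteq> UU \<and> tiny Z \<and> X = enc ` Z" if "X \<subseteq> enc ` UU" "tiny X" for X
  proof (intro exI conjI)
    show "inv_into UU enc ` X \<subseteq> UU" using that inv_into_into[of _ enc UU] by blast
    show "X = enc ` inv_into UU enc ` X" using that by (auto simp: image_comp f_inv_into_f image_iff subset_iff)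
  qed (rule tiny_image[OF that(2)])
  show ?thesis
  proof (rule that[of F])
    show "F \<noteq> {}"
    proof -
      obtain i0 where i0: "i0 \<in> K" using K_inf by fastforce
      have "\<exists>x. i \<in> K \<longrightarrow> x \<in> Th i" for i using Th_ne by blast
      then obtain b where "\<And>i. i \<in> K \<Longrightarrow> b i \<in> Th i" by metis
      then show ?thesis using compatible_initial[OF i0] i0 unfolding F_def by blast
    qed
    show "back_and_forth lam voc (mdl s) (mdl s') F"
    proof
      fix D f assume DF: "(D, f) \<in> F"
      obtain i0 b w v V where D: "D = enc ` known_part (known i0 b)" "f = (\<lambda>x. enc (shift_map w v V (inv_into UU enc x)))"
        "compatible s s' (known i0 b) w v V" using DF unfolding F_def by blast
      have fe: "f (enc z) = enc (shift_map w v V z)" if "z \<in> UU" for z using that inv by (simp add: D(2))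
      show "D \<subseteq> universe (mdl s) \<and> inj_on f D \<and> f ` D \<subseteq> universe (mdl s')"
      proof (intro conjI)
        show "D \<subseteq> universe (mdl s)" using known_part D(1) by auto
        show "f ` D \<subseteq> universe (mdl s')"
        proof
          fix x assume "x \<in> f ` D"
          then obtain z where "z \<in> UU" "x = f (enc z)" using known_part D(1) by blast
          then show "x \<in> universe (mdl s')" using fe shift_map_UU[OF D(3)] by simp
        qed
        show "inj_on f D"
        proof (rule inj_onI)
          fix x y assume "x \<in> D" "y \<in> D" and eq: "f x = f y"
          then obtain z z' where z: "x = enc z" "y = enc z'" "z \<in> UU" "z' \<in> UU" using known_part D(1) by blast
          then have "enc (shift_map w v V z) = enc (shift_map w v V z')" using eq fe by simp
          then have "shift_map w v V z = shift_map w v V z'" using enc shift_map_UU[OF D(3)] z(3,4) by (meson inj_onD)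
          then show "x = y" using inj_onD[OF shift_map_inj[OF D(3)] _ z(3,4)] z(1,2) by simp
        qed
      qed
      show "xs \<in> interp (mdl s) R \<longleftrightarrow> map f xs \<in> interp (mdl s') R"
        if R: "voc R = Some (length xs)" and xs: "set xs \<subseteq> D" for R xs
      proof -
        obtain y where y: "y \<in> SYM" "R = \<sigma> y" "length xs = 2" using R by (auto simp: voc_def split: if_splits)
        then obtain p q where pq: "xs = [p, q]" by (auto simp: numeral_2_eq_2 length_Suc_conv)
        then obtain z z' where z: "p = enc z" "q = enc z'" "z \<in> known_part (known i0 b)" "z' \<in> known_part (known i0 b)"
          using xs D(1) by auto
        then have zU: "z \<in> UU" "z' \<in> UU" using known_part by auto
        show ?thesis
          using rel_in_mdl[OF y(1) zU, of s] rel_in_mdl[OF y(1) shift_map_UU[OF D(3) zU(1)] shift_map_UU[OF D(3) zU(2)], of s']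
            shift_map_rel[OF D(3) y(1) z(3,4)] pq z y fe[OF zU(1)] fe[OF zU(2)]
          by (simp add: rel_in_def)
      qed
      show "\<exists>D' f'. (D', f') \<in> F \<and> D \<union> X \<subseteq> D' \<and> (\<forall>x\<in>D. f' x = f x)"
        if X: "X \<subseteq> universe (mdl s)" "tiny X" for X
      proof -
        obtain Z where Z: "Z \<subseteq> UU" "tiny Z" "X = enc ` Z" using pull[of X] X by auto
        from sorts[OF DF Z(1,2)] obtain D' where "\<exists>f'. (D', f') \<in> F \<and> (\<forall>x\<in>D. x \<in> D' \<and> f' x = f x) \<and>
          (\<forall>z\<in>Z. enc z \<in> D' \<and> (\<exists>z'. enc z' \<in> D' \<and> f' (enc z') = enc z))" ..
        then obtain f' where D': "(D', f') \<in> F \<and> (\<forall>x\<in>D. x \<in> D' \<and> f' x = f x) \<and>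
          (\<forall>z\<in>Z. enc z \<in> D' \<and> (\<exists>z'. enc z' \<in> D' \<and> f' (enc z') = enc z))" ..
        show ?thesis
        proof (intro exI conjI)
          show "(D', f') \<in> F" "D \<union> X \<subseteq> D'" "\<forall>x\<in>D. f' x = f x" using D' Z(3) by auto
        qed
      qed
      show "\<exists>D' f'. (D', f') \<in> F \<and> D \<subseteq> D' \<and> Y \<subseteq> f' ` D' \<and> (\<forall>x\<in>D. f' x = f x)"
        if Y: "Y \<subseteq> universe (mdl s')" "tiny Y" for Y
      proof -
        obtain Z where Z: "Z \<subseteq> UU" "tiny Z" "Y = enc ` Z" using pull[of Y] Y by auto
        from sorts[OF DF Z(1,2)] obtain D' where "\<exists>f'. (D', f') \<in> F \<and> (\<forall>x\<in>D. x \<in> D' \<and> f' x = f x) \<and>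
          (\<forall>z\<in>Z. enc z \<in> D' \<and> (\<exists>z'. enc z' \<in> D' \<and> f' (enc z') = enc z))" ..
        then obtain f' where D': "(D', f') \<in> F \<and> (\<forall>x\<in>D. x \<in> D' \<and> f' x = f x) \<and>
          (\<forall>z\<in>Z. enc z \<in> D' \<and> (\<exists>z'. enc z' \<in> D' \<and> f' (enc z') = enc z))" ..
        have "Y \<subseteq> f' ` D'"
        proof
          fix x assume "x \<in> Y"
          then obtain z where "z \<in> Z" "x = enc z" using Z(3) by blast
          then obtain z' where "enc z' \<in> D'" "f' (enc z') = x" using D' by metis
          then show "x \<in> f' ` D'" by blast
        qed
        then show ?thesis using D' by (intro exI[of _ D'] exI[of _ f']) auto
      qed
    qed
  qed
qed

end

lemma mdl_equiv:
  assumes "\<And>p. p \<in> Ind \<Longrightarrow> thr (s p)" "\<And>p. p \<in> Ind \<Longrightarrow> thr (s' p)"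
  shows "L_inf_equiv lam voc (mdl (\<lambda>i d. s (i, d))) (mdl (\<lambda>i d. s' (i, d)))"
proof -
  let ?u = "\<lambda>i d j. sw j (s (i, d) j) (s' (i, d) j)"
  have u: "tree_auto (?u i d) \<and> (\<forall>j\<in>K. ?u i d j (s (i, d) j) = s' (i, d) j)" if "(i, d) \<in> Ind" for i d
    using sw_AT[OF assms(1,2)[OF that]] sw_eq assms(1,2)[OF that] by (auto simp: thr_def)
  obtain F where F: "back_and_forth lam voc (mdl (\<lambda>i d. s (i, d))) (mdl (\<lambda>i d. s' (i, d))) F" "F \<noteq> {}"
    by (rule back_forth_family[of ?u, OF u])
  show ?thesis unfolding L_inf_equiv_def
    using back_and_forth.sentence_iff[OF F] UU_ne by auto
qed

end

section \<open>Frames in an equivalent model\<close>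

locale equivalent = homogeneous lam kap Th tl T pr A UF oo enc \<sigma> sw
  for lam :: "'a rel" and kap :: "'k rel" and Th :: "'k \<Rightarrow> 'b set" and tl
    and T :: "'k \<Rightarrow> 't set" and pr A UF oo enc \<sigma> sw +
  fixes N :: "('a, 'a set) model"
  assumes N_model: "is_model voc N" and N_equiv: "L_inf_equiv lam voc N (mdl (\<lambda>_ _. oo))"
begin

abbreviation s0 where "s0 \<equiv> (\<lambda>_ _. oo)"
abbreviation NU where "NU \<equiv> universe N"

lemma N_ne: "NU \<noteq> {}" using N_model by (simp add: is_model_def)

lemma rel_in_UN: assumes "y \<in> SYM" "rel_in N y b c" shows "b \<in> NU \<and> c \<in> NU"
proof -
  have "case voc (\<sigma> y) of None \<Rightarrow> interp N (\<sigma> y) = {}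
          | Some n \<Rightarrow> interp N (\<sigma> y) \<subseteq> {xs. set xs \<subseteq> NU \<and> length xs = n}"
    using N_model unfolding is_model_def by blast
  then show ?thesis using assms voc_SYM[OF assms(1)] by (auto simp: rel_in_def)
qed

text \<open>Elementary maps from sets of fewer than \<open>lam\<close> elements of the structure into the
  model. Each element serves as its own variable.\<close>

definition elem_map :: "('k, 'b, 't) el set \<Rightarrow> (('k, 'b, 't) el \<Rightarrow> 'a) \<Rightarrow> bool" where
  "elem_map X \<phi> \<longleftrightarrow> X \<subseteq> UU \<and> tiny X \<and>
     (\<exists>d. elem_eq lam voc (mdl s0) N (enc ` X) id d \<and> (\<forall>x\<in>X. d (enc x) = \<phi> x))"

lemma elem_map_UU: "elem_map X \<phi> \<Longrightarrow> X \<subseteq> UU" by (simp add: elem_map_def)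
lemma elem_map_UN: "elem_map X \<phi> \<Longrightarrow> x \<in> X \<Longrightarrow> \<phi> x \<in> NU"
proof -
  assume "elem_map X \<phi>" and x: "x \<in> X"
  then obtain d where "elem_eq lam voc (mdl s0) N (enc ` X) id d" "\<forall>x\<in>X. d (enc x) = \<phi> x"
    by (auto simp: elem_map_def)
  then show "\<phi> x \<in> NU" using x unfolding elem_eq_def by (metis image_eqI subsetD)
qed

lemma elem_map_empty: "elem_map {} \<phi>"
proof -
  have "elem_eq lam voc N (mdl s0) {} undefined id"
    by (rule elem_eq_empty[OF N_equiv N_ne]) (simp add: UU_ne)
  then have "elem_eq lam voc (mdl s0) N {} id undefined" by (rule elem_eq_sym)
  then show ?thesis unfolding elem_map_def using tiny_finite[of "{}"] by auto
qed

lemma elem_map_rel: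
  assumes "elem_map X \<phi>" "y \<in> SYM" "u \<in> X" "v \<in> X" shows "rel s0 y u v \<longleftrightarrow> rel_in N y (\<phi> u) (\<phi> v)"
proof -
  obtain d where d: "elem_eq lam voc (mdl s0) N (enc ` X) id d" "\<forall>x\<in>X. d (enc x) = \<phi> x" "X \<subseteq> UU"
    using assms(1) by (auto simp: elem_map_def)
  have "rel_in (mdl s0) y (enc u) (enc v) \<longleftrightarrow> rel_in N y (\<phi> u) (\<phi> v)"
    using elem_eq_rel[OF d(1), of "[enc u, enc v]" "\<sigma> y"] voc_SYM[OF assms(2)] assms(3,4) d(2)
    by (simp add: rel_in_def)
  then show ?thesis using rel_in_mdl[OF assms(2), of u v s0] d(3) assms(3,4) by auto
qed

lemma elem_map_inj:
  assumes "elem_map X \<phi>" "u \<in> X" "v \<in> X" shows "\<phi> u = \<phi> v \<longleftrightarrow> u = v"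
proof -
  obtain d where d: "elem_eq lam voc (mdl s0) N (enc ` X) id d" "\<forall>x\<in>X. d (enc x) = \<phi> x" "X \<subseteq> UU"
    using assms(1) by (auto simp: elem_map_def)
  have "enc u = enc v \<longleftrightarrow> \<phi> u = \<phi> v"
    using elem_eq_eq[OF d(1), of "enc u" "enc v"] assms(2,3) d(2) by simp
  then show ?thesis using enc d(3) assms(2,3) by (auto simp: inj_on_def)
qed

lemma elem_map_ext:
  assumes X: "elem_map X \<phi>" and Y: "Y \<subseteq> UU" "tiny Y"
  obtains \<psi> where "elem_map (X \<union> Y) \<psi>" "\<And>x. x \<in> X \<Longrightarrow> \<psi> x = \<phi> x"
proof -
  obtain d where d: "elem_eq lam voc (mdl s0) N (enc ` X) id d" "\<forall>x\<in>X. d (enc x) = \<phi> x" "X \<subseteq> UU"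
    using X by (auto simp: elem_map_def)
  have disj: "enc ` X \<inter> enc ` (Y - X) = {}"
    using inj_on_image_Int[OF enc, of X "Y - X"] d(3) Y(1) by auto
  have tY: "tiny (enc ` (Y - X))" by (rule tiny_image[OF tiny_mono[OF _ Y(2)]]) auto
  have sub: "id ` enc ` (Y - X) \<subseteq> universe (mdl s0)" using Y(1) by auto
  obtain d1 where d1: "\<And>x. x \<in> enc ` X \<Longrightarrow> d1 x = d x"
    "elem_eq lam voc (mdl s0) N (enc ` X \<union> enc ` (Y - X)) id d1"
    by (rule elem_eq_forth[OF d(1) tY disj _ sub]) auto
  have "enc ` X \<union> enc ` (Y - X) = enc ` (X \<union> Y)" by auto
  then have "elem_map (X \<union> Y) (d1 \<circ> enc)"
    using d1(2) d(3) Y X tiny_Un[of X Y] by (auto simp: elem_map_def)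
  then show ?thesis using that[of "d1 \<circ> enc"] d1(1) d(2) by simp
qed

text \<open>Two elements of the model, which may be equal or already in the range, are pulled back with
  fresh variables.\<close>

lemma elem_map_back:
  assumes X: "elem_map X \<phi>" and b: "b \<in> NU" "b' \<in> NU"
  obtains u u' where "u \<in> UU" "u' \<in> UU" "b = b' \<longleftrightarrow> u = u'"
    "\<And>y. y \<in> SYM \<Longrightarrow> rel s0 y u u' \<longleftrightarrow> rel_in N y b b'"
    "\<And>y. y \<in> SYM \<Longrightarrow> rel s0 y u u \<longleftrightarrow> rel_in N y b b"
    "\<And>y. y \<in> SYM \<Longrightarrow> rel s0 y u' u' \<longleftrightarrow> rel_in N y b' b'"
    "\<And>x. x \<in> X \<Longrightarrow> \<phi> x = b \<longleftrightarrow> x = u"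
    "\<And>x y. x \<in> X \<Longrightarrow> y \<in> SYM \<Longrightarrow> rel s0 y x u \<longleftrightarrow> rel_in N y (\<phi> x) b"
proof -
  obtain d where d: "elem_eq lam voc (mdl s0) N (enc ` X) id d" "\<forall>x\<in>X. d (enc x) = \<phi> x" "X \<subseteq> UU" "tiny X"
    using X by (auto simp: elem_map_def)
  have "infinite (Field lam - enc ` X)"
  proof
    assume "finite (Field lam - enc ` X)"
    then have "tiny ((Field lam - enc ` X) \<union> enc ` X)" by (intro tiny_Un tiny_finite tiny_image d(4))
    then have "tiny (Field lam)" by (rule tiny_mono[rotated]) auto
    then show False using card_of_Field_ordIso[OF lamC] not_ordLess_ordIso by blast
  qed
  note inf = this
  obtain v1 where v1: "v1 \<in> Field lam - enc ` X" using infinite_imp_nonempty[OF inf] by blast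
  have inf': "infinite (Field lam - enc ` X - {v1})" using inf by simp
  obtain v2 where v2: "v2 \<in> Field lam - enc ` X - {v1}" using infinite_imp_nonempty[OF inf'] by blast
  define d' where "d' = d(v1 := b, v2 := b')"
  have sub: "d' ` {v1, v2} \<subseteq> NU" using b by (auto simp: d'_def)
  have agree: "d' x = d x" if "x \<in> enc ` X" for x using that v1 v2 by (auto simp: d'_def)
  have disj: "enc ` X \<inter> {v1, v2} = {}" using v1 v2 by auto
  obtain e where e: "\<And>x. x \<in> enc ` X \<Longrightarrow> e x = id x" "elem_eq lam voc N (mdl s0) (enc ` X \<union> {v1, v2}) d' e"
    by (rule elem_eq_forth[OF elem_eq_sym[OF d(1)] tiny_finite[of "{v1, v2}"] disj agree sub]) auto
  have "e v1 \<in> enc ` UU" "e v2 \<in> enc ` UU" using e(2) by (auto simp: elem_eq_def)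
  then obtain u u' where u: "u \<in> UU" "u' \<in> UU" "e v1 = enc u" "e v2 = enc u'" by auto
  have d'v: "d' v1 = b" "d' v2 = b'" using v2 by (auto simp: d'_def)
  show ?thesis
  proof (rule that[OF u(1,2)])
    show "b = b' \<longleftrightarrow> u = u'"
      using elem_eq_eq[OF e(2), of v1 v2] d'v u inj_on_eq_iff[OF enc u(1,2)] by simp
    show "rel s0 y u u' \<longleftrightarrow> rel_in N y b b'" if y: "y \<in> SYM" for y
      using elem_eq_rel[OF e(2), of "[v1, v2]" "\<sigma> y"] voc_SYM[OF y] d'v u rel_in_mdl[OF y u(1,2), of s0]
      by (simp add: rel_in_def)
    show "rel s0 y u u \<longleftrightarrow> rel_in N y b b" if y: "y \<in> SYM" for y
      using elem_eq_rel[OF e(2), of "[v1, v1]" "\<sigma> y"] voc_SYM[OF y] d'v u rel_in_mdl[OF y u(1,1), of s0]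
      by (simp add: rel_in_def)
    show "rel s0 y u' u' \<longleftrightarrow> rel_in N y b' b'" if y: "y \<in> SYM" for y
      using elem_eq_rel[OF e(2), of "[v2, v2]" "\<sigma> y"] voc_SYM[OF y] d'v u rel_in_mdl[OF y u(2,2), of s0]
      by (simp add: rel_in_def)
    fix x assume x: "x \<in> X"
    then have xU: "x \<in> UU" using d(3) by blast
    have ex: "d' (enc x) = \<phi> x" "e (enc x) = enc x" using agree[of "enc x"] e(1)[of "enc x"] d(2) x by auto
    show "\<phi> x = b \<longleftrightarrow> x = u"
      using elem_eq_eq[OF e(2), of "enc x" v1] ex d'v u x inj_on_eq_iff[OF enc xU u(1)] by simp
    show "rel s0 y x u \<longleftrightarrow> rel_in N y (\<phi> x) b" if y: "y \<in> SYM" for y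
      using elem_eq_rel[OF e(2), of "[enc x, v1]" "\<sigma> y"] voc_SYM[OF y] ex d'v u x rel_in_mdl[OF y xU u(1), of s0]
      by (simp add: rel_in_def)
  qed
qed

text \<open>In the model a sort has no distinguished element, but translations still act on it.\<close>

definition translate where "translate b \<kappa> f = (THE c. rel_in N (Tr \<kappa> f) b c)"

lemma Tr_SYM: "\<kappa> \<in> Srt \<Longrightarrow> f \<in> G \<kappa> \<Longrightarrow> Tr \<kappa> f \<in> SYM" by (force simp: SYM_def)
lemma Ln_SYM: "l \<in> Lnk \<Longrightarrow> Ln l \<in> SYM" by (simp add: SYM_def)
lemma UU_iff: "(\<kappa>, f) \<in> UU \<longleftrightarrow> \<kappa> \<in> Srt \<and> f \<in> G \<kappa>" by (simp add: UU_def)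

lemma elem_map_app:
  assumes X: "elem_map X \<phi>" "(\<kappa>, sec_one) \<in> X" "(\<kappa>, f) \<in> X"
  shows "rel_in N (Tr \<kappa> f) (\<phi> (\<kappa>, sec_one)) c \<longleftrightarrow> c = \<phi> (\<kappa>, f)" "translate (\<phi> (\<kappa>, sec_one)) \<kappa> f = \<phi> (\<kappa>, f)"
proof -
  have \<kappa>: "\<kappa> \<in> Srt" "f \<in> G \<kappa>" using elem_map_UU[OF X(1)] X(3) by (auto simp: UU_iff)
  note y = Tr_SYM[OF \<kappa>]
  have 1: "rel_in N (Tr \<kappa> f) (\<phi> (\<kappa>, sec_one)) (\<phi> (\<kappa>, f))"
    using elem_map_rel[OF X(1) y X(2,3)] by simp
  have 2: "c = \<phi> (\<kappa>, f)" if c: "rel_in N (Tr \<kappa> f) (\<phi> (\<kappa>, sec_one)) c" for c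
  proof -
    have cU: "c \<in> NU" using rel_in_UN[OF y c] by simp
    obtain u u' where u: "u \<in> UU" "\<And>x. x \<in> X \<Longrightarrow> \<phi> x = c \<longleftrightarrow> x = u"
      "\<And>x y. x \<in> X \<Longrightarrow> y \<in> SYM \<Longrightarrow> rel s0 y x u \<longleftrightarrow> rel_in N y (\<phi> x) c"
      by (rule elem_map_back[OF X(1) cU cU]) blast
    have "rel s0 (Tr \<kappa> f) (\<kappa>, sec_one) u" using u(3)[OF X(2) y] c by simp
    then have "u = (\<kappa>, f)" by (cases u) simp
    then show ?thesis using u(2)[OF X(3)] by simp
  qed
  show "rel_in N (Tr \<kappa> f) (\<phi> (\<kappa>, sec_one)) c \<longleftrightarrow> c = \<phi> (\<kappa>, f)" using 1 2 by blast
  show "translate (\<phi> (\<kappa>, sec_one)) \<kappa> f = \<phi> (\<kappa>, f)" unfolding translate_def using 1 2 by (rule the_equality)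
qed

definition in_sort where "in_sort \<kappa> b \<longleftrightarrow> \<kappa> \<in> Srt \<and> rel_in N (Tr \<kappa> sec_one) b b"

lemma in_sort_ex: assumes "b \<in> NU" obtains \<kappa> where "\<kappa> \<in> Srt" "in_sort \<kappa> b" "\<And>\<mu>. in_sort \<mu> b \<Longrightarrow> \<mu> = \<kappa>"
proof -
  obtain u u' where u: "u \<in> UU" "u' \<in> UU" "b = b \<longleftrightarrow> u = u'"
    "\<And>y. y \<in> SYM \<Longrightarrow> rel s0 y u u' \<longleftrightarrow> rel_in N y b b"
    by (rule elem_map_back[OF elem_map_empty[of undefined] assms assms]) blast
  obtain \<kappa> f where k: "u = (\<kappa>, f)" "\<kappa> \<in> Srt" using u(1) by (auto simp: UU_def)
  have "rel_in N (Tr \<mu> sec_one) b b \<longleftrightarrow> \<mu> = \<kappa>" if "\<mu> \<in> Srt" for \<mu>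
    using u(4)[OF Tr_SYM[OF that G_one[OF that]]] u(3) k by auto
  then show ?thesis using that[of \<kappa>] k(2) by (auto simp: in_sort_def)
qed

lemma in_sort_rel:
  assumes y: "y \<in> SYM" and b: "rel_in N y b c"
  shows "case y of Tr \<kappa> f \<Rightarrow> in_sort \<kappa> b \<and> in_sort \<kappa> c | Ln l \<Rightarrow> in_sort (src l) b \<and> in_sort (tgt l) c"
proof -
  have U: "b \<in> NU" "c \<in> NU" using rel_in_UN[OF y b] by auto
  obtain u u' where u: "u \<in> UU" "u' \<in> UU" 
    "\<And>y. y \<in> SYM \<Longrightarrow> rel s0 y u u' \<longleftrightarrow> rel_in N y b c"
    "\<And>y. y \<in> SYM \<Longrightarrow> rel s0 y u u \<longleftrightarrow> rel_in N y b b"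
    "\<And>y. y \<in> SYM \<Longrightarrow> rel s0 y u' u' \<longleftrightarrow> rel_in N y c c"
    by (rule elem_map_back[OF elem_map_empty[of undefined] U]) blast
  have r: "rel s0 y u u'" using u(3)[OF y] b by simp
  have "in_sort (fst u) b" using u(4)[OF Tr_SYM[OF _ G_one], of "fst u"] u(1) by (auto simp: in_sort_def UU_def)
  moreover have "in_sort (fst u') c" using u(5)[OF Tr_SYM[OF _ G_one], of "fst u'"] u(2)
    by (auto simp: in_sort_def UU_def)
  ultimately show ?thesis using r by (cases y) auto
qed

text \<open>A frame consists of base points for fewer than \<open>lam\<close> sorts that together have the
  type of the identity sections. It identifies these sorts with groups of sections and respects
  all links among them.\<close>

definition frame where "frame D y \<longleftrightarrow> D \<subseteq> Srt \<and> elem_map ((\<lambda>\<kappa>. (\<kappa>, sec_one)) ` D) (\<lambda>u. y (fst u))"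

lemma frame_Srt: "frame D y \<Longrightarrow> \<kappa> \<in> D \<Longrightarrow> \<kappa> \<in> Srt" by (auto simp: frame_def)

lemma frame_with:
  assumes D: "frame D y" and Z: "Z \<subseteq> UU" "finite Z" "fst ` Z \<subseteq> D"
  obtains \<psi> where "elem_map ((\<lambda>\<kappa>. (\<kappa>, sec_one)) ` D \<union> Z) \<psi>" "\<And>\<kappa>. \<kappa> \<in> D \<Longrightarrow> \<psi> (\<kappa>, sec_one) = y \<kappa>"
    "\<And>\<kappa> f. (\<kappa>, f) \<in> Z \<Longrightarrow> \<psi> (\<kappa>, f) = translate (y \<kappa>) \<kappa> f"
proof -
  obtain \<psi> where p: "elem_map ((\<lambda>\<kappa>. (\<kappa>, sec_one)) ` D \<union> Z) \<psi>" "\<And>x. x \<in> (\<lambda>\<kappa>. (\<kappa>, sec_one)) ` D \<Longrightarrow> \<psi> x = y (fst x)"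
  proof -
    have e: "elem_map ((\<lambda>\<kappa>. (\<kappa>, sec_one)) ` D) (\<lambda>u. y (fst u))" using D by (simp add: frame_def)
    show ?thesis by (rule elem_map_ext[OF e Z(1) tiny_finite[OF Z(2)]]) (rule that)
  qed
  have y: "\<psi> (\<kappa>, sec_one) = y \<kappa>" if "\<kappa> \<in> D" for \<kappa> using p(2)[of "(\<kappa>, sec_one)"] that by simp
  show ?thesis
  proof (rule that[OF p(1) y])
    show "\<psi> (\<kappa>, f) = translate (y \<kappa>) \<kappa> f" if "(\<kappa>, f) \<in> Z" for \<kappa> f
    proof -
      have k: "\<kappa> \<in> D" using Z(3) that by force
      then show ?thesis using elem_map_app(2)[OF p(1), of \<kappa> f] y[OF k] that by simp
    qed
  qed
qed

lemma frame_rel: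
  assumes D: "frame D y" and k: "\<kappa> \<in> D" "\<mu> \<in> D" "f \<in> G \<kappa>" "g \<in> G \<mu>"
  shows "z \<in> SYM \<Longrightarrow> rel_in N z (translate (y \<kappa>) \<kappa> f) (translate (y \<mu>) \<mu> g) \<longleftrightarrow> rel s0 z (\<kappa>, f) (\<mu>, g)"
    and "translate (y \<kappa>) \<kappa> f = translate (y \<mu>) \<mu> g \<longleftrightarrow> (\<kappa>, f) = (\<mu>, g)"
    and "translate (y \<kappa>) \<kappa> f \<in> NU"
proof -
  have Z: "{(\<kappa>, f), (\<mu>, g)} \<subseteq> UU" "finite {(\<kappa>, f), (\<mu>, g)}" "fst ` {(\<kappa>, f), (\<mu>, g)} \<subseteq> D"
    using k frame_Srt[OF D] by (auto simp: UU_iff)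
  obtain \<psi> where p: "elem_map ((\<lambda>\<kappa>. (\<kappa>, sec_one)) ` D \<union> {(\<kappa>, f), (\<mu>, g)}) \<psi>"
    "\<And>\<nu> h. (\<nu>, h) \<in> {(\<kappa>, f), (\<mu>, g)} \<Longrightarrow> \<psi> (\<nu>, h) = translate (y \<nu>) \<nu> h"
    by (rule frame_with[OF D Z]) blast
  have e: "\<psi> (\<kappa>, f) = translate (y \<kappa>) \<kappa> f" "\<psi> (\<mu>, g) = translate (y \<mu>) \<mu> g" using p(2) by simp_all
  show "rel_in N z (translate (y \<kappa>) \<kappa> f) (translate (y \<mu>) \<mu> g) \<longleftrightarrow> rel s0 z (\<kappa>, f) (\<mu>, g)" if "z \<in> SYM"
    using elem_map_rel[OF p(1) that, of "(\<kappa>, f)" "(\<mu>, g)"] e by simp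
  show "translate (y \<kappa>) \<kappa> f = translate (y \<mu>) \<mu> g \<longleftrightarrow> (\<kappa>, f) = (\<mu>, g)"
    using elem_map_inj[OF p(1), of "(\<kappa>, f)" "(\<mu>, g)"] e by simp
  show "translate (y \<kappa>) \<kappa> f \<in> NU" using elem_map_UN[OF p(1), of "(\<kappa>, f)"] e by simp
qed

lemma frame_one:
  assumes D: "frame D y" "\<kappa> \<in> D" shows "translate (y \<kappa>) \<kappa> sec_one = y \<kappa>"
proof -
  have e: "elem_map ((\<lambda>\<kappa>. (\<kappa>, sec_one)) ` D) (\<lambda>u. y (fst u))" using D(1) by (simp add: frame_def)
  show ?thesis using elem_map_app(2)[OF e, of \<kappa> sec_one] D(2) by simp
qed

lemma frame_app_uniq:
  assumes D: "frame D y" and k: "\<kappa> \<in> D" "f \<in> G \<kappa>" and c: "rel_in N (Tr \<kappa> f) (y \<kappa>) c"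
  shows "c = translate (y \<kappa>) \<kappa> f"
proof -
  have Z: "{(\<kappa>, f)} \<subseteq> UU" "finite {(\<kappa>, f)}" "fst ` {(\<kappa>, f)} \<subseteq> D"
    using k frame_Srt[OF D] by (auto simp: UU_iff)
  obtain \<psi> where p: "elem_map ((\<lambda>\<kappa>. (\<kappa>, sec_one)) ` D \<union> {(\<kappa>, f)}) \<psi>" "\<And>\<nu>. \<nu> \<in> D \<Longrightarrow> \<psi> (\<nu>, sec_one) = y \<nu>"
    "\<And>\<nu> h. (\<nu>, h) \<in> {(\<kappa>, f)} \<Longrightarrow> \<psi> (\<nu>, h) = translate (y \<nu>) \<nu> h"
    by (rule frame_with[OF D Z]) blast
  show ?thesis using elem_map_app(1)[OF p(1), of \<kappa> f c] p(2)[OF k(1)] p(3)[of \<kappa> f] c k(1) by simp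
qed

lemma frame_inS: assumes D: "frame D y" and k: "\<kappa> \<in> D" "f \<in> G \<kappa>" shows "in_sort \<kappa> (translate (y \<kappa>) \<kappa> f)"
  using frame_rel(1)[OF D k(1,1,2,2) Tr_SYM[OF frame_Srt[OF D k(1)] G_one[OF frame_Srt[OF D k(1)]]]]
    frame_Srt[OF D k(1)] by (simp add: in_sort_def)

lemma frame_all:
  assumes D: "frame D y" and k: "\<kappa> \<in> D" and b: "in_sort \<kappa> b"
  obtains f where "f \<in> G \<kappa>" "b = translate (y \<kappa>) \<kappa> f"
proof -
  have kS: "\<kappa> \<in> Srt" using frame_Srt[OF D k] .
  have bU: "b \<in> NU" using rel_in_UN[OF Tr_SYM[OF kS G_one[OF kS]]] b by (auto simp: in_sort_def)
  have e: "elem_map ((\<lambda>\<kappa>. (\<kappa>, sec_one)) ` D) (\<lambda>u. y (fst u))" using D by (simp add: frame_def)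
  obtain u u' where u: "u \<in> UU" "u' \<in> UU" "b = b \<longleftrightarrow> u = u'"
    "\<And>z. z \<in> SYM \<Longrightarrow> rel s0 z u u \<longleftrightarrow> rel_in N z b b"
    "\<And>x z. x \<in> (\<lambda>\<kappa>. (\<kappa>, sec_one)) ` D \<Longrightarrow> z \<in> SYM \<Longrightarrow> rel s0 z x u \<longleftrightarrow> rel_in N z (y (fst x)) b"
    by (rule elem_map_back[OF e bU bU]) blast
  have "rel s0 (Tr \<kappa> sec_one) u u" using u(4)[OF Tr_SYM[OF kS G_one[OF kS]]] b by (simp add: in_sort_def)
  then obtain f where f: "u = (\<kappa>, f)" "f \<in> G \<kappa>" using u(1) by (cases u) (auto simp: UU_iff)
  have "rel_in N (Tr \<kappa> f) (y \<kappa>) b" using u(5)[of "(\<kappa>, sec_one)", OF _ Tr_SYM[OF kS f(2)]] k f(1) by simp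
  then show ?thesis using frame_app_uniq[OF D k f(2)] f(2) that by blast
qed

lemma frame_ext:
  assumes D: "frame D y" and D': "D' \<subseteq> Srt" "tiny D'"
  obtains y' where "frame (D \<union> D') y'" "\<And>\<kappa>. \<kappa> \<in> D \<Longrightarrow> y' \<kappa> = y \<kappa>"
proof -
  have e: "elem_map ((\<lambda>\<kappa>. (\<kappa>, sec_one)) ` D) (\<lambda>u. y (fst u))" using D by (simp add: frame_def)
  have U: "(\<lambda>\<kappa>. (\<kappa>, sec_one)) ` D' \<subseteq> UU" using D'(1) G_one by (auto simp: UU_iff)
  obtain \<psi> where p: "elem_map ((\<lambda>\<kappa>. (\<kappa>, sec_one)) ` D \<union> (\<lambda>\<kappa>. (\<kappa>, sec_one)) ` D') \<psi>"
    "\<And>x. x \<in> (\<lambda>\<kappa>. (\<kappa>, sec_one)) ` D \<Longrightarrow> \<psi> x = y (fst x)"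
    by (rule elem_map_ext[OF e U tiny_image[OF D'(2)]]) blast
  have "elem_map ((\<lambda>\<kappa>. (\<kappa>, sec_one)) ` (D \<union> D')) (\<lambda>u. \<psi> (fst u, sec_one))"
    using p(1) unfolding elem_map_def image_Un[symmetric] by auto
  then have "frame (D \<union> D') (\<lambda>\<kappa>. \<psi> (\<kappa>, sec_one))" using D D' by (auto simp: frame_def)
  then show ?thesis by (rule that) (simp add: p(2))
qed

lemma frame_mono: assumes "frame D y" "D' \<subseteq> D" shows "frame D' y"
proof -
  obtain d where d: "elem_eq lam voc (mdl s0) N (enc ` (\<lambda>\<kappa>. (\<kappa>, sec_one)) ` D) id d"
     "\<forall>x\<in>(\<lambda>\<kappa>. (\<kappa>, sec_one)) ` D. d (enc x) = y (fst x)"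
    using assms(1) by (auto simp: frame_def elem_map_def)
  have s: "(\<lambda>\<kappa>. (\<kappa>, sec_one)) ` D' \<subseteq> (\<lambda>\<kappa>. (\<kappa>, sec_one :: ('k, 'b, 't) sec)) ` D" using assms(2) by blast
  have "elem_eq lam voc (mdl s0) N (enc ` (\<lambda>\<kappa>. (\<kappa>, sec_one)) ` D') id d"
    by (rule elem_eq_subset[OF d(1) image_mono[OF s]])
  moreover have "(\<lambda>\<kappa>. (\<kappa>, sec_one)) ` D \<subseteq> UU" "tiny ((\<lambda>\<kappa>. (\<kappa>, sec_one :: ('k, 'b, 't) sec)) ` D)" "D \<subseteq> Srt"
    using assms(1) by (simp_all add: frame_def elem_map_def)
  ultimately show ?thesis unfolding frame_def elem_map_def using assms(2) s d(2) tiny_mono[OF s] by blast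
qed

text \<open>Two frames differ, on a common sort, by a multiplication from the left.\<close>

lemma frame_change:
  assumes D: "frame D y" "\<kappa> \<in> D" and D': "frame D' y'" "\<kappa> \<in> D'"
  obtains v where "v \<in> G \<kappa>" "\<And>f. f \<in> G \<kappa> \<Longrightarrow> translate (y' \<kappa>) \<kappa> f = translate (y \<kappa>) \<kappa> (v \<odot> f)" "y' \<kappa> = translate (y \<kappa>) \<kappa> v"
proof -
  have kS: "\<kappa> \<in> Srt" using frame_Srt[OF D] .
  have "in_sort \<kappa> (y' \<kappa>)" using frame_inS[OF D' G_one[OF kS]] frame_one[OF D'] by simp
  then obtain v where v: "v \<in> G \<kappa>" "y' \<kappa> = translate (y \<kappa>) \<kappa> v" by (rule frame_all[OF D])
  show ?thesis
  proof (rule that[OF v(1) _ v(2)])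
    fix f assume f: "f \<in> G \<kappa>"
    have "rel_in N (Tr \<kappa> f) (translate (y \<kappa>) \<kappa> v) (translate (y \<kappa>) \<kappa> (v \<odot> f))"
      using frame_rel(1)[OF D(1) D(2,2) v(1) G_mult[OF kS v(1) f] Tr_SYM[OF kS f]] by simp
    then show "translate (y' \<kappa>) \<kappa> f = translate (y \<kappa>) \<kappa> (v \<odot> f)"
      using frame_app_uniq[OF D' f] v(2) by metis
  qed
qed

lemma frame_empty: "frame {} y" unfolding frame_def using elem_map_empty by simp

end

context hidden_threads
begin

section \<open>Every equivalent model hides a family of threads\<close>

lemma tl_asym: "tl i x y \<Longrightarrow> \<not> tl i y x" using tl_trans tl_irrefl by blast

text \<open>One threshold at \<open>d\<close> serves all conditions indexed by the thresholds of lower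
  rows.\<close>

lemma ev_common_Low:
  assumes d: "d \<in> K" and ev: "\<And>i b. lt i d \<Longrightarrow> b \<in> Th i \<Longrightarrow> ev d (W i b)"
  obtains c where "c \<in> Th d" "\<And>i b. lt i d \<Longrightarrow> b \<in> Th i \<Longrightarrow> W i b c"
proof -
  have "\<exists>a. lt i d \<and> b \<in> Th i \<longrightarrow> a \<in> Th d \<and> (\<forall>x\<in>Th d. \<not> tl d x a \<longrightarrow> W i b x)" for i b
    using ev unfolding ev_def by blast
  then obtain g where g: "\<And>i b. lt i d \<Longrightarrow> b \<in> Th i \<Longrightarrow>
      g i b \<in> Th d \<and> (\<forall>x\<in>Th d. \<not> tl d x (g i b) \<longrightarrow> W i b x)" by metis
  have "\<exists>c\<in>Th d. \<forall>i b. lt i d \<longrightarrow> b \<in> Th i \<longrightarrow> tl d (g i b) c"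
    by (rule Th_bd_Low[OF d]) (simp add: g)
  then obtain c where c: "c \<in> Th d" "\<forall>i b. lt i d \<longrightarrow> b \<in> Th i \<longrightarrow> tl d (g i b) c" ..
  show ?thesis by (rule that[OF c(1)]) (use c g tl_asym in simp)
qed

lemma ev_common_K:
  assumes i: "i \<in> K" and ev: "\<And>d. d \<in> K \<Longrightarrow> ev i (W d)"
  obtains b where "b \<in> Th i" "\<And>d. d \<in> K \<Longrightarrow> W d b"
proof -
  have "\<exists>a. d \<in> K \<longrightarrow> a \<in> Th i \<and> (\<forall>x\<in>Th i. \<not> tl i x a \<longrightarrow> W d x)" for d
    using ev unfolding ev_def by blast
  then obtain g where g: "\<And>d. d \<in> K \<Longrightarrow> g d \<in> Th i \<and> (\<forall>x\<in>Th i. \<not> tl i x (g d) \<longrightarrow> W d x)" by metis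
  have "\<exists>b\<in>Th i. \<forall>d\<in>K. tl i (g d) b" by (rule Th_bd_K[OF i]) (simp add: g)
  then obtain b where b: "b \<in> Th i" "\<forall>d\<in>K. tl i (g d) b" ..
  show ?thesis by (rule that[OF b(1)]) (use b g tl_asym in simp)
qed

definition sorts_upto where "sorts_upto m = {\<kappa> \<in> Srt. (case \<kappa> of Q j \<Rightarrow> True | _ \<Rightarrow> le (level \<kappa>) m)}"

lemma sorts_upto_simps [simp]:
  "Q j \<in> sorts_upto m \<longleftrightarrow> j \<in> K" "R i b j \<in> sorts_upto m \<longleftrightarrow> R i b j \<in> Srt \<and> le i m"
  "E i b d j \<in> sorts_upto m \<longleftrightarrow> E i b d j \<in> Srt \<and> le d m" "C d c j \<in> sorts_upto m \<longleftrightarrow> C d c j \<in> Srt \<and> le d m"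
  by (auto simp: sorts_upto_def)

lemma sorts_upto_Srt: "sorts_upto m \<subseteq> Srt" by (auto simp: sorts_upto_def)

lemma sorts_upto_mono: assumes "le m n" shows "sorts_upto m \<subseteq> sorts_upto n"
proof
  fix \<kappa> assume "\<kappa> \<in> sorts_upto m"
  then show "\<kappa> \<in> sorts_upto n" using assms le_trans by (cases \<kappa>) auto
qed

lemma sorts_upto_tiny: assumes m: "m \<in> K" shows "tiny (sorts_upto m)"
proof -
  define L where "L = {i. le i m}"
  have "L = {i. lt i m} \<union> {m}" using m by (auto simp: L_def le_iff)
  then have L: "|L| <o |K|" using K_ordLess_Un[OF kap_underS[OF m] K_finite[of "{m}"]] by simp
  have "tiny (\<Union>i\<in>L. {i} \<times> Th i)"
    by (rule tiny_UN[OF L], rule tiny_Times[OF tiny_finite Th_tiny]) (auto simp: L_def le_def)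
  then have low: "tiny (Sigma L Th)" by (simp add: Sigma_def)
  let ?S = "Q ` K \<union> (\<lambda>((i, b), j). R i b j) ` (Sigma L Th \<times> K) \<union>
      (\<lambda>((i, b), d, j). E i b d j) ` (Sigma L Th \<times> K \<times> K) \<union> (\<lambda>((d, c), j). C d c j) ` (Sigma L Th \<times> K)"
  have "sorts_upto m \<subseteq> ?S"
  proof
    fix s assume s: "s \<in> sorts_upto m"
    show "s \<in> ?S"
    proof (cases s)
      case (R i b j)
      have *: "((i, b), j) \<in> Sigma L Th \<times> K" using s R by (simp add: L_def)
      have "s \<in> (\<lambda>((i, b), j). R i b j) ` (Sigma L Th \<times> K)" by (rule image_eqI[OF _ *]) (simp add: R)
      then show ?thesis by (simp only: Un_iff simp_thms)
    next
      case (E i b d j)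
      have I: "(i, d) \<in> Ind" "le d m" using s E by auto
      then have "le i m" using Ind_D[OF I(1)] lt_le le_trans by blast
      then have *: "((i, b), d, j) \<in> Sigma L Th \<times> K \<times> K" using s E Ind_D[OF I(1)] by (simp add: L_def)
      have "s \<in> (\<lambda>((i, b), d, j). E i b d j) ` (Sigma L Th \<times> K \<times> K)" by (rule image_eqI[OF _ *]) (simp add: E)
      then show ?thesis by (simp only: Un_iff simp_thms)
    next
      case (C d c j)
      have *: "((d, c), j) \<in> Sigma L Th \<times> K" using s C by (simp add: L_def)
      have "s \<in> (\<lambda>((d, c), j). C d c j) ` (Sigma L Th \<times> K)" by (rule image_eqI[OF _ *]) (simp add: C)
      then show ?thesis by (simp only: Un_iff simp_thms)
    qed (use s in auto)
  qed
  then show ?thesis by (rule tiny_mono) (intro tiny_Un tiny_image tiny_Times low tiny_K)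
qed

end

context equivalent
begin

text \<open>A frame covers fewer than \<open>lam\<close> sorts, but there are frames for all sorts up to a
  given level, and they can be chosen to agree on the sorts \<open>Q\<close>.\<close>

lemma levels:
  obtains y where "\<And>m. m \<in> K \<Longrightarrow> frame (sorts_upto m) (y m)" "\<And>m n j. m \<in> K \<Longrightarrow> n \<in> K \<Longrightarrow> j \<in> K \<Longrightarrow> y m (Q j) = y n (Q j)"
proof -
  have Q: "Q ` K \<subseteq> Srt" "tiny (Q ` K)" using tiny_image[OF tiny_K] by auto
  obtain y0 where "frame ({} \<union> Q ` K) y0" by (rule frame_ext[OF frame_empty Q])
  then have y0: "frame (Q ` K) y0" by simp
  have "\<exists>y. frame (sorts_upto m) y \<and> (\<forall>j\<in>K. y (Q j) = y0 (Q j))" if m: "m \<in> K" for m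
  proof -
    obtain y where "frame (Q ` K \<union> sorts_upto m) y" "\<And>\<kappa>. \<kappa> \<in> Q ` K \<Longrightarrow> y \<kappa> = y0 \<kappa>"
      by (rule frame_ext[OF y0 sorts_upto_Srt sorts_upto_tiny[OF m]]) blast
    then show ?thesis using frame_mono[of "Q ` K \<union> sorts_upto m" y "sorts_upto m"] by (intro exI[of _ y]) auto
  qed
  then obtain y where "\<And>m. m \<in> K \<Longrightarrow> frame (sorts_upto m) (y m) \<and> (\<forall>j\<in>K. y m (Q j) = y0 (Q j))" by metis
  then show ?thesis using that[of y] by simp
qed

lemma link_pull:
  assumes D: "frame D y" and l: "l \<in> Lnk" "src l \<in> D" "tgt l \<in> D" and a: "a \<in> G (src l)" "b \<in> G (tgt l)"
  shows "rel_in N (Ln l) (translate (y (src l)) (src l) a) (translate (y (tgt l)) (tgt l) b) \<longleftrightarrow> holds s0 l a b"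
  using frame_rel(1)[OF D l(2,3) a Ln_SYM[OF l(1)]] by simp

lemma link_pull_one:
  assumes D: "frame D y" and l: "l \<in> Lnk" "src l \<in> D" "tgt l \<in> D" and H: "holds s0 l sec_one sec_one"
  shows "rel_in N (Ln l) (y (src l)) (y (tgt l))"
  using link_pull[OF D l G_one G_one] frame_one[OF D l(2)] frame_one[OF D l(3)] frame_Srt[OF D l(2)] frame_Srt[OF D l(3)] H
  by simp

lemma link_change:
  assumes D: "frame D y" and D': "frame D y'" and l: "l \<in> Lnk" "src l \<in> D" "tgt l \<in> D" and H: "holds s0 l sec_one sec_one"
    and a: "a \<in> G (src l)" "y' (src l) = translate (y (src l)) (src l) a"
    and b: "b \<in> G (tgt l)" "y' (tgt l) = translate (y (tgt l)) (tgt l) b"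
  shows "holds s0 l a b"
  using link_pull_one[OF D' l H] link_pull[OF D l a(1) b(1)] a(2) b(2) by simp

text \<open>The frame \<open>y i\<close> gives base points for the rows \<open>i\<close>, and \<open>y
  d\<close>, corrected by \<open>aa\<close>, for the columns at \<open>d\<close>. The correction
  \<open>vv\<close> compares the row base points of \<open>y i\<close> and \<open>y d\<close> at
  the place \<open>(i, d)\<close>. With these base points all links except the marker hold as in
  the structures. The marker holds for the family \<open>s\<close> that is obtained from the
  base thread by inverting the limits of the corrections. The limits exist because the
  corrections have finitely many steps: \<open>vv\<close> coincides with the entries of a
  column, at a threshold chosen after all thresholds of the rows.\<close>

theorem classification:
  obtains s where "\<And>i d. (i, d) \<in> Ind \<Longrightarrow> thr (s i d)" "isomorphic voc (mdl s) N"
proof -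
  obtain y where y: "\<And>m. m \<in> K \<Longrightarrow> frame (sorts_upto m) (y m)"
    "\<And>m n j. m \<in> K \<Longrightarrow> n \<in> K \<Longrightarrow> j \<in> K \<Longrightarrow> y m (Q j) = y n (Q j)" by (rule levels) blast
  have vex: "\<exists>v. v \<in> G (R i b j) \<and>
      (\<forall>f\<in>G (R i b j). translate (y i (R i b j)) (R i b j) f = translate (y d (R i b j)) (R i b j) (v \<odot> f)) \<and>
      y i (R i b j) = translate (y d (R i b j)) (R i b j) v" if "(i, d) \<in> Ind" "b \<in> Th i" "j \<in> K" for i d b j
  proof -
    have id: "i \<in> K" "d \<in> K" "lt i d" using that Ind_D by auto
    have m: "R i b j \<in> sorts_upto i" "R i b j \<in> sorts_upto d" using that id lt_le le_refl by simp_all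
    obtain v where "v \<in> G (R i b j)"
        "\<And>f. f \<in> G (R i b j) \<Longrightarrow> translate (y i (R i b j)) (R i b j) f = translate (y d (R i b j)) (R i b j) (v \<odot> f)"
        "y i (R i b j) = translate (y d (R i b j)) (R i b j) v"
      by (rule frame_change[OF y(1)[OF id(2)] m(2) y(1)[OF id(1)] m(1)]) (rule that)
    then show ?thesis by blast
  qed
  define v where "v i d b j = (SOME v. v \<in> G (R i b j) \<and>
      (\<forall>f\<in>G (R i b j). translate (y i (R i b j)) (R i b j) f = translate (y d (R i b j)) (R i b j) (v \<odot> f)) \<and>
      y i (R i b j) = translate (y d (R i b j)) (R i b j) v)" for i d b j
  have v: "v i d b j \<in> G (R i b j)"
    "f \<in> G (R i b j) \<Longrightarrow> translate (y i (R i b j)) (R i b j) f = translate (y d (R i b j)) (R i b j) (v i d b j \<odot> f)"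
    "y i (R i b j) = translate (y d (R i b j)) (R i b j) (v i d b j)"
    if "(i, d) \<in> Ind" "b \<in> Th i" "j \<in> K" for i d b j f
    using someI_ex[OF vex[OF that]] unfolding v_def[symmetric] by blast+
  define vv where "vv i b d j = v i d b j (P i d)" for i b d j
  have vvA: "vv i b d j \<in> A j" if "(i, d) \<in> Ind" "b \<in> Th i" "j \<in> K" for i b d j
    using G_A[OF _ v(1)[OF that]] that Ind_D[OF that(1)] by (simp add: vv_def)
  \<comment> \<open>The frame \<open>y i\<close> is prolonged to level \<open>d\<close>. Its prolongation \<open>y'\<close> differs from \<open>y d\<close> by sections \<open>a\<close>, which satisfy the links, so rows can be read off from a column.\<close>
  have FSvv: "FS i (\<lambda>b. vv i b d j)" if I: "(i, d) \<in> Ind" and j: "j \<in> K" for i d j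
  proof -
    have id: "i \<in> K" "d \<in> K" "lt i d" "d \<in> Lim" using Ind_D[OF I] by auto
    have "sorts_upto i \<subseteq> sorts_upto d" by (rule sorts_upto_mono[OF lt_le[OF id(3)]])
    then have un: "sorts_upto i \<union> sorts_upto d = sorts_upto d" by blast
    obtain y' where y': "frame (sorts_upto d) y'" "\<And>\<kappa>. \<kappa> \<in> sorts_upto i \<Longrightarrow> y' \<kappa> = y i \<kappa>"
      using frame_ext[OF y(1)[OF id(1)] sorts_upto_Srt sorts_upto_tiny[OF id(2)], unfolded un] by blast
    have aex: "\<exists>a. a \<in> G \<kappa> \<and> (\<forall>f\<in>G \<kappa>. translate (y d \<kappa>) \<kappa> f = translate (y' \<kappa>) \<kappa> (a \<odot> f)) \<and>
        y d \<kappa> = translate (y' \<kappa>) \<kappa> a" if True: "\<kappa> \<in> sorts_upto d" for \<kappa>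
    proof -
      obtain a where "a \<in> G \<kappa>" "\<And>f. f \<in> G \<kappa> \<Longrightarrow> translate (y d \<kappa>) \<kappa> f = translate (y' \<kappa>) \<kappa> (a \<odot> f)"
        "y d \<kappa> = translate (y' \<kappa>) \<kappa> a"
        by (rule frame_change[OF y'(1) True y(1)[OF id(2)] True]) (rule that)
      then show ?thesis by blast
    qed
    define a where "a \<kappa> = (SOME a. a \<in> G \<kappa> \<and> (\<forall>f\<in>G \<kappa>. translate (y d \<kappa>) \<kappa> f = translate (y' \<kappa>) \<kappa> (a \<odot> f)) \<and>
        y d \<kappa> = translate (y' \<kappa>) \<kappa> a)" for \<kappa>
    have a: "a \<kappa> \<in> G \<kappa>" "f \<in> G \<kappa> \<Longrightarrow> translate (y d \<kappa>) \<kappa> f = translate (y' \<kappa>) \<kappa> (a \<kappa> \<odot> f)"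
      "y d \<kappa> = translate (y' \<kappa>) \<kappa> (a \<kappa>)" if "\<kappa> \<in> sorts_upto d" for \<kappa> f
      using someI_ex[OF aex[OF that]] unfolding a_def[symmetric] by blast+
    have mem: "R i b j \<in> sorts_upto d" "R i b j \<in> sorts_upto i" "E i b d j \<in> sorts_upto d" if "b \<in> Th i" for b
      using that I j id lt_le le_refl by auto
    have memC: "C d c j \<in> sorts_upto d" if "c \<in> Th d" for c using that j id le_refl by simp
    have li: "ev d (\<lambda>c. a (E i b d j) (B d c) = a (R i b j) (P i d))" if b: "b \<in> Th i" for b
    proof -
      have l: "Li i b d j \<in> Lnk" using mem[OF b] sorts_upto_Srt by (auto simp: Lnk_def)
      have "holds s0 (Li i b d j) (a (E i b d j)) (a (R i b j))"
        using link_change[OF y'(1) y(1)[OF id(2)] l] mem[OF b] a(1,3)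
        by (simp add: sec_one_def ev_true[OF id(2)])
      then show ?thesis by simp
    qed
    have ev: "ev d (if i' = i then (\<lambda>c. a (E i b d j) (B d c) = a (R i b j) (P i d)) else (\<lambda>_. True))"
      if "b \<in> Th i'" for i' b
    proof (cases "i' = i")
      case True
      then show ?thesis using li[of b] that by simp
    next
      case False
      then show ?thesis using ev_true[OF id(2), of "\<lambda>_. True"] by simp
    qed
    obtain c where c: "c \<in> Th d" "\<And>b. b \<in> Th i \<Longrightarrow> a (E i b d j) (B d c) = a (R i b j) (P i d)"
    proof -
      obtain c where c: "c \<in> Th d" "\<And>i' b. lt i' d \<Longrightarrow> b \<in> Th i' \<Longrightarrow>
          (if i' = i then (\<lambda>c. a (E i b d j) (B d c) = a (R i b j) (P i d)) else (\<lambda>_. True)) c"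
        by (rule ev_common_Low[OF id(2) ev]) (assumption+, rule that)
      show ?thesis by (rule that[OF c(1)]) (use c(2)[OF id(3)] in simp)
    qed
    have col: "a (R i b j) (P i d) = a (C d c j) (B i b)" if b: "b \<in> Th i" for b
    proof -
      have l: "Xx i b d c j \<in> Lnk" using mem[OF b] memC[OF c(1)] sorts_upto_Srt by (auto simp: Lnk_def)
      have "holds s0 (Xx i b d c j) (a (E i b d j)) (a (C d c j))"
        using link_change[OF y'(1) y(1)[OF id(2)] l] mem[OF b] memC[OF c(1)] a(1,3)
        by (simp add: sec_one_def)
      then show ?thesis using c(2)[OF b] by simp
    qed
    have vinv: "vv i b d j = inv (a (C d c j) (B i b))" if b: "b \<in> Th i" for b
    proof -
      let ?r = "R i b j"
      have rS: "?r \<in> Srt" using mem[OF b] sorts_upto_Srt by blast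
      have aG: "a ?r \<in> G ?r" using a(1) mem[OF b] by simp
      have vG: "v i d b j \<in> G ?r" by (rule v(1)[OF I b j])
      have "translate (y' ?r) ?r sec_one = y i ?r" using frame_one[OF y'(1) mem(1)[OF b]] y'(2)[OF mem(2)[OF b]] by simp
      also have "\<dots> = translate (y' ?r) ?r (a ?r \<odot> v i d b j)"
        using v(3)[OF I b j] a(2)[OF mem(1)[OF b] vG] by simp
      finally have "(?r, sec_one) = (?r, a ?r \<odot> v i d b j)"
        using frame_rel(2)[OF y'(1) mem(1)[OF b] mem(1)[OF b] G_one[OF rS] G_mult[OF rS aG vG]] by blast
      then have "a ?r \<odot> v i d b j = sec_one" by simp
      then have "v i d b j = sec_inv (a ?r)" using sec_inv_left[OF rS aG] by (metis sec_mult_assoc sec_mult_one)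
      then show ?thesis using col[OF b] by (simp add: vv_def sec_inv_def)
    qed
    have "FS i (\<lambda>b. a (C d c j) (B i b))" using a(1)[OF memC[OF c(1)]] id(1) by (simp add: G_def FSall_def)
    then show ?thesis by (rule FS_cong[OF FS_map[where h = inv]]) (simp add: vinv)
  qed
  have "\<exists>p. (i, d) \<in> Ind \<and> j \<in> K \<longrightarrow> p \<in> A j \<and> ev i (\<lambda>b. vv i b d j = p)" for i d j
  proof (cases "(i, d) \<in> Ind \<and> j \<in> K")
    case True
    then have i: "i \<in> K" using Ind_D by blast
    obtain p where "ev i (\<lambda>b. vv i b d j = p)" "\<exists>b\<in>Th i. p = vv i b d j"
      by (rule FS_limit[OF i FSvv]) (use True in auto)
    then show ?thesis using vvA True by blast
  qed blast
  then obtain p where p: "\<And>i d j. (i, d) \<in> Ind \<Longrightarrow> j \<in> K \<Longrightarrow> p i d j \<in> A j"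
    "\<And>i d j. (i, d) \<in> Ind \<Longrightarrow> j \<in> K \<Longrightarrow> ev i (\<lambda>b. vv i b d j = p i d j)" by metis
  define s where "s i d j = inv (p i d j) (oo j)" for i d j
  have ps: "p i d j (s i d j) = oo j" if "(i, d) \<in> Ind" "j \<in> K" for i d j
    using A_bij[OF that(2) p(1)[OF that]] by (simp add: s_def bij_is_surj surj_f_inv_f)
  have vPr: "pr j j' (vv i b d j t) = vv i b d j' (pr j j' t)"
    if I: "(i, d) \<in> Ind" and b: "b \<in> Th i" and j: "le j' j" and t: "t \<in> T j" for i d b j j' t
  proof -
    have id: "i \<in> K" "d \<in> K" "lt i d" "j \<in> K" "j' \<in> K" using Ind_D[OF I] le_K[OF j] by auto
    have mem: "R i b j'' \<in> sorts_upto i \<and> R i b j'' \<in> sorts_upto d" if "j'' \<in> K" for j''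
      using that b id lt_le le_refl by simp
    have l: "Pr i b d j j' \<in> Lnk" using id b I j by (simp add: Lnk_def)
    have "rel_in N (Ln (Pr i b d j j')) (y i (R i b j)) (y i (R i b j'))"
      using link_pull_one[OF y(1)[OF id(1)] l] mem id by (simp add: sec_one_def)
    then have "holds s0 (Pr i b d j j') (v i d b j) (v i d b j')"
      using link_pull[OF y(1)[OF id(2)] l, of "v i d b j" "v i d b j'"] mem id v(1,3)[OF I b] by simp
    then show ?thesis using t by (simp add: vv_def)
  qed
  have thr_s: "thr (s i d)" if I: "(i, d) \<in> Ind" for i d
  proof -
    have T: "s i d j \<in> T j" if "j \<in> K" for j
      using A_T[OF that A_inv[OF that p(1)[OF I that]] oo_T[OF that]] by (simp add: s_def)
    have "pr j j' (s i d j) = s i d j'" if j: "le j' j" for j j'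
    proof -
      have K: "j \<in> K" "j' \<in> K" using le_K[OF j] by auto
      obtain b where b: "b \<in> Th i" "vv i b d j = p i d j \<and> vv i b d j' = p i d j'"
        by (rule ev_ex[OF ev_conj[OF p(2)[OF I K(1)] p(2)[OF I K(2)]]]) blast
      have "p i d j' (pr j j' (s i d j)) = p i d j' (s i d j')"
        using vPr[OF I b(1) j T[OF K(1)]] b(2) ps[OF I] K oo_pr[OF j] by simp
      moreover have "inj (p i d j')" using A_bij[OF K(2) p(1)[OF I K(2)]] bij_is_inj by blast
      ultimately show ?thesis by (rule injD[rotated])
    qed
    then show ?thesis using T by (simp add: thr_def)
  qed
  let ?i1 = "\<lambda>_ _ _. id :: 't \<Rightarrow> 't" and ?i2 = "\<lambda>_ _ _ _. id :: 't \<Rightarrow> 't"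
  define V where "V i b d c j = vv i b d j" for i b d and c :: 'b and j
  define aa where "aa = shift ?i1 ?i2 V"
  have aaG: "aa \<kappa> \<in> G \<kappa>" if "\<kappa> \<in> Srt" for \<kappa>
    unfolding aa_def by (rule shift_G_general[OF _ _ _ _ _ that]) (simp_all add: A_id V_def vvA FSvv FS_const)
  have aaQ: "aa (Q j) = sec_one" and aaR: "aa (R i b j) = sec_one" for i b j
    unfolding aa_def sec_one_def by (auto split: crd.split)
  define F where "F = (\<lambda>(\<kappa>, f). translate (y (level \<kappa>) \<kappa>) \<kappa> (aa \<kappa> \<odot> f))"
  have D: "frame (sorts_upto (level \<kappa>)) (y (level \<kappa>))" "\<kappa> \<in> sorts_upto (level \<kappa>)" if "\<kappa> \<in> Srt" for \<kappa>
    using y(1)[OF level_K[OF that]] level_K[OF that] that le_refl by (auto simp: sorts_upto_def split: srt.split)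
  have FinS: "in_sort \<kappa> (F (\<kappa>, f))" and FN: "F (\<kappa>, f) \<in> NU" if "(\<kappa>, f) \<in> UU" for \<kappa> f
  proof -
    have k: "\<kappa> \<in> Srt" "f \<in> G \<kappa>" using that by (auto simp: UU_iff)
    show "in_sort \<kappa> (F (\<kappa>, f))" "F (\<kappa>, f) \<in> NU"
      using frame_inS[OF D[OF k(1)] G_mult[OF k(1) aaG[OF k(1)] k(2)]] k(1)
        rel_in_UN[OF Tr_SYM[OF k(1) G_one[OF k(1)]]] by (auto simp: F_def in_sort_def)
  qed
  have in_sort_uniq: "\<kappa> = \<mu>" if "in_sort \<kappa> b" "in_sort \<mu> b" for \<kappa> \<mu> b
  proof -
    have "b \<in> NU" using that(1) rel_in_UN[OF Tr_SYM[OF _ G_one]] by (auto simp: in_sort_def)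
    then obtain \<nu> where "\<And>\<mu>. in_sort \<mu> b \<Longrightarrow> \<mu> = \<nu>" by (rule in_sort_ex) blast
    then show ?thesis using that by metis
  qed
  have Feq: "F (\<kappa>, f) = F (\<kappa>, g) \<longleftrightarrow> f = g" and FTr: "c \<in> G \<kappa> \<Longrightarrow> rel_in N (Tr \<kappa> c) (F (\<kappa>, f)) (F (\<kappa>, g)) \<longleftrightarrow> g = f \<odot> c"
    if "(\<kappa>, f) \<in> UU" "(\<kappa>, g) \<in> UU" for \<kappa> f g c
  proof -
    have k: "\<kappa> \<in> Srt" "f \<in> G \<kappa>" "g \<in> G \<kappa>" using that by (auto simp: UU_iff)
    note m = G_mult[OF k(1) aaG[OF k(1)] k(2)] G_mult[OF k(1) aaG[OF k(1)] k(3)]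
    show "F (\<kappa>, f) = F (\<kappa>, g) \<longleftrightarrow> f = g"
      using frame_rel(2)[OF D[OF k(1)] D(2)[OF k(1)] m] G_cancel[OF k(1) aaG[OF k(1)]] by (simp add: F_def)
    show "rel_in N (Tr \<kappa> c) (F (\<kappa>, f)) (F (\<kappa>, g)) \<longleftrightarrow> g = f \<odot> c" if "c \<in> G \<kappa>"
      using frame_rel(1)[OF D[OF k(1)] D(2)[OF k(1)] m Tr_SYM[OF k(1) that]] G_cancel[OF k(1) aaG[OF k(1)]]
      by (simp add: F_def sec_mult_assoc)
  qed
  have bij: "bij_betw F UU NU"
  proof (rule bij_betw_imageI)
    show "inj_on F UU"
    proof (rule inj_onI)
      fix u u' assume u: "u \<in> UU" "u' \<in> UU" "F u = F u'"
      obtain \<kappa> f \<mu> g where e: "u = (\<kappa>, f)" "u' = (\<mu>, g)" by (cases u, cases u')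
      have "in_sort \<kappa> (F u)" "in_sort \<mu> (F u)" using FinS[of \<kappa> f] FinS[of \<mu> g] u e by simp_all
      then have "\<kappa> = \<mu>" by (rule in_sort_uniq)
      then show "u = u'" using Feq[of \<kappa> f g] u e by simp
    qed
    show "F ` UU = NU"
    proof (intro equalityI subsetI)
      fix b assume "b \<in> F ` UU"
      then obtain \<kappa> f where "(\<kappa>, f) \<in> UU" "b = F (\<kappa>, f)" by auto
      then show "b \<in> NU" using FN by simp
    next
      fix b assume "b \<in> NU"
      then obtain \<kappa> where k: "\<kappa> \<in> Srt" "in_sort \<kappa> b" by (rule in_sort_ex) blast
      obtain g where g: "g \<in> G \<kappa>" "b = translate (y (level \<kappa>) \<kappa>) \<kappa> g" by (rule frame_all[OF D[OF k(1)] k(2)])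
      have "(\<kappa>, sec_inv (aa \<kappa>) \<odot> g) \<in> UU" using k(1) G_mult[OF k(1) G_siv[OF k(1) aaG[OF k(1)]] g(1)] by (simp add: UU_iff)
      moreover have "F (\<kappa>, sec_inv (aa \<kappa>) \<odot> g) = b"
        using sec_inv_right[OF k(1) aaG[OF k(1)]] g(2) by (simp add: F_def sec_mult_assoc[symmetric])
      ultimately show "b \<in> F ` UU" by (metis imageI)
    qed
  qed
  have FR: "F (R i b j, f) = translate (y d (R i b j)) (R i b j) (v i d b j \<odot> f)"
    if "(i, d) \<in> Ind" "b \<in> Th i" "j \<in> K" "f \<in> G (R i b j)" for i b d j f
    using v(2)[OF that] by (simp add: F_def aaR)
  have link: "holds s l f g \<longleftrightarrow> rel_in N (Ln l) (F (src l, f)) (F (tgt l, g))"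
    if l: "l \<in> Lnk" and f: "f \<in> G (src l)" and g: "g \<in> G (tgt l)" for l f g
  proof -
    have S: "src l \<in> Srt" "tgt l \<in> Srt" using l by (auto simp: Lnk_def)
    have grp: "holds s l f g \<longleftrightarrow> rel_in N (Ln l) (F (src l, f)) (F (tgt l, g))"
      if lp: "link_preserved s s0 l a b" and m: "m \<in> K" "src l \<in> sorts_upto m" "tgt l \<in> sorts_upto m" and a: "a \<in> G (src l)" "b \<in> G (tgt l)"
        and e: "F (src l, f) = translate (y m (src l)) (src l) (a \<odot> f)" "F (tgt l, g) = translate (y m (tgt l)) (tgt l) (b \<odot> g)"
      for a b m
      using link_pull[OF y(1)[OF m(1)] l m(2,3) G_mult[OF S(1) a(1) f] G_mult[OF S(2) a(2) g]] e lp f g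
      by (simp add: link_preserved_def)
    show ?thesis
    proof (cases l)
      case (Ev i b j)
      have k: "i \<in> K" "j \<in> K" "b \<in> Th i" using S Ev by auto
      have "link_preserved s s0 l sec_one sec_one"
        by (rule link_preserved_by_group[OF l _ G_one[OF S(1)] G_one[OF S(2)], of s0]) (use Ev k in auto)
      then show ?thesis
        by (rule grp[OF _ k(1) _ _ G_one[OF S(1)] G_one[OF S(2)]])
          (use Ev k le_refl y(2)[OF k(1) k(2) k(2)] in \<open>simp_all add: F_def aaR aaQ\<close>)
    next
      case (Pr i b d j j')
      have k: "i \<in> K" "j \<in> K" "j' \<in> K" "b \<in> Th i" using S Pr by auto
      have "link_preserved s s0 l sec_one sec_one"
        by (rule link_preserved_by_group[OF l _ G_one[OF S(1)] G_one[OF S(2)], of s0]) (use Pr k in \<open>auto simp: sec_one_def\<close>)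
      then show ?thesis
        by (rule grp[OF _ k(1) _ _ G_one[OF S(1)] G_one[OF S(2)]])
          (use Pr k le_refl in \<open>simp_all add: F_def aaR\<close>)
    next
      case (Li i b d j)
      have k: "(i, d) \<in> Ind" "b \<in> Th i" "j \<in> K" using S Li by auto
      have id: "i \<in> K" "d \<in> K" "lt i d" "le i d" using Ind_D[OF k(1)] lt_le by auto
      have vG: "v i d b j \<in> G (tgt l)" using v(1)[OF k] Li by simp
      have "ev d (\<lambda>c. aa (E i b d j) (B d c) = v i d b j (P i d))"
        by (rule ev_true[OF id(2)]) (simp add: aa_def V_def vv_def)
      then have "link_preserved s s0 l (aa (src l)) (v i d b j)"
        by (intro link_preserved_by_group[OF l _ aaG[OF S(1)] vG, of s0]) (use Li k in auto)
      then show ?thesis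
        by (rule grp[OF _ id(2) _ _ aaG[OF S(1)] vG])
          (use Li k id le_refl FR[OF k] g in \<open>simp_all add: F_def\<close>)
    next
      case (Xx i b d c j)
      have k: "(i, d) \<in> Ind" "b \<in> Th i" "j \<in> K" "d \<in> Lim" "c \<in> Th d" using S Xx by auto
      have id: "i \<in> K" "d \<in> K" "lt i d" "le i d" using Ind_D[OF k(1)] lt_le by auto
      have "link_preserved s s0 l (aa (src l)) (aa (tgt l))"
        by (rule link_preserved_by_group[OF l _ aaG[OF S(1)] aaG[OF S(2)], of s0])
          (use Xx k id in \<open>auto simp: aa_def V_def\<close>)
      then show ?thesis
        by (rule grp[OF _ id(2) _ _ aaG[OF S(1)] aaG[OF S(2)]])
          (use Xx k id le_refl in \<open>simp_all add: F_def\<close>)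
    next
      case (Pu j)
      have k: "j \<in> K" using S Pu by auto
      have "link_preserved s s0 l sec_one sec_one"
        by (rule link_preserved_by_group[OF l _ G_one[OF S(1)] G_one[OF S(2)], of s0])
          (use Pu k UF_all in \<open>auto simp: sec_one_def\<close>)
      then show ?thesis
        by (rule grp[OF _ k _ _ G_one[OF S(1)] G_one[OF S(2)]])
          (use Pu k in \<open>simp_all add: F_def aaQ\<close>)
    next
      case (St d c j)
      have k: "d \<in> Lim" "c \<in> Th d" "j \<in> K" using S St by auto
      have dK: "d \<in> K" using Lim_K[OF k(1)] .
      obtain m where m: "lt m d" using k(1) by (auto simp: Lim_def)
      have S': "C d c j \<in> Srt" using S St by simp
      have "link_preserved s s0 (St d c j) (aa (C d c j)) (aa (C d c j))"
      proof (rule link_preserved_marker[OF S' aaG[OF S'] m])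
        fix i assume i: "\<not> lt i m" "lt i d"
        then have I: "(i, d) \<in> Ind" using k(1) by (simp add: Ind_def)
        show "ev i (\<lambda>b. aa (C d c j) (B i b) (s i d j) = oo j)"
          by (rule ev_mono[OF p(2)[OF I k(3)]]) (simp add: aa_def V_def i ps[OF I k(3)])
      qed
      then have "link_preserved s s0 l (aa (src l)) (aa (tgt l))" using St by simp
      then show ?thesis
        by (rule grp[OF _ dK _ _ aaG[OF S(1)] aaG[OF S(2)]])
          (use St k dK le_refl in \<open>simp_all add: F_def\<close>)
    qed
  qed
  have "isomorphic voc (mdl s) N" unfolding iso_iff
  proof (intro exI[of _ F] conjI bij ballI)
    fix z u u' assume z: "z \<in> SYM" and u: "u \<in> UU" "u' \<in> UU"
    obtain \<kappa> f \<mu> g where e: "u = (\<kappa>, f)" "u' = (\<mu>, g)" by (cases u, cases u')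
    note i = FinS[of \<kappa> f] FinS[of \<mu> g]
    show "rel s z u u' \<longleftrightarrow> rel_in N z (F u) (F u')"
    proof (cases z)
      case (Tr \<nu> c)
      show ?thesis
      proof (cases "\<nu> = \<kappa> \<and> \<nu> = \<mu>")
        case True
        then have k: "\<kappa> = \<nu>" "\<mu> = \<nu>" by auto
        have "c \<in> G \<nu>" using z Tr by (auto simp: SYM_def)
        then show ?thesis using FTr[of \<nu> f g c] u e Tr k by simp
      next
        case False
        then have "\<not> rel_in N z (F u) (F u')" using in_sort_rel[OF z] Tr i u e in_sort_uniq by fastforce
        then show ?thesis using False Tr e by auto
      qed
    next
      case (Ln l)
      show ?thesis
      proof (cases "src l = \<kappa> \<and> tgt l = \<mu>")
        case True
        then show ?thesis using link[of l f g] u e Ln z by (auto simp: SYM_def UU_iff)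
      next
        case False
        then have "\<not> rel_in N z (F u) (F u')" using in_sort_rel[OF z] Ln i u e in_sort_uniq by fastforce
        then show ?thesis using False Ln e by auto
      qed
    qed
  qed
  then show ?thesis using that thr_s by blast
qed

end

context homogeneous
begin

section \<open>Isomorphism and limits along the ultrafilter\<close>

text \<open>The permutations exchanging \<open>s\<close> and \<open>s'\<close> define a total shift that
  is constant along thresholds. The link \<open>Pu\<close> is preserved because a point moved at
  a place would tell the two families apart there.\<close>

theorem same_type_iso:
  assumes s: "\<And>p. p \<in> Ind \<Longrightarrow> thr (s p)" "\<And>p. p \<in> Ind \<Longrightarrow> thr (s' p)"
    and ty: "\<And>j t. j \<in> K \<Longrightarrow> t \<in> T j \<Longrightarrow>
      {p \<in> Ind. {i. le i j \<and> pr j i (s p j) = pr j i t} = {i. le i j \<and> pr j i (s' p j) = pr j i t}} \<in> UF"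
  shows "isomorphic voc (mdl (\<lambda>i d. s (i, d))) (mdl (\<lambda>i d. s' (i, d)))"
proof -
  define w where "w i d j = sw j (s (i, d) j) (s' (i, d) j)" for i d j
  have tree_auto: "tree_auto (w i d)" if "(i, d) \<in> Ind" for i d
    using sw_AT[OF s(1)[OF that] s(2)[OF that]] by (simp add: w_def[abs_def])
  have T: "s p j \<in> T j" "s' p j \<in> T j" if "p \<in> Ind" "j \<in> K" for p j
    using s that by (auto simp: thr_def)
  have "compatible (\<lambda>i d. s (i, d)) (\<lambda>i d. s' (i, d)) (\<lambda>i b. i \<in> K \<and> b \<in> Th i) w (\<lambda>i b d. w i d) (\<lambda>i b d c. w i d)"
    unfolding compatible_def
  proof (intro conjI allI impI ballI; (elim conjE)?)
    fix i d assume I: "(i, d) \<in> Ind"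
    then show "tree_auto (w i d)" "tree_auto (w i d)" "tree_auto (w i d)" by (simp_all add: tree_auto)
    show "FS d (\<lambda>c. w i d)" by (rule FS_const)
    show "FS i (\<lambda>b. w i d)" by (rule FS_const)
    show "ev d (\<lambda>c. w i d = w i d)" using Ind_D[OF I] by (intro ev_true) auto
  next
    fix j t assume jt: "j \<in> K" "t \<in> T j"
    show "{(i, d) \<in> Ind. w i d j t = t} \<in> UF"
    proof (rule UF_sub[OF ty[OF jt]])
      show "{p \<in> Ind. {i. le i j \<and> pr j i (s p j) = pr j i t} = {i. le i j \<and> pr j i (s' p j) = pr j i t}}
          \<subseteq> {(i, d) \<in> Ind. w i d j t = t}"
      proof clarify
        fix i d assume I: "(i, d) \<in> Ind"
          and eq: "{i'. le i' j \<and> pr j i' (s (i, d) j) = pr j i' t} = {i'. le i' j \<and> pr j i' (s' (i, d) j) = pr j i' t}"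
        show "w i d j t = t"
        proof (rule ccontr)
          assume "w i d j t \<noteq> t"
          then show False using sw_mv[OF jt(1) T[OF I jt(1)] jt(2)] eq by (simp add: w_def)
        qed
      qed
    qed auto
  next
    fix i b assume "i \<in> K"
    then show "\<exists>h\<in>K. \<forall>d\<in>Lim. lt i d \<and> \<not> lt d h \<longrightarrow> w i d = w i d" by blast
  next
    fix d assume d: "d \<in> Lim"
    then obtain k where k: "lt k d" by (auto simp: Lim_def)
    have "ev i (\<lambda>b. \<forall>j\<in>K. w i d j (s (i, d) j) = s' (i, d) j)" if "lt i d" for i
    proof -
      have I: "(i, d) \<in> Ind" using that d by (simp add: Ind_def)
      show ?thesis using Ind_D[OF I] sw_eq T[OF I] by (intro ev_true) (auto simp: w_def)
    qed
    then show "\<exists>k. lt k d \<and> (\<forall>i. \<not> lt i k \<and> lt i d \<longrightarrow> ev i (\<lambda>b. \<forall>j\<in>K. w i d j (s (i, d) j) = s' (i, d) j))"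
      using k by blast
  qed
  then show ?thesis by (rule compatible_all_iso)
qed

text \<open>An isomorphism is a shift by sections \<open>c\<close>. Its marker condition says that the
  germs of columns carry \<open>s\<close> to \<open>s'\<close>; choosing the column threshold
  after all row thresholds, and the row thresholds after all \<open>kap\<close> many conditions,
  transports this to the section at \<open>Q j\<close>, at all places of some box. By the link
  \<open>Pu\<close> that section fixes the limit point almost everywhere.\<close>

theorem iso_limit:
  assumes s: "\<And>p. p \<in> Ind \<Longrightarrow> thr (s p)" "\<And>p. p \<in> Ind \<Longrightarrow> thr (s' p)"
    and iso: "isomorphic voc (mdl (\<lambda>i d. s (i, d))) (mdl (\<lambda>i d. s' (i, d)))"
    and j: "j \<in> K" and lim: "{p \<in> Ind. s p j = t} \<in> UF"
  shows "{p \<in> Ind. s' p j = t} \<in> UF"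
proof -
  let ?s = "\<lambda>i d. s (i, d)" and ?s' = "\<lambda>i d. s' (i, d)"
  obtain \<phi> where \<phi>: "bij_betw \<phi> UU (enc ` UU)"
    and R: "\<And>y u v. y \<in> SYM \<Longrightarrow> u \<in> UU \<Longrightarrow> v \<in> UU \<Longrightarrow> rel ?s y u v \<longleftrightarrow> rel_in (mdl ?s') y (\<phi> u) (\<phi> v)"
    using iso[unfolded iso_iff] by auto
  define \<psi> where "\<psi> = inv_into UU enc \<circ> \<phi>"
  have \<psi>: "\<psi> u \<in> UU" "enc (\<psi> u) = \<phi> u" if "u \<in> UU" for u
  proof -
    have "\<phi> u \<in> enc ` UU" using \<phi> that by (auto simp: bij_betw_def)
    then show "\<psi> u \<in> UU" "enc (\<psi> u) = \<phi> u" by (simp_all add: \<psi>_def inv_into_into f_inv_into_f)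
  qed
  have R': "rel ?s y u v \<longleftrightarrow> rel ?s' y (\<psi> u) (\<psi> v)" if "y \<in> SYM" "u \<in> UU" "v \<in> UU" for y u v
    using R[OF that] rel_in_mdl[OF that(1) \<psi>(1)[OF that(2)] \<psi>(1)[OF that(3)], of ?s'] \<psi>(2)[OF that(2)] \<psi>(2)[OF that(3)]
    by simp
  define c where "c \<kappa> = snd (\<psi> (\<kappa>, sec_one))" for \<kappa>
  have Tr: "Tr \<kappa> f \<in> SYM" if "(\<kappa>, f) \<in> UU" for \<kappa> f using that by (force simp: SYM_def UU_def)
  have one: "(\<kappa>, sec_one) \<in> UU" if "\<kappa> \<in> Srt" for \<kappa> using that G_one by (simp add: UU_def)
  have \<psi>c: "\<psi> (\<kappa>, f) = (\<kappa>, c \<kappa> \<odot> f)" if "(\<kappa>, f) \<in> UU" for \<kappa> f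
  proof -
    have k: "\<kappa> \<in> Srt" using that by (simp add: UU_def)
    have "rel ?s' (Tr \<kappa> f) (\<psi> (\<kappa>, sec_one)) (\<psi> (\<kappa>, f))" using R'[OF Tr[OF that] one[OF k] that] by simp
    then show ?thesis by (cases "\<psi> (\<kappa>, f)") (simp add: c_def)
  qed
  have cG: "c \<kappa> \<in> G \<kappa>" if "\<kappa> \<in> Srt" for \<kappa>
    using \<psi>c[OF one[OF that]] \<psi>(1)[OF one[OF that]] by (simp add: UU_def)
  have link: "holds ?s l f g \<longleftrightarrow> holds ?s' l (c (src l) \<odot> f) (c (tgt l) \<odot> g)"
    if l: "l \<in> Lnk" and f: "f \<in> G (src l)" and g: "g \<in> G (tgt l)" for l f g
  proof -
    have U: "(src l, f) \<in> UU" "(tgt l, g) \<in> UU" using l f g by (auto simp: UU_def Lnk_def)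
    have "Ln l \<in> SYM" using l by (simp add: SYM_def)
    from R'[OF this U] show ?thesis by (simp add: \<psi>c[OF U(1)] \<psi>c[OF U(2)])
  qed
  have link1: "holds ?s' l (c (src l)) (c (tgt l))" if l: "l \<in> Lnk" and H: "holds ?s l sec_one sec_one" for l
    using link[OF l G_one G_one] l H by (simp add: Lnk_def)
  have Ev: "\<exists>h\<in>K. \<forall>d\<in>Lim. lt i d \<and> \<not> lt d h \<longrightarrow> c (R i b j) (P i d) = c (Q j) (P i d)"
    if "i \<in> K" "b \<in> Th i" for i b
    using link1[of "Ev i b j"] that j by (auto simp: Lnk_def)
  have Li: "ev d (\<lambda>x. c (E i b d j) (B d x) = c (R i b j) (P i d))" if "(i, d) \<in> Ind" "b \<in> Th i" for i d b
    using link1[of "Li i b d j"] that j Ind_D[OF that(1)] by (simp add: Lnk_def ev_true sec_one_def)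
  have Xx: "c (E i b d j) (B d x) = c (C d x j) (B i b)" if "(i, d) \<in> Ind" "b \<in> Th i" "x \<in> Th d" for i d b x
    using link1[of "Xx i b d x j"] that j Ind_D[OF that(1)] by (simp add: Lnk_def sec_one_def)
  have Pu: "{(i, d) \<in> Ind. c (Q j) (P i d) t = t} \<in> UF" if "t \<in> T j" for t
  proof -
    have l: "Pu j \<in> Lnk" using j by (simp add: Lnk_def)
    have "holds ?s (Pu j) sec_one sec_one" using UF_all by (simp add: sec_one_def)
    from link1[OF l this] show ?thesis using that by simp
  qed
  have St: "\<exists>k. lt k d \<and> (\<forall>i. \<not> lt i k \<and> lt i d \<longrightarrow> ev i (\<lambda>b. c (C d x j) (B i b) (s (i, d) j) = s' (i, d) j))"
    if d: "d \<in> Lim" and x: "x \<in> Th d" for d x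
  proof -
    have S: "C d x j \<in> Srt" and l: "St d x j \<in> Lnk" using d x j by (simp_all add: Lnk_def)
    \<comment> \<open>A test element: a section of the column sort that satisfies the marker for \<open>s\<close>.\<close>
    define q where "q i = sw j (oo j) (s (i, d) j)" for i
    have oo: "thr oo" using oo_T oo_pr by (simp add: thr_def)
    have q: "q i \<in> A j \<and> q i (oo j) = s (i, d) j" if "(i, d) \<in> Ind" for i
      using sw_AT[OF oo s(1)[OF that]] sw_eq[OF j oo_T[OF j]] s(1)[OF that] j by (auto simp: q_def tree_auto_def thr_def)
    define f where "f = shift (\<lambda>_ _ _. id) (\<lambda>_ _ _ _. id) (\<lambda>i b d' x' j'. if d' = d \<and> j' = j then q i else id) (C d x j)"
    have f: "f \<in> G (C d x j)"
      unfolding f_def by (rule shift_G_general[OF _ _ _ _ _ S]) (auto simp: A_id q FS_const)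
    obtain k where k: "lt k d" using d by (auto simp: Lim_def)
    have "ev i (\<lambda>b. f (B i b) (oo j) = s (i, d) j)" if "lt i d" for i
    proof -
      have I: "(i, d) \<in> Ind" using that d by (simp add: Ind_def)
      show ?thesis using Ind_D[OF I] q[OF I] that by (intro ev_true) (auto simp: f_def)
    qed
    then have "holds ?s (St d x j) f f" using k by auto
    then have "holds ?s' (St d x j) (c (C d x j) \<odot> f) (c (C d x j) \<odot> f)" using link[OF l, of f f] f by simp
    then obtain k where k: "lt k d" "\<And>i. \<not> lt i k \<Longrightarrow> lt i d \<Longrightarrow>
        ev i (\<lambda>b. (c (C d x j) \<odot> f) (B i b) (oo j) = s' (i, d) j)" by auto
    have "ev i (\<lambda>b. c (C d x j) (B i b) (s (i, d) j) = s' (i, d) j)" if i: "\<not> lt i k" "lt i d" for i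
    proof -
      have I: "(i, d) \<in> Ind" using i d by (simp add: Ind_def)
      show ?thesis by (rule ev_mono[OF k(2)[OF i]]) (use q[OF I] i in \<open>simp add: f_def sec_mult_def\<close>)
    qed
    then show ?thesis using k(1) by blast
  qed
  have "\<exists>x k. d \<in> Lim \<longrightarrow> x \<in> Th d \<and> (\<forall>i b. lt i d \<longrightarrow> b \<in> Th i \<longrightarrow> c (R i b j) (P i d) = c (C d x j) (B i b)) \<and>
      lt k d \<and> (\<forall>i. \<not> lt i k \<and> lt i d \<longrightarrow> ev i (\<lambda>b. c (R i b j) (P i d) (s (i, d) j) = s' (i, d) j))" for d
  proof (cases "d \<in> Lim")
    case True
    have dK: "d \<in> K" using Lim_K[OF True] .
    obtain x where x: "x \<in> Th d" "\<And>i b. lt i d \<Longrightarrow> b \<in> Th i \<Longrightarrow> c (E i b d j) (B d x) = c (R i b j) (P i d)"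
      by (rule ev_common_Low[of d "\<lambda>i b x. c (E i b d j) (B d x) = c (R i b j) (P i d)", OF dK])
        (use True in \<open>auto simp: Ind_def intro: Li\<close>)
    have e: "c (R i b j) (P i d) = c (C d x j) (B i b)" if "lt i d" "b \<in> Th i" for i b
      using x(2)[OF that] Xx[of i d b x] that x(1) True by (simp add: Ind_def)
    obtain k where k: "lt k d" "\<And>i. \<not> lt i k \<Longrightarrow> lt i d \<Longrightarrow>
        ev i (\<lambda>b. c (C d x j) (B i b) (s (i, d) j) = s' (i, d) j)" using St[OF True x(1)] by blast
    have "ev i (\<lambda>b. c (R i b j) (P i d) (s (i, d) j) = s' (i, d) j)" if i: "\<not> lt i k" "lt i d" for i
      by (rule ev_mono[OF k(2)[OF i]]) (simp add: e[OF i(2)])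
    then show ?thesis using e x(1) k(1) by blast
  qed blast
  then have "\<exists>k. \<forall>d. d \<in> Lim \<longrightarrow> 
      lt (k d) d \<and> (\<forall>i. \<not> lt i (k d) \<and> lt i d \<longrightarrow> ev i (\<lambda>b. c (R i b j) (P i d) (s (i, d) j) = s' (i, d) j))"
    by (intro choice) blast
  then obtain k where k: "\<And>d. d \<in> Lim \<Longrightarrow> lt (k d) d"
    "\<And>d i. d \<in> Lim \<Longrightarrow> \<not> lt i (k d) \<Longrightarrow> lt i d \<Longrightarrow> ev i (\<lambda>b. c (R i b j) (P i d) (s (i, d) j) = s' (i, d) j)"
    by blast
  have "\<exists>h. i \<in> K \<longrightarrow> h \<in> K \<and> (\<forall>d\<in>Lim. lt i d \<and> \<not> lt d h \<and> \<not> lt i (k d) \<longrightarrow> c (Q j) (P i d) (s (i, d) j) = s' (i, d) j)" for i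
  proof (cases "i \<in> K")
    case True
    have evd: "ev i (\<lambda>b. d \<in> Lim \<and> \<not> lt i (k d) \<and> lt i d \<longrightarrow> c (R i b j) (P i d) (s (i, d) j) = s' (i, d) j)" for d
    proof (cases "d \<in> Lim \<and> \<not> lt i (k d) \<and> lt i d")
      case True
      then show ?thesis using k(2)[of d i] by simp
    next
      case False
      show ?thesis by (rule ev_true[OF \<open>i \<in> K\<close>]) (use False in blast)
    qed
    obtain b where b: "b \<in> Th i" "\<And>d. d \<in> K \<Longrightarrow> d \<in> Lim \<and> \<not> lt i (k d) \<and> lt i d \<longrightarrow>
        c (R i b j) (P i d) (s (i, d) j) = s' (i, d) j"
      by (rule ev_common_K[of i "\<lambda>d b. d \<in> Lim \<and> \<not> lt i (k d) \<and> lt i d \<longrightarrow>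
          c (R i b j) (P i d) (s (i, d) j) = s' (i, d) j", OF True]) (rule evd, rule that)
    obtain h where h: "h \<in> K" "\<forall>d\<in>Lim. lt i d \<and> \<not> lt d h \<longrightarrow> c (R i b j) (P i d) = c (Q j) (P i d)"
      using Ev[OF True b(1)] by blast
    have "c (Q j) (P i d) (s (i, d) j) = s' (i, d) j" if "d \<in> Lim" "lt i d" "\<not> lt d h" "\<not> lt i (k d)" for d
      using b(2)[OF Lim_K[OF that(1)]] h(2)[rule_format, OF that(1)] that by simp
    then show ?thesis using h(1) by blast
  qed blast
  then obtain h where h: "\<And>i. i \<in> K \<Longrightarrow> h i \<in> K" "\<And>i d. i \<in> K \<Longrightarrow> d \<in> Lim \<Longrightarrow> lt i d \<Longrightarrow>
      \<not> lt d (h i) \<Longrightarrow> \<not> lt i (k d) \<Longrightarrow> c (Q j) (P i d) (s (i, d) j) = s' (i, d) j"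
    by metis
  have B: "{(i, d) \<in> Ind. \<not> lt i (k d) \<and> \<not> lt d (h i)} \<in> UF" by (rule UF_B[OF h(1) k(1)])
  have tT: "t \<in> T j"
  proof -
    have "{p \<in> Ind. s p j = t} \<noteq> {}" using lim UF_ne by metis
    then obtain p where "p \<in> Ind" "s p j = t" by blast
    then show ?thesis using s(1)[of p] j by (auto simp: thr_def)
  qed
  show ?thesis
  proof (rule UF_sub[OF UF_int[OF lim UF_int[OF B Pu[OF tT]]]])
    show "{p \<in> Ind. s p j = t} \<inter> ({(i, d) \<in> Ind. \<not> lt i (k d) \<and> \<not> lt d (h i)} \<inter>
        {(i, d) \<in> Ind. c (Q j) (P i d) t = t}) \<subseteq> {p \<in> Ind. s' p j = t}"
    proof clarify
      fix i d assume I: "(i, d) \<in> Ind" and q: "\<not> lt i (k d)" "\<not> lt d (h i)" "c (Q j) (P i d) (s (i, d) j) = s (i, d) j"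
      show "s' (i, d) j = s (i, d) j" using h(2)[OF _ _ _ q(2,1)] q(3) Ind_D[OF I] by metis
    qed
  qed auto
qed

end

section \<open>Thresholds and the ultrafilter\<close>

text \<open>Regularity of an infinite successor cardinal.\<close>

lemma cardSuc_bound:
  assumes A: "infinite A" and X: "X \<subseteq> Field (cardSuc |A| )" "|X| \<le>o |A|"
  obtains b where "b \<in> Field (cardSuc |A| )" "\<And>x. x \<in> X \<Longrightarrow> (x, b) \<in> cardSuc |A| \<and> x \<noteq> b"
proof (rule ccontr)
  note thesisI = that
  assume no: "\<not> thesis"
  let ?r = "cardSuc |A|"
  have C: "Card_order ?r" by (simp add: cardSuc_Card_order card_of_Card_order)
  have wo: "wo_rel ?r" using C by (simp add: wo_rel_def card_order_on_def)
  have inf: "\<not> finite (Field ?r)"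
    using cardSuc_finite[OF card_of_Card_order, of A] A by (simp add: Field_card_of)
  have "cofinal X ?r" unfolding cofinal_def
  proof
    fix a assume a: "a \<in> Field ?r"
    obtain a' where a': "a' \<in> Field ?r" "a \<noteq> a'" "(a, a') \<in> ?r" using infinite_Card_order_limit[OF C inf a] by blast
    obtain x where x: "x \<in> X" "\<not> ((x, a') \<in> ?r \<and> x \<noteq> a')" using no thesisI[OF a'(1)] by blast
    have "(a', x) \<in> ?r"
      using wo_rel.TOTALS[OF wo] a'(1) x X(1) by blast
    then have "(a, x) \<in> ?r" "a \<noteq> x"
      using a' wo_rel.TRANS[OF wo] wo_rel.ANTISYM[OF wo] unfolding trans_def antisym_def by blast+
    then show "\<exists>b\<in>X. a \<noteq> b \<and> (a, b) \<in> ?r" using x(1) by blast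
  qed
  moreover have "regularCard ?r"
    using infinite_cardSuc_regularCard[OF _ card_of_Card_order, of A] A by (simp add: Field_card_of)
  ultimately have "|X| =o ?r" using X(1) by (simp add: regularCard_def)
  then have "?r \<le>o |A|" using X(2) ordIso_ordLeq_trans ordIso_symmetric by blast
  then show False using cardSuc_greater[OF card_of_Card_order, of A] not_ordLess_ordLeq by blast
qed

context singular
begin

text \<open>The places that lie late in their row, as prescribed by \<open>h\<close>, and late in their
  column, as prescribed by \<open>k\<close>.\<close>

definition tail_box where
  "tail_box h k = {(i, d) \<in> Ind. \<not> lt i (k d) \<and> \<not> lt d (h i)}"
definition admissible where "admissible h k \<longleftrightarrow> (\<forall>i\<in>K. h i \<in> K) \<and> (\<forall>d\<in>Lim. lt (k d) d)"

lemma tail_box_ne: assumes "admissible h k" shows "tail_box h k \<noteq> {}"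
proof -
  have h: "\<And>i. i \<in> K \<Longrightarrow> h i \<in> K" and k: "\<And>d. d \<in> Lim \<Longrightarrow> lt (k d) d" using assms by (auto simp: admissible_def)
  obtain d where d: "d \<in> Lim" "\<And>i. lt i d \<Longrightarrow> lt (h i) d" by (rule lim_closed[OF h]) blast+
  have "lt (h (k d)) d" using d k by blast
  then have "\<not> lt d (h (k d))" using lt_trans lt_irrefl by blast
  then have "(k d, d) \<in> tail_box h k" using k[OF d(1)] d(1) lt_irrefl by (simp add: tail_box_def Ind_def)
  then show ?thesis by blast
qed

lemma tail_box_int:
  assumes "admissible h k" "admissible h' k'" obtains h'' k'' where "admissible h'' k''" "tail_box h'' k'' \<subseteq> tail_box h k \<inter> tail_box h' k'"
proof -
  define m where "m x y = (if lt x y then y else x)" for x y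
  have m: "lt z (m x y)" if "lt z x \<or> lt z y" "x \<in> K" "y \<in> K" for x y z
    using that lt_trans lt_total[of x y] by (auto simp: m_def)
  have "admissible (\<lambda>i. m (h i) (h' i)) (\<lambda>d. m (k d) (k' d))" using assms by (auto simp: admissible_def m_def)
  moreover have "tail_box (\<lambda>i. m (h i) (h' i)) (\<lambda>d. m (k d) (k' d)) \<subseteq> tail_box h k \<inter> tail_box h' k'"
  proof clarify
    fix i d assume "(i, d) \<in> tail_box (\<lambda>i. m (h i) (h' i)) (\<lambda>d. m (k d) (k' d))"
    then have *: "(i, d) \<in> Ind" "\<not> lt i (m (k d) (k' d))" "\<not> lt d (m (h i) (h' i))" by (auto simp: tail_box_def)
    have "h i \<in> K" "h' i \<in> K" "k d \<in> K" "k' d \<in> K" using assms Ind_D[OF *(1)] lt_K by (auto simp: admissible_def)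
    then show "(i, d) \<in> tail_box h k \<inter> tail_box h' k'" using * m by (auto simp: tail_box_def)
  qed
  ultimately show ?thesis by (rule that)
qed

definition box_filter where
  "box_filter F \<longleftrightarrow> F \<subseteq> Pow Ind \<and> {} \<notin> F \<and> (\<forall>X Y. X \<in> F \<longrightarrow> X \<subseteq> Y \<longrightarrow> Y \<subseteq> Ind \<longrightarrow> Y \<in> F) \<and>
     (\<forall>X\<in>F. \<forall>Y\<in>F. X \<inter> Y \<in> F) \<and> (\<forall>h k. admissible h k \<longrightarrow> tail_box h k \<in> F)"

text \<open>The boxes of late places have the finite intersection property, and Zorn's lemma extends them
  to an ultrafilter.\<close>

lemma ultrafilter:
  obtains UF where "box_filter UF" "\<And>X. X \<subseteq> Ind \<Longrightarrow> X \<in> UF \<or> Ind - X \<in> UF"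
proof -
  define F0 where "F0 = {X. X \<subseteq> Ind \<and> (\<exists>h k. admissible h k \<and> tail_box h k \<subseteq> X)}"
  have BInd: "tail_box h k \<subseteq> Ind" for h k by (auto simp: tail_box_def)
  have "box_filter F0" unfolding box_filter_def
  proof (intro conjI allI impI ballI)
    show "{} \<notin> F0" using tail_box_ne by (auto simp: F0_def)
    show "X \<inter> Y \<in> F0" if X: "X \<in> F0" and Y: "Y \<in> F0" for X Y
    proof -
      obtain h k where 1: "admissible h k" "tail_box h k \<subseteq> X" using X by (auto simp: F0_def)
      obtain h' k' where 2: "admissible h' k'" "tail_box h' k' \<subseteq> Y" using Y by (auto simp: F0_def)
      obtain h'' k'' where "admissible h'' k''" "tail_box h'' k'' \<subseteq> tail_box h k \<inter> tail_box h' k'" by (rule tail_box_int[OF 1(1) 2(1)])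
      then show ?thesis using 1 2 X unfolding F0_def by blast
    qed
    show "Y \<in> F0" if "X \<in> F0" "X \<subseteq> Y" "Y \<subseteq> Ind" for X Y using that unfolding F0_def by blast
  qed (use BInd in \<open>auto simp: F0_def\<close>)
  then have ne: "{F. box_filter F} \<noteq> {}" by blast
  have "\<exists>M\<in>{F. box_filter F}. \<forall>X\<in>{F. box_filter F}. M \<subseteq> X \<longrightarrow> X = M"
  proof (rule subset_Zorn_nonempty[OF ne])
    fix \<C> assume C: "\<C> \<noteq> {}" "subset.chain {F. box_filter F} \<C>"
    then have fl: "box_filter F" if "F \<in> \<C>" for F using that by (auto simp: subset.chain_def)
    have tot: "F \<subseteq> F' \<or> F' \<subseteq> F" if "F \<in> \<C>" "F' \<in> \<C>" for F F'
      using C(2) that by (auto simp: subset.chain_def)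
    have "box_filter (\<Union>\<C>)" unfolding box_filter_def
    proof (intro conjI allI impI ballI)
      show "\<Union>\<C> \<subseteq> Pow Ind"
      proof (rule Union_least)
        show "F \<subseteq> Pow Ind" if "F \<in> \<C>" for F using fl[OF that] by (simp add: box_filter_def)
      qed
      show "{} \<notin> \<Union>\<C>" using fl by (auto simp: box_filter_def)
      show "Y \<in> \<Union>\<C>" if "X \<in> \<Union>\<C>" "X \<subseteq> Y" "Y \<subseteq> Ind" for X Y
        using fl that unfolding box_filter_def by blast
      show "X \<inter> Y \<in> \<Union>\<C>" if X: "X \<in> \<Union>\<C>" and Y: "Y \<in> \<Union>\<C>" for X Y
      proof -
        obtain F F' where F: "F \<in> \<C>" "X \<in> F" "F' \<in> \<C>" "Y \<in> F'" using X Y by blast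
        obtain F'' where "F'' \<in> \<C>" "X \<in> F''" "Y \<in> F''" using tot[OF F(1,3)] F by blast
        then have "X \<inter> Y \<in> F''" using fl[of F''] unfolding box_filter_def by blast
        then show ?thesis using \<open>F'' \<in> \<C>\<close> by (rule UnionI[rotated])
      qed
      show "tail_box h k \<in> \<Union>\<C>" if "admissible h k" for h k using C(1) fl that by (auto simp: box_filter_def)
    qed
    then show "\<Union>\<C> \<in> {F. box_filter F}" by simp
  qed
  then obtain U where U: "box_filter U" "\<And>X. box_filter X \<Longrightarrow> U \<subseteq> X \<Longrightarrow> X = U" by blast
  show ?thesis
  proof (rule that[OF U(1)])
    fix X assume X: "X \<subseteq> Ind"
    define F where "F = {Y. Y \<subseteq> Ind \<and> (\<exists>Z\<in>U. Z \<inter> X \<subseteq> Y)}"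
    have UF: "U \<subseteq> F" using U(1) unfolding F_def box_filter_def by blast
    obtain h k where hk: "admissible h k"
    proof -
      have "\<forall>d\<in>Lim. \<exists>k. lt k d" by (simp add: Lim_def)
      then obtain k where "\<And>d. d \<in> Lim \<Longrightarrow> lt (k d) d" by metis
      then show ?thesis using that[of "\<lambda>i. i" k] by (simp add: admissible_def)
    qed
    show "X \<in> U \<or> Ind - X \<in> U"
    proof (cases "{} \<in> F")
      case True
      then obtain Z where "Z \<in> U" "Z \<inter> X = {}" by (auto simp: F_def)
      then have "Z \<in> U" "Z \<subseteq> Ind - X" "Ind - X \<subseteq> Ind" using U(1) by (auto simp: box_filter_def)
      then show ?thesis using U(1) unfolding box_filter_def by blast
    next
      case False
      have "box_filter F" unfolding box_filter_def
      proof (intro conjI allI impI ballI False)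
        show "Y \<inter> Y' \<in> F" if Y: "Y \<in> F" "Y' \<in> F" for Y Y'
        proof -
          obtain Z Z' where Z: "Z \<in> U" "Z' \<in> U" "Z \<inter> X \<subseteq> Y" "Z' \<inter> X \<subseteq> Y'" using Y by (auto simp: F_def)
          have "Z \<inter> Z' \<in> U" using U(1) Z(1,2) by (simp add: box_filter_def)
          moreover have "Z \<inter> Z' \<inter> X \<subseteq> Y \<inter> Y'" using Z(3,4) by blast
          ultimately show ?thesis using Y unfolding F_def by blast
        qed
        show "tail_box h k \<in> F" if "admissible h k" for h k using U(1) UF that by (auto simp: box_filter_def)
        show "Y' \<in> F" if "Y \<in> F" "Y \<subseteq> Y'" "Y' \<subseteq> Ind" for Y Y' using that unfolding F_def by blast
      qed (auto simp: F_def)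
      then have "F = U" using U(2) UF by blast
      moreover have "tail_box h k \<in> U" using U(1) hk by (simp add: box_filter_def)
      ultimately have "X \<in> U" using X unfolding F_def by blast
      then show ?thesis by simp
    qed
  qed
qed

text \<open>The order at \<open>i\<close> is the successor cardinal of a set \<open>A i\<close>, chosen by
  recursion on \<open>i\<close> so that it is at least as large as \<open>K\<close>, as the
  union of all earlier orders, and as the \<open>i\<close>-th member of a sequence cofinal in
  \<open>lam\<close>. As \<open>lam\<close> is a limit cardinal, the recursion stays below it.\<close>

lemma thresholds:
  obtains Th :: "'k \<Rightarrow> 'a set set" and tl where
    "\<And>i. i \<in> K \<Longrightarrow> Th i \<noteq> {}"
    "\<And>i x. \<not> tl i x x"
    "\<And>i x y z. tl i x y \<Longrightarrow> tl i y z \<Longrightarrow> tl i x z"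
    "\<And>i x y. x \<in> Th i \<Longrightarrow> y \<in> Th i \<Longrightarrow> tl i x y \<or> x = y \<or> tl i y x"
    "\<And>i f. i \<in> K \<Longrightarrow> (\<And>d. d \<in> K \<Longrightarrow> f d \<in> Th i) \<Longrightarrow> \<exists>b\<in>Th i. \<forall>d\<in>K. tl i (f d) b"
    "\<And>d g. d \<in> K \<Longrightarrow> (\<And>i b. lt i d \<Longrightarrow> b \<in> Th i \<Longrightarrow> g i b \<in> Th d) \<Longrightarrow>
        \<exists>c\<in>Th d. \<forall>i b. lt i d \<longrightarrow> b \<in> Th i \<longrightarrow> tl d (g i b) c"
    "\<And>i. i \<in> K \<Longrightarrow> |Th i| <o lam"
    "\<And>a. a \<in> Field lam \<Longrightarrow> \<exists>i0\<in>K. \<forall>i. lt i0 i \<longrightarrow>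
        (\<forall>Y \<subseteq> Th i. |Y| \<le>o |underS lam a| \<longrightarrow> (\<exists>b\<in>Th i. \<forall>y\<in>Y. tl i y b))"
    "lam \<le>o |SIGMA i:K. Th i|"
proof -
  obtain c where c: "\<And>i. i \<in> K \<Longrightarrow> c i \<in> Field lam"
    "\<And>a. a \<in> Field lam \<Longrightarrow> \<exists>i\<in>K. (a, c i) \<in> lam \<and> a \<noteq> c i" using cof_seq by blast
  define low where "low f i = (SIGMA i' : {i'. lt i' i}. Field (cardSuc |f i' :: 'a set| ))" for f i
  have wf: "wf {(i, j). lt i j}" using lt_wf by (simp add: wfp_def)
  have "\<exists>f. \<forall>i. i \<in> K \<longrightarrow> tiny (f i :: 'a set) \<and> |K| \<le>o |f i| \<and> |low f i| \<le>o |f i| \<and> |underS lam (c i)| \<le>o |f i|"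
  proof (rule dependent_wf_choice[OF wf, where P = "\<lambda>f i S. i \<in> K \<longrightarrow> tiny (S :: 'a set) \<and> |K| \<le>o |S| \<and> |low f i| \<le>o |S| \<and> |underS lam (c i)| \<le>o |S|"])
    fix f g :: "'k \<Rightarrow> 'a set" and i r assume "\<And>z. (z, i) \<in> {(i, j). lt i j} \<Longrightarrow> f z = g z"
    then have "low f i = low g i" by (auto simp: low_def)
    then show "(i \<in> K \<longrightarrow> tiny r \<and> |K| \<le>o |r| \<and> |low f i| \<le>o |r| \<and> |underS lam (c i)| \<le>o |r| ) =
        (i \<in> K \<longrightarrow> tiny r \<and> |K| \<le>o |r| \<and> |low g i| \<le>o |r| \<and> |underS lam (c i)| \<le>o |r| )" by simp
  next
    fix i and f :: "'k \<Rightarrow> 'a set"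
    assume IH: "\<And>y. (y, i) \<in> {(i, j). lt i j} \<Longrightarrow> y \<in> K \<longrightarrow>
        tiny (f y) \<and> |K| \<le>o |f y| \<and> |low f y| \<le>o |f y| \<and> |underS lam (c y)| \<le>o |f y|"
    show "\<exists>S. i \<in> K \<longrightarrow> tiny (S :: 'a set) \<and> |K| \<le>o |S| \<and> |low f i| \<le>o |S| \<and> |underS lam (c i)| \<le>o |S|"
    proof (cases "i \<in> K")
      case True
      have "tiny (Field (cardSuc |f i'| ))" if "lt i' i" for i'
        by (rule tiny_cardSuc) (use IH[of i'] that lt_K[OF that] in simp)
      then have "tiny (\<Union>i'\<in>{i'. lt i' i}. {i'} \<times> Field (cardSuc |f i'| ))"
        by (intro tiny_UN[OF kap_underS[OF True]] tiny_Times[OF tiny_finite]) auto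
      then have "tiny (low f i)" by (simp add: low_def Sigma_def)
      then have tU: "tiny (K <+> (low f i <+> underS lam (c i)))"
        by (intro card_of_Plus_ordLess_infinite_Field[OF lamI lamC] tiny_K tiny_underS c(1) True)
      obtain S where S: "S \<subset> Field lam" "|K <+> (low f i <+> underS lam (c i))| =o |S|" "tiny S"
        using internalize_card_of_ordLess[THEN iffD1, OF tU] by blast
      have le: "|X| \<le>o |S|" if "|X| \<le>o |K <+> (low f i <+> underS lam (c i))|" for X :: "'z set"
        by (rule ordLeq_ordIso_trans[OF that S(2)])
      have 1: "|K| \<le>o |K <+> (low f i <+> underS lam (c i))|" by (rule card_of_Plus1)
      have 2: "|low f i| \<le>o |K <+> (low f i <+> underS lam (c i))|"
        by (rule ordLeq_transitive[OF card_of_Plus1 card_of_Plus2])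
      have 3: "|underS lam (c i)| \<le>o |K <+> (low f i <+> underS lam (c i))|"
        by (rule ordLeq_transitive[OF card_of_Plus2 card_of_Plus2])
      show ?thesis
        using S(3) ordLeq_ordIso_trans[OF 1 S(2)] ordLeq_ordIso_trans[OF 2 S(2)] ordLeq_ordIso_trans[OF 3 S(2)]
        by (intro exI[of _ S]) simp
    qed simp
  qed
  then obtain A :: "'k \<Rightarrow> 'a set" where A: "\<And>i. i \<in> K \<Longrightarrow> tiny (A i)" "\<And>i. i \<in> K \<Longrightarrow> |K| \<le>o |A i|"
    "\<And>i. i \<in> K \<Longrightarrow> |low A i| \<le>o |A i|" "\<And>i. i \<in> K \<Longrightarrow> |underS lam (c i)| \<le>o |A i|" by blast
  define Th where "Th i = Field (cardSuc |A i| )" for i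
  define tl where "tl i x y \<longleftrightarrow> (x, y) \<in> cardSuc |A i| \<and> x \<noteq> y" for i x y
  have wo: "wo_rel (cardSuc |A i| )" for i
    using cardSuc_Card_order[OF card_of_Card_order, of "A i"] by (simp add: wo_rel_def card_order_on_def)
  have inf: "infinite (A i)" if "i \<in> K" for i
    using A(2)[OF that] K_inf card_of_ordLeq_finite by blast
  have bound: "\<exists>b\<in>Th i. \<forall>x\<in>X. tl i x b" if asm: "i \<in> K" "X \<subseteq> Th i" "|X| \<le>o |A i|" for i X
  proof -
    obtain b where "b \<in> Field (cardSuc |A i| )" "\<And>x. x \<in> X \<Longrightarrow> (x, b) \<in> cardSuc |A i| \<and> x \<noteq> b"
      by (rule cardSuc_bound[OF inf[OF asm(1)] asm(2)[unfolded Th_def] asm(3)]) (rule that)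
    then show ?thesis unfolding Th_def tl_def by blast
  qed
  have Ath: "|A i| <o |Th i|" for i
  proof -
    have "cardSuc |A i| =o |Th i|"
      unfolding Th_def by (rule ordIso_symmetric[OF card_of_Field_ordIso[OF cardSuc_Card_order[OF card_of_Card_order]]])
    then show ?thesis using cardSuc_greater[OF card_of_Card_order, of "A i"] ordLess_ordIso_trans by blast
  qed
  have low: "low A i = (SIGMA i' : {i'. lt i' i}. Th i')" for i by (simp add: low_def Th_def)
  show ?thesis
  proof (rule that[of Th tl])
    show "Th i \<noteq> {}" if "i \<in> K" for i 
    proof
      assume "Th i = {}"
      then have "|A i| <o |{} :: 'a set set|" using Ath[of i] by simp
      then show False using card_of_empty[of "A i"] not_ordLess_ordLeq by blast
    qed
    show "\<not> tl i x x" for i x by (simp add: tl_def)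
    show "tl i x z" if "tl i x y" "tl i y z" for i x y z
      using that wo_rel.TRANS[OF wo[of i]] wo_rel.ANTISYM[OF wo[of i]] unfolding tl_def trans_def antisym_def by metis
    show "tl i x y \<or> x = y \<or> tl i y x" if "x \<in> Th i" "y \<in> Th i" for i x y
      using that wo_rel.TOTALS[OF wo[of i]] unfolding tl_def Th_def by blast
    show "\<exists>b\<in>Th i. \<forall>d\<in>K. tl i (f d) b" if i: "i \<in> K" and f: "\<And>d. d \<in> K \<Longrightarrow> f d \<in> Th i" for i f
    proof -
      have "|f ` K| \<le>o |A i|" by (rule ordLeq_transitive[OF card_of_image A(2)[OF i]])
      from bound[OF i _ this] show ?thesis using f by blast
    qed
    show "\<exists>c\<in>Th d. \<forall>i b. lt i d \<longrightarrow> b \<in> Th i \<longrightarrow> tl d (g i b) c"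
      if d: "d \<in> K" and g: "\<And>i b. lt i d \<Longrightarrow> b \<in> Th i \<Longrightarrow> g i b \<in> Th d" for d g
    proof -
      have le: "|case_prod g ` low A d| \<le>o |A d|" by (rule ordLeq_transitive[OF card_of_image A(3)[OF d]])
      have sub: "case_prod g ` low A d \<subseteq> Th d" using g by (auto simp: low)
      from bound[OF d sub le] obtain b where b: "b \<in> Th d" "\<forall>x\<in>case_prod g ` low A d. tl d x b" by blast
      have "tl d (g i x) b" if "lt i d" "x \<in> Th i" for i x
      proof -
        have "(i, x) \<in> low A d" using that by (simp add: low)
        then have "case_prod g (i, x) \<in> case_prod g ` low A d" by (rule imageI)
        then show ?thesis using b(2) by auto
      qed
      then show ?thesis using b(1) by blast
    qed
    show "|Th i| <o lam" if "i \<in> K" for i unfolding Th_def by (rule tiny_cardSuc[OF A(1)[OF that]])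
    have under: "|underS lam a| \<le>o |underS lam (c i)|" if "(a, c i) \<in> lam" for a i
    proof (rule card_of_mono1)
      show "underS lam a \<subseteq> underS lam (c i)" using that lam_trans lam_antisym unfolding underS_def by blast
    qed
    have up: "|Th i'| \<le>o |A i|" if "lt i' i" for i i'
    proof -
      have "|Th i'| \<le>o |low A i|"
        by (rule card_of_ordLeqI[where f = "\<lambda>x. (i', x)"]) (auto simp: inj_on_def low that)
      then show ?thesis using A(3) lt_K[OF that] ordLeq_transitive by blast
    qed
    show "\<exists>i0\<in>K. \<forall>i. lt i0 i \<longrightarrow>
        (\<forall>Y \<subseteq> Th i. |Y| \<le>o |underS lam a| \<longrightarrow> (\<exists>b\<in>Th i. \<forall>y\<in>Y. tl i y b))" if a: "a \<in> Field lam" for a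
    proof -
      obtain i0 where i0: "i0 \<in> K" "(a, c i0) \<in> lam" using c(2)[OF a] by blast
      have le1: "|underS lam a| \<le>o |A i0|" by (rule ordLeq_transitive[OF under[OF i0(2)] A(4)[OF i0(1)]])
      show ?thesis
      proof (intro bexI[OF _ i0(1)] allI impI)
        fix i Y assume i: "lt i0 i" and Y: "Y \<subseteq> Th i" "|Y| \<le>o |underS lam a|"
        have "|Y| \<le>o |A i|"
          by (rule ordLeq_transitive[OF Y(2) ordLeq_transitive[OF le1
                ordLeq_transitive[OF ordLess_imp_ordLeq[OF Ath] up[OF i]]]])
        then show "\<exists>b\<in>Th i. \<forall>y\<in>Y. tl i y b" using bound[OF _ Y(1)] lt_K[OF i] by blast
      qed
    qed
    show "lam \<le>o |SIGMA i:K. Th i|"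
    proof (rule ccontr)
      assume "\<not> lam \<le>o |SIGMA i:K. Th i|"
      then have "tiny (SIGMA i:K. Th i)"
        using not_ordLeq_iff_ordLess[OF card_of_Well_order lamW] by blast
      then obtain a where a: "a \<in> Field lam" "|SIGMA i:K. Th i| =o |underS lam a|" by (rule tiny_embed)
      obtain i where i: "i \<in> K" "(a, c i) \<in> lam" using c(2)[OF a(1)] by blast
      have "|SIGMA i:K. Th i| \<le>o |A i|"
        by (rule ordIso_ordLeq_trans[OF a(2) ordLeq_transitive[OF under[OF i(2)] A(4)[OF i(1)]]])
      then have "|SIGMA i:K. Th i| <o |Th i|" using Ath ordLeq_ordLess_trans by blast
      moreover have "|Th i| \<le>o |SIGMA i:K. Th i|"
        by (rule card_of_ordLeqI[where f = "\<lambda>x. (i, x)"]) (auto simp: inj_on_def i)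
      ultimately show False using not_ordLess_ordLeq by blast
    qed
  qed
qed

end

section \<open>Counting the models of a homogeneous tree\<close>

text \<open>The group generated by a set of involutions, written out so that its size is visible.\<close>

definition flips :: "('t \<Rightarrow> 't) set \<Rightarrow> ('t \<Rightarrow> 't) set" where
  "flips S = (\<lambda>ps. foldr (\<circ>) ps id) ` lists S"

lemma flips_id: "id \<in> flips S" unfolding flips_def by (rule image_eqI[of _ _ "[]"]) auto

lemma flips_single: "p \<in> S \<Longrightarrow> p \<in> flips S"
  unfolding flips_def by (rule image_eqI[of _ _ "[p]"]) auto

lemma foldr_comp_append: "foldr (\<circ>) (ps @ qs) id = foldr (\<circ>) ps id \<circ> foldr (\<circ>) qs id"
  by (induction ps) (auto simp: comp_assoc)

lemma flips_comp: assumes "p \<in> flips S" "q \<in> flips S" shows "p \<circ> q \<in> flips S"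
proof -
  obtain ps qs where "p = foldr (\<circ>) ps id" "q = foldr (\<circ>) qs id" "ps \<in> lists S" "qs \<in> lists S"
    using assms by (auto simp: flips_def)
  then show ?thesis unfolding flips_def
    by (intro image_eqI[of _ _ "ps @ qs"]) (simp_all only: foldr_comp_append append_in_lists_conv simp_thms)
qed

lemma flips_inverse:
  assumes inv: "\<And>p. p \<in> S \<Longrightarrow> p \<circ> p = id" and p: "p \<in> flips S"
  shows "\<exists>q\<in>flips S. p \<circ> q = id \<and> q \<circ> p = id"
proof -
  have *: "foldr (\<circ>) ps id \<circ> foldr (\<circ>) (rev ps) id = id" if "ps \<in> lists S" for ps
    using that
  proof (induction ps)
    case (Cons a ps)
    have a: "a \<in> S" using Cons.hyps by simp
    have 1: "foldr (\<circ>) (rev (a # ps)) id = foldr (\<circ>) (rev ps) id \<circ> a"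
      unfolding rev.simps foldr_comp_append by simp
    have "foldr (\<circ>) (a # ps) id \<circ> foldr (\<circ>) (rev (a # ps)) id =
        a \<circ> (foldr (\<circ>) ps id \<circ> foldr (\<circ>) (rev ps) id) \<circ> a"
      unfolding 1 foldr.simps by (simp only: comp_assoc comp_apply)
    also have "\<dots> = id" unfolding Cons.IH using inv[OF a] by simp
    finally show ?case .
  qed simp
  obtain ps where ps: "p = foldr (\<circ>) ps id" "ps \<in> lists S" using p by (auto simp: flips_def)
  have r: "rev ps \<in> lists S" using ps(2) by auto
  show ?thesis
  proof (intro bexI conjI)
    show "p \<circ> foldr (\<circ>) (rev ps) id = id" using *[OF ps(2)] ps(1) by simp
    show "foldr (\<circ>) (rev ps) id \<circ> p = id" using *[OF r] ps(1) by simp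
    show "foldr (\<circ>) (rev ps) id \<in> flips S" using r by (auto simp: flips_def)
  qed
qed

lemma flips_inv: assumes "\<And>p. p \<in> S \<Longrightarrow> p \<circ> p = id" "p \<in> flips S" shows "inv p \<in> flips S" "bij p"
proof -
  obtain q where q: "q \<in> flips S" "p \<circ> q = id" "q \<circ> p = id" using flips_inverse[OF assms] by blast
  show "inv p \<in> flips S" using inv_unique_comp[OF q(2,3)] q(1) by simp
  show "bij p" using o_bij[OF q(3,2)] .
qed

lemma flips_closed:
  assumes "\<And>p t. p \<in> S \<Longrightarrow> t \<in> X \<Longrightarrow> p t \<in> X" "p \<in> flips S" "t \<in> X" shows "p t \<in> X"
proof -
  have "foldr (\<circ>) ps id t \<in> X" if "ps \<in> lists S" for ps
    using that by (induction ps) (auto simp: assms)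
  then show ?thesis using assms(2) by (auto simp: flips_def)
qed

lemma (in singular) flips_tiny: "tiny S \<Longrightarrow> tiny (flips S)"
  unfolding flips_def by (intro tiny_image tiny_lists)

lemma iso_refl: "isomorphic voc M M"
  unfolding isomorphic_def by (rule exI[of _ id]) auto

lemma iso_sym: assumes "isomorphic voc M N" shows "isomorphic voc N M"
proof -
  obtain f where f: "bij_betw f (universe M) (universe N)"
    and R: "\<And>R n xs. voc R = Some n \<Longrightarrow> set xs \<subseteq> universe M \<Longrightarrow> length xs = n \<Longrightarrow>
        xs \<in> interp M R \<longleftrightarrow> map f xs \<in> interp N R" using assms unfolding isomorphic_def by blast
  let ?g = "inv_into (universe M) f"
  show ?thesis unfolding isomorphic_def
  proof (intro exI[of _ ?g] conjI allI impI)
    show "bij_betw ?g (universe N) (universe M)" using bij_betw_inv_into[OF f] .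
    fix R n xs assume *: "voc R = Some n \<and> set xs \<subseteq> universe N \<and> length xs = n"
    have im: "f ` universe M = universe N" using f by (simp add: bij_betw_def)
    have 1: "set (map ?g xs) \<subseteq> universe M" using * im inv_into_into[of _ f "universe M"] by auto
    have "map f (map ?g xs) = xs"
      by (rule map_idI[of xs "f \<circ> ?g", folded map_map, unfolded map_map[symmetric]])
        (use * im f_inv_into_f[of _ f "universe M"] in auto)
    then show "xs \<in> interp N R \<longleftrightarrow> map ?g xs \<in> interp M R" using R[of R n "map ?g xs"] * 1 by simp
  qed
qed

lemma iso_trans: assumes "isomorphic voc M N" "isomorphic voc N L" shows "isomorphic voc M L"
proof -
  obtain f where f: "bij_betw f (universe M) (universe N)"
    and R: "\<And>R n xs. voc R = Some n \<Longrightarrow> set xs \<subseteq> universe M \<Longrightarrow> length xs = n \<Longrightarrow>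
        xs \<in> interp M R \<longleftrightarrow> map f xs \<in> interp N R" using assms(1) unfolding isomorphic_def by blast
  obtain g where g: "bij_betw g (universe N) (universe L)"
    and S: "\<And>R n xs. voc R = Some n \<Longrightarrow> set xs \<subseteq> universe N \<Longrightarrow> length xs = n \<Longrightarrow>
        xs \<in> interp N R \<longleftrightarrow> map g xs \<in> interp L R" using assms(2) unfolding isomorphic_def by blast
  show ?thesis unfolding isomorphic_def
  proof (intro exI[of _ "g \<circ> f"] conjI allI impI)
    show "bij_betw (g \<circ> f) (universe M) (universe L)" using bij_betw_trans[OF f g] .
    fix R n xs assume *: "voc R = Some n \<and> set xs \<subseteq> universe M \<and> length xs = n"
    have "set (map f xs) \<subseteq> universe N" using * f by (auto simp: bij_betw_def)
    then show "xs \<in> interp M R \<longleftrightarrow> map (g \<circ> f) xs \<in> interp L R"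
      using R[of R n xs] S[of R n "map f xs"] * by simp
  qed
qed

text \<open>The data from which the structures are built, without the auxiliary orders and groups.\<close>

locale homogeneous_tree = singular lam kap for lam :: "'a rel" and kap :: "'k rel" +
  fixes T :: "'k \<Rightarrow> 't set" and pr :: "'k \<Rightarrow> 'k \<Rightarrow> 't \<Rightarrow> 't" and sw :: "'k \<Rightarrow> 't \<Rightarrow> 't \<Rightarrow> 't \<Rightarrow> 't"
    and UF :: "('k \<times> 'k) set set"
  assumes T_tiny: "j \<in> K \<Longrightarrow> |T j| <o lam"
    and T_pr: "le i j \<Longrightarrow> t \<in> T j \<Longrightarrow> pr j i t \<in> T i"
    and sw_T: "j \<in> K \<Longrightarrow> a \<in> T j \<Longrightarrow> b \<in> T j \<Longrightarrow> t \<in> T j \<Longrightarrow> sw j a b t \<in> T j"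
    and sw_sw: "j \<in> K \<Longrightarrow> a \<in> T j \<Longrightarrow> b \<in> T j \<Longrightarrow> sw j a b (sw j a b t) = t"
    and sw_eq: "j \<in> K \<Longrightarrow> a \<in> T j \<Longrightarrow> b \<in> T j \<Longrightarrow> sw j a b a = b"
    and sw_mv: "j \<in> K \<Longrightarrow> a \<in> T j \<Longrightarrow> b \<in> T j \<Longrightarrow> t \<in> T j \<Longrightarrow> sw j a b t \<noteq> t \<Longrightarrow>
        {i. le i j \<and> pr j i a = pr j i t} \<noteq> {i. le i j \<and> pr j i b = pr j i t}"
    and sw_pr: "le i j \<Longrightarrow> a \<in> T j \<Longrightarrow> b \<in> T j \<Longrightarrow> t \<in> T j \<Longrightarrow>
        pr j i (sw j a b t) = sw i (pr j i a) (pr j i b) (pr j i t)"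
    and box_filter: "box_filter UF" and ultra: "X \<subseteq> Ind \<Longrightarrow> X \<in> UF \<or> Ind - X \<in> UF"
begin

definition thread where
  "thread x \<longleftrightarrow> (\<forall>j\<in>K. x j \<in> T j) \<and> (\<forall>i j. le i j \<longrightarrow> pr j i (x j) = x i)"

text \<open>For almost all places, the two threads meet each point of the tree in the same levels.\<close>

definition same_type where
  "same_type s s' \<longleftrightarrow> (\<forall>j\<in>K. \<forall>t\<in>T j.
      {p \<in> Ind. {i. le i j \<and> pr j i (s p j) = pr j i t} = {i. le i j \<and> pr j i (s' p j) = pr j i t}} \<in> UF)"

definition threads :: "('k \<times> 'k \<Rightarrow> 'k \<Rightarrow> 't) set" where "threads = {s. \<forall>p\<in>Ind. thread (s p)}"

lemma UF_props:
  "X \<in> UF \<Longrightarrow> X \<subseteq> Y \<Longrightarrow> Y \<subseteq> Ind \<Longrightarrow> Y \<in> UF" "X \<in> UF \<Longrightarrow> Y \<in> UF \<Longrightarrow> X \<inter> Y \<in> UF"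
  "X \<in> UF \<Longrightarrow> X \<subseteq> Ind" "{} \<notin> UF" "admissible h k \<Longrightarrow> tail_box h k \<in> UF"
  using box_filter unfolding box_filter_def by blast+

lemma Ind_UF: "Ind \<in> UF"
proof -
  have "\<forall>d\<in>Lim. \<exists>k. lt k d" by (simp add: Lim_def)
  then obtain k where "\<And>d. d \<in> Lim \<Longrightarrow> lt (k d) d" by metis
  then have "admissible (\<lambda>i. i) k" by (simp add: admissible_def)
  then show ?thesis using UF_props(1)[OF UF_props(5)] by (auto simp: tail_box_def)
qed

theorem homogeneous_tree_models:
  assumes oo: "thread oo"
  obtains voc :: "'a set vocabulary" and mdl where
    "\<And>s. is_model voc (mdl s)" "\<And>s. |universe (mdl s :: ('a, 'a set) model)| =o lam"
    "\<And>s s'. s \<in> threads \<Longrightarrow> s' \<in> threads \<Longrightarrow> L_inf_equiv lam voc (mdl s) (mdl s')"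
    "\<And>N. is_model voc N \<Longrightarrow> L_inf_equiv lam voc N (mdl (\<lambda>_. oo)) \<Longrightarrow> \<exists>s\<in>threads. isomorphic voc (mdl s) N"
    "\<And>s s'. s \<in> threads \<Longrightarrow> s' \<in> threads \<Longrightarrow> same_type s s' \<Longrightarrow> isomorphic voc (mdl s) (mdl s')"
    "\<And>s s' j t. s \<in> threads \<Longrightarrow> s' \<in> threads \<Longrightarrow> isomorphic voc (mdl s) (mdl s') \<Longrightarrow> j \<in> K \<Longrightarrow>
       {p \<in> Ind. s p j = t} \<in> UF \<Longrightarrow> {p \<in> Ind. s' p j = t} \<in> UF"
proof -
  show ?thesis
  proof (rule thresholds)
  fix Th :: "'k \<Rightarrow> 'a set set" and tl
  assume Th:
    "\<And>i. i \<in> K \<Longrightarrow> Th i \<noteq> {}"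
    "\<And>i x. \<not> tl i x x"
    "\<And>i x y z. tl i x y \<Longrightarrow> tl i y z \<Longrightarrow> tl i x z"
    "\<And>i x y. x \<in> Th i \<Longrightarrow> y \<in> Th i \<Longrightarrow> tl i x y \<or> x = y \<or> tl i y x"
    "\<And>i f. i \<in> K \<Longrightarrow> (\<And>d. d \<in> K \<Longrightarrow> f d \<in> Th i) \<Longrightarrow> \<exists>b\<in>Th i. \<forall>d\<in>K. tl i (f d) b"
    "\<And>d g. d \<in> K \<Longrightarrow> (\<And>i b. lt i d \<Longrightarrow> b \<in> Th i \<Longrightarrow> g i b \<in> Th d) \<Longrightarrow>
        \<exists>c\<in>Th d. \<forall>i b. lt i d \<longrightarrow> b \<in> Th i \<longrightarrow> tl d (g i b) c"
    "\<And>i. i \<in> K \<Longrightarrow> |Th i| <o lam"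
    "\<And>a. a \<in> Field lam \<Longrightarrow> \<exists>i0\<in>K. \<forall>i. lt i0 i \<longrightarrow>
        (\<forall>Y \<subseteq> Th i. |Y| \<le>o |underS lam a| \<longrightarrow> (\<exists>b\<in>Th i. \<forall>y\<in>Y. tl i y b))"
    "lam \<le>o |SIGMA i:K. Th i|"
  define S where "S j = (\<lambda>(a, b). sw j a b) ` (T j \<times> T j)" for j
  define A where "A j = flips (S j)" for j
  have Sinv: "p \<circ> p = id" if "j \<in> K" "p \<in> S j" for j p
    using that sw_sw by (auto simp: S_def fun_eq_iff)
  have ST: "p t \<in> T j" if "j \<in> K" "p \<in> S j" "t \<in> T j" for j p t using that sw_T by (auto simp: S_def)
  interpret hidden_threads lam kap Th tl T pr A UF oo
  proof
    show "tiny (A j)" if "j \<in> K" for j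
      unfolding A_def S_def by (intro flips_tiny tiny_image tiny_Times T_tiny that)
    show "{(i, d). (i, d) \<in> Ind \<and> \<not> lt i (k d) \<and> \<not> lt d (h i)} \<in> UF"
      if "\<And>i. i \<in> K \<Longrightarrow> h i \<in> K" "\<And>d. d \<in> Lim \<Longrightarrow> lt (k d) d" for h k
      using UF_props(5)[of h k] that by (simp add: tail_box_def admissible_def)
    show "inv p \<in> A j" if "j \<in> K" "p \<in> A j" for j p
      using flips_inv(1)[OF Sinv[OF that(1)] that(2)[unfolded A_def]] by (simp add: A_def)
    show "bij p" if "j \<in> K" "p \<in> A j" for j p
      using flips_inv(2)[OF Sinv[OF that(1)] that(2)[unfolded A_def]] .
    show "p t \<in> T j" if "j \<in> K" "p \<in> A j" "t \<in> T j" for j p t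
      by (rule flips_closed[of "S j" "T j", OF _ that(2)[unfolded A_def] that(3)]) (rule ST[OF that(1)])
    show "Th i \<noteq> {}" "tiny (Th i)" if "i \<in> K" for i by (rule Th(1)[OF that], rule Th(7)[OF that])
    show "\<not> tl i x x" for i x by (rule Th(2))
    show "tl i x z" if "tl i x y" "tl i y z" for i x y z by (rule Th(3)[OF that])
    show "tl i x y \<or> x = y \<or> tl i y x" if "x \<in> Th i" "y \<in> Th i" for i x y by (rule Th(4)[OF that])
    show "\<exists>b\<in>Th i. \<forall>d\<in>K. tl i (f d) b" if "i \<in> K" "\<And>d. d \<in> K \<Longrightarrow> f d \<in> Th i" for i f
      by (rule Th(5)[OF that])
    show "\<exists>c\<in>Th d. \<forall>i b. lt i d \<longrightarrow> b \<in> Th i \<longrightarrow> tl d (g i b) c"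
      if "d \<in> K" "\<And>i b. lt i d \<Longrightarrow> b \<in> Th i \<Longrightarrow> g i b \<in> Th d" for d g by (rule Th(6)[OF that])
    show "\<exists>i0\<in>K. \<forall>i. lt i0 i \<longrightarrow>
        (\<forall>Y \<subseteq> Th i. |Y| \<le>o |underS lam a| \<longrightarrow> (\<exists>b\<in>Th i. \<forall>y\<in>Y. tl i y b))" if "a \<in> Field lam" for a
      by (rule Th(8)[OF that])
    show "lam \<le>o |SIGMA i:K. Th i|" by (rule Th(9))
    show "pr j i t \<in> T i" if "le i j" "t \<in> T j" for i j t by (rule T_pr[OF that])
    show "id \<in> A j" for j by (simp add: A_def flips_id)
    show "p \<circ> q \<in> A j" if "p \<in> A j" "q \<in> A j" for j p q using that by (simp add: A_def flips_comp)
    show "oo j \<in> T j" if "j \<in> K" for j using oo that by (simp add: thread_def)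
    show "pr j i (oo j) = oo i" if "le i j" for i j using oo that by (simp add: thread_def)
    show "Y \<in> UF" if "X \<in> UF" "X \<subseteq> Y" "Y \<subseteq> Ind" for X Y by (rule UF_props(1)[OF that])
    show "X \<inter> Y \<in> UF" if "X \<in> UF" "Y \<in> UF" for X Y by (rule UF_props(2)[OF that])
    show "X \<subseteq> Ind" if "X \<in> UF" for X by (rule UF_props(3)[OF that])
    show "{} \<notin> UF" by (rule UF_props(4))
  qed
  have thr: "thr = thread" by (simp add: fun_eq_iff thr_def thread_def)
  obtain enc :: "('k, 'a set, 't) el \<Rightarrow> 'a" and \<sigma> :: "('k, 'a set, 't) sym \<Rightarrow> 'a set"
    where e: "inj_on enc UU" "inj_on \<sigma> SYM" by (rule encodings)
  interpret homogeneous lam kap Th tl T pr A UF oo enc \<sigma> sw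
  proof
    show "tree_auto (\<lambda>j. sw j (x j) (y j))" if "thr x" "thr y" for x y
    proof -
      have x: "\<And>j. j \<in> K \<Longrightarrow> x j \<in> T j" "\<And>i j. le i j \<Longrightarrow> pr j i (x j) = x i"
        and y: "\<And>j. j \<in> K \<Longrightarrow> y j \<in> T j" "\<And>i j. le i j \<Longrightarrow> pr j i (y j) = y i"
        using that by (auto simp: thr_def)
      have "sw j (x j) (y j) \<in> A j" if "j \<in> K" for j
        unfolding A_def S_def by (rule flips_single) (use x(1) y(1) that in force)
      moreover have "pr j i (sw j (x j) (y j) t) = sw i (x i) (y i) (pr j i t)" if "le i j" "t \<in> T j" for i j t
        using sw_pr[OF that(1) x(1) y(1) that(2)] le_K[OF that(1)] x(2)[OF that(1)] y(2)[OF that(1)] by simp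
      ultimately show ?thesis by (simp add: tree_auto_def)
    qed
  qed (fact e sw_eq sw_mv)+
  define md where "md s = mdl (\<lambda>i d. s (i, d))" for s
  show thesis
  proof (rule that[of voc md])
    show "is_model voc (md s)" "|universe (md s)| =o lam" for s
      unfolding md_def by (rule mdl_model mdl_card)+
    show "L_inf_equiv lam voc (md s) (md s')" if "s \<in> threads" "s' \<in> threads" for s s'
      unfolding md_def by (rule mdl_equiv) (use that in \<open>auto simp: threads_def thr\<close>)
    show "isomorphic voc (md s) (md s')" if "s \<in> threads" "s' \<in> threads" "same_type s s'" for s s'
      unfolding md_def
      by (rule same_type_iso) (use that in \<open>auto simp: threads_def thr same_type_def\<close>)
    show "{p \<in> Ind. s' p j = t} \<in> UF"
      if "s \<in> threads" "s' \<in> threads" "isomorphic voc (md s) (md s')" "j \<in> K" "{p \<in> Ind. s p j = t} \<in> UF" for s s' j t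
      by (rule iso_limit[OF _ _ that(3)[unfolded md_def] that(4,5)]) (use that in \<open>auto simp: threads_def thr\<close>)
    show "\<exists>s\<in>threads. isomorphic voc (md s) N"
      if N: "is_model voc N" "L_inf_equiv lam voc N (md (\<lambda>_. oo))" for N
    proof -
      interpret equivalent lam kap Th tl T pr A UF oo enc \<sigma> sw N
        by unfold_locales (use N in \<open>simp_all add: md_def\<close>)
      obtain s where s: "\<And>i d. (i, d) \<in> Ind \<Longrightarrow> thr (s i d)" "isomorphic voc (mdl s) N"
        by (rule classification) (rule that)
      then have "case_prod s \<in> threads" by (auto simp: threads_def thr)
      moreover have "md (case_prod s) = mdl s" by (simp add: md_def)
      ultimately show ?thesis using s(2) by metis
    qed
  qed
  qed
qed

text \<open>Constant families of different threads are not isomorphic, by \<open>iso_limit\<close>. This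
  gives the lower bound; the codes of types give the upper bound, since every equivalent model
  hides some family.\<close>

theorem count_models:
  assumes oo: "thread oo" and mu: "|X :: 'x set| =o mu" and thr: "\<And>x. x \<in> X \<Longrightarrow> thread (g x)"
    and sep: "\<And>x y. x \<in> X \<Longrightarrow> y \<in> X \<Longrightarrow> x \<noteq> y \<Longrightarrow> \<exists>j\<in>K. g x j \<noteq> g y j"
    and cd: "\<And>s. s \<in> threads \<Longrightarrow> cd s \<in> Y" "\<And>s s'. s \<in> threads \<Longrightarrow> s' \<in> threads \<Longrightarrow> cd s = cd s' \<Longrightarrow> same_type s s'"
    and Y: "|Y| \<le>o mu"
  shows "\<exists>(voc :: 'a set vocabulary) (M :: ('a, 'a set) model).
           is_model voc M \<and> |universe M| =o lam \<and> No lam voc M =o mu"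
proof -
  show ?thesis
  proof (rule homogeneous_tree_models[OF oo])
  fix voc :: "'a set vocabulary" and mdl :: "('k \<times> 'k \<Rightarrow> 'k \<Rightarrow> 't) \<Rightarrow> ('a, 'a set) model"
  assume m:
    "\<And>s. is_model voc (mdl s)" "\<And>s. |universe (mdl s)| =o lam"
    "\<And>s s'. s \<in> threads \<Longrightarrow> s' \<in> threads \<Longrightarrow> L_inf_equiv lam voc (mdl s) (mdl s')"
    "\<And>N. is_model voc N \<Longrightarrow> L_inf_equiv lam voc N (mdl (\<lambda>_. oo)) \<Longrightarrow> \<exists>s\<in>threads. isomorphic voc (mdl s) N"
    "\<And>s s'. s \<in> threads \<Longrightarrow> s' \<in> threads \<Longrightarrow> same_type s s' \<Longrightarrow> isomorphic voc (mdl s) (mdl s')"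
    "\<And>s s' j t. s \<in> threads \<Longrightarrow> s' \<in> threads \<Longrightarrow> isomorphic voc (mdl s) (mdl s') \<Longrightarrow> j \<in> K \<Longrightarrow>
       {p \<in> Ind. s p j = t} \<in> UF \<Longrightarrow> {p \<in> Ind. s' p j = t} \<in> UF"
  define M where "M = mdl (\<lambda>_. oo)"
  define NN where "NN = {N. is_model voc N \<and> |universe N| =o lam \<and> L_inf_equiv lam voc N M}"
  have oo': "(\<lambda>_. oo) \<in> threads" using oo by (simp add: threads_def)
  have mdlNN: "mdl s \<in> NN" if "s \<in> threads" for s using m(1,2,3) that oo' by (simp add: NN_def M_def)
  have cls: "iso_rel voc `` {N} = iso_rel voc `` {N'}"
    if "isomorphic voc N N'" "is_model voc N" "is_model voc N'" for N N' :: "('a, 'a set) model"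
    using that iso_sym iso_trans unfolding iso_rel_def by blast
  have cls': "isomorphic voc N N'"
    if "iso_rel voc `` {N} = iso_rel voc `` {N'}" "is_model voc N'" for N N' :: "('a, 'a set) model"
  proof -
    have "N' \<in> iso_rel voc `` {N'}" using that(2) iso_refl by (auto simp: iso_rel_def)
    then show ?thesis using that(1) by (auto simp: iso_rel_def)
  qed
  have "|NN // iso_rel voc| \<le>o |Y|"
  proof -
    have "\<exists>s. s \<in> threads \<and> C = iso_rel voc `` {mdl s}" if C: "C \<in> NN // iso_rel voc" for C
    proof -
      obtain N where N: "N \<in> NN" "C = iso_rel voc `` {N}" using C by (auto simp: quotient_def)
      then obtain s where "s \<in> threads" "isomorphic voc (mdl s) N" using m(4) by (auto simp: NN_def M_def)
      then show ?thesis using cls[of "mdl s" N] m(1) N by (auto simp: NN_def)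
    qed
    then obtain r where r: "\<And>C. C \<in> NN // iso_rel voc \<Longrightarrow> r C \<in> threads \<and> C = iso_rel voc `` {mdl (r C)}" by metis
    show ?thesis
    proof (rule card_of_ordLeqI[where f = "\<lambda>C. cd (r C)"])
      show "inj_on (\<lambda>C. cd (r C)) (NN // iso_rel voc)"
      proof (rule inj_onI)
        fix C C' assume C: "C \<in> NN // iso_rel voc" "C' \<in> NN // iso_rel voc" and eq: "cd (r C) = cd (r C')"
        have "isomorphic voc (mdl (r C)) (mdl (r C'))" using m(5) cd(2) r[OF C(1)] r[OF C(2)] eq by blast
        then show "C = C'" using cls[of "mdl (r C)" "mdl (r C')"] m(1) r[OF C(1)] r[OF C(2)] by metis
      qed
    qed (use r cd(1) in blast)
  qed
  moreover have "|X| \<le>o |NN // iso_rel voc|"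
  proof (rule card_of_ordLeqI[where f = "\<lambda>x. iso_rel voc `` {mdl (\<lambda>_. g x)}"])
    have gt: "(\<lambda>_. g x) \<in> threads" if "x \<in> X" for x using thr[OF that] by (simp add: threads_def)
    show "iso_rel voc `` {mdl (\<lambda>_. g x)} \<in> NN // iso_rel voc" if "x \<in> X" for x
      by (rule quotientI[OF mdlNN[OF gt[OF that]]])
    show "inj_on (\<lambda>x. iso_rel voc `` {mdl (\<lambda>_. g x)}) X"
    proof (rule inj_onI, rule ccontr)
      fix x y assume xy: "x \<in> X" "y \<in> X" "iso_rel voc `` {mdl (\<lambda>_. g x)} = iso_rel voc `` {mdl (\<lambda>_. g y)}" "x \<noteq> y"
      have iso: "isomorphic voc (mdl (\<lambda>_. g x)) (mdl (\<lambda>_. g y))" by (rule cls'[OF xy(3) m(1)])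
      obtain j where j: "j \<in> K" "g x j \<noteq> g y j" using sep xy by blast
      have "{p \<in> Ind. g x j = g x j} \<in> UF" using Ind_UF by simp
      then have "{p \<in> Ind. g y j = g x j} \<in> UF" by (rule m(6)[OF gt[OF xy(1)] gt[OF xy(2)] iso j(1)])
      then show False using j(2) UF_props(4) by simp
    qed
  qed
  ultimately have "|NN // iso_rel voc| =o mu"
    using mu Y ordLeq_transitive ordIso_iff_ordLeq ordIso_symmetric
    by (metis ordIso_ordLeq_trans)
  then have "No lam voc M =o mu" by (simp add: No_def NN_def)
  then show ?thesis using m(1,2) unfolding M_def by blast
  qed
qed

end

section \<open>Constant trees, and trees of finite sets\<close>

lemma wfp_minimal_ex: "wfp r \<Longrightarrow> U x \<Longrightarrow> \<exists>y. U y \<and> (\<forall>z. r z y \<longrightarrow> \<not> U z)"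
  by (induction x rule: wfp_induct_rule) blast

context homogeneous_tree
begin

lemma ae_conj: assumes "{p \<in> Ind. U p} \<in> UF" "{p \<in> Ind. W p} \<in> UF"
    "\<And>p. p \<in> Ind \<Longrightarrow> U p \<Longrightarrow> W p \<Longrightarrow> Z p" shows "{p \<in> Ind. Z p} \<in> UF"
  by (rule UF_props(1)[OF UF_props(2)[OF assms(1,2)]]) (use assms(3) in auto)

lemma ae_ex: assumes "{p \<in> Ind. U p} \<in> UF" obtains p where "p \<in> Ind" "U p"
proof -
  have "{p \<in> Ind. U p} \<noteq> {}" using assms UF_props(4) by metis
  then show ?thesis using that by blast
qed

lemma ae_not: assumes "\<not> {p \<in> Ind. U p} \<in> UF" shows "{p \<in> Ind. \<not> U p} \<in> UF"
proof -
  have "{p \<in> Ind. U p} \<subseteq> Ind" by auto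
  then have "Ind - {p \<in> Ind. U p} \<in> UF" using ultra assms by blast
  moreover have "Ind - {p \<in> Ind. U p} = {p \<in> Ind. \<not> U p}" by auto
  ultimately show ?thesis by simp
qed

lemma ae_finite:
  assumes "finite V" "{p \<in> Ind. f p \<in> V} \<in> UF" shows "\<exists>v\<in>V. {p \<in> Ind. f p = v} \<in> UF"
  using assms
proof (induction V)
  case empty
  then show ?case using UF_props(4) by simp
next
  case (insert v V)
  show ?case
  proof (cases "{p \<in> Ind. f p = v} \<in> UF")
    case False
    have "{p \<in> Ind. f p \<in> V} \<in> UF"
      by (rule ae_conj[OF insert.prems ae_not[OF False]]) auto
    then show ?thesis using insert.IH by blast
  qed simp
qed

end

context singular
begin

text \<open>The tree is constant with \<open>mu\<close> branches. A family is determined, up to its type,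
  by its limit along the ultrafilter, or by having no limit. The latter adds one type, but only
  when \<open>mu\<close> is infinite.\<close>

theorem few_models:
  fixes mu :: "'m rel"
  assumes mu: "Card_order mu" "Field mu \<noteq> {}" "mu <o lam"
  shows "\<exists>(voc :: 'a set vocabulary) (M :: ('a, 'a set) model).
           is_model voc M \<and> |universe M| =o lam \<and> No lam voc M =o mu"
proof -
  have F: "|Field mu| =o mu" by (rule card_of_Field_ordIso[OF mu(1)])
  have tF: "tiny (Field mu)" using F mu(3) ordIso_ordLess_trans by blast
  show ?thesis
  proof (rule ultrafilter)
    fix UF assume UF: "box_filter UF" "\<And>X. X \<subseteq> Ind \<Longrightarrow> X \<in> UF \<or> Ind - X \<in> UF"
    define sw where "sw = (\<lambda>(j :: 'k) (a :: 'm) b t. if t = a then b else if t = b then a else t)"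
    define pr where "pr = (\<lambda>(j :: 'k) (i :: 'k) (t :: 'm). t)"
    interpret homogeneous_tree lam kap "\<lambda>_. Field mu" pr sw UF
    proof
      show "{i. le i j \<and> pr j i a = pr j i t} \<noteq> {i. le i j \<and> pr j i b = pr j i t}"
        if "j \<in> K" "sw j a b t \<noteq> t" for j a b t
      proof -
        have "(a = t) \<noteq> (b = t)" using that(2) by (auto simp: sw_def split: if_splits)
        moreover have "le j j" using that(1) le_refl by blast
        ultimately show ?thesis by (auto simp: pr_def)
      qed
    qed (use UF tF in \<open>auto simp: sw_def pr_def\<close>)
    obtain j0 where j0: "j0 \<in> K" using K_inf by fastforce
    have const: "s p j = s p j0" if "s \<in> threads" "p \<in> Ind" "j \<in> K" for s p j
    proof -
      have "thread (s p)" using that by (simp add: threads_def)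
      then have "s p j = s p i" if "le i j" for i j using that by (simp add: thread_def) (simp add: pr_def)
      then show ?thesis using le_total[OF j0 that(3)] by metis
    qed
    have inF: "s p j0 \<in> Field mu" if "s \<in> threads" "p \<in> Ind" for s p
      using that j0 by (auto simp: threads_def thread_def)
    define lim where "lim s t \<longleftrightarrow> {p \<in> Ind. s p j0 = t} \<in> UF" for s :: "'k \<times> 'k \<Rightarrow> 'k \<Rightarrow> 'm" and t
    define cd where "cd s = (if \<exists>t. lim s t then Some (SOME t. lim s t) else None)" for s
    obtain x0 where x0: "x0 \<in> Field mu" using mu(2) by blast
    show ?thesis
    proof (rule count_models[of "\<lambda>_. x0" "Field mu" mu "\<lambda>x _. x" cd "cd ` threads"])
      show "thread (\<lambda>_. x0)" unfolding thread_def using x0 by (simp add: pr_def)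
      show "|Field mu| =o mu" by (rule F)
      show "thread (\<lambda>_. x)" if "x \<in> Field mu" for x unfolding thread_def using that by (simp add: pr_def)
      show "\<exists>j\<in>K. x \<noteq> y" if "x \<noteq> y" for x y :: 'm using j0 that by blast
      show "cd s \<in> cd ` threads" if "s \<in> threads" for s using that by simp
      show "same_type s s'" if s: "s \<in> threads" "s' \<in> threads" and eq: "cd s = cd s'" for s s'
        unfolding same_type_def
      proof (intro ballI)
        fix j t assume j: "j \<in> K" "t \<in> Field mu"
        have "{p \<in> Ind. (s p j0 = t) = (s' p j0 = t)} \<in> UF"
        proof (cases "\<exists>t. lim s t")
          case True
          then have "lim s (SOME t. lim s t)" by (rule someI_ex)
          moreover have "\<exists>t. lim s' t" using True eq by (auto simp: cd_def split: if_splits)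
          then have "lim s' (SOME t. lim s' t)" by (rule someI_ex)
          moreover have "(SOME t. lim s t) = (SOME t. lim s' t)"
            using True eq by (auto simp: cd_def split: if_splits)
          ultimately obtain v where "lim s v" "lim s' v" by metis
          then show ?thesis unfolding lim_def by (rule ae_conj) simp
        next
          case False
          then have "\<not> lim s t" "\<not> lim s' t" using eq by (auto simp: cd_def split: if_splits)
          note n = this[unfolded lim_def]
          have "{p \<in> Ind. s p j0 \<noteq> t} \<in> UF" by (rule ae_not[OF n(1)])
          moreover have "{p \<in> Ind. s' p j0 \<noteq> t} \<in> UF" by (rule ae_not[OF n(2)])
          ultimately show ?thesis by (rule ae_conj) simp
        qed
        then show "{p \<in> Ind. {i. le i j \<and> pr j i (s p j) = pr j i t} = {i. le i j \<and> pr j i (s' p j) = pr j i t}} \<in> UF"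
        proof (rule UF_props(1))
          show "{p \<in> Ind. (s p j0 = t) = (s' p j0 = t)} \<subseteq>
              {p \<in> Ind. {i. le i j \<and> pr j i (s p j) = pr j i t} = {i. le i j \<and> pr j i (s' p j) = pr j i t}}"
            using const[OF s(1) _ j(1)] const[OF s(2) _ j(1)] by (auto simp: pr_def)
        qed auto
      qed
      have V: "v \<in> Field mu" if "s \<in> threads" "lim s v" for s v
        using ae_ex[OF that(2)[unfolded lim_def]] inF[OF that(1)] by metis
      have Y: "cd ` threads \<subseteq> insert None (Some ` Field mu)"
        using V someI_ex[of "lim _"] by (auto simp: cd_def)
      show "|cd ` threads| \<le>o mu"
      proof (cases "finite (Field mu)")
        case True
        have "\<exists>t. lim s t" if "s \<in> threads" for s
        proof -
          have "{p \<in> Ind. s p j0 \<in> Field mu} = Ind" using inF that by auto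
          then show ?thesis using ae_finite[OF True, of "\<lambda>p. s p j0"] Ind_UF by (auto simp: lim_def)
        qed
        then have "cd ` threads \<subseteq> Some ` Field mu" using Y by (auto simp: cd_def)
        then have "|cd ` threads| \<le>o |Field mu|" by (rule ordLeq_transitive[OF card_of_mono1 card_of_image])
        then show ?thesis using F ordLeq_ordIso_trans by blast
      next
        case False
        have "|{None :: 'm option}| \<le>o mu"
          by (rule ordLeq_ordIso_trans[OF card_of_singl_ordLeq[OF mu(2)] F])
        moreover have "|Some ` Field mu| \<le>o mu" by (rule ordLeq_ordIso_trans[OF card_of_image F])
        ultimately have "|{None} \<union> Some ` Field mu| \<le>o mu"
          by (rule card_of_Un_ordLeq_infinite_Field[OF False _ _ mu(1)])
        moreover have "|cd ` threads| \<le>o |{None} \<union> Some ` Field mu|" using Y by (intro card_of_mono1) simp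
        ultimately show ?thesis using ordLeq_transitive by blast
      qed
    qed
  qed
qed

end

definition symdiff :: "'x set \<Rightarrow> 'x set \<Rightarrow> 'x set" where "symdiff X Y = (X - Y) \<union> (Y - X)"

lemma symdiff_self [simp]: "symdiff X X = {}" and symdiff_empty [simp]: "symdiff X {} = X" "symdiff {} X = X"
  by (auto simp: symdiff_def)

lemma symdiff_cancel: "symdiff X (symdiff X Y) = Y" "symdiff X (symdiff Y X) = Y" by (auto simp: symdiff_def)

lemma symdiff_finite: "finite X \<Longrightarrow> finite Y \<Longrightarrow> finite (symdiff X Y)" by (simp add: symdiff_def)

lemma odd_card_sd:
  assumes "finite X" "finite Y" shows "odd (card (symdiff X Y)) \<longleftrightarrow> odd (card X) \<noteq> odd (card Y)"
proof -
  have "card X = card (X - Y) + card (X \<inter> Y)" "card Y = card (Y - X) + card (X \<inter> Y)"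
    using assms by (metis card_Diff_subset_Int card_mono add.commute finite_Int inf_le1 le_add_diff_inverse,
        metis card_Diff_subset_Int card_mono add.commute finite_Int inf_le1 le_add_diff_inverse inf_commute)
  moreover have "card (symdiff X Y) = card (X - Y) + card (Y - X)"
    unfolding symdiff_def using assms by (intro card_Un_disjoint) auto
  ultimately show ?thesis by presburger
qed

text \<open>A set of branches that is closed in the inverse limit of its truncations, with few truncations
  at each level.\<close>

locale closed_family = singular lam kap for lam :: "'a rel" and kap :: "'k rel" +
  fixes tr :: "'k \<Rightarrow> 'x \<Rightarrow> 'x" and Bs :: "'x set"
  assumes tr_tr: "le i j \<Longrightarrow> tr i (tr j v) = tr i v"
    and tr_tiny: "j \<in> K \<Longrightarrow> |tr j ` Bs| <o lam"
    and tr_sep: "f \<in> Bs \<Longrightarrow> g \<in> Bs \<Longrightarrow> f \<noteq> g \<Longrightarrow> \<exists>j\<in>K. tr j f \<noteq> tr j g"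
    and tr_closed: "(\<And>j. j \<in> K \<Longrightarrow> k j \<in> tr j ` Bs) \<Longrightarrow> (\<And>i j. le i j \<Longrightarrow> tr i (k j) = k i) \<Longrightarrow>
        \<exists>f\<in>Bs. \<forall>j\<in>K. tr j f = k j"
begin

text \<open>Truncation is extended to finite sets as to a vector space over the field with two elements: a
  point survives if it has an odd number of preimages. The levels \<open>T j\<close> become
  groups, and this makes the tree homogeneous, although the tree of branches need not be.\<close>

definition push where "push i S = {u. odd (card {v \<in> S. tr i v = u})}"
definition T where "T j = {S. finite S \<and> S \<subseteq> tr j ` Bs}"
definition flip where
  "flip j a b t \<longleftrightarrow> (\<exists>i. le i j \<and> push i a \<noteq> push i b \<and> (push i t = push i a \<or> push i t = push i b))"
text \<open>Translation by the difference of \<open>a\<close> and \<open>b\<close>, restricted to the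
  points that agree with one of them beyond the level where they part. A point that meets
  neither stays fixed, as the assumption on moved points demands.\<close>

definition sw where "sw j a b t = (if t \<in> T j \<and> flip j a b t then symdiff t (symdiff a b) else t)"

lemma push_sub: "push i S \<subseteq> tr i ` S"
proof
  fix u assume "u \<in> push i S"
  then have odd: "odd (card {v \<in> S. tr i v = u})" by (simp add: push_def)
  have "{v \<in> S. tr i v = u} \<noteq> {}"
  proof
    assume "{v \<in> S. tr i v = u} = {}"
    then show False using odd by (simp only: card.empty) simp
  qed
  then show "u \<in> tr i ` S" by blast
qed

lemma push_finite: "finite S \<Longrightarrow> finite (push i S)"
  using push_sub finite_subset finite_imageI by metis

lemma push_sd: assumes "finite S" "finite S'" shows "push i (symdiff S S') = symdiff (push i S) (push i S')"
proof (rule set_eqI)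
  fix u
  have "{v \<in> symdiff S S'. tr i v = u} = symdiff {v \<in> S. tr i v = u} {v \<in> S'. tr i v = u}"
    by (auto simp: symdiff_def)
  then have "u \<in> push i (symdiff S S') \<longleftrightarrow> odd (card {v \<in> S. tr i v = u}) \<noteq> odd (card {v \<in> S'. tr i v = u})"
    using odd_card_sd[of "{v \<in> S. tr i v = u}" "{v \<in> S'. tr i v = u}"] assms by (simp add: push_def)
  also have "\<dots> \<longleftrightarrow> u \<in> symdiff (push i S) (push i S')" by (auto simp: push_def symdiff_def)
  finally show "u \<in> push i (symdiff S S') \<longleftrightarrow> u \<in> symdiff (push i S) (push i S')" .
qed

lemma push_empty [simp]: "push i {} = {}" by (simp add: push_def)

lemma push_single [simp]: "push i {v} = {tr i v}"
proof -
  have "{w \<in> {v}. tr i w = u} = (if u = tr i v then {v} else {})" for u by auto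
  then show ?thesis by (auto simp: push_def)
qed

lemma push_push: assumes "finite S" "le i j" shows "push i (push j S) = push i S"
  using assms(1)
proof (induction S)
  case (insert v S)
  have e: "insert v S = symdiff {v} S" using insert.hyps by (auto simp: symdiff_def)
  show ?case
    unfolding e using insert push_finite tr_tr[OF assms(2)] by (simp add: push_sd)
qed simp

lemma push_T: assumes ij: "le i j" and S: "S \<in> T j" shows "push i S \<in> T i"
proof -
  have "tr i ` S \<subseteq> tr i ` Bs" using S tr_tr[OF ij] by (force simp: T_def)
  then show ?thesis using push_sub[of i S] push_finite[of S i] S by (auto simp: T_def)
qed

lemma push_id: assumes j: "j \<in> K" and S: "S \<in> T j" shows "push j S = S"
proof -
  have "tr j w = w" if "w \<in> S" for w using S that tr_tr[OF le_refl[OF j]] by (auto simp: T_def)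
  then have "{w \<in> S. tr j w = u} = (if u \<in> S then {u} else {})" for u by auto
  then show ?thesis by (auto simp: push_def)
qed

lemma T_fin: "S \<in> T j \<Longrightarrow> finite S" by (simp add: T_def)
lemma T_sd: "S \<in> T j \<Longrightarrow> S' \<in> T j \<Longrightarrow> symdiff S S' \<in> T j" by (auto simp: T_def symdiff_def)

lemma flip_sd:
  assumes "a \<in> T j" "b \<in> T j" "t \<in> T j" "flip j a b t" shows "flip j a b (symdiff t (symdiff a b))"
proof -
  obtain i where i: "le i j" "push i a \<noteq> push i b" "push i t = push i a \<or> push i t = push i b"
    using assms(4) by (auto simp: flip_def)
  have "push i (symdiff t (symdiff a b)) = symdiff (push i t) (symdiff (push i a) (push i b))"
    using T_fin[OF assms(1)] T_fin[OF assms(2)] T_fin[OF assms(3)] by (simp add: push_sd symdiff_finite)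
  then have "push i (symdiff t (symdiff a b)) = push i a \<or> push i (symdiff t (symdiff a b)) = push i b"
    using i(3) symdiff_cancel by metis
  then show ?thesis using i by (auto simp: flip_def)
qed

lemma T_tiny: "j \<in> K \<Longrightarrow> tiny (T j)" unfolding T_def by (rule tiny_subsets[OF tr_tiny])

text \<open>If the level at which \<open>t\<close> joins \<open>a\<close> or \<open>b\<close> lies above
  \<open>i\<close>, then \<open>a\<close> and \<open>b\<close> agree at \<open>i\<close> and the
  flip is invisible there. This is why it commutes with the projections.\<close>

lemma symdiff_flips:
  shows "j \<in> K \<Longrightarrow> a \<in> T j \<Longrightarrow> b \<in> T j \<Longrightarrow> t \<in> T j \<Longrightarrow> sw j a b t \<in> T j"
    and "j \<in> K \<Longrightarrow> a \<in> T j \<Longrightarrow> b \<in> T j \<Longrightarrow> sw j a b (sw j a b t) = t"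
    and "j \<in> K \<Longrightarrow> a \<in> T j \<Longrightarrow> b \<in> T j \<Longrightarrow> sw j a b a = b"
    and "j \<in> K \<Longrightarrow> a \<in> T j \<Longrightarrow> b \<in> T j \<Longrightarrow> t \<in> T j \<Longrightarrow> sw j a b t \<noteq> t \<Longrightarrow>
        {i. le i j \<and> push i a = push i t} \<noteq> {i. le i j \<and> push i b = push i t}"
    and "le i j \<Longrightarrow> a \<in> T j \<Longrightarrow> b \<in> T j \<Longrightarrow> t \<in> T j \<Longrightarrow>
        push i (sw j a b t) = sw i (push i a) (push i b) (push i t)"
proof -
  show "sw j a b t \<in> T j" if "j \<in> K" "a \<in> T j" "b \<in> T j" "t \<in> T j" using that T_sd by (simp add: sw_def)
  show "sw j a b (sw j a b t) = t" if ab: "j \<in> K" "a \<in> T j" "b \<in> T j"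
  proof (cases "t \<in> T j \<and> flip j a b t")
    case True
    then have "flip j a b (symdiff t (symdiff a b))" "symdiff t (symdiff a b) \<in> T j" using ab flip_sd T_sd by auto
    moreover have "symdiff (symdiff t (symdiff a b)) (symdiff a b) = t" by (auto simp: symdiff_def)
    ultimately show ?thesis using True by (simp add: sw_def)
  qed (auto simp: sw_def)
  show "sw j a b a = b" if ab: "j \<in> K" "a \<in> T j" "b \<in> T j"
  proof (cases "a = b")
    case True
    then show ?thesis by (simp add: sw_def flip_def)
  next
    case False
    then have "flip j a b a" using ab push_id le_refl by (auto simp: flip_def intro!: exI[of _ j])
    then show ?thesis using ab by (simp add: sw_def symdiff_cancel)
  qed
  show "{i. le i j \<and> push i a = push i t} \<noteq> {i. le i j \<and> push i b = push i t}"
    if "j \<in> K" "a \<in> T j" "b \<in> T j" "t \<in> T j" and mv: "sw j a b t \<noteq> t"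
  proof -
    obtain i where "le i j" "push i a \<noteq> push i b" "push i t = push i a \<or> push i t = push i b"
      using mv by (auto simp: sw_def flip_def split: if_splits)
    then show ?thesis by auto
  qed
  show "push i (sw j a b t) = sw i (push i a) (push i b) (push i t)"
    if ij: "le i j" and ab: "a \<in> T j" "b \<in> T j" "t \<in> T j"
  proof -
    have fin: "finite a" "finite b" "finite t" using ab T_fin by auto
    have pp: "push i' (push i a) = push i' a" "push i' (push i b) = push i' b" "push i' (push i t) = push i' t"
      if "le i' i" for i' using that fin push_push by auto
    have lo: "flip i (push i a) (push i b) (push i t) \<longleftrightarrow>
        (\<exists>i'. le i' i \<and> push i' a \<noteq> push i' b \<and> (push i' t = push i' a \<or> push i' t = push i' b))"
      using pp unfolding flip_def by metis
    have ti: "push i t \<in> T i" by (rule push_T[OF ij ab(3)])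
    have add: "push i (symdiff t (symdiff a b)) = symdiff (push i t) (symdiff (push i a) (push i b))"
      using fin by (simp add: push_sd symdiff_finite)
    show ?thesis
    proof (cases "flip j a b t")
      case False
      then have "\<not> flip i (push i a) (push i b) (push i t)" using lo ij le_trans unfolding flip_def by blast
      then show ?thesis using False by (simp add: sw_def)
    next
      case True
      show ?thesis
      proof (cases "flip i (push i a) (push i b) (push i t)")
        case True
        then show ?thesis using \<open>flip j a b t\<close> ab ti add by (simp add: sw_def)
      next
        case False
        obtain i' where i': "le i' j" "push i' a \<noteq> push i' b" "push i' t = push i' a \<or> push i' t = push i' b"
          using True by (auto simp: flip_def)
        have "\<not> le i' i" using False lo i' by blast
        then have "le i i'" using le_total le_K i'(1) ij by blast
        then have "push i t = push i a \<or> push i t = push i b" using i'(3) push_push fin by metis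
        then have "push i a = push i b" using False lo le_refl le_K[OF ij] by blast
        then show ?thesis using True False ab add by (simp add: sw_def)
      qed
    qed
  qed
qed

lemma closed_family_tree: "box_filter UF \<Longrightarrow> (\<And>X. X \<subseteq> Ind \<Longrightarrow> X \<in> UF \<or> Ind - X \<in> UF) \<Longrightarrow>
    homogeneous_tree lam kap T (\<lambda>j i. push i) sw UF"
  by unfold_locales (simp_all add: T_tiny push_T symdiff_flips)

definition coherent where
  "coherent y \<longleftrightarrow> (\<forall>j\<in>K. y j \<in> T j) \<and> (\<forall>i j. le i j \<longrightarrow> push i (y j) = y i)"

text \<open>The cardinalities of the members of a thread increase. By uncountable cofinality they are
  bounded, hence eventually constant, and from there on truncation is a bijection between the
  members. Each of the finitely many points then traces a branch, which belongs to the closed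
  set.\<close>

lemma coherent_from_family:
  assumes y: "coherent y"
  obtains j1 F where "j1 \<in> K" "finite F" "F \<subseteq> Bs" "\<And>j. le j1 j \<Longrightarrow> y j = tr j ` F"
proof -
  have yT: "y j \<in> T j" if "j \<in> K" for j using y that by (simp add: coherent_def)
  have yp: "push i (y j) = y i" if "le i j" for i j using y that by (simp add: coherent_def)
  have fin: "finite (y j)" if "j \<in> K" for j using yT[OF that] by (rule T_fin)
  have sub: "y i \<subseteq> tr i ` y j" if "le i j" for i j using push_sub[of i "y j"] yp[OF that] by simp
  have mono: "card (y i) \<le> card (y j)" if ij: "le i j" for i j
  proof -
    have f: "finite (y j)" using fin le_K[OF ij] by blast
    have "card (y i) \<le> card (tr i ` y j)" by (rule card_mono[OF finite_imageI[OF f] sub[OF ij]])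
    also have "\<dots> \<le> card (y j)" by (rule card_image_le[OF f])
    finally show ?thesis .
  qed
  have "\<exists>n. \<forall>j\<in>K. card (y j) < n"
  proof (rule ccontr)
    assume "\<not> ?thesis"
    then have "\<forall>n. \<exists>j. j \<in> K \<and> n \<le> card (y j)" by (meson not_less)
    then obtain f where f: "\<And>n. f n \<in> K \<and> n \<le> card (y (f n))" by metis
    then have "range f \<subseteq> K" by auto
    then obtain b where b: "b \<in> K" "\<And>n. lt (f n) b" by (rule K_bound_nat) (rule that)
    have "Suc (card (y b)) \<le> card (y b)"
      using f[of "Suc (card (y b))"] mono[OF lt_le[OF b(2)]] le_trans[of] order_trans by blast
    then show False by simp
  qed
  then obtain n where n: "\<forall>j\<in>K. card (y j) < n" ..
  obtain j0 where "j0 \<in> K" using K_inf by fastforce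
  then obtain j1 where j1: "j1 \<in> K" "\<And>j. j \<in> K \<Longrightarrow> card (y j) \<le> card (y j1)"
    using ex_has_greatest_nat[of "\<lambda>j. j \<in> K" j0 "\<lambda>j. card (y j)" n] n by (metis less_imp_le)
  have bij: "y i = tr i ` y j \<and> inj_on (tr i) (y j)" if i: "le j1 i" and ij: "le i j" for i j
  proof -
    have K: "i \<in> K" "j \<in> K" using le_K[OF ij] by auto
    have "card (y j) \<le> card (y i)" using j1(2)[OF K(2)] mono[OF i] by simp
    moreover have "card (tr i ` y j) \<le> card (y j)" by (rule card_image_le[OF fin[OF K(2)]])
    ultimately have e: "y i = tr i ` y j"
      by (intro card_seteq[OF finite_imageI[OF fin[OF K(2)]] sub[OF ij]]) simp
    then have "card (tr i ` y j) = card (y j)" using \<open>card (y j) \<le> card (y i)\<close> mono[OF ij] by simp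
    then show ?thesis using e eq_card_imp_inj_on[OF fin[OF K(2)]] by blast
  qed
  \<comment> \<open>The branch traced by the point \<open>k\<close> of \<open>y j1\<close>.\<close>
  define lift where "lift k j = (if le j1 j then inv_into (y j) (tr j1) k else tr j k)" for k j
  have lift1: "lift k j \<in> y j" "tr j1 (lift k j) = k" if k: "k \<in> y j1" and j: "le j1 j" for k j
  proof -
    have "k \<in> tr j1 ` y j" using bij[OF le_refl[OF j1(1)] j] k by simp
    then show "lift k j \<in> y j" "tr j1 (lift k j) = k"
      using j inv_into_into[of k "tr j1" "y j"] f_inv_into_f[of k "tr j1" "y j"] by (simp_all add: lift_def)
  qed
  have lift2: "lift (tr j1 v) j = v" if v: "v \<in> y j" and j: "le j1 j" for v j
    using bij[OF le_refl[OF j1(1)] j] v j by (simp add: lift_def)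
  have lift_coh: "tr i (lift k j) = lift k i" if k: "k \<in> y j1" and ij: "le i j" for i j k
  proof (cases "le j1 i")
    case True
    then have j: "le j1 j" using ij le_trans by blast
    have "tr i (lift k j) \<in> y i" using bij[OF True ij] lift1(1)[OF k j] by blast
    moreover have "tr j1 (tr i (lift k j)) = k" using tr_tr[OF True] lift1(2)[OF k j] by simp
    ultimately show ?thesis using lift2[OF _ True] by metis
  next
    case False
    then have i: "le i j1" using le_total le_K[OF ij] j1(1) by blast
    show ?thesis
    proof (cases "le j1 j")
      case True
      have "tr i (lift k j) = tr i (tr j1 (lift k j))" using tr_tr[OF i] by simp
      then show ?thesis using lift1(2)[OF k True] False by (simp add: lift_def)
    next
      case j: False
      then show ?thesis using False tr_tr[OF ij] by (simp add: lift_def)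
    qed
  qed
  have lift_B: "lift k j \<in> tr j ` Bs" if k: "k \<in> y j1" and j: "j \<in> K" for k j
  proof (cases "le j1 j")
    case True
    then show ?thesis using lift1(1)[OF k] yT[OF j] by (auto simp: T_def)
  next
    case False
    then have le: "le j j1" using le_total j j1(1) by blast
    obtain b where "b \<in> Bs" "k = tr j1 b" using k yT[OF j1(1)] by (auto simp: T_def)
    then show ?thesis using tr_tr[OF le] False by (auto simp: lift_def)
  qed
  have "\<exists>f. f \<in> Bs \<and> (\<forall>j\<in>K. tr j f = lift k j)" if k: "k \<in> y j1" for k
    using tr_closed[of "lift k", OF lift_B[OF k] lift_coh[OF k]] by blast
  then obtain f where f: "\<And>k. k \<in> y j1 \<Longrightarrow> f k \<in> Bs" "\<And>k j. k \<in> y j1 \<Longrightarrow> j \<in> K \<Longrightarrow> tr j (f k) = lift k j" by metis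
  show ?thesis
  proof (rule that[OF j1(1)])
    show "finite (f ` y j1)" using fin[OF j1(1)] by simp
    show "f ` y j1 \<subseteq> Bs" using f(1) by blast
    show "y j = tr j ` f ` y j1" if j: "le j1 j" for j
    proof -
      have jK: "j \<in> K" using le_K[OF j] by blast
      have "tr j ` f ` y j1 = (\<lambda>k. lift k j) ` y j1" using f(2)[OF _ jK] by (force simp: image_image)
      moreover have "\<dots> = y j"
      proof (intro equalityI subsetI)
        show "v \<in> y j" if "v \<in> (\<lambda>k. lift k j) ` y j1" for v using that lift1(1)[OF _ j] by blast
        fix v assume v: "v \<in> y j"
        have "tr j1 v \<in> y j1" using bij[OF le_refl[OF j1(1)] j] v by blast
        then show "v \<in> (\<lambda>k. lift k j) ` y j1" using lift2[OF v j] by (metis imageI)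
      qed
      ultimately show ?thesis by simp
    qed
  qed
qed

lemma coherent_count:
  assumes mu: "|Bs| =o mu" "lam \<le>o mu"
  shows "|{restrict y K |y. coherent y}| \<le>o mu"
proof -
  let ?Fin = "{F. finite F \<and> F \<subseteq> Bs}"
  have Blam: "lam \<le>o |Bs|" using mu ordLeq_ordIso_trans ordIso_symmetric by blast
  have infB: "infinite Bs"
  proof
    assume "finite Bs"
    then have "|Bs| <o lam" by (rule tiny_finite)
    then show False using Blam not_ordLess_ordLeq by blast
  qed
  have "?Fin \<subseteq> set ` lists Bs"
  proof
    fix F assume "F \<in> ?Fin"
    moreover then obtain xs where "set xs = F" using finite_list by blast
    ultimately show "F \<in> set ` lists Bs" by auto
  qed
  then have "|?Fin| \<le>o |lists Bs|" by (rule ordLeq_transitive[OF card_of_mono1 card_of_image])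
  then have Fin: "|?Fin| \<le>o |Bs|" using card_lists_infinite[OF infB] ordLeq_transitive by blast
  have "|K| \<le>o |Bs|" using ordLess_imp_ordLeq[OF tiny_K] Blam ordLeq_transitive by blast
  then have KF: "|K \<times> ?Fin| \<le>o |Bs|" using Fin infB card_of_Sigma_ordLeq_infinite[of Bs K "\<lambda>_. ?Fin"] by simp
  let ?f = "\<lambda>(j1, F). restrict (\<lambda>j. if le j1 j then tr j ` F else push j (tr j1 ` F)) K"
  have "{restrict y K |y. coherent y} \<subseteq> ?f ` (K \<times> ?Fin)"
  proof
    fix z assume "z \<in> {restrict y K |y. coherent y}"
    then obtain y where y: "z = restrict y K" "coherent y" by blast
    obtain j1 F where j: "j1 \<in> K" "finite F" "F \<subseteq> Bs" "\<And>j. le j1 j \<Longrightarrow> y j = tr j ` F"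
      by (rule coherent_from_family[OF y(2)]) (rule that)
    have "z = ?f (j1, F)"
    proof
      fix j show "z j = ?f (j1, F) j"
      proof (cases "j \<in> K \<and> \<not> le j1 j")
        case True
        then have "le j j1" using le_total j(1) by blast
        then have "y j = push j (y j1)" using y(2) by (simp add: coherent_def)
        then show ?thesis using True y(1) j(4)[OF le_refl[OF j(1)]] by simp
      next
        case False
        then show ?thesis using y(1) j(4) by auto
      qed
    qed
    then show "z \<in> ?f ` (K \<times> ?Fin)" using j(1-3) by blast
  qed
  then have "|{restrict y K |y. coherent y}| \<le>o |K \<times> ?Fin|" by (rule ordLeq_transitive[OF card_of_mono1 card_of_image])
  then show ?thesis using KF mu(1) ordLeq_transitive ordLeq_ordIso_trans by blast
qed

text \<open>If a family converges at all levels, its limit is a thread, and there are at most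
  \<open>mu\<close> threads, since they come from finite sets of branches. Otherwise let
  \<open>first s\<close> be the first level without a limit. No point meets almost all threads
  at that level, so the type depends only on the limits below it and on the set of lower levels
  where each thread already agrees with them. There are few such codes.\<close>

theorem many_models:
  assumes mu: "|Bs| =o mu" "lam \<le>o mu"
  shows "\<exists>(voc :: 'a set vocabulary) (M :: ('a, 'a set) model).
           is_model voc M \<and> |universe M| =o lam \<and> No lam voc M =o mu"
proof (rule ultrafilter)
  fix UF assume UF: "box_filter UF" "\<And>X. X \<subseteq> Ind \<Longrightarrow> X \<in> UF \<or> Ind - X \<in> UF"
  interpret homogeneous_tree lam kap T "\<lambda>j i. push i" sw UF by (rule closed_family_tree[OF UF])
  have thr: "thread = coherent" by (simp add: fun_eq_iff thread_def coherent_def)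
  define lim where "lim s j t \<longleftrightarrow> {p \<in> Ind. s p j = t} \<in> UF" for s :: "'k \<times> 'k \<Rightarrow> 'k \<Rightarrow> 'x set" and j t
  define conv where "conv s j \<longleftrightarrow> (\<exists>t. lim s j t)" for s j
  define x where "x s j = (SOME t. lim s j t)" for s j
  have lim_x: "lim s j (x s j)" if "conv s j" for s j using that someI_ex[of "lim s j"] by (auto simp: conv_def x_def)
  define total where "total s \<longleftrightarrow> (\<forall>j\<in>K. conv s j)" for s
  define first where "first s = (SOME j0. j0 \<in> K \<and> \<not> conv s j0 \<and> (\<forall>i. lt i j0 \<longrightarrow> conv s i))" for s
  have first: "first s \<in> K \<and> \<not> conv s (first s) \<and> (\<forall>i. lt i (first s) \<longrightarrow> conv s i)" if nt: "\<not> total s" for s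
  proof -
    obtain j where "j \<in> K" "\<not> conv s j" using nt by (auto simp: total_def)
    then obtain j0 where j0: "j0 \<in> K" "\<not> conv s j0" "\<And>i. lt i j0 \<Longrightarrow> \<not> (i \<in> K \<and> \<not> conv s i)"
      using wfp_minimal_ex[OF lt_wf, of "\<lambda>j. j \<in> K \<and> \<not> conv s j" j] by metis
    have "j0 \<in> K \<and> \<not> conv s j0 \<and> (\<forall>i. lt i j0 \<longrightarrow> conv s i)" using j0 lt_K by metis
    then show ?thesis unfolding first_def by (rule someI)
  qed
  define agr where "agr s p = {i. lt i (first s) \<and> s p i = x s i}" for s p
  define cd where "cd s = (if total s then Inl (restrict (x s) K)
     else Inr (first s, restrict (x s) {i. lt i (first s)}, restrict (agr s) Ind))" for s
  define Y where "Y = Inl ` {restrict y K |y. coherent y} \<union>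
     Inr ` (SIGMA j0 : K. (PiE {i. lt i j0} T) \<times> (PiE Ind (\<lambda>_. Pow K)))"
  have sT: "s p j \<in> T j" if "s \<in> threads" "p \<in> Ind" "j \<in> K" for s p j
    using that by (auto simp: threads_def thread_def)
  have sp: "push i (s p j) = s p i" if "s \<in> threads" "p \<in> Ind" "le i j" for s p i j
    using that by (auto simp: threads_def thread_def)
  have xT: "x s j \<in> T j" if s: "s \<in> threads" and j: "conv s j" "j \<in> K" for s j
  proof -
    obtain p where "p \<in> Ind" "s p j = x s j" by (rule ae_ex[OF lim_x[OF j(1), unfolded lim_def]])
    then show ?thesis using sT[OF s _ j(2)] by metis
  qed
  have xp: "push i (x s j) = x s i" if s: "s \<in> threads" and j: "conv s j" "conv s i" "le i j" for s i j
  proof -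
    have "{p \<in> Ind. s p j = x s j \<and> s p i = x s i} \<in> UF"
      by (rule ae_conj[OF lim_x[OF j(1), unfolded lim_def] lim_x[OF j(2), unfolded lim_def]]) simp
    then obtain p where "p \<in> Ind" "s p j = x s j \<and> s p i = x s i" by (rule ae_ex)
    then show ?thesis using sp[OF s _ j(3)] by metis
  qed
  show ?thesis
  proof (rule count_models[of "\<lambda>_. {}" Bs mu "\<lambda>f j. {tr j f}" cd Y])
    show "thread (\<lambda>_. {})" by (simp add: thread_def T_def)
    show "|Bs| =o mu" by (rule mu(1))
    show "thread (\<lambda>j. {tr j f})" if "f \<in> Bs" for f using that tr_tr by (simp add: thread_def T_def)
    show "\<exists>j\<in>K. {tr j f} \<noteq> {tr j g}" if "f \<in> Bs" "g \<in> Bs" "f \<noteq> g" for f g using tr_sep[OF that] by simp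
    show "cd s \<in> Y" if s: "s \<in> threads" for s
    proof (cases "total s")
      case True
      then have "coherent (x s)" using xT[OF s] xp[OF s] le_K unfolding coherent_def total_def by blast
      then show ?thesis using True by (auto simp: cd_def Y_def)
    next
      case False
      have "restrict (x s) {i. lt i (first s)} \<in> PiE {i. lt i (first s)} T"
        using xT[OF s] first[OF False] lt_K by auto
      moreover have "restrict (agr s) Ind \<in> PiE Ind (\<lambda>_. Pow K)" using lt_K by (auto simp: agr_def)
      ultimately show ?thesis using False first[OF False] by (auto simp: cd_def Y_def)
    qed
    show "same_type s s'" if s: "s \<in> threads" "s' \<in> threads" and eq: "cd s = cd s'" for s s'
    proof -
      have key: "\<exists>Z. {p \<in> Ind. {i. le i j \<and> push i (s p j) = push i t} = Z p} \<in> UF \<and>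
          {p \<in> Ind. {i. le i j \<and> push i (s' p j) = push i t} = Z p} \<in> UF" if j: "j \<in> K" and t: "t \<in> T j" for j t
      proof (cases "conv s j \<and> conv s' j \<and> x s j = x s' j")
        case True
        have "{p \<in> Ind. {i. le i j \<and> push i (s p j) = push i t} = {i. le i j \<and> push i (x s j) = push i t}} \<in> UF"
          by (rule UF_props(1)[OF lim_x[of s j, unfolded lim_def]]) (use True in auto)
        moreover have "{p \<in> Ind. {i. le i j \<and> push i (s' p j) = push i t} = {i. le i j \<and> push i (x s j) = push i t}} \<in> UF"
          by (rule UF_props(1)[OF lim_x[of s' j, unfolded lim_def]]) (use True in auto)
        ultimately show ?thesis by (intro exI[of _ "\<lambda>_. {i. le i j \<and> push i (x s j) = push i t}"]) blast
      next
        case ncv: False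
        have nt: "\<not> total s" "\<not> total s'"
        proof -
          have "x s j = x s' j" if "total s" "total s'"
          proof -
            have "restrict (x s) K = restrict (x s') K" using eq that by (simp add: cd_def)
            from fun_cong[OF this, of j] show ?thesis using j by simp
          qed
          moreover have "total s \<longleftrightarrow> total s'" using eq by (auto simp: cd_def split: if_splits)
          ultimately show "\<not> total s" "\<not> total s'" using ncv j by (auto simp: total_def)
        qed
        define j0 where "j0 = first s"
        have e: "first s = first s'" "restrict (x s) {i. lt i (first s)} = restrict (x s') {i. lt i (first s')}"
          "restrict (agr s) Ind = restrict (agr s') Ind"
        proof -
          have "Inr (first s, restrict (x s) {i. lt i (first s)}, restrict (agr s) Ind) =
            (Inr (first s', restrict (x s') {i. lt i (first s')}, restrict (agr s') Ind) ::
              ('k \<Rightarrow> 'x set) + 'k \<times> ('k \<Rightarrow> 'x set) \<times> ('k \<times> 'k \<Rightarrow> 'k set))"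
            using eq nt by (simp only: cd_def if_False)
          then show "first s = first s'" "restrict (x s) {i. lt i (first s)} = restrict (x s') {i. lt i (first s')}"
            "restrict (agr s) Ind = restrict (agr s') Ind" unfolding sum.inject prod.inject by blast+
        qed
        have eqs: "first s' = j0" "restrict (x s) {i. lt i j0} = restrict (x s') {i. lt i j0}"
          "restrict (agr s) Ind = restrict (agr s') Ind"
          using e(1) e(2)[folded e(1)] e(3) unfolding j0_def by - ((rule sym, assumption) | assumption)+
        have xe: "x s i = x s' i" if "lt i j0" for i using fun_cong[OF eqs(2), of i] that by simp
        have ag: "agr s p = agr s' p" if "p \<in> Ind" for p using fun_cong[OF eqs(3), of p] that by simp
        have j0: "j0 \<in> K" "\<not> conv s j0" "\<not> conv s' j0" "\<And>i. lt i j0 \<Longrightarrow> conv s i \<and> conv s' i"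
          using first[OF nt(1)] first[OF nt(2)] eqs(1) by (auto simp: j0_def)
        have "\<not> lt j j0" using ncv j0(4) xe by blast
        then have j0j: "le j0 j" using not_lt_le j j0(1) by blast
        have tf: "finite t" using T_fin[OF t] .
        have gen: "{p \<in> Ind. {i. le i j \<and> push i (r p j) = push i t} = {i. lt i j0 \<and> r p i = push i t}} \<in> UF"
          if r: "r \<in> threads" "\<not> conv r j0" for r
        proof -
          have "\<not> lim r j0 (push j0 t)" using r(2) by (auto simp: conv_def)
          then have "{p \<in> Ind. r p j0 \<noteq> push j0 t} \<in> UF" unfolding lim_def by (rule ae_not)
          then show ?thesis
          proof (rule UF_props(1))
            show "{p \<in> Ind. r p j0 \<noteq> push j0 t} \<subseteq>
                {p \<in> Ind. {i. le i j \<and> push i (r p j) = push i t} = {i. lt i j0 \<and> r p i = push i t}}"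
            proof (intro subsetI CollectI conjI)
              fix p assume "p \<in> {p \<in> Ind. r p j0 \<noteq> push j0 t}"
              then have p: "p \<in> Ind" "r p j0 \<noteq> push j0 t" by auto
              show "p \<in> Ind" by (rule p(1))
              show "{i. le i j \<and> push i (r p j) = push i t} = {i. lt i j0 \<and> r p i = push i t}"
              proof (rule equalityI; rule subsetI; rule CollectI; rule conjI)
                fix i assume "i \<in> {i. le i j \<and> push i (r p j) = push i t}"
                then have i: "le i j" "push i (r p j) = push i t" by auto
                then show e: "r p i = push i t" using sp[OF r(1) p(1) i(1)] by simp
                show "lt i j0"
                proof (rule ccontr)
                  assume "\<not> lt i j0"
                  then have l: "le j0 i" using not_lt_le le_K[OF i(1)] j0(1) by blast
                  have "r p j0 = push j0 (push i t)" using sp[OF r(1) p(1) l] e by simp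
                  then show False using push_push[OF tf l] p(2) by simp
                qed
              next
                fix i assume "i \<in> {i. lt i j0 \<and> r p i = push i t}"
                then have i: "lt i j0" "r p i = push i t" by auto
                then show l: "le i j" using lt_le le_trans j0j by blast
                show "push i (r p j) = push i t" using sp[OF r(1) p(1) l] i(2) by simp
              qed
            qed
          qed auto
        qed
        show ?thesis
        proof (cases "\<forall>i. lt i j0 \<longrightarrow> x s i = push i t")
          case True
          have a: "{i. lt i j0 \<and> s p i = push i t} = agr s p" for p using True by (auto simp: agr_def j0_def)
          have b: "{i. lt i j0 \<and> s' p i = push i t} = agr s' p" for p
            using True xe eqs(1) by (auto simp: agr_def)
          have "{p \<in> Ind. {i. le i j \<and> push i (s p j) = push i t} = agr s p} \<in> UF"
            using gen[OF s(1) j0(2)] unfolding a .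
          moreover have "{p \<in> Ind. {i. le i j \<and> push i (s' p j) = push i t} = agr s p} \<in> UF"
            by (rule UF_props(1)[OF gen[OF s(2) j0(3), unfolded b]]) (use ag in auto)
          ultimately show ?thesis by blast
        next
          case False
          then obtain i1 where i1: "lt i1 j0" "x s i1 \<noteq> push i1 t" by blast
          let ?Z = "{i. lt i i1 \<and> x s i = push i t}"
          have sub: "{p \<in> Ind. {i. le i j \<and> push i (r p j) = push i t} = ?Z} \<in> UF"
            if r: "r \<in> threads" "\<not> conv r j0" "\<And>i. lt i j0 \<Longrightarrow> conv r i" "\<And>i. lt i j0 \<Longrightarrow> x r i = x s i" for r
          proof -
            have "{p \<in> Ind. r p i1 = x s i1} \<in> UF"
              using lim_x[OF r(3)[OF i1(1)]] r(4)[OF i1(1)] by (simp add: lim_def)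
            from gen[OF r(1,2)] this show ?thesis
            proof (rule ae_conj)
              fix p assume p: "p \<in> Ind" and e: "{i. le i j \<and> push i (r p j) = push i t} = {i. lt i j0 \<and> r p i = push i t}"
                and v: "r p i1 = x s i1"
              have "{i. lt i j0 \<and> r p i = push i t} = ?Z"
              proof (rule equalityI; rule subsetI; rule CollectI; rule conjI)
                fix i assume "i \<in> {i. lt i j0 \<and> r p i = push i t}"
                then have i: "lt i j0" "r p i = push i t" by auto
                show l: "lt i i1"
                proof (rule ccontr)
                  assume "\<not> lt i i1"
                  then have l: "le i1 i" using not_lt_le lt_K[OF i(1)] lt_K[OF i1(1)] by blast
                  have "x s i1 = push i1 (push i t)" using sp[OF r(1) p l] i(2) v by simp
                  then show False using push_push[OF tf l] i1(2) by simp
                qed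
                have "r p i = push i (x s i1)" using sp[OF r(1) p lt_le[OF l]] v by simp
                also have "\<dots> = x s i" using xp[OF r(1) r(3)[OF i1(1)] r(3)[OF i(1)] lt_le[OF l]] r(4) i(1) i1(1) by simp
                finally show "x s i = push i t" using i(2) by simp
              next
                fix i assume "i \<in> ?Z"
                then have i: "lt i i1" "x s i = push i t" by auto
                show l: "lt i j0" using i(1) i1(1) lt_trans by blast
                have "r p i = push i (x s i1)" using sp[OF r(1) p lt_le[OF i(1)]] v by simp
                also have "\<dots> = x s i" using xp[OF r(1) r(3)[OF i1(1)] r(3)[OF l] lt_le[OF i(1)]] r(4) l i1(1) by simp
                finally show "r p i = push i t" using i(2) by simp
              qed
              then show "{i. le i j \<and> push i (r p j) = push i t} = ?Z" using e by simp
            qed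
          qed
          have "{p \<in> Ind. {i. le i j \<and> push i (s p j) = push i t} = ?Z} \<in> UF"
            by (rule sub[OF s(1) j0(2)]) (use j0(4) in auto)
          moreover have "{p \<in> Ind. {i. le i j \<and> push i (s' p j) = push i t} = ?Z} \<in> UF"
            by (rule sub[OF s(2) j0(3)]) (use j0(4) xe in auto)
          ultimately show ?thesis by (intro exI[of _ "\<lambda>_. ?Z"]) blast
        qed
      qed
      show ?thesis unfolding same_type_def
      proof (intro ballI)
        fix j t assume "j \<in> K" "t \<in> T j"
        then obtain Z where "{p \<in> Ind. {i. le i j \<and> push i (s p j) = push i t} = Z p} \<in> UF"
          "{p \<in> Ind. {i. le i j \<and> push i (s' p j) = push i t} = Z p} \<in> UF" using key by blast
        then show "{p \<in> Ind. {i. le i j \<and> push i (s p j) = push i t} = {i. le i j \<and> push i (s' p j) = push i t}} \<in> UF"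
          by (rule ae_conj) simp
      qed
    qed
    show "|Y| \<le>o mu"
    proof -
      have muC: "Card_order mu" by (rule Card_order_ordIso[OF card_of_Card_order ordIso_symmetric[OF mu(1)]])
      have muI: "infinite (Field mu)"
      proof
        assume "finite (Field mu)"
        then have "tiny (Field mu)" by (rule tiny_finite)
        then have "mu <o lam" using card_of_Field_ordIso[OF muC] ordIso_ordLess_trans ordIso_symmetric by blast
        then show False using mu(2) not_ordLess_ordLeq by blast
      qed
      have "tiny (PiE {i. lt i j0} T \<times> PiE Ind (\<lambda>_. Pow K))" if j0: "j0 \<in> K" for j0
      proof (rule tiny_Times)
        have "PiE {i. lt i j0} T \<subseteq> PiE {i. lt i j0} (\<lambda>_. \<Union>i\<in>{i. lt i j0}. T i)" by (rule PiE_mono) auto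
        moreover have "tiny (PiE {i. lt i j0} (\<lambda>_. \<Union>i\<in>{i. lt i j0}. T i))"
          unfolding PiE_Func
          by (intro tiny_Func tiny_UN[OF kap_underS[OF j0]] ordLess_imp_ordLeq[OF kap_underS[OF j0]] T_tiny) (use lt_K in auto)
        ultimately show "tiny (PiE {i. lt i j0} T)" by (rule tiny_mono)
        have "Ind \<subseteq> K \<times> K" using Ind_D by auto
        then have "|Ind| \<le>o |K|" using card_of_mono1 card_of_Times_same_infinite[OF K_inf] ordLeq_ordIso_trans by blast
        then show "tiny (PiE Ind (\<lambda>_. Pow K))"
          unfolding PiE_Func by (intro tiny_Func tiny_PowI) (auto intro: card_of_mono1)
      qed
      then have "small (SIGMA j0 : K. (PiE {i. lt i j0} T) \<times> (PiE Ind (\<lambda>_. Pow K)))"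
        by (intro small_Sigma small_tiny tiny_K) auto
      then have 2: "|Inr ` (SIGMA j0 : K. (PiE {i. lt i j0} T) \<times> (PiE Ind (\<lambda>_. Pow K))) ::
          (('k \<Rightarrow> 'x set) + 'k \<times> ('k \<Rightarrow> 'x set) \<times> ('k \<times> 'k \<Rightarrow> 'k set)) set| \<le>o mu"
        by (intro ordLeq_transitive[OF card_of_image ordLeq_transitive[OF _ mu(2)]])
      have 1: "|Inl ` {restrict y K |y. coherent y} ::
          (('k \<Rightarrow> 'x set) + 'k \<times> ('k \<Rightarrow> 'x set) \<times> ('k \<times> 'k \<Rightarrow> 'k set)) set| \<le>o mu"
        by (rule ordLeq_transitive[OF card_of_image coherent_count[OF mu]])
      show ?thesis unfolding Y_def by (rule card_of_Un_ordLeq_infinite_Field[OF muI 1 2 muC])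
    qed
  qed
qed

end

section \<open>Ranks modulo bounded sets of coordinates\<close>

definition strict_ub :: "'w rel \<Rightarrow> 'w set \<Rightarrow> 'w \<Rightarrow> bool" where
  "strict_ub W S r \<longleftrightarrow> r \<in> Field W \<and> (\<forall>x\<in>S. (x, r) \<in> W \<and> x \<noteq> r)"

text \<open>Ranks of a well-founded relation in an ordinal that depends only on the type, so that ranks
  for different relations can be compared.\<close>

lemma rank_exists:
  fixes Rl :: "'y rel"
  assumes wf: "wf Rl" and inf: "infinite (UNIV :: 'y set)"
  defines "W \<equiv> cardSuc |UNIV :: 'y set|"
  shows "\<exists>f. \<forall>y. strict_ub W (f ` {x. (x, y) \<in> Rl}) (f y) \<and>
     (\<forall>r. strict_ub W (f ` {x. (x, y) \<in> Rl}) r \<longrightarrow> (f y, r) \<in> W)"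
proof (rule dependent_wf_choice[OF wf, where P = "\<lambda>f y r. strict_ub W (f ` {x. (x, y) \<in> Rl}) r \<and>
     (\<forall>r'. strict_ub W (f ` {x. (x, y) \<in> Rl}) r' \<longrightarrow> (r, r') \<in> W)"])
  fix f g :: "'y \<Rightarrow> 'y set" and y r assume "\<And>z. (z, y) \<in> Rl \<Longrightarrow> f z = g z"
  then have "f ` {x. (x, y) \<in> Rl} = g ` {x. (x, y) \<in> Rl}" by (auto simp: image_iff)
  then show "(strict_ub W (f ` {x. (x, y) \<in> Rl}) r \<and> (\<forall>r'. strict_ub W (f ` {x. (x, y) \<in> Rl}) r' \<longrightarrow> (r, r') \<in> W)) =
    (strict_ub W (g ` {x. (x, y) \<in> Rl}) r \<and> (\<forall>r'. strict_ub W (g ` {x. (x, y) \<in> Rl}) r' \<longrightarrow> (r, r') \<in> W))" by simp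
next
  fix f :: "'y \<Rightarrow> 'y set" and y
  assume IH: "\<And>x. (x, y) \<in> Rl \<Longrightarrow> strict_ub W (f ` {z. (z, x) \<in> Rl}) (f x) \<and>
     (\<forall>r'. strict_ub W (f ` {z. (z, x) \<in> Rl}) r' \<longrightarrow> (f x, r') \<in> W)"
  let ?S = "f ` {x. (x, y) \<in> Rl}"
  have S: "?S \<subseteq> Field W" using IH by (auto simp: strict_ub_def)
  have le: "|?S| \<le>o |UNIV :: 'y set|" by (rule ordLeq_transitive[OF card_of_image card_of_mono1]) simp
  obtain b where b: "b \<in> Field W" "\<And>x. x \<in> ?S \<Longrightarrow> (x, b) \<in> W \<and> x \<noteq> b"
    unfolding W_def by (rule cardSuc_bound[OF inf S[unfolded W_def] le]) (rule that, auto simp: W_def)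
  have wo: "wo_rel W"
    unfolding W_def using cardSuc_Card_order[OF card_of_Card_order, of "UNIV :: 'y set"]
    by (simp add: wo_rel_def card_order_on_def)
  let ?U = "{r. strict_ub W ?S r}"
  have U: "?U \<subseteq> Field W" "?U \<noteq> {}" using b by (auto simp: strict_ub_def)
  show "\<exists>r. strict_ub W ?S r \<and> (\<forall>r'. strict_ub W ?S r' \<longrightarrow> (r, r') \<in> W)"
  proof (intro exI[of _ "wo_rel.minim W ?U"] conjI allI impI)
    show "strict_ub W ?S (wo_rel.minim W ?U)" using wo_rel.minim_in[OF wo U] by simp
    show "(wo_rel.minim W ?U, r') \<in> W" if "strict_ub W ?S r'" for r'
      using wo_rel.minim_least[OF wo U(1), of r'] that by simp
  qed
qed

text \<open>Ranks are members of an ordinal attached to the type of the parameter.\<close>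

locale wf_rank =
  fixes dummy :: "'y"
  assumes inf: "infinite (UNIV :: 'y set)"
begin

definition W :: "'y set rel" where "W = cardSuc |UNIV :: 'y set|"

lemma wo: "wo_rel W"
  unfolding W_def using cardSuc_Card_order[OF card_of_Card_order, of "UNIV :: 'y set"]
  by (simp add: wo_rel_def card_order_on_def)

definition rle where "rle a b \<longleftrightarrow> (a, b) \<in> W"
definition rls where "rls a b \<longleftrightarrow> (a, b) \<in> W \<and> a \<noteq> b"

lemma rle_trans: "rle a b \<Longrightarrow> rle b c \<Longrightarrow> rle a c"
  using wo_rel.TRANS[OF wo] unfolding rle_def trans_def by blast
lemma rle_antisym: "rle a b \<Longrightarrow> rle b a \<Longrightarrow> a = b"
  using wo_rel.ANTISYM[OF wo] unfolding rle_def antisym_def by blast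
lemma rls_rle: "rls a b \<Longrightarrow> rle a b" by (simp add: rls_def rle_def)
lemma rls_Field: "rls a b \<Longrightarrow> a \<in> Field W \<and> b \<in> Field W" by (auto simp: rls_def Field_def)
lemma rle_rls_False: "rle a b \<Longrightarrow> rls b a \<Longrightarrow> False"
  using rle_antisym unfolding rls_def rle_def by blast
lemma rle_total: "a \<in> Field W \<Longrightarrow> b \<in> Field W \<Longrightarrow> rle a b \<or> rls b a"
  using wo_rel.TOTALS[OF wo] unfolding rls_def rle_def by blast
lemma rls_rle_trans: "rls a b \<Longrightarrow> rle b c \<Longrightarrow> rls a c"
  using rle_trans rle_antisym unfolding rls_def rle_def by blast
lemma rls_wf: "wfp rls"
proof -
  have "wf (W - Id)" using wo_rel.WF[OF wo] .
  moreover have "{(a, b). rls a b} = W - Id" by (auto simp: rls_def)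
  ultimately show ?thesis by (simp add: wfp_def)
qed

definition rank :: "'y rel \<Rightarrow> 'y \<Rightarrow> 'y set" where
  "rank Rl = (SOME f. \<forall>y. strict_ub W (f ` {x. (x, y) \<in> Rl}) (f y) \<and>
     (\<forall>r. strict_ub W (f ` {x. (x, y) \<in> Rl}) r \<longrightarrow> (f y, r) \<in> W))"

lemma rank: assumes "wf Rl"
  shows "strict_ub W (rank Rl ` {x. (x, y) \<in> Rl}) (rank Rl y)"
    "strict_ub W (rank Rl ` {x. (x, y) \<in> Rl}) r \<Longrightarrow> rle (rank Rl y) r"
  using someI_ex[OF rank_exists[OF assms inf, folded W_def]] unfolding rank_def[symmetric] rle_def by blast+

lemma rank_Field: "wf Rl \<Longrightarrow> rank Rl y \<in> Field W" using rank(1) by (simp add: strict_ub_def)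

lemma rank_less: "wf Rl \<Longrightarrow> (x, y) \<in> Rl \<Longrightarrow> rls (rank Rl x) (rank Rl y)"
  using rank(1)[of Rl y] by (auto simp: strict_ub_def rls_def)

lemma rank_cong: "wf Rl \<Longrightarrow> (\<And>x. (x, y) \<in> Rl \<longleftrightarrow> (x, z) \<in> Rl) \<Longrightarrow> rank Rl y = rank Rl z"
  using rank[of Rl y] rank[of Rl z] by (intro rle_antisym) auto

lemma rank_below: assumes "wf Rl" "rls \<eta> (rank Rl y)" obtains x where "(x, y) \<in> Rl" "rle \<eta> (rank Rl x)"
proof (rule ccontr)
  note thesisI = that
  assume no: "\<not> thesis"
  have "strict_ub W (rank Rl ` {x. (x, y) \<in> Rl}) \<eta>" unfolding strict_ub_def
  proof (intro conjI ballI)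
    show F: "\<eta> \<in> Field W" using rls_Field[OF assms(2)] by simp
    fix r assume "r \<in> rank Rl ` {x. (x, y) \<in> Rl}"
    then obtain x where x: "(x, y) \<in> Rl" "r = rank Rl x" by blast
    then have "\<not> rle \<eta> r" using no thesisI by blast
    then have "rls r \<eta>" using rle_total[OF F rank_Field[OF assms(1), of x]] x(2) by blast
    then show "(r, \<eta>) \<in> W" "r \<noteq> \<eta>" by (auto simp: rls_def)
  qed
  then show False using rank(2)[OF assms(1)] assms(2) rle_rls_False by blast
qed

lemma rank_ge:
  assumes Rl: "wf Rl" and \<xi>: "\<xi> \<in> Field W" and "\<And>\<eta>. rls \<eta> \<xi> \<Longrightarrow> \<exists>x. (x, y) \<in> Rl \<and> rle \<eta> (rank Rl x)"
  shows "rle \<xi> (rank Rl y)"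
proof (rule ccontr)
  assume "\<not> rle \<xi> (rank Rl y)"
  then have "rls (rank Rl y) \<xi>" using rle_total[OF \<xi> rank_Field[OF Rl]] by blast
  then obtain x where "(x, y) \<in> Rl" "rle (rank Rl y) (rank Rl x)" using assms(3) by blast
  then show False using rank_less[OF Rl] rle_rls_False by blast
qed

end

context singular
begin

text \<open>Comparison at all late coordinates in \<open>X\<close>. It is well-founded for unbounded
  \<open>X\<close> because of uncountable cofinality.\<close>

definition tail_less :: "('x \<Rightarrow> 'x \<Rightarrow> bool) \<Rightarrow> 'k set \<Rightarrow> ('k \<Rightarrow> 'x) rel" where
  "tail_less ls X = {(Y', Y). \<exists>i\<in>K. \<forall>d\<in>X. lt i d \<longrightarrow> ls (Y' d) (Y d)}"
definition unbounded where "unbounded X \<longleftrightarrow> X \<subseteq> K \<and> (\<forall>i\<in>K. \<exists>d\<in>X. lt i d)"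

lemma tail_less_wf: assumes ls: "wfp ls" and X: "unbounded X" shows "wf (tail_less ls X)"
  unfolding wf_iff_no_infinite_down_chain
proof
  assume "\<exists>f. \<forall>n. (f (Suc n), f n) \<in> tail_less ls X"
  then obtain f where f: "\<And>n. (f (Suc n), f n) \<in> tail_less ls X" by blast
  have "\<forall>n. \<exists>i. i \<in> K \<and> (\<forall>d\<in>X. lt i d \<longrightarrow> ls (f (Suc n) d) (f n d))" using f by (auto simp: tail_less_def)
  then obtain g where g: "\<And>n. g n \<in> K" "\<And>n d. d \<in> X \<Longrightarrow> lt (g n) d \<Longrightarrow> ls (f (Suc n) d) (f n d)" by metis
  have "range g \<subseteq> K" using g(1) by auto
  then obtain b where b: "b \<in> K" "\<And>n. lt (g n) b" by (rule K_bound_nat) (rule that)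
  obtain d where d: "d \<in> X" "lt b d" using X b(1) by (auto simp: unbounded_def)
  have "ls (f (Suc n) d) (f n d)" for n using g(2)[OF d(1)] b(2) d(2) lt_trans by blast
  then have "\<exists>h. \<forall>n. (h (Suc n), h n) \<in> {(x, y). ls x y}" by (intro exI[of _ "\<lambda>n. f n d"]) simp
  moreover have "wf {(x, y). ls x y}" using ls by (simp add: wfp_def)
  ultimately show False unfolding wf_iff_no_infinite_down_chain by blast
qed

lemma unbounded_Un: assumes "unbounded (X1 \<union> X2)" shows "unbounded X1 \<or> unbounded X2"
proof (rule ccontr)
  assume no: "\<not> ?thesis"
  have "X1 \<subseteq> K" "X2 \<subseteq> K" using assms by (auto simp: unbounded_def)
  then obtain i1 i2 where i: "i1 \<in> K" "\<forall>d\<in>X1. \<not> lt i1 d" "i2 \<in> K" "\<forall>d\<in>X2. \<not> lt i2 d" using no by (auto simp: unbounded_def)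
  obtain m where m: "m \<in> K" "le i1 m" "le i2 m" using le_max[OF i(1,3)] .
  obtain d where "d \<in> X1 \<union> X2" "lt m d" using assms m(1) unfolding unbounded_def by blast
  then show False using i(2,4) m le_lt_trans by blast
qed

lemma tail_bounded:
  fixes ls :: "'d \<Rightarrow> 'd \<Rightarrow> bool"
  assumes "X2 \<subseteq> K" "\<not> unbounded X2" shows "tail_less ls (X1 \<union> X2) = tail_less ls X1"
proof -
  obtain i2 where i2: "i2 \<in> K" "\<forall>d\<in>X2. \<not> lt i2 d" using assms by (auto simp: unbounded_def)
  have "\<exists>i\<in>K. \<forall>d\<in>X1 \<union> X2. lt i d \<longrightarrow> ls (Y' d) (Y d)"
    if i1: "i1 \<in> K" "\<forall>d\<in>X1. lt i1 d \<longrightarrow> ls (Y' d) (Y d)" for i1 and Y' Y :: "'k \<Rightarrow> 'd"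
  proof -
    obtain m where m: "m \<in> K" "le i1 m" "le i2 m" using le_max[OF i1(1) i2(1)] .
    then have "\<forall>d\<in>X1 \<union> X2. lt m d \<longrightarrow> ls (Y' d) (Y d)" using i1(2) i2(2) le_lt_trans by blast
    then show ?thesis using m(1) by blast
  qed
  then show ?thesis unfolding tail_less_def by blast
qed

end

locale tail_rank = singular lam kap + wf_rank dummy
  for lam :: "'a rel" and kap :: "'k rel" and dummy :: "'k \<Rightarrow> 'x" +
  fixes ls :: "'x \<Rightarrow> 'x \<Rightarrow> bool"
  assumes ls: "wfp ls"
begin

definition rkx where "rkx X = rank (tail_less ls X)"

lemma rkx_Field: "unbounded X \<Longrightarrow> rkx X Y \<in> Field W" unfolding rkx_def by (rule rank_Field[OF tail_less_wf[OF ls]])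

lemma rkx_cong: assumes X: "unbounded X" and e: "\<And>d. d \<in> X \<Longrightarrow> Y d = Z d" shows "rkx X Y = rkx X Z"
  unfolding rkx_def by (rule rank_cong[OF tail_less_wf[OF ls X]]) (use e in \<open>auto simp: tail_less_def\<close>)

text \<open>Descents on two disjoint sets of coordinates can be performed simultaneously.\<close>

lemma rkx_split:
  assumes X: "unbounded X1" "unbounded X2" "X1 \<inter> X2 = {}"
  shows "rle \<xi> (rkx X1 Y) \<Longrightarrow> rle \<xi> (rkx X2 Y) \<Longrightarrow> rle \<xi> (rkx (X1 \<union> X2) Y)"
proof (induction \<xi> arbitrary: Y rule: wfp_induct_rule[OF rls_wf])
  case (1 \<xi>)
  have U: "unbounded (X1 \<union> X2)" using X by (auto simp: unbounded_def)
  show ?case unfolding rkx_def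
  proof (rule rank_ge[OF tail_less_wf[OF ls U]])
    show "\<xi> \<in> Field W" using "1.prems"(1) by (auto simp: rle_def Field_def)
    fix \<eta> assume \<eta>: "rls \<eta> \<xi>"
    obtain Y1 where Y1: "(Y1, Y) \<in> tail_less ls X1" "rle \<eta> (rkx X1 Y1)"
      using rank_below[OF tail_less_wf[OF ls X(1)] rls_rle_trans[OF \<eta> "1.prems"(1)[unfolded rkx_def]]]
      unfolding rkx_def by metis
    obtain Y2 where Y2: "(Y2, Y) \<in> tail_less ls X2" "rle \<eta> (rkx X2 Y2)"
      using rank_below[OF tail_less_wf[OF ls X(2)] rls_rle_trans[OF \<eta> "1.prems"(2)[unfolded rkx_def]]]
      unfolding rkx_def by metis
    define Y' where "Y' d = (if d \<in> X1 then Y1 d else Y2 d)" for d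
    have e1: "rkx X1 Y' = rkx X1 Y1" by (rule rkx_cong[OF X(1)]) (simp add: Y'_def)
    have e2: "rkx X2 Y' = rkx X2 Y2" by (rule rkx_cong[OF X(2)]) (use X(3) in \<open>auto simp: Y'_def\<close>)
    have "rle \<eta> (rkx (X1 \<union> X2) Y')" by (rule "1.IH"[OF \<eta>]) (simp_all add: e1 e2 Y1(2) Y2(2))
    moreover have "(Y', Y) \<in> tail_less ls (X1 \<union> X2)"
    proof -
      obtain i1 i2 where i: "i1 \<in> K" "\<forall>d\<in>X1. lt i1 d \<longrightarrow> ls (Y1 d) (Y d)"
        "i2 \<in> K" "\<forall>d\<in>X2. lt i2 d \<longrightarrow> ls (Y2 d) (Y d)"
        using Y1(1) Y2(1) by (auto simp: tail_less_def)
      obtain m where m: "m \<in> K" "le i1 m" "le i2 m" using le_max[OF i(1,3)] .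
      have "\<forall>d\<in>X1 \<union> X2. lt m d \<longrightarrow> ls (Y' d) (Y d)"
        using i(2,4) m(2,3) le_lt_trans by (auto simp: Y'_def)
      then show ?thesis using m(1) by (auto simp: tail_less_def)
    qed
    ultimately show "\<exists>x. (x, Y) \<in> tail_less ls (X1 \<union> X2) \<and> rle \<eta> (rank (tail_less ls (X1 \<union> X2)) x)"
      unfolding rkx_def by blast
  qed
qed

text \<open>Shrinking the set of coordinates can increase the rank, but not on both parts of a partition.\<close>

lemma rkx_half:
  assumes X: "unbounded (X1 \<union> X2)" "X1 \<inter> X2 = {}"
  shows "unbounded X1 \<and> rle (rkx X1 Y) (rkx (X1 \<union> X2) Y) \<or> unbounded X2 \<and> rle (rkx X2 Y) (rkx (X1 \<union> X2) Y)"
proof -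
  have K: "X1 \<subseteq> K" "X2 \<subseteq> K" using X(1) by (auto simp: unbounded_def)
  have refl: "rle (rkx (X1 \<union> X2) Y) (rkx (X1 \<union> X2) Y)"
    using rle_total[OF rkx_Field[OF X(1)] rkx_Field[OF X(1)], of Y Y] by (auto simp: rls_def)
  consider "\<not> unbounded X1" | "\<not> unbounded X2" | "unbounded X1" "unbounded X2" by blast
  then show ?thesis
  proof cases
    case 1
    then have "rkx (X1 \<union> X2) Y = rkx X2 Y" using tail_bounded[OF K(1) 1, of ls X2] by (simp add: rkx_def Un_commute)
    then show ?thesis using unbounded_Un[OF X(1)] 1 refl by simp
  next
    case 2
    then have "rkx (X1 \<union> X2) Y = rkx X1 Y" using tail_bounded[OF K(2) 2, of ls X1] by (simp add: rkx_def)
    then show ?thesis using unbounded_Un[OF X(1)] 2 refl by simp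
  next
    case 3
    note F = rkx_Field[OF 3(1), of Y] rkx_Field[OF 3(2), of Y] rkx_Field[OF X(1), of Y]
    show ?thesis
    proof (rule ccontr)
      assume no: "\<not> ?thesis"
      then have g: "rls (rkx (X1 \<union> X2) Y) (rkx X1 Y)" "rls (rkx (X1 \<union> X2) Y) (rkx X2 Y)"
        using 3 rle_total F by blast+
      have r: "rle (rkx X1 Y) (rkx X1 Y)" "rle (rkx X2 Y) (rkx X2 Y)"
        using rle_total[OF F(1,1)] rle_total[OF F(2,2)] by (auto simp: rls_def)
      have "rle (rkx X1 Y) (rkx (X1 \<union> X2) Y) \<or> rle (rkx X2 Y) (rkx (X1 \<union> X2) Y)"
        using rle_total[OF F(1,2)] rls_rle r rkx_split[OF 3 X(2)] by blast
      then show False using g rle_rls_False by blast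
    qed
  qed
qed

end

context singular
begin

section \<open>Closed families of prescribed size\<close>

definition seqs :: "('k \<Rightarrow> 'a option) set" where
  "seqs = {f. \<forall>a x. f a = Some x \<longrightarrow> a \<in> K \<and> x \<in> Field lam}"

lemma level_sets:
  obtains A where "\<And>d. d \<in> K \<Longrightarrow> tiny (A d)" "\<And>d e. le d e \<Longrightarrow> A d \<subseteq> A e"
    "\<And>x. x \<in> Field lam \<Longrightarrow> \<exists>d\<in>K. x \<in> A d"
proof -
  obtain c where c: "\<And>i. i \<in> K \<Longrightarrow> c i \<in> Field lam"
    "\<And>a. a \<in> Field lam \<Longrightarrow> \<exists>i\<in>K. (a, c i) \<in> lam \<and> a \<noteq> c i" using cof_seq by blast
  define A where "A d = (\<Union>e\<in>{e. le e d}. underS lam (c e))" for d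
  show ?thesis
  proof (rule that[of A])
    show "tiny (A d)" if d: "d \<in> K" for d
    proof -
      have "{e. le e d} = {e. lt e d} \<union> {d}" using d by (auto simp: le_iff)
      then have "|{e. le e d}| <o |K|" using K_ordLess_Un[OF kap_underS[OF d] K_finite[of "{d}"]] by simp
      then show ?thesis unfolding A_def by (rule tiny_UN) (use c(1) le_K tiny_underS in blast)
    qed
    show "A d \<subseteq> A e" if "le d e" for d e using that le_trans by (auto simp: A_def)
    show "\<exists>d\<in>K. x \<in> A d" if x: "x \<in> Field lam" for x
    proof -
      obtain i where i: "i \<in> K" "(x, c i) \<in> lam" "x \<noteq> c i" using c(2)[OF x] by blast
      then have "x \<in> A i" using le_refl by (auto simp: A_def underS_def)
      then show ?thesis using i(1) by blast
    qed
  qed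
qed

end

text \<open>Sequences of length \<open>kap\<close> with values in \<open>lam\<close> are truncated in
  length and in values, so that fewer than \<open>lam\<close> truncations remain at each level.
  Undefined entries are admitted, whence every coherent system of truncations has a limit.\<close>

locale truncation = singular lam kap for lam :: "'a rel" and kap :: "'k rel" +
  fixes A :: "'k \<Rightarrow> 'a set"
  assumes A_tiny: "d \<in> K \<Longrightarrow> tiny (A d)" and A_mono: "le d e \<Longrightarrow> A d \<subseteq> A e"
    and A_cover: "x \<in> Field lam \<Longrightarrow> \<exists>d\<in>K. x \<in> A d"
begin

definition trunc :: "'k \<Rightarrow> ('k \<Rightarrow> 'a option) \<Rightarrow> 'k \<Rightarrow> 'a option" where
  "trunc d f a = (case f a of None \<Rightarrow> None | Some x \<Rightarrow> if lt a d \<and> x \<in> A d then Some x else None)"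

lemma trunc_Some: "trunc d f a = Some x \<longleftrightarrow> f a = Some x \<and> lt a d \<and> x \<in> A d"
  by (auto simp: trunc_def split: option.splits if_splits)

lemma option_eqI: "(\<And>x. u = Some x \<longleftrightarrow> v = Some x) \<Longrightarrow> u = v"
  by (cases u; cases v) auto

lemma truncation_trunc: assumes "le i j" shows "trunc i (trunc j f) = trunc i f"
proof
  fix a show "trunc i (trunc j f) a = trunc i f a"
    by (rule option_eqI) (use A_mono[OF assms] lt_le_trans[OF _ assms] in \<open>auto simp: trunc_Some\<close>)
qed


lemma trunc_sep:
  assumes f: "f \<in> seqs" and g: "g \<in> seqs" and ne: "f \<noteq> g"
  obtains j where "j \<in> K" "\<And>d. le j d \<Longrightarrow> trunc d f \<noteq> trunc d g"
proof -
  obtain a where a: "f a \<noteq> g a" using ne by blast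
  have *: "\<exists>j\<in>K. \<forall>d. le j d \<longrightarrow> trunc d u a = Some x" if u: "u \<in> seqs" "u a = Some x" for u x
  proof -
    have aK: "a \<in> K" "x \<in> Field lam" using u by (auto simp: seqs_def)
    obtain b where b: "lt a b" using K_nomax[OF aK(1)] by blast
    obtain e where e: "e \<in> K" "x \<in> A e" using A_cover[OF aK(2)] by blast
    have bK: "b \<in> K" using lt_K[OF b] by simp
    obtain m where m: "m \<in> K" "le b m" "le e m" using le_max[OF bK e(1)] .
    have "trunc d u a = Some x" if "le m d" for d
      unfolding trunc_Some using u(2) lt_le_trans[OF b le_trans[OF m(2) that]] A_mono[OF le_trans[OF m(3) that]] e(2) by blast
    then show ?thesis using m(1) by blast
  qed
  show ?thesis
  proof (cases "f a")
    case None
    then obtain x where x: "g a = Some x" using a by (cases "g a") auto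
    obtain j where j: "j \<in> K" "\<forall>d. le j d \<longrightarrow> trunc d g a = Some x" using *[OF g x] by blast
    have "trunc d f a = None" for d using None by (simp add: trunc_def)
    then have "trunc d f \<noteq> trunc d g" if "le j d" for d using j(2) that by (metis option.distinct(1))
    then show ?thesis using that j(1) by blast
  next
    case (Some x)
    obtain j where j: "j \<in> K" "\<forall>d. le j d \<longrightarrow> trunc d f a = Some x" using *[OF f Some] by blast
    have "trunc d g a \<noteq> Some x" for d using a Some by (auto simp: trunc_Some)
    then have "trunc d f \<noteq> trunc d g" if "le j d" for d using j(2) that by metis
    then show ?thesis using that j(1) by blast
  qed
qed

lemma trunc_tiny: assumes d: "d \<in> K" shows "tiny (trunc d ` seqs)"
proof -
  have "inj_on (\<lambda>f. restrict f K) (trunc d ` seqs)"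
  proof (rule inj_onI, rule ext)
    fix f g a assume fg: "f \<in> trunc d ` seqs" "g \<in> trunc d ` seqs" and eq: "restrict f K = restrict g K"
    show "f a = g a"
    proof (cases "a \<in> K")
      case True then show ?thesis using fun_cong[OF eq, of a] by simp
    next
      case False
      then have "f a = None" "g a = None" using fg lt_K by (auto simp: trunc_def split: option.splits)
      then show ?thesis by simp
    qed
  qed
  moreover have "(\<lambda>f. restrict f K) ` trunc d ` seqs \<subseteq> PiE K (\<lambda>_. {None} \<union> Some ` A d)"
  proof
    fix h assume "h \<in> (\<lambda>f. restrict f K) ` trunc d ` seqs"
    then obtain f where h: "h = restrict (trunc d f) K" by blast
    have "trunc d f a \<in> {None} \<union> Some ` A d" for a
      by (cases "trunc d f a") (auto simp: trunc_Some)
    then show "h \<in> PiE K (\<lambda>_. {None} \<union> Some ` A d)" by (simp add: h)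
  qed
  ultimately have "|trunc d ` seqs| \<le>o |PiE K (\<lambda>_. {None} \<union> Some ` A d)|" using card_of_ordLeq by blast
  moreover have "tiny (PiE K (\<lambda>_. {None} \<union> Some ` A d))"
    unfolding PiE_Func by (intro tiny_Func tiny_Un tiny_image A_tiny d card_of_mono1 subset_refl tiny_finite) simp
  ultimately show ?thesis by (rule tiny_le)
qed

lemma trunc_closed:
  assumes k: "\<And>d. d \<in> K \<Longrightarrow> k d \<in> trunc d ` seqs" and coh: "\<And>i j. le i j \<Longrightarrow> trunc i (k j) = k i"
  obtains f where "f \<in> seqs" "\<And>d. d \<in> K \<Longrightarrow> trunc d f = k d"
proof -
  have kS: "lt a d \<and> x \<in> A d \<and> a \<in> K \<and> x \<in> Field lam" if d: "d \<in> K" "k d a = Some x" for d a x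
  proof -
    obtain g where "g \<in> seqs" "k d = trunc d g" using k[OF d(1)] by blast
    then show ?thesis using d(2) by (auto simp: trunc_Some seqs_def)
  qed
  have mv: "k e a = Some x" if "d \<in> K" "e \<in> K" "k d a = Some x" "lt a e" "x \<in> A e" for d e a x
    using le_total[OF that(1,2)]
  proof
    assume "le d e"
    then have "trunc d (k e) a = Some x" using coh that(3) by simp
    then show ?thesis by (simp add: trunc_Some)
  next
    assume "le e d"
    then have "k e = trunc e (k d)" using coh by simp
    then show ?thesis using that(3-5) by (simp add: trunc_Some)
  qed
  have uniq: "x = y" if "d \<in> K" "e \<in> K" "k d a = Some x" "k e a = Some y" for d e a x y
    using le_total[OF that(1,2)]
  proof
    assume "le d e"
    then have "trunc d (k e) a = Some x" using coh that(3) by simp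
    then show ?thesis using that(4) by (simp add: trunc_Some)
  next
    assume "le e d"
    then have "trunc e (k d) a = Some y" using coh that(4) by simp
    then show ?thesis using that(3) by (simp add: trunc_Some)
  qed
  define f where "f a = (if \<exists>d\<in>K. \<exists>x. k d a = Some x then Some (SOME x. \<exists>d\<in>K. k d a = Some x) else None)" for a
  have f: "f a = Some x \<longleftrightarrow> (\<exists>d\<in>K. k d a = Some x)" for a x
  proof
    assume "\<exists>d\<in>K. k d a = Some x"
    moreover then have "\<exists>d\<in>K. k d a = Some (SOME x. \<exists>d\<in>K. k d a = Some x)" by (rule someI)
    ultimately have "(SOME x. \<exists>d\<in>K. k d a = Some x) = x" using uniq by blast
    then show "f a = Some x" using \<open>\<exists>d\<in>K. k d a = Some x\<close> by (auto simp: f_def)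
  next
    assume fx: "f a = Some x"
    then obtain d y where dy: "d \<in> K" "k d a = Some y" by (auto simp: f_def split: if_splits)
    then have "\<exists>y. \<exists>d\<in>K. k d a = Some y" by blast
    then have "\<exists>d\<in>K. k d a = Some (SOME x. \<exists>d\<in>K. k d a = Some x)" by (rule someI_ex)
    then show "\<exists>d\<in>K. k d a = Some x" using fx dy by (auto simp: f_def split: if_splits)
  qed
  show ?thesis
  proof (rule that[of f])
    show "f \<in> seqs" unfolding seqs_def using f kS by blast
    fix d assume d: "d \<in> K"
    show "trunc d f = k d"
    proof
      fix a show "trunc d f a = k d a"
      proof (rule option_eqI)
        fix x show "trunc d f a = Some x \<longleftrightarrow> k d a = Some x"
          unfolding trunc_Some f using mv d kS by blast
      qed
    qed
  qed
qed

lemma seqs_large: "lam ^c kap \<le>o |seqs|"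
proof -
  have "|Func (Field kap) (Field lam)| \<le>o |seqs|"
  proof (rule card_of_ordLeqI[where f = "\<lambda>g a. if a \<in> K then Some (g a) else None"])
    show "inj_on (\<lambda>g a. if a \<in> K then Some (g a) else None) (Func (Field kap) (Field lam))"
    proof (rule inj_onI, rule ext)
      fix g h a assume gh: "g \<in> Func (Field kap) (Field lam)" "h \<in> Func (Field kap) (Field lam)"
        and eq: "(\<lambda>a. if a \<in> K then Some (g a) else None) = (\<lambda>a. if a \<in> K then Some (h a) else None)"
      show "g a = h a"
      proof (cases "a \<in> K")
        case True then show ?thesis using fun_cong[OF eq, of a] by simp
      next
        case False then show ?thesis using gh by (simp add: Func_def K_def)
      qed
    qed
    show "(\<lambda>a. if a \<in> K then Some (g a) else None) \<in> seqs" if "g \<in> Func (Field kap) (Field lam)" for g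
      using that by (auto simp: seqs_def Func_def K_def split: if_splits)
  qed
  then show ?thesis by (simp add: cexp_def)
qed

text \<open>Sequences are paired with the set of coordinates at which they satisfy the condition. A union
  of such sets of sequences need not be closed, but their disjoint union is.\<close>

definition pairs where "pairs \<X> g = {(f, X). X \<in> \<X> \<and> f \<in> seqs \<and> (\<forall>d\<in>X. g X d (trunc d f))}"

lemma pairs_closed_family:
  assumes \<X>: "\<X> \<subseteq> Pow K" shows "closed_family lam kap (\<lambda>d (f, X). (trunc d f, X)) (pairs \<X> g)"
proof
  show "(case (case v of (f, X) \<Rightarrow> (trunc j f, X)) of (f, X) \<Rightarrow> (trunc i f, X)) = (case v of (f, X) \<Rightarrow> (trunc i f, X))"
    if "le i j" for i j v using truncation_trunc[OF that] by (cases v) simp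
  show "tiny ((\<lambda>(f, X). (trunc j f, X)) ` pairs \<X> g)" if j: "j \<in> K" for j
  proof (rule tiny_mono)
    show "(\<lambda>(f, X). (trunc j f, X)) ` pairs \<X> g \<subseteq> trunc j ` seqs \<times> Pow K" using \<X> by (auto simp: pairs_def)
    show "tiny (trunc j ` seqs \<times> Pow K)"
      by (intro tiny_Times trunc_tiny[OF j] tiny_PowI card_of_mono1 subset_refl)
  qed
  obtain j0 where j0: "j0 \<in> K" using K_inf by fastforce
  show "\<exists>j\<in>K. (case u of (f, X) \<Rightarrow> (trunc j f, X)) \<noteq> (case v of (f, X) \<Rightarrow> (trunc j f, X))"
    if uv: "u \<in> pairs \<X> g" "v \<in> pairs \<X> g" "u \<noteq> v" for u v
  proof -
    obtain f X f' X' where e: "u = (f, X)" "v = (f', X')" by (cases u, cases v)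
    show ?thesis
    proof (cases "f = f'")
      case True
      then have "X \<noteq> X'" using uv(3) e by simp
      then show ?thesis using e j0 by auto
    next
      case False
      have s: "f \<in> seqs" "f' \<in> seqs" using uv(1,2) e by (auto simp: pairs_def)
      obtain j where j: "j \<in> K" "\<And>d. le j d \<Longrightarrow> trunc d f \<noteq> trunc d f'" by (rule trunc_sep[OF s False]) (rule that)
      then have "trunc j f \<noteq> trunc j f'" using le_refl by blast
      then show ?thesis using e j(1) by (intro bexI[of _ j]) auto
    qed
  qed
  show "\<exists>u\<in>pairs \<X> g. \<forall>j\<in>K. (case u of (f, X) \<Rightarrow> (trunc j f, X)) = k j"
    if k: "\<And>j. j \<in> K \<Longrightarrow> k j \<in> (\<lambda>(f, X). (trunc j f, X)) ` pairs \<X> g"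
      and coh: "\<And>i j. le i j \<Longrightarrow> (case k j of (f, X) \<Rightarrow> (trunc i f, X)) = k i" for k
  proof -
    have kX: "snd (k j) = snd (k j0)" if "j \<in> K" for j
      using le_total[OF that j0] coh by (metis (no_types, lifting) case_prod_unfold snd_conv)
    have k1: "fst (k j) \<in> trunc j ` seqs" if "j \<in> K" for j using k[OF that] by (auto simp: pairs_def)
    have k2: "trunc i (fst (k j)) = fst (k i)" if "le i j" for i j
      using coh[OF that] by (metis (no_types, lifting) case_prod_unfold fst_conv)
    obtain f where f: "f \<in> seqs" "\<And>d. d \<in> K \<Longrightarrow> trunc d f = fst (k d)"
      by (rule trunc_closed[of "\<lambda>d. fst (k d)", OF k1 k2]) (assumption+, rule that)
    define X where "X = snd (k j0)"
    have XX: "X \<in> \<X>" using k[OF j0] by (auto simp: pairs_def X_def)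
    have "g X d (trunc d f)" if d: "d \<in> X" for d
    proof -
      have dK: "d \<in> K" using d XX \<X> by blast
      obtain f' X' where f': "k d = (trunc d f', X')" "(f', X') \<in> pairs \<X> g" using k[OF dK] by auto
      have "X' = X" using kX[OF dK] f'(1) by (simp add: X_def)
      then have "g X d (trunc d f')" using f'(2) d by (auto simp: pairs_def)
      then show ?thesis using f(2)[OF dK] f'(1) by simp
    qed
    then have "(f, X) \<in> pairs \<X> g" using XX f(1) by (simp add: pairs_def)
    moreover have "(trunc j f, X) = k j" if "j \<in> K" for j
      using f(2)[OF that] kX[OF that] by (simp add: X_def prod_eq_iff)
    ultimately show ?thesis by (intro bexI[of _ "(f, X)"]) auto
  qed
qed

fun below :: "(('k \<Rightarrow> 'a option) \<Rightarrow> ('k \<Rightarrow> 'a option) \<Rightarrow> bool) \<Rightarrow> ('k \<Rightarrow> 'a option) option \<Rightarrow> ('k \<Rightarrow> 'a option) \<Rightarrow> bool" where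
  "below l None f = True" | "below l (Some g) f = l f g"

fun option_less where "option_less l (Some f) q = below l q f" | "option_less l None q = False"

lemma option_less_wf: assumes l: "wfp l" shows "wfp (option_less l)"
  unfolding wfp_def wf_eq_minimal
proof (intro allI impI)
  fix Z and q :: "('k \<Rightarrow> 'a option) option" assume q: "q \<in> Z"
  show "\<exists>z\<in>Z. \<forall>y. (y, z) \<in> {(x, y). option_less l x y} \<longrightarrow> y \<notin> Z"
  proof (cases "\<exists>f. Some f \<in> Z")
    case True
    then obtain f where f: "Some f \<in> Z" "\<forall>g. l g f \<longrightarrow> Some g \<notin> Z"
      using wfp_minimal_ex[OF l, of "\<lambda>f. Some f \<in> Z"] by blast
    have "y \<notin> Z" if "option_less l y (Some f)" for y using that f(2) by (cases y) auto
    then show ?thesis using f(1) by blast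
  next
    case False
    then have "q = None" using q by (cases q) auto
    moreover have "y \<notin> Z" if "option_less l y None" for y using that False by (cases y) auto
    ultimately show ?thesis using q by blast
  qed
qed

text \<open>The sequences whose truncations stay below a given function on \<open>X\<close>, with respect
  to a well-ordering of all truncations; the value \<open>None\<close> is infinity.\<close>

definition below_on where "below_on l X Y = {f \<in> seqs. \<forall>d\<in>X. below l (Y d) (trunc d f)}"

text \<open>Among all sets \<open>below_on l X Y\<close> with at least \<open>mu\<close> members one of
  least rank \<open>\<rho>\<close> is taken. If it is too large, each two of its members are
  comparable on a set \<open>X'\<close> of coordinates whose rank is still at most
  \<open>\<rho>\<close>. If every member \<open>y\<close> had fewer than \<open>mu\<close>
  members below it in this sense, a member outside the union of \<open>mu\<close> such sets
  would have \<open>mu\<close> members below it. So some \<open>y\<close> has at least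
  \<open>mu\<close>. They fall into at most \<open>2^kap\<close> classes, one for each
  \<open>X'\<close>, and each class is smaller than \<open>mu\<close> since its rank is less
  than \<open>\<rho>\<close>. Hence their disjoint union has exactly \<open>mu\<close> members.\<close>

lemma family_exists:
  assumes mu: "Card_order mu" "lam \<le>o mu" "mu \<le>o lam ^c kap"
  obtains \<X> g where "\<X> \<subseteq> Pow K" "|pairs \<X> g| =o mu"
proof -
  note thesisI = that
  obtain r :: "('k \<Rightarrow> 'a option) rel" where r: "well_order_on UNIV r" using well_order_on by blast
  define l where "l f g \<longleftrightarrow> (f, g) \<in> r \<and> f \<noteq> g" for f g
  have l_wf: "wfp l"
  proof -
    have "wf (r - Id)" using r by (simp add: well_order_on_def)
    moreover have "{(f, g). l f g} = r - Id" by (auto simp: l_def)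
    ultimately show ?thesis by (simp add: wfp_def)
  qed
  have l_tot: "l f g \<or> f = g \<or> l g f" for f g
    using r by (auto simp: well_order_on_def linear_order_on_def total_on_def l_def)
  have l_asym: "\<not> (l f g \<and> l g f)" for f g
    using r unfolding well_order_on_def linear_order_on_def partial_order_on_def antisym_def l_def by blast
  have infy: "infinite (UNIV :: ('k \<Rightarrow> ('k \<Rightarrow> 'a option) option) set)"
  proof -
    have i: "inj (\<lambda>(k :: 'k) k'. if k' = k then Some (\<lambda>_ :: 'k. None :: 'a option) else None)"
      by (auto simp: inj_def fun_eq_iff split: if_splits)
    have "infinite (UNIV :: 'k set)" using K_inf finite_subset[of K UNIV] by blast
    then have "infinite (range (\<lambda>(k :: 'k) k'. if k' = k then Some (\<lambda>_ :: 'k. None :: 'a option) else None))"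
      using finite_imageD[OF _ i] by blast
    then show ?thesis by (rule infinite_super[rotated]) simp
  qed
  interpret tail_rank lam kap "\<lambda>_. None" "option_less l"
    by unfold_locales (rule infy, rule option_less_wf[OF l_wf])
  have muI: "infinite (Field mu)"
  proof
    assume "finite (Field mu)"
    then have "tiny (Field mu)" by (rule tiny_finite)
    then have "mu <o lam" using card_of_Field_ordIso[OF mu(1)] ordIso_ordLess_trans ordIso_symmetric by blast
    then show False using mu(2) not_ordLess_ordLeq by blast
  qed
  have muW: "Well_order mu" using mu(1) by (simp add: card_order_on_def)
  have not_le: "|Z| <o mu" if "\<not> mu \<le>o |Z|" for Z :: "'z set"
    using that not_ordLeq_iff_ordLess[OF card_of_Well_order muW] by blast
  have pairs_bel: "pairs \<X> (\<lambda>X d. below l (Y X d)) = {(f, X). X \<in> \<X> \<and> f \<in> below_on l X (Y X)}" for \<X> Y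
    by (auto simp: pairs_def below_on_def)
  define good where "good \<rho> \<longleftrightarrow> (\<exists>X Y. unbounded X \<and> mu \<le>o |below_on l X Y| \<and> \<rho> = rkx X Y)" for \<rho>
  have unbK: "unbounded K" unfolding unbounded_def using K_nomax lt_K by blast
  have "below_on l K (\<lambda>_. None) = seqs" by (simp add: below_on_def)
  then have "good (rkx K (\<lambda>_. None))" unfolding good_def
    using unbK ordLeq_transitive[OF mu(3) seqs_large] by metis
  then obtain \<rho> where \<rho>: "good \<rho>" "\<forall>\<rho>'. rls \<rho>' \<rho> \<longrightarrow> \<not> good \<rho>'"
    using wfp_minimal_ex[OF rls_wf, of good] by blast
  obtain X Y where X: "unbounded X" "mu \<le>o |below_on l X Y|" "\<rho> = rkx X Y" using \<rho>(1) by (auto simp: good_def)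
  have XK: "X \<subseteq> K" using X(1) by (simp add: unbounded_def)
  show ?thesis
  proof (cases "|below_on l X Y| \<le>o mu")
    case True
    have e: "pairs {X} (\<lambda>X d. below l (Y d)) = (\<lambda>f. (f, X)) ` below_on l X Y"
      by (auto simp: pairs_def below_on_def)
    have "bij_betw (\<lambda>f. (f, X)) (below_on l X Y) ((\<lambda>f. (f, X)) ` below_on l X Y)" by (auto simp: bij_betw_def inj_on_def)
    then have "|below_on l X Y| =o |(\<lambda>f. (f, X)) ` below_on l X Y|" by (rule card_of_ordIsoI)
    then have "|pairs {X} (\<lambda>X d. below l (Y d))| =o mu"
      using True X(2) unfolding e by (meson ordIso_iff_ordLeq ordIso_symmetric ordIso_transitive)
    then show ?thesis using thesisI[of "{X}"] XK by blast
  next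
    case big: False
    define \<X> where "\<X> = {X'. X' \<subseteq> X \<and> unbounded X' \<and> rle (rkx X' Y) \<rho>}"
    define S where "S y d = Some (trunc d y)" for y d
    define Ay where "Ay y = (\<Union>X'\<in>\<X>. below_on l X' (S y))" for y
    have smaller: "|below_on l X' (S y)| <o mu" if y: "y \<in> below_on l X Y" and X': "X' \<in> \<X>" for y X'
    proof (rule not_le, rule notI)
      assume "mu \<le>o |below_on l X' (S y)|"
      then have g: "good (rkx X' (S y))" using X' by (auto simp: good_def \<X>_def)
      obtain i where i: "i \<in> K" using K_inf by fastforce
      have "(S y, Y) \<in> tail_less (option_less l) X'"
        unfolding tail_less_def using i y X' by (auto simp: S_def below_on_def \<X>_def)
      then have "rls (rkx X' (S y)) (rkx X' Y)"
        unfolding rkx_def using X' by (intro rank_less[OF tail_less_wf[OF ls]]) (auto simp: \<X>_def)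
      then have "rls (rkx X' (S y)) \<rho>" using rls_rle_trans X' by (auto simp: \<X>_def)
      then show False using g \<rho>(2) by blast
    qed
    have tri: "f \<in> Ay y \<or> y \<in> Ay f" if f: "f \<in> below_on l X Y" and y: "y \<in> below_on l X Y" and ne: "f \<noteq> y" for f y
    proof -
      have s: "f \<in> seqs" "y \<in> seqs" using f y by (auto simp: below_on_def)
      obtain j where j: "j \<in> K" "\<And>d. le j d \<Longrightarrow> trunc d f \<noteq> trunc d y" by (rule trunc_sep[OF s ne]) (rule that)
      \<comment> \<open>The coordinates in \<open>Z\<close> are bounded, so they may be added to \<open>L\<close> to complete the partition.\<close>
      define L where "L = {d \<in> X. l (trunc d f) (trunc d y)}"
      define M where "M = {d \<in> X. l (trunc d y) (trunc d f)}"
      define Z where "Z = {d \<in> X. trunc d f = trunc d y}"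
      have part: "X = (L \<union> Z) \<union> M" using l_tot by (auto simp: L_def M_def Z_def)
      have disj: "(L \<union> Z) \<inter> M = {}" using l_asym by (auto simp: L_def M_def Z_def l_def)
      have "\<not> unbounded Z"
      proof
        assume "unbounded Z"
        then obtain d where d: "d \<in> Z" "lt j d" using j(1) by (auto simp: unbounded_def)
        then show False using j(2)[OF lt_le[OF d(2)]] by (simp add: Z_def)
      qed
      moreover have "Z \<subseteq> K" using XK by (auto simp: Z_def)
      ultimately have e: "tail_less (option_less l) (L \<union> Z) = tail_less (option_less l) L" and bz: "unbounded (L \<union> Z) \<Longrightarrow> unbounded L"
        using tail_bounded[of Z "option_less l" L] unbounded_Un[of L Z] by auto
      have "unbounded (L \<union> Z) \<and> rle (rkx (L \<union> Z) Y) \<rho> \<or> unbounded M \<and> rle (rkx M Y) \<rho>"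
        using rkx_half[of "L \<union> Z" M Y] X(1,3) part disj by simp
      then show ?thesis
      proof
        assume a: "unbounded (L \<union> Z) \<and> rle (rkx (L \<union> Z) Y) \<rho>"
        then have "unbounded L" "rle (rkx L Y) \<rho>" using bz e by (simp_all add: rkx_def)
        then have "L \<in> \<X>" by (auto simp: \<X>_def L_def)
        moreover have "f \<in> below_on l L (S y)" using s by (simp add: below_on_def S_def L_def)
        ultimately show ?thesis by (auto simp: Ay_def)
      next
        assume a: "unbounded M \<and> rle (rkx M Y) \<rho>"
        then have "M \<in> \<X>" by (auto simp: \<X>_def M_def)
        moreover have "y \<in> below_on l M (S f)" using s by (simp add: below_on_def S_def M_def)
        ultimately show ?thesis by (auto simp: Ay_def)
      qed
    qed
    obtain y where y: "y \<in> below_on l X Y" "mu \<le>o |Ay y|"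
    proof (rule ccontr)
      assume no: "\<not> thesis"
      have no': "|Ay y| <o mu" if "y \<in> below_on l X Y" for y using no that not_le \<open>\<And>y. y \<in> below_on l X Y \<Longrightarrow> mu \<le>o |Ay y| \<Longrightarrow> thesis\<close> by blast
      have F: "|Field mu| \<le>o |below_on l X Y|"
        by (rule ordIso_ordLeq_trans[OF card_of_Field_ordIso[OF mu(1)] X(2)])
      obtain h where h: "inj_on h (Field mu)" "h ` Field mu \<subseteq> below_on l X Y" using F by (rule ordLeq_imp_inj)
      define D where "D = h ` Field mu"
      have D: "|D| =o mu"
        unfolding D_def using card_of_ordIsoI[of h "Field mu" "h ` Field mu"] h(1)
          card_of_Field_ordIso[OF mu(1)] ordIso_symmetric ordIso_transitive
        by (metis bij_betw_imageI)
      have Dle: "|D| \<le>o mu" using D ordIso_imp_ordLeq by blast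
      have "|\<Union>y\<in>D. Ay y| \<le>o mu"
        by (rule card_of_UNION_ordLeq_infinite_Field[OF muI mu(1) Dle])
          (use no' h(2) ordLess_imp_ordLeq in \<open>auto simp: D_def\<close>)
      then have "|(\<Union>y\<in>D. Ay y) \<union> D| \<le>o mu" by (rule card_of_Un_ordLeq_infinite_Field[OF muI _ Dle mu(1)])
      then have "\<not> below_on l X Y \<subseteq> (\<Union>y\<in>D. Ay y) \<union> D" using big card_of_mono1 ordLeq_transitive by blast
      then obtain f where f: "f \<in> below_on l X Y" "f \<notin> D" "\<And>y. y \<in> D \<Longrightarrow> f \<notin> Ay y" by blast
      have "D \<subseteq> Ay f"
      proof
        fix y assume y: "y \<in> D"
        then have "y \<in> below_on l X Y" "f \<noteq> y" using h(2) f(2) by (auto simp: D_def)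
        then show "y \<in> Ay f" using tri[OF f(1)] f(3)[OF y] by blast
      qed
      then have "mu \<le>o |Ay f|" using card_of_mono1 D ordIso_ordLeq_trans ordIso_symmetric by blast
      then show False using no'[OF f(1)] not_ordLess_ordLeq by blast
    qed
    have \<X>K: "\<X> \<subseteq> Pow K" using XK by (auto simp: \<X>_def)
    define PP where "PP = pairs \<X> (\<lambda>X' d. below l (S y d))"
    have PP: "PP = {(f, X'). X' \<in> \<X> \<and> f \<in> below_on l X' (S y)}" by (auto simp: PP_def pairs_def below_on_def)
    have "|PP| \<le>o mu"
    proof -
      have "PP = prod.swap ` Sigma \<X> (\<lambda>X'. below_on l X' (S y))" by (auto simp: PP prod.swap_def image_iff)
      then have 1: "|PP| \<le>o |Sigma \<X> (\<lambda>X'. below_on l X' (S y))|" using card_of_image by metis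
      have "tiny (Pow K)" by (rule tiny_PowI[OF card_of_mono1[OF subset_refl]])
      then have "tiny \<X>" by (rule tiny_mono[OF \<X>K])
      then have "|\<X>| \<le>o mu" using mu(2) ordLess_imp_ordLeq ordLeq_transitive by blast
      then have "|Sigma \<X> (\<lambda>X'. below_on l X' (S y))| \<le>o mu"
        by (rule card_of_Sigma_ordLeq_infinite_Field[OF muI mu(1)])
          (use smaller[OF y(1)] ordLess_imp_ordLeq in auto)
      with 1 show ?thesis by (rule ordLeq_transitive)
    qed
    moreover have "mu \<le>o |PP|"
    proof -
      have "Ay y = fst ` PP" by (force simp: PP Ay_def)
      then have "|Ay y| \<le>o |PP|" using card_of_image by metis
      then show ?thesis by (rule ordLeq_transitive[OF y(2)])
    qed
    ultimately have "|PP| =o mu" by (simp add: ordIso_iff_ordLeq)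
    then show ?thesis using thesisI[OF \<X>K] unfolding PP_def by blast
  qed
qed

end

context singular
begin

theorem large_models:
  fixes mu :: "'m rel"
  assumes mu: "Card_order mu" "lam \<le>o mu" "mu \<le>o lam ^c kap"
  shows "\<exists>(voc :: 'a set vocabulary) (M :: ('a, 'a set) model).
           is_model voc M \<and> |universe M| =o lam \<and> No lam voc M =o mu"
proof (rule level_sets)
  fix A assume A: "\<And>d. d \<in> K \<Longrightarrow> tiny (A d)" "\<And>d e. le d e \<Longrightarrow> A d \<subseteq> A e"
    "\<And>x. x \<in> Field lam \<Longrightarrow> \<exists>d\<in>K. x \<in> A d"
  interpret truncation lam kap A by unfold_locales (fact A)+
  show ?thesis
  proof (rule family_exists[OF mu])
    fix \<X> g assume g: "\<X> \<subseteq> Pow K" "|pairs \<X> g| =o mu"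
    interpret closed_family lam kap "\<lambda>d (f, X). (trunc d f, X)" "pairs \<X> g"
      by (rule pairs_closed_family[OF g(1)])
    show ?thesis by (rule many_models[OF g(2) mu(2)])
  qed
qed

end

theorem mainTheorem2:
  fixes lam :: "'a rel" and kap :: "'k rel" and mu :: "'m rel"
  assumes "singular_cardinal lam"
    and "is_cofinality kap lam"
    and "natLeq <o kap"
    and "\<forall>theta :: 'a rel. Card_order theta \<and> theta <o lam \<longrightarrow> theta ^c kap <o lam"
    and "Card_order mu" "Field mu \<noteq> {}" "mu \<le>o lam ^c kap"
  shows "\<exists>(voc :: 'a set vocabulary) (M :: ('a, 'a set) model).
           is_model voc M \<and> |universe M| =o lam \<and> No lam voc M =o mu"
proof -
  interpret singular lam kap by unfold_locales (fact assms)+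
  have "Well_order mu" using assms(5) by (simp add: card_order_on_def)
  then consider "mu <o lam" | "lam \<le>o mu" using not_ordLeq_iff_ordLess[OF _ lamW] lamW by blast
  then show ?thesis
  proof cases
    case 1
    then show ?thesis by (rule few_models[OF assms(5,6)])
  next
    case 2
    then show ?thesis by (rule large_models[OF assms(5) _ assms(7)])
  qed
qed

end
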